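(* Assume that $A$ is generated as a $\mathcal{D}$-module by the monomials $S_2^{a_2}S_4^{a_4}\cdots$ (i.e. the map $\mathrm{ev}_1:\mathcal{D}\otimes\mathbb{C}[\bar S_2,\bar S_4,\ldots]\to A$, $P\otimes\bar S_2^{a_2}\bar S_4^{a_4}\cdots\mapsto P(S_2^{a_2}S_4^{a_4}\cdots)$, is surjective). Then the map $\mathcal{D}\otimes \tilde H^\ast_{-1}/C\tilde H^\ast_{-5}\to A$ induced by $\mathrm{ev}_2$ is surjective, and the complex $$\cdots\xrightarrow{Q}\mathcal{D}\otimes\frac{\tilde H^\ast_{-5}}{C\tilde H^\ast_{-9}}\xrightarrow{Q}\mathcal{D}\otimes\frac{\tilde H^\ast_{-3}}{C\tilde H^\ast_{-7}}\xrightarrow{Q}\mathcal{D}\otimes\frac{\tilde H^\ast_{-1}}{C\tilde H^\ast_{-5}}\xrightarrow{\mathrm{ev}_2}A\to0$$ is a $\mathcal{D}$-free resolution of $A$ (each term other than $A$ is a free $\mathcal{D}$-module and the sequence is exact).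
   Context: The KdV ring. Let $A=\mathbb{C}[u^{(0)},u^{(1)},\ldots]$ be the polynomial ring, $u=u^{(0)}$, with derivation $(u^{(m)})'=u^{(m+1)}$. Define $S_2,S_4,\ldots\in A$ (without constant term) by $S_2=-\frac12u$ and $S_{n+2}'=\frac14S_n'''-uS_n'-\frac12u'S_n$ ($n$ even). For odd $n\ge1$, $\partial_n$ is the derivation of $A$ with $\partial_n(u^{(k)})=(S_{n+1})^{(k+1)}$; they commute, $\partial_1={}'$, and $A$ is a module over $\mathcal{D}=\mathbb{C}[\partial_1,\partial_3,\ldots]$. For odd $i,j\ge1$, $\zeta_{ij}\in A$ is $\partial_i\partial_j\log\tau$ ($\tau$ the KdV tau function) as a differential polynomial in $u$; equivalently the element of $A$ with zero constant term with $\partial_1\zeta_{ij}=\partial_i(S_{j+1})$. The $\bar S_{2n}$ are formal variables (polynomials in $J_{2k}$ via $\exp(-\sum_k\frac1kJ_{2k}z^{-2k})=\sum_n\bar S_{2n}z^{-2n}$). Fermions. $\tilde\psi_n,\tilde\psi^\ast_n$ ($n$ odd) satisfy $[\tilde\psi_m,\tilde\psi_n]_+=[\tilde\psi^\ast_m,\tilde\psi^\ast_n]_+=0$, $[\tilde\psi^\ast_m,\tilde\psi_n]_+=\delta_{mn}$. Bra vacua $\langle m|$ ($m$ odd): $\langle m|\tilde\psi_n=0$ ($n\le m$), $\langle m|\tilde\psi^\ast_n=0$ ($n>m$), $\langle m-2|\tilde\psi_m=\langle m|$. $\tilde H^\ast_m$ is the Fock space obtained from $\langle m|$ by right multiplication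 with products having equal numbers of $\tilde\psi$'s and $\tilde\psi^\ast$'s. Put $\alpha_i=\tilde\psi_{-i}$, $\beta_i=\tilde\psi_i$ ($i$ odd $\ge1$). Operators: $Q:\mathcal{D}\otimes\tilde H^\ast_m\to\mathcal{D}\otimes\tilde H^\ast_{m+2}$, $Q(P\otimes v)=\sum_{n\ge1}\partial_{2n-1}P\otimes v\,\alpha_{2n-1}$; $C:\tilde H^\ast_m\to\tilde H^\ast_{m+4}$, $C(v)=\sum_{n\ge1}v\,\beta_{2n-1}\alpha_{2n-1}$ (extended $\mathcal{D}$-linearly). The map $\mathrm{ev}_2:\mathcal{D}\otimes\tilde H^\ast_{-1}\to A$: for $N\ge0$, $0\le k\le N$, odd $2N+1>i_{N-k}>\cdots>i_1\ge1$, odd $j_k>\cdots>j_1\ge1$, the vectors $v=\langle-2N-1|\alpha_{i_{N-k}}\cdots\alpha_{i_1}\beta_{j_k}\cdots\beta_{j_1}$ span $\tilde H^\ast_{-1}$ (identifying $\langle-2N-1|a=\langle-2N'-1|\alpha_{2N'-1}\cdots\alpha_{2N+1}a$ for $N<N'$). With $I=(i_{N-k},\ldots,i_1)$, $\{l_k>\cdots>l_1\}=\{1,3,\ldots,2N-1\}\setminus I$ and $\mathrm{sgn}(I,I^c)$ the sign of the permutation $(2N-1,\ldots,3,1)\mapsto(i_{N-k},\ldots,i_1,l_k,\ldots,l_1)$, set $\mathrm{ev}_2(P\otimes v)=P\big(\mathrm{sgn}(I,I^c)\det(\zeta_{l_aj_b})_{1\le a,b\le k}\big)$ (determinant $1$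 if $k=0$), extended $\mathcal{D}$-linearly (independent of $N$). It vanishes on $\mathcal{D}\otimes C\tilde H^\ast_{-5}$, hence induces a map on $\mathcal{D}\otimes\tilde H^\ast_{-1}/C\tilde H^\ast_{-5}$. *)

theory Defs
  imports Complex_Main "HOL-Library.Poly_Mapping" "HOL-Combinatorics.Permutations"
begin

text \<open>Monomials in the variables u^(k) (k :: nat) are finitely supported exponent
  vectors nat =>0 nat; elements of A are finitely supported coefficient maps.\<close>

type_synonym kdv = "(nat \<Rightarrow>\<^sub>0 nat) \<Rightarrow>\<^sub>0 complex"

definition cst :: "complex \<Rightarrow> kdv" where
  "cst c = Poly_Mapping.single 0 c"

definition uvar :: "nat \<Rightarrow> kdv" where
  "uvar k = Poly_Mapping.single (Poly_Mapping.single k 1) 1"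

definition der :: "(nat \<Rightarrow> kdv) \<Rightarrow> kdv \<Rightarrow> kdv" where
  "der g p = (\<Sum>m::nat \<Rightarrow>\<^sub>0 nat\<in>Poly_Mapping.keys p. cst (Poly_Mapping.lookup p m) *
      (\<Sum>k::nat\<in>Poly_Mapping.keys m. cst (of_nat (Poly_Mapping.lookup m k :: nat)) *
          Poly_Mapping.single (m - Poly_Mapping.single k 1) 1 * g k))"

definition dx :: "kdv \<Rightarrow> kdv" where
  "dx = der (\<lambda>k. uvar (Suc k))"

definition antider :: "kdv \<Rightarrow> kdv" where
  "antider q = (THE p. Poly_Mapping.lookup p 0 = 0 \<and> dx p = q)"

function S :: "nat \<Rightarrow> kdv" where
  "S n = (if n < 2 \<or> odd n then 0
          else if n = 2 then cst (-1/2) * uvar 0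
          else antider (cst (1/4) * (dx ^^ 3) (S (n - 2)) - uvar 0 * dx (S (n - 2))
                        - cst (1/2) * uvar 1 * S (n - 2)))"
  by auto
termination by (relation "measure id") auto

declare S.simps [simp del]

definition dd :: "nat \<Rightarrow> kdv \<Rightarrow> kdv" where
  "dd n = der (\<lambda>k. (dx ^^ Suc k) (S (n + 1)))"

text \<open>zeta i j = \<partial>_i \<partial>_j log tau: zero constant term, \<partial>_1 zeta_ij = \<partial>_i S_(j+1).\<close>
definition zeta :: "nat \<Rightarrow> nat \<Rightarrow> kdv" where
  "zeta i j = (THE z. Poly_Mapping.lookup z 0 = 0 \<and> dd 1 z = dd i (S (j + 1)))"

text \<open>Variable j of D stands for \<partial>_(2j+1).\<close>
type_synonym dring = "(nat \<Rightarrow>\<^sub>0 nat) \<Rightarrow>\<^sub>0 complex"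

definition dmon :: "(nat \<Rightarrow>\<^sub>0 nat) \<Rightarrow> kdv \<Rightarrow> kdv" where
  "dmon a = foldr (\<lambda>j f. (dd (2 * j + 1) ^^ Poly_Mapping.lookup a j) \<circ> f)
                  (sorted_list_of_set (Poly_Mapping.keys a)) id"

definition dact :: "dring \<Rightarrow> kdv \<Rightarrow> kdv" where
  "dact P f = (\<Sum>a\<in>Poly_Mapping.keys P. cst (Poly_Mapping.lookup P a) * dmon a f)"

definition dvar :: "int \<Rightarrow> dring" where
  "dvar n = Poly_Mapping.single (Poly_Mapping.single (nat ((n - 1) div 2)) 1) 1"

text \<open>D (x) C[Sbar_2, Sbar_4, ...]: exponent vector e, key n stands for Sbar_(2n+2).\<close>
definition Smon :: "(nat \<Rightarrow>\<^sub>0 nat) \<Rightarrow> kdv" where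
  "Smon e = (\<Prod>n\<in>Poly_Mapping.keys e. S (2 * n + 2) ^ Poly_Mapping.lookup e n)"

definition ev1 :: "((nat \<Rightarrow>\<^sub>0 nat) \<Rightarrow>\<^sub>0 dring) \<Rightarrow> kdv" where
  "ev1 x = (\<Sum>e\<in>Poly_Mapping.keys x. dact (Poly_Mapping.lookup x e) (Smon e))"

text \<open>Basis vectors <S| of the bra Fock spaces are indexed by their sets S of occupied
  odd integers; the vacuum <m| corresponds to vac m = {n odd. n \<le> m}. Right
  multiplication by psi_n adds n (with the sign (-1)^#{s in S. s > n}), so that
  <m-2| psi_m = <m| and <m| psi_n = 0 for n \<le> m.\<close>

definition vac :: "int \<Rightarrow> int set" where
  "vac m = {n. odd n \<and> n \<le> m}"

definition valid :: "int \<Rightarrow> int set \<Rightarrow> bool" where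
  "valid m X \<longleftrightarrow> (\<forall>s\<in>X. odd s) \<and> finite (X - vac m) \<and> finite (vac m - X)
                 \<and> card (X - vac m) = card (vac m - X)"

definition rpsi :: "int \<Rightarrow> (int set \<Rightarrow>\<^sub>0 'r::comm_ring_1) \<Rightarrow> (int set \<Rightarrow>\<^sub>0 'r)" where
  "rpsi n x = (\<Sum>X\<in>Poly_Mapping.keys x. if n \<in> X then 0
       else Poly_Mapping.single (insert n X) ((-1) ^ card {s\<in>X. s > n} * Poly_Mapping.lookup x X))"

type_synonym fock = "int set \<Rightarrow>\<^sub>0 dring"

definition Msp :: "int \<Rightarrow> fock set" where
  "Msp m = {x. \<forall>X\<in>Poly_Mapping.keys x. valid m X}"

text \<open>Indices j (odd, \<ge> 1) for which alpha_j = psi_(-j) can act nontrivially on <X|.\<close>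
definition Jset :: "int set \<Rightarrow> int set" where
  "Jset X = {j. 0 < j \<and> odd j \<and> - j \<notin> X}"

definition Cop :: "fock \<Rightarrow> fock" where
  "Cop x = (\<Sum>X\<in>Poly_Mapping.keys x. \<Sum>j\<in>Jset X.
              rpsi (- j) (rpsi j (Poly_Mapping.single X (Poly_Mapping.lookup x X))))"

definition Qop :: "fock \<Rightarrow> fock" where
  "Qop x = (\<Sum>X\<in>Poly_Mapping.keys x. \<Sum>j\<in>Jset X.
              rpsi (- j) (Poly_Mapping.single X (dvar j * Poly_Mapping.lookup x X)))"

definition Nsp :: "int \<Rightarrow> fock set" where
  "Nsp m = Cop ` Msp (m - 4)"

text \<open>Sign of the permutation taking the decreasing list (2N-1,...,3,1) to xs,
  computed as (-1)^(number of inversions w.r.t. the decreasing order).\<close>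
definition perm_sgn :: "nat list \<Rightarrow> complex" where
  "perm_sgn xs = (-1) ^ card {(p, q). p < q \<and> q < length xs \<and> xs ! p < xs ! q}"

definition det_zeta :: "nat list \<Rightarrow> nat list \<Rightarrow> kdv" where
  "det_zeta ls js = (\<Sum>p | p permutes {..<length ls}.
       of_int (sign p) * (\<Prod>a<length ls. zeta (ls ! a) (js ! p a)))"

text \<open>The paper's spanning vector <-2N-1| alpha_(i_(N-k)) ... alpha_(i_1) beta_(j_k) ... beta_(j_1),
  for I, J finite sets of positive odd naturals.\<close>
definition paper_vec :: "nat \<Rightarrow> nat set \<Rightarrow> nat set \<Rightarrow> int set \<Rightarrow>\<^sub>0 complex" where
  "paper_vec N I J =
     foldl (\<lambda>v j. rpsi (int j) v)
       (foldl (\<lambda>v i. rpsi (- int i) v) (Poly_Mapping.single (vac (- 2 * int N - 1)) 1)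
          (rev (sorted_list_of_set I)))
       (rev (sorted_list_of_set J))"

text \<open>ev_2 on D (x) <X| for X of charge -1: the holes of X are -l (l \<in> L), the particles
  are j \<in> J; for N with L \<subseteq> {1,3,...,2N-1} one has I = {1,...,2N-1} - L and the paper's
  vector equals eps * <X| with eps = \<plusminus>1.  ev_2 <X| = eps * sgn(I,I^c) det(zeta_(l_a j_b)).\<close>
definition ev2_basis :: "int set \<Rightarrow> kdv" where
  "ev2_basis X =
     (let L = nat ` uminus ` (vac (-1) - X);
          J = nat ` (X - vac (-1));
          N = (if L = {} then 0 else (Max L + 1) div 2);
          I = {i. odd i \<and> i < 2 * N} - L;
          eps = Poly_Mapping.lookup (paper_vec N I J) X
      in cst (eps * perm_sgn (rev (sorted_list_of_set I) @ rev (sorted_list_of_set L)))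
           * det_zeta (sorted_list_of_set L) (sorted_list_of_set J))"

definition ev2 :: "fock \<Rightarrow> kdv" where
  "ev2 x = (\<Sum>X\<in>Poly_Mapping.keys x. dact (Poly_Mapping.lookup x X) (ev2_basis X))"

definition dscale :: "dring \<Rightarrow> fock \<Rightarrow> fock" where
  "dscale P x = Poly_Mapping.map (\<lambda>c. P * c) x"

definition free_quot :: "fock set \<Rightarrow> fock set \<Rightarrow> bool" where
  "free_quot M N \<longleftrightarrow> (\<exists>B\<subseteq>M.
      (\<forall>x\<in>M. \<exists>c. finite {b\<in>B. c b \<noteq> 0} \<and> x - (\<Sum>b | b \<in> B \<and> c b \<noteq> 0. dscale (c b) b) \<in> N) \<and>
      (\<forall>c. finite {b\<in>B. c b \<noteq> 0} \<and> (\<Sum>b | b \<in> B \<and> c b \<noteq> 0. dscale (c b) b) \<in> N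
             \<longrightarrow> (\<forall>b\<in>B. c b = 0)))"

end

theory Submission
  imports Defs "HOL-Computational_Algebra.Formal_Power_Series" "Jordan_Normal_Form.Determinant"
begin

text \<open>
  The Lenard densities $S_{2n}$ are the coefficients of a series $B$ with
  $B^2 + x (u B^2 - \frac12 B B'' + \frac14 B'^2) = 1$, and $W = B^{-1}$. With the $S_{2n}$ playing the role
  of complete symmetric functions and the coefficients of $W$ that of signed elementary ones, the hook
  functions are, up to scalar factors and modulo the image of $\partial_i$, the $\zeta_{ij}$; hence by Jacobi-Trudi and
  Giambelli every monomial in the $S_{2n}$ is, modulo the images of the $\partial_i$, a combination of the
  determinants of $\zeta_{ij}$. As the $\partial_i$ raise the weight, surjectivity of the first evaluation map
  gives that of the second.

  Exactness in positive degrees is that of a Koszul complex: contracting with $\sum_i \varphi_{-i}\,\partial/\partial\partial_i$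
  gives a homotopy between $0$ and a positive number operator. An $\mathfrak{sl}_2$ argument makes $C$ injective
  in negative charge, which carries exactness over to the quotients. The kernel of the second evaluation map is found by
  counting dimensions of filtration steps, by means of an injection from the basis of
  charge $-1$ into the monomials of $A$ and the basis of charge $-3$.
\<close>

section \<open>Derivations of the ring of differential polynomials\<close>

text \<open>The homotopy says nothing about \<open>ev2\<close>, so exactness at charge -1 needs
  another argument. By degree, charge -1 has Hilbert series the product of 1/(1 - q^n) over n \<ge>
  1: partitions give the even n, the operators the odd n. The series of A omits n = 1, and charge -3
  has the series of charge -1 times q. Once \<open>ev2\<close> is surjective, its kernel is
  therefore as large as charge -3, and for a suitable finite set F of modes
  \<open>Qop z + Cop (KF F z)\<close> supplies that many independent elements: \<open>KF F\<close>
  is injective on the kernel of \<open>Qop\<close>, so what \<open>Qop\<close> loses reappears in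
  the second term.

  The passage from densities to tau function derivatives rests on W = 1/B. Up to an x-derivative,
  \<open>kS n\<close> is 1 - 2n times the n-th coefficient of W, and each flow takes the latter to
  an x-derivative of a hook function; this can be integrated. A hook thus differs from a multiple of
  the corresponding zeta by the j-th flow of an element that depends on the row only. That
  independence of the column j makes the correction of a whole determinant a sum of flow
  derivatives, by the same Jacobian identity that yields \<open>ev2 (Qop x) = 0\<close>.\<close>

abbreviation lk where "lk \<equiv> Poly_Mapping.lookup"
abbreviation ks where "ks \<equiv> Poly_Mapping.keys"
abbreviation sg where "sg \<equiv> Poly_Mapping.single"

lemma additive_imps:
  assumes "Modules.additive F"
  shows "F 0 = 0" "F (x + y) = F x + F y" "F (x - y) = F x - F y" "F (- x) = - F x"
    "F (sum h A) = (\<Sum>a\<in>A. F (h a))"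
  using assms by (simp_all add: additive.zero additive.add additive.diff additive.minus additive.sum)

lemma additive_comp: "Modules.additive F \<Longrightarrow> Modules.additive G \<Longrightarrow> Modules.additive (\<lambda>x. F (G x))"
  by (simp add: additive_def)

lemma additive_plus: "Modules.additive F \<Longrightarrow> Modules.additive G \<Longrightarrow> Modules.additive (\<lambda>x. F x + G x)"
  by (simp add: additive_def)

lemma additive_diff: "Modules.additive F \<Longrightarrow> Modules.additive G \<Longrightarrow> Modules.additive (\<lambda>x. F x - G x)"
  by (simp add: additive_def)

lemma additive_sum: "(\<And>a. a \<in> A \<Longrightarrow> Modules.additive (F a)) \<Longrightarrow> Modules.additive (\<lambda>x. \<Sum>a\<in>A. F a x)"
  by (simp add: additive_def sum.distrib)

lemma additive_id: "Modules.additive (\<lambda>x. x)"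
  by (simp add: additive_def)

lemma additive_mult: "Modules.additive (\<lambda>x::'a::ring. c * x)"
  by (simp add: additive_def algebra_simps)

lemma additive_keys_sum:
  fixes g :: "'k \<Rightarrow> 'v::ab_group_add \<Rightarrow> 'w::ab_group_add"
  assumes "\<And>k. Modules.additive (g k)"
  shows "Modules.additive (\<lambda>x. \<Sum>k\<in>ks x. g k (lk x k))"
  unfolding additive_def
  by (intro allI setsum_keys_plus_distrib) (simp_all add: additive_imps[OF assms])

lemma keys_sum_single:
  assumes "g a 0 = 0"
  shows "(\<Sum>k\<in>ks (sg a b). g k (lk (sg a b) k)) = g a b"
  using assms by (cases "b = 0") auto

lemma pm_sum_singles: "x = (\<Sum>k\<in>ks x. sg k (lk x k))"
proof (rule poly_mapping_eqI)
  fix i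
  have "(\<Sum>k\<in>ks x. lk (sg k (lk x k)) i) = (\<Sum>k\<in>ks x. if k = i then lk x k else 0)"
    by (intro sum.cong) (auto simp: lookup_single when_def)
  also have "\<dots> = lk x i" by (auto simp: in_keys_iff)
  finally show "lk x i = lk (\<Sum>k\<in>ks x. sg k (lk x k)) i" by (simp add: lookup_sum)
qed

text \<open>Every finitely supported map is the sum of its singles. Only additivity is asked for, so
  that one principle serves derivations, module actions and Fock space operators alike.\<close>

lemma additive_ext:
  assumes "Modules.additive F" "Modules.additive G"
    and "\<And>k v. k \<in> ks x \<Longrightarrow> F (sg k v) = G (sg k v)"
  shows "F x = G x"
proof -
  have "F (\<Sum>k\<in>ks x. sg k (lk x k)) = G (\<Sum>k\<in>ks x. sg k (lk x k))"
    using assms by (simp add: additive_imps)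
  then show ?thesis using pm_sum_singles[of x] by simp
qed

lemma cst_simps [simp]: "cst 0 = 0" "cst 1 = 1" "cst (a + b) = cst a + cst b" "cst (a * b) = cst a * cst b"
  "cst (- a) = - cst a" "cst (a - b) = cst a - cst b" "cst (of_nat n) = of_nat n" "cst (numeral v) = numeral v"
  "cst (a ^ n) = cst a ^ n"
proof -
  show m: "cst (a * b) = cst a * cst b" for a b by (simp add: cst_def mult_single)
  show o: "cst 1 = 1" by (simp add: cst_def)
  show "cst (a ^ n) = cst a ^ n" by (induction n) (simp_all add: m o)
qed (simp_all add: cst_def single_add single_uminus single_diff)

lemma lookup_cst_mult: "lk (cst c * p) m = c * lk p m"
proof -
  have "cst c * p = Poly_Mapping.map ((*) c) p" by (simp add: mult_map_scale_conv_mult cst_def)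
  then show ?thesis by (auto simp add: map.rep_eq when_def)
qed

lemma cst_eq_0_iff [simp]: "cst c = 0 \<longleftrightarrow> c = 0"
  by (metis cst_def lookup_single_eq lookup_zero single_zero)

lemma single_cst: "sg m c = cst c * sg m 1"
  by (simp add: cst_def mult_single)

definition dmono :: "(nat \<Rightarrow> kdv) \<Rightarrow> (nat \<Rightarrow>\<^sub>0 nat) \<Rightarrow> kdv" where
  "dmono g m = (\<Sum>k\<in>ks m. of_nat (lk m k) * sg (m - sg k 1) 1 * g k)"

lemma der_alt: "der g p = (\<Sum>m\<in>ks p. cst (lk p m) * dmono g m)"
  unfolding der_def dmono_def by simp

lemma additive_der: "Modules.additive (der g)"
  unfolding der_alt[abs_def] by (intro additive_keys_sum) (simp add: additive_def algebra_simps)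

lemma der_single: "der g (sg m c) = cst c * dmono g m"
  unfolding der_alt by (subst keys_sum_single[where g="\<lambda>m c. cst c * dmono g m"]) auto

lemma dmono_superset:
  assumes "finite K" "ks m \<subseteq> K"
  shows "dmono g m = (\<Sum>k\<in>K. of_nat (lk m k) * sg (m - sg k 1) 1 * g k)"
  unfolding dmono_def using assms by (intro sum.mono_neutral_left) (auto simp: in_keys_iff)

text \<open>Subtraction of exponents is truncated, so pulling \<open>m\<close> out of the difference
  is wrong where \<open>k\<close> does not occur in \<open>n\<close>; the factor
  \<open>lk n k\<close> vanishes exactly there.\<close>

lemma dmono_term:
  "(of_nat (lk n k) * sg (m + n - sg k 1) 1 :: kdv) = sg m 1 * (of_nat (lk n k) * sg (n - sg k 1) 1)"
proof (cases "lk n k = 0")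
  case False
  have "m + n - sg k 1 = m + (n - sg k 1)"
    using False by (intro poly_mapping_eqI) (auto simp: lookup_add lookup_minus lookup_single when_def)
  then have *: "(sg (m + n - sg k 1) 1 :: kdv) = sg m 1 * sg (n - sg k 1) 1" by (simp add: mult_single)
  show ?thesis unfolding * by (simp only: mult.left_commute)
qed simp

lemma dmono_add: "dmono g (m + n) = sg m 1 * dmono g n + sg n 1 * dmono g m"
proof -
  let ?K = "ks m \<union> ks n"
  have "dmono g (m + n) = (\<Sum>k\<in>?K. of_nat (lk (m + n) k) * sg (m + n - sg k 1) 1 * g k)"
    by (rule dmono_superset) (auto simp: keys_add)
  also have "\<dots> = (\<Sum>k\<in>?K. sg m 1 * (of_nat (lk n k) * sg (n - sg k 1) 1 * g k)
       + sg n 1 * (of_nat (lk m k) * sg (m - sg k 1) 1 * g k))"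
  proof (rule sum.cong)
    fix k
    show "of_nat (lk (m + n) k) * sg (m + n - sg k 1) 1 * g k = sg m 1 * (of_nat (lk n k) * sg (n - sg k 1) 1 * g k)
       + sg n 1 * (of_nat (lk m k) * sg (m - sg k 1) 1 * g k)"
      using arg_cong2[where f="(+)", OF dmono_term[of n k m] dmono_term[of m k n]]
      by (simp add: lookup_add algebra_simps)
  qed simp
  also have "\<dots> = sg m 1 * dmono g n + sg n 1 * dmono g m"
    by (simp add: sum.distrib sum_distrib_left[symmetric] dmono_superset[of ?K])
  finally show ?thesis .
qed

lemma der_mult: "der g (p * q) = der g p * q + p * der g q"
proof -
  have 1: "der g (sg m c * sg n d) = der g (sg m c) * sg n d + sg m c * der g (sg n d)" for m n c d
    by (simp add: mult_single der_single dmono_add, subst single_cst[of m c], subst single_cst[of n d])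
       (simp add: algebra_simps)
  have 2: "der g (sg m c * q) = der g (sg m c) * q + sg m c * der g q" for m c
    by (rule additive_ext[where x=q]) 
      (auto simp: 1 additive_def algebra_simps additive_imps[OF additive_der])
  show ?thesis
    by (rule additive_ext[where x=p], simp_all only: 2)
      (auto simp: additive_def algebra_simps additive_imps[OF additive_der])
qed

lemma der_cst [simp]: "der g (cst c) = 0"
  by (simp add: cst_def der_single dmono_def)

lemma der_uvar [simp]: "der g (uvar k) = g k"
  by (simp add: uvar_def der_single dmono_def)

lemmas der_simps = additive_imps[OF additive_der] der_mult

lemma der_0 [simp]: "der g 0 = 0" and der_1 [simp]: "der g 1 = 0" and der_of_nat [simp]: "der g (of_nat n) = 0"
   and der_numeral [simp]: "der g (numeral v) = 0"
  using der_cst[of g 0] der_cst[of g 1] der_cst[of g "of_nat n"] der_cst[of g "numeral v"] by simp_all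

lemma der_cst_mult [simp]: "der g (cst c * p) = cst c * der g p"
  by (simp add: der_mult)

lemma monom_times_uvar: "(sg (m + sg k 1) 1 :: kdv) = sg m 1 * uvar k"
  by (simp add: uvar_def mult_single)

lemma monomial_induct:
  assumes "P 0" "\<And>m k. P m \<Longrightarrow> P (m + sg k (1::nat))"
  shows "P m"
proof (induction "\<Sum>k\<in>ks m. lk m k" arbitrary: m)
  case 0
  then have "m = 0" by (intro poly_mapping_eqI) (metis finite_keys in_keys_iff lookup_zero sum_eq_0_iff)
  then show ?case using assms by simp
next
  case (Suc n)
  then obtain k where k: "k \<in> ks m" by (metis nat.distinct(1) sum.empty equals0I)
  let ?m = "m - sg k 1"
  have m: "m = ?m + sg k 1"
    using k by (intro poly_mapping_eqI) (auto simp: lookup_add lookup_minus lookup_single when_def in_keys_iff)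
  have "(\<Sum>i\<in>ks m. lk m i) = (\<Sum>i\<in>ks m. lk ?m i) + (\<Sum>i\<in>ks m. lk (sg k 1) i)"
    by (subst m) (simp add: lookup_add sum.distrib)
  also have "(\<Sum>i\<in>ks m. lk (sg k (1::nat)) i) = 1"
    using k by (simp add: lookup_single when_def)
  also have "(\<Sum>i\<in>ks m. lk ?m i) = (\<Sum>i\<in>ks ?m. lk ?m i)"
    by (intro sum.mono_neutral_right) (auto simp: in_keys_iff lookup_minus)
  finally have "P ?m" using Suc by simp
  then show ?case using assms(2) m by metis
qed

lemma kdv_induct [case_names cst uvar add mult]:
  assumes c: "\<And>c. P (cst c)" and u: "\<And>k. P (uvar k)"
    and a: "\<And>p q. P p \<Longrightarrow> P q \<Longrightarrow> P (p + q)" and m: "\<And>p q. P p \<Longrightarrow> P q \<Longrightarrow> P (p * q)"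
  shows "P (p::kdv)"
proof -
  have 1: "P (sg m 1)" for m
    by (induction m rule: monomial_induct) (use c[of 1] u m in \<open>simp_all add: cst_def monom_times_uvar del: single_one One_nat_def\<close>)
  have s: "P (\<Sum>k\<in>A. f k)" if "\<And>k. k \<in> A \<Longrightarrow> P (f k)" for A and f :: "(nat \<Rightarrow>\<^sub>0 nat) \<Rightarrow> kdv"
    using that c[of 0] a by (induction A rule: infinite_finite_induct) simp_all
  have "P (\<Sum>k\<in>ks p. sg k (lk p k))" by (rule s) (metis 1 c m single_cst)
  then show ?thesis using pm_sum_singles[of p] by simp
qed

lemma derivation_eqI:
  assumes D: "Modules.additive D" "\<And>p q. D (p * q) = D p * q + p * D q" "\<And>c. D (cst c) = 0"
    and E: "Modules.additive E" "\<And>p q. E (p * q) = E p * q + p * E q" "\<And>c. E (cst c) = 0"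
    and u: "\<And>k. D (uvar k) = E (uvar k)"
  shows "D p = E (p::kdv)"
  by (induction p rule: kdv_induct) (simp_all add: D E u additive_imps[OF D(1)] additive_imps[OF E(1)])

text \<open>The commutator of two derivations is a derivation, so its vanishing on the generators is
  enough.\<close>

lemma der_commute:
  assumes "\<And>k. der g (f k) = der f (g k)"
  shows "der g (der f p) = der f (der g p)"
proof -
  have "der g (der f p) - der f (der g p) = 0"
  proof (rule derivation_eqI[where D="\<lambda>p. der g (der f p) - der f (der g p)" and E="\<lambda>_. 0"])
    show "Modules.additive (\<lambda>p. der g (der f p) - der f (der g p))"
      by (intro additive_diff additive_comp[OF additive_der] additive_der)
  qed (auto simp: additive_def der_simps algebra_simps assms)
  then show ?thesis by simp
qed

lemma dx_uvar [simp]: "dx (uvar k) = uvar (Suc k)"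
  by (simp add: dx_def)

lemmas dx_simps = der_simps[of "\<lambda>k. uvar (Suc k)", folded dx_def]

lemma dx_cst [simp]: "dx (cst c) = 0" and dx_0 [simp]: "dx 0 = 0" and dx_1 [simp]: "dx 1 = 0"
  and dx_numeral [simp]: "dx (numeral v) = 0" and dx_cst_mult [simp]: "dx (cst c * p) = cst c * dx p"
  by (simp_all add: dx_def)

lemma lookup_sum_shift:
  "lk (sg (n - sg k 1) 1 * uvar (Suc k) :: kdv) m' = (if n - sg k 1 + sg (Suc k) 1 = m' then 1 else 0)"
  by (simp add: uvar_def mult_single lookup_single when_def)

text \<open>Let \<open>K\<close> be the highest index of a variable in \<open>p\<close>, occurring
  in \<open>m\<close>. Trading one factor of index \<open>K\<close> in \<open>m\<close> for one of
  index \<open>Suc K\<close> gives a monomial that \<open>dx p\<close> receives from a single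
  source, because \<open>Suc K\<close> is absent from \<open>p\<close>.\<close>

lemma dx_eq_0:
  assumes "dx p = 0" "lk p 0 = 0"
  shows "p = 0"
proof (rule ccontr)
  assume "p \<noteq> 0"
  then obtain m0 where m0: "m0 \<in> ks p" by (meson all_not_in_conv keys_eq_empty)
  have "m0 \<noteq> 0" using m0 assms(2) by (auto simp: in_keys_iff)
  then have "ks m0 \<noteq> {}" by simp
  define V where "V = (\<Union>m\<in>ks p. ks m)"
  have V: "finite V" "V \<noteq> {}" unfolding V_def using m0 \<open>ks m0 \<noteq> {}\<close> by auto
  define K where "K = Max V"
  have "K \<in> V" using V by (simp add: K_def)
  then obtain m where m: "m \<in> ks p" "K \<in> ks m" by (auto simp: V_def)
  have top: "lk n k = 0" if "n \<in> ks p" "k > K" for n k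
  proof (rule ccontr)
    assume "lk n k \<noteq> 0"
    then have "k \<in> V" using that(1) by (auto simp: V_def in_keys_iff)
    then have "k \<le> K" using V by (simp add: K_def)
    then show False using that by simp
  qed
  let ?m = "m - sg K 1 + sg (Suc K) 1"
  have eq: "n - sg k 1 + sg (Suc k) 1 = ?m \<longleftrightarrow> n = m \<and> k = K" if n: "n \<in> ks p" "k \<in> ks n" for n k
  proof
    assume e: "n - sg k 1 + sg (Suc k) 1 = ?m"
    \<comment> \<open>The exponent at \<open>Suc K\<close> is 1 on the right and can be nonzero on
      the left only for this \<open>k\<close>.\<close>
    have kK: "k = K"
      using arg_cong[OF e, of "\<lambda>x. lk x (Suc K)"] top[OF n(1), of "Suc K"] top[OF m(1), of "Suc K"]
      by (auto simp: lookup_add lookup_minus lookup_single when_def split: if_splits)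
    have "n - sg K 1 = m - sg K 1" using e kK by simp
    then have "lk (n - sg K 1) i = lk (m - sg K 1) i" for i by simp
    then have i: "lk n i - lk (sg K (1::nat)) i = lk m i - lk (sg K 1) i" for i by (simp add: lookup_minus)
    have "lk n i = lk m i" for i
      using i[of i] n(2) m(2) kK by (cases "i = K") (auto simp: lookup_single when_def in_keys_iff)
    then show "n = m \<and> k = K" using kK by (auto intro: poly_mapping_eqI)
  qed simp
  have "lk (dx p) ?m = (\<Sum>n\<in>ks p. \<Sum>k\<in>ks n. if n = m \<and> k = K then lk p n * of_nat (lk n k) else 0)"
    unfolding dx_def der_alt dmono_def lookup_sum
  proof (intro sum.cong refl)
    fix n assume n: "n \<in> ks p"
    have "lk (of_nat (lk n k) * sg (n - sg k 1) 1 * uvar (Suc k) :: kdv) ?m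
        = (if n = m \<and> k = K then of_nat (lk n k) else 0)" if "k \<in> ks n" for k
    proof -
      have "(of_nat (lk n k) * sg (n - sg k 1) 1 * uvar (Suc k) :: kdv) = cst (of_nat (lk n k)) * (sg (n - sg k 1) 1 * uvar (Suc k))"
        by (simp add: mult.assoc)
      then show ?thesis
        by (simp only: lookup_cst_mult lookup_sum_shift eq[OF n that]) simp
    qed
    then show "lk (cst (lk p n) * (\<Sum>k\<in>ks n. of_nat (lk n k) * sg (n - sg k 1) 1 * uvar (Suc k))) ?m
      = (\<Sum>k\<in>ks n. if n = m \<and> k = K then lk p n * of_nat (lk n k) else 0)"
      by (auto simp: lookup_cst_mult lookup_sum sum_distrib_left intro!: sum.cong)
  qed
  also have "\<dots> = (\<Sum>n\<in>ks p. if n = m then (\<Sum>k\<in>ks n. if k = K then lk p n * of_nat (lk n k) else 0) else 0)"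
    by (intro sum.cong refl) auto
  also have "\<dots> = lk p m * of_nat (lk m K)"
    using m by simp
  also have "\<dots> \<noteq> 0" using m by (simp add: in_keys_iff)
  finally show False using assms(1) by simp
qed

lemma dx_inj: "dx p = dx q \<Longrightarrow> lk p 0 = lk q 0 \<Longrightarrow> p = q"
  using dx_eq_0[of "p - q"] by (simp add: dx_simps lookup_minus)

lemma antider_eqI:
  assumes "dx p = q" "lk p 0 = 0"
  shows "antider q = p"
  unfolding antider_def
proof (rule the_equality)
  show "lk p 0 = 0 \<and> dx p = q" using assms by simp
  show "r = p" if "lk r 0 = 0 \<and> dx r = q" for r
    using that assms by (metis dx_inj)
qed

section \<open>Weights, and derivations acting coefficientwise on power series\<close>

no_notation vec_index (infixl "$" 100)
unbundle fps_syntax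

text \<open>For this grading \<open>kS n\<close> has weight 2n and, for positive n, the flow
  \<open>dt n\<close> raises weights by 2n - 1. It forces constant terms to vanish and cuts A into
  finite-dimensional pieces.\<close>

definition wt :: "(nat \<Rightarrow>\<^sub>0 nat) \<Rightarrow> nat" where
  "wt m = (\<Sum>k\<in>ks m. lk m k * (k + 2))"

definition homog :: "nat \<Rightarrow> kdv \<Rightarrow> bool" where
  "homog d p \<longleftrightarrow> (\<forall>m\<in>ks p. wt m = d)"

lemma wt_superset: "finite K \<Longrightarrow> ks m \<subseteq> K \<Longrightarrow> wt m = (\<Sum>k\<in>K. lk m k * (k + 2))"
  unfolding wt_def by (intro sum.mono_neutral_left) (auto simp: in_keys_iff)

lemma wt_0 [simp]: "wt 0 = 0"
  by (simp add: wt_def)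

lemma wt_single [simp]: "wt (sg k a) = a * (k + 2)"
  by (simp add: wt_def)

lemma wt_add [simp]: "wt (m + n) = wt m + wt n"
proof -
  let ?K = "ks m \<union> ks n"
  have "wt (m + n) = (\<Sum>k\<in>?K. lk (m + n) k * (k + 2))" by (rule wt_superset) (auto simp: keys_add)
  also have "\<dots> = wt m + wt n"
    by (simp add: lookup_add algebra_simps sum.distrib wt_superset[of ?K])
  finally show ?thesis .
qed

lemma homog_0 [simp]: "homog d 0"
  by (simp add: homog_def)

lemma homog_add: "homog d p \<Longrightarrow> homog d q \<Longrightarrow> homog d (p + q)"
  unfolding homog_def using keys_add[of p q] by blast

lemma homog_uminus: "homog d p \<Longrightarrow> homog d (- p)"
  by (simp add: homog_def)

lemma homog_diff: "homog d p \<Longrightarrow> homog d q \<Longrightarrow> homog d (p - q)"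
  using homog_add[of d p "- q"] homog_uminus by simp

lemma homog_sum: "(\<And>a. a \<in> A \<Longrightarrow> homog d (f a)) \<Longrightarrow> homog d (\<Sum>a\<in>A. f a)"
  by (induction A rule: infinite_finite_induct) (auto intro: homog_add)

lemma homog_mult: "homog d p \<Longrightarrow> homog e q \<Longrightarrow> d + e = f \<Longrightarrow> homog f (p * q)"
  unfolding homog_def using keys_mult[of p q] by fastforce



lemma homog_cst [simp]: "homog 0 (cst c)"
  by (simp add: homog_def cst_def)

lemma homog_1 [simp]: "homog 0 1"
  by (simp add: homog_def)

lemma homog_cst_mult: "homog d p \<Longrightarrow> homog d (cst c * p)"
  by (rule homog_mult[of 0]) simp_all

lemma homog_uvar [simp]: "homog (k + 2) (uvar k)"
  by (simp add: homog_def uvar_def)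

lemma homog_single: "homog (wt m) (sg m c)"
  by (simp add: homog_def)

lemma homog_lookup_0: "homog d p \<Longrightarrow> d > 0 \<Longrightarrow> lk p 0 = 0"
  unfolding homog_def by (metis in_keys_iff less_numeral_extra(3) wt_0)

lemma homog_dmono:
  assumes "\<And>k. homog (k + 2 + n) (g k)"
  shows "homog (wt m + n) (dmono g m)"
  unfolding dmono_def
proof (rule homog_sum)
  fix k assume k: "k \<in> ks m"
  have "m = (m - sg k 1) + sg k 1"
    using k by (intro poly_mapping_eqI) (auto simp: lookup_add lookup_minus lookup_single when_def in_keys_iff)
  then have "wt m = wt (m - sg k 1) + (k + 2)" by (metis mult_1 wt_add wt_single)
  then have *: "wt (m - sg k 1) + (k + 2 + n) = wt m + n" by simp
  have "homog (wt m + n) (sg (m - sg k 1) 1 * g k)"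
    by (rule homog_mult[OF homog_single assms *])
  then have "homog (wt m + n) (cst (of_nat (lk m k)) * (sg (m - sg k 1) 1 * g k))" by (rule homog_cst_mult)
  then show "homog (wt m + n) (of_nat (lk m k) * sg (m - sg k 1) 1 * g k)" by (simp add: mult.assoc)
qed

lemma homog_der:
  assumes "\<And>k. homog (k + 2 + n) (g k)" "homog d p"
  shows "homog (d + n) (der g p)"
  unfolding der_alt
proof (rule homog_sum)
  fix m assume "m \<in> ks p"
  then have "wt m = d" using assms(2) by (simp add: homog_def)
  then show "homog (d + n) (cst (lk p m) * dmono g m)"
    using homog_cst_mult[OF homog_dmono[of n g m]] assms(1) by auto
qed

lemma homog_dx: "homog d p \<Longrightarrow> homog (d + 1) (dx p)"
  unfolding dx_def by (rule homog_der) (use homog_uvar[of "Suc k" for k] in simp_all)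

lemma homog_dx_pow: "homog d p \<Longrightarrow> homog (d + k) ((dx ^^ k) p)"
  by (induction k) (auto dest: homog_dx)

definition fmap :: "(kdv \<Rightarrow> kdv) \<Rightarrow> kdv fps \<Rightarrow> kdv fps" where
  "fmap d F = Abs_fps (\<lambda>n. d (F $ n))"

lemma fmap_nth [simp]: "fmap d F $ n = d (F $ n)"
  by (simp add: fmap_def)

lemma fmap_der_mult: "fmap (der g) (F * G) = fmap (der g) F * G + F * fmap (der g) G"
  by (rule fps_ext) (simp add: fps_mult_nth der_simps sum.distrib)

lemma fmap_der_simps:
  "fmap (der g) (F + G) = fmap (der g) F + fmap (der g) G"
  "fmap (der g) (F - G) = fmap (der g) F - fmap (der g) G"
  "fmap (der g) (- F) = - fmap (der g) F"
  "fmap (der g) (fps_const c) = fps_const (der g c)"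
  "fmap (der g) fps_X = 0" "fmap (der g) 0 = 0" "fmap (der g) 1 = 0" "fmap (der g) (numeral v) = 0"
  "fmap (der g) (fps_X * F) = fps_X * fmap (der g) F"
  by (auto simp: fps_eq_iff der_simps numeral_fps_const)

lemmas fmap_dx_mult = fmap_der_mult[of "\<lambda>k. uvar (Suc k)", folded dx_def]
lemmas fmap_dx_simps = fmap_der_simps[of "\<lambda>k. uvar (Suc k)", folded dx_def]

section \<open>The Lenard densities\<close>

abbreviation hf :: "kdv fps" where "hf \<equiv> fps_const (cst (1/2))"
abbreviation Uf :: "kdv fps" where "Uf \<equiv> fps_const (uvar 0)"

lemma half2: "2 * cst (1/2) = 1" "2 * cst (1/2) * p = p"
proof -
  have "cst 2 * cst (1/2) = 1" by (subst cst_simps(4)[symmetric]) simp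
  then show "2 * cst (1/2) = 1" "2 * cst (1/2) * p = p" by simp_all
qed

lemma hf2: "2 * hf = 1"
  using half2 by (simp add: numeral_fps_const)

text \<open>$S_{2n}$ with $S_0 = 1$: solving the first integral of the Lenard recursion (see \<open>Bf_quadratic\<close>)
  for its leading coefficient exhibits $S_{2n}$ as a differential polynomial without integration.\<close>
function kS :: "nat \<Rightarrow> kdv" where
  "kS 0 = 1"
| "kS (Suc n) = - (cst (1/2) * ((\<Sum>i\<in>{1..n}. kS i * kS (Suc n - i)) +
      (\<Sum>i\<in>{0..n}. uvar 0 * kS i * kS (n - i) - cst (1/2) * (kS i * dx (dx (kS (n - i))))
                    + cst (1/2) * cst (1/2) * (dx (kS i) * dx (kS (n - i))))))"
  by pat_completeness auto
termination by (relation "measure id") auto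

declare kS.simps(2) [simp del]

definition Bf :: "kdv fps" where "Bf = Abs_fps kS"

abbreviation "B1 \<equiv> fmap dx Bf"
abbreviation "B2 \<equiv> fmap dx B1"
abbreviation "B3 \<equiv> fmap dx B2"

lemma Bf_nth [simp]: "Bf $ n = kS n"
  by (simp add: Bf_def)

lemma Bf_nz: "Bf \<noteq> 0"
  by (metis Bf_nth fps_zero_nth kS.simps(1) zero_neq_one)

lemma Bf_quadratic:
  "Bf * Bf + fps_X * (Uf * Bf * Bf - hf * (Bf * B2) + hf * hf * (B1 * B1)) = 1"
proof (rule fps_ext)
  fix n
  show "(Bf * Bf + fps_X * (Uf * Bf * Bf - hf * (Bf * B2) + hf * hf * (B1 * B1))) $ n = 1 $ n"
  proof (cases n)
    case (Suc m)
    have c: "(fps_const c * F * G) $ k = c * (F * G) $ k" for c :: kdv and F G k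
      by (simp add: mult.assoc)
    have BB: "(Bf * Bf) $ Suc m = 2 * kS (Suc m) + (\<Sum>i\<in>{1..m}. kS i * kS (Suc m - i))"
    proof -
      have "(Bf * Bf) $ Suc m = (\<Sum>i=0..Suc m. kS i * kS (Suc m - i))" by (simp add: fps_mult_nth)
      also have "{0..Suc m} = insert 0 (insert (Suc m) {1..m})" by auto
      finally show ?thesis by simp
    qed
    have k: "2 * kS (Suc m) = - (\<Sum>i\<in>{1..m}. kS i * kS (Suc m - i)) -
      (\<Sum>i\<in>{0..m}. uvar 0 * kS i * kS (m - i) - cst (1/2) * (kS i * dx (dx (kS (m - i))))
                    + cst (1/2) * cst (1/2) * (dx (kS i) * dx (kS (m - i))))"
      unfolding kS.simps(2) by (subst mult_minus_right, subst mult.assoc[symmetric], subst half2) simp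
    have "(fps_X * (Uf * Bf * Bf - hf * (Bf * B2) + hf * hf * (B1 * B1))) $ Suc m
      = uvar 0 * (Bf * Bf) $ m - cst (1/2) * (Bf * B2) $ m + cst (1/2) * cst (1/2) * (B1 * B1) $ m"
      by (simp add: mult.assoc)
    also have "\<dots> = (\<Sum>i\<in>{0..m}. uvar 0 * kS i * kS (m - i) - cst (1/2) * (kS i * dx (dx (kS (m - i))))
                    + cst (1/2) * cst (1/2) * (dx (kS i) * dx (kS (m - i))))"
      by (simp add: fps_mult_nth sum_distrib_left sum_subtractf sum.distrib mult.assoc)
    finally show ?thesis using BB k Suc by simp
  qed simp
qed

text \<open>The differentiated relation is \<open>B\<close> times the claim, the terms in
  \<open>Ba * Bb\<close> cancelling because \<open>2 * h = 1\<close>. As in the other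
  \<open>idom_\<close> lemmas, \<open>Ba\<close>, \<open>Bb\<close>, \<open>Bc\<close> stand for
  successive x-derivatives, so that the computation is plain ring algebra.\<close>

lemma idom_quadratic_derivative:
  fixes B Ba Bb Bc X U Ua h :: "'a::idom"
  assumes h: "2 * h = 1"
    and e: "Ba * B + B * Ba + X * (Ua * B * B + U * Ba * B + U * B * Ba - h * (Ba * Bb + B * Bc) + h * h * (Bb * Ba + Ba * Bb)) = 0"
    and "B \<noteq> 0"
  shows "2 * Ba + X * (Ua * B + 2 * U * Ba - h * Bc) = 0"
proof -
  have "h * h * (Bb * Ba + Ba * Bb) = (2 * h) * (h * (Ba * Bb))" by (simp add: algebra_simps)
  then have *: "h * h * (Bb * Ba + Ba * Bb) = h * (Ba * Bb)" using h by simp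
  have "B * (2 * Ba + X * (Ua * B + 2 * U * Ba - h * Bc)) = 0"
    using e[unfolded *] by (simp add: algebra_simps)
  then show ?thesis using \<open>B \<noteq> 0\<close> by simp
qed

lemma fmap_dx_const [simp]: "fmap dx (fps_const c) = fps_const (dx c)"
  by (rule fmap_dx_simps)

text \<open>This is the Lenard recursion, all orders at once.\<close>

lemma Bf_ode: "2 * B1 + fps_X * (fps_const (uvar 1) * Bf + 2 * Uf * B1 - hf * B3) = 0"
proof (rule idom_quadratic_derivative[where Bb=B2])
  have "fmap dx (Bf * Bf + fps_X * (Uf * Bf * Bf - hf * (Bf * B2) + hf * hf * (B1 * B1))) = 0"
    unfolding Bf_quadratic by (rule fmap_dx_simps)
  then show "B1 * Bf + Bf * B1 + fps_X * (fps_const (uvar 1) * Bf * Bf + Uf * B1 * Bf + Uf * Bf * B1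
    - hf * (B1 * B2 + Bf * B3) + hf * hf * (B2 * B1 + B1 * B2)) = 0"
    unfolding fmap_dx_simps(1,2,4,9) fmap_dx_mult fmap_dx_simps(5) by (simp add: algebra_simps)
qed (simp_all add: hf2 Bf_nz)

lemma kS_ode: "2 * dx (kS (Suc n)) + (uvar 1 * kS n + 2 * uvar 0 * dx (kS n) - cst (1/2) * dx (dx (dx (kS n)))) = 0"
proof -
  have "(2 * B1 + fps_X * (fps_const (uvar 1) * Bf + 2 * Uf * B1 - hf * B3)) $ Suc n = 0"
    by (simp only: Bf_ode fps_zero_nth)
  then show ?thesis by (simp add: mult.assoc numeral_fps_const)
qed

lemma homog_kS: "homog (2 * n) (kS n)"
proof (induction n rule: less_induct)
  case (less n)
  show ?case
  proof (cases n)
    case (Suc m)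
    have IH: "homog (2 * i) (kS i)" if "i \<le> m" for i using less[of i] that Suc by simp
    have IH1: "homog (2 * i + 1) (dx (kS i))" if "i \<le> m" for i by (rule homog_dx[OF IH[OF that]])
    have IH2: "homog (2 * i + 2) (dx (dx (kS i)))" if "i \<le> m" for i using homog_dx[OF IH1[OF that]] by simp
    have "homog (2 * n) (kS i * kS (Suc m - i))" if "i \<in> {1..m}" for i
      by (rule homog_mult[OF IH IH]) (use that Suc in auto)
    moreover have "homog (2 * n) (uvar 0 * kS i * kS (m - i))" if "i \<in> {0..m}" for i
      by (rule homog_mult[OF homog_mult[OF homog_uvar IH refl] IH]) (use that Suc in auto)
    moreover have "homog (2 * n) (kS i * dx (dx (kS (m - i))))" if "i \<in> {0..m}" for i
      by (rule homog_mult[OF IH IH2]) (use that Suc in auto)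
    moreover have "homog (2 * n) (dx (kS i) * dx (kS (m - i)))" if "i \<in> {0..m}" for i
      by (rule homog_mult[OF IH1 IH1]) (use that Suc in auto)
    ultimately show ?thesis
      unfolding Suc kS.simps(2) mult.assoc[of "cst (1/2)" "cst (1/2)"]
      by (intro homog_uminus homog_cst_mult homog_add homog_sum homog_diff) (simp_all add: Suc)
  qed simp
qed

lemma idom_solve_half:
  fixes h :: "'a::idom"
  assumes h: "2 * h = 1" and e: "2 * T + (a - h * D) = 0"
  shows "T = h * h * D - h * a"
proof -
  have "T = (2 * h) * T" using h by simp
  then have "T = h * (2 * T)" by (simp add: algebra_simps)
  also have "2 * T = h * D - a" using e by (simp add: algebra_simps eq_neg_iff_add_eq_0)
  finally show ?thesis by (simp add: algebra_simps)
qed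

lemma S_odd_even:
  "S (2 * Suc n) = kS (Suc n)"
proof (induction n)
  case 0
  have "kS 1 = cst (-1/2) * uvar 0"
    using kS.simps(2)[of 0] by simp
  then show ?case by (simp add: S.simps)
next
  case (Suc n)
  have "S (2 * Suc (Suc n)) = antider (cst (1/4) * (dx ^^ 3) (kS (Suc n)) - uvar 0 * dx (kS (Suc n))
                        - cst (1/2) * uvar 1 * kS (Suc n))"
    using Suc by (subst S.simps) simp
  also have "\<dots> = kS (Suc (Suc n))"
  proof (rule antider_eqI)
    have c: "cst (1/4) = cst (1/2) * cst (1/2)" by (subst cst_simps(4)[symmetric]) simp
    have s: "cst (1/2) * (uvar 1 * kS (Suc n) + 2 * uvar 0 * dx (kS (Suc n)))
      = cst (1/2) * uvar 1 * kS (Suc n) + (2 * cst (1/2)) * (uvar 0 * dx (kS (Suc n)))"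
      by (simp add: algebra_simps)
    show "dx (kS (Suc (Suc n))) = cst (1/4) * (dx ^^ 3) (kS (Suc n)) - uvar 0 * dx (kS (Suc n))
                        - cst (1/2) * uvar 1 * kS (Suc n)"
      unfolding c using idom_solve_half[OF half2(1) kS_ode[of "Suc n"]] unfolding s half2
      by (simp add: eval_nat_numeral)
    \<comment> \<open>The normalisation of the antiderivative comes for free: an element of positive
      weight has no constant term.\<close>
    show "lk (kS (Suc (Suc n))) 0 = 0"
      by (rule homog_lookup_0[OF homog_kS]) simp
  qed
  finally show ?case .
qed

section \<open>The commuting flows\<close>

definition dt :: "nat \<Rightarrow> kdv \<Rightarrow> kdv" where
  "dt n = der (\<lambda>k. (dx ^^ Suc k) (kS n))"

lemmas additive_dt = additive_der[of "\<lambda>k. (dx ^^ Suc k) (kS n)", folded dt_def] for n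
lemmas dt_simps = der_simps[of "\<lambda>k. (dx ^^ Suc k) (kS n)", folded dt_def] for n
lemmas fmap_dt_mult = fmap_der_mult[of "\<lambda>k. (dx ^^ Suc k) (kS n)", folded dt_def] for n
lemmas fmap_dt_simps = fmap_der_simps[of "\<lambda>k. (dx ^^ Suc k) (kS n)", folded dt_def] for n

lemma dt_uvar: "dt n (uvar k) = (dx ^^ Suc k) (kS n)"
  by (simp add: dt_def)

lemma dt_cst [simp]: "dt n (cst c) = 0" and dt_0 [simp]: "dt n 0 = 0" and dt_1 [simp]: "dt n 1 = 0"
  and dt_cst_mult [simp]: "dt n (cst c * p) = cst c * dt n p"
  by (simp_all add: dt_def)

lemma dd_dt: "dd (2 * n + 1) = dt (Suc n)"
proof -
  have "2 * n + 1 + 1 = 2 * Suc n" by simp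
  then show ?thesis unfolding dd_def dt_def by (simp only: S_odd_even)
qed

lemma dt_dx: "dt n (dx p) = dx (dt n p)"
  unfolding dt_def dx_def by (rule der_commute) (simp flip: dx_def)

lemma dt_dx_pow: "dt n ((dx ^^ k) p) = (dx ^^ k) (dt n p)"
  by (induction k) (simp_all add: dt_dx)

text \<open>The density with index 0 is constant. This degenerate flow starts the induction in
  \<open>kY_sym\<close>.\<close>

lemma dt_zero: "dt 0 p = 0"
proof -
  have "dx ((dx ^^ k) 1) = 0" for k by (induction k) simp_all
  then show ?thesis unfolding dt_def der_alt dmono_def by simp
qed

lemma homog_dt: "homog d p \<Longrightarrow> homog (d + (2 * n - 1)) (dt n p)"
proof (cases "n = 0")
  case True
  then show ?thesis by (simp add: dt_zero)
next
  case False
  assume "homog d p"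
  moreover have "homog (k + 2 + (2 * n - 1)) ((dx ^^ Suc k) (kS n))" for k
    using homog_dx_pow[OF homog_kS[of n], of "Suc k"] False by (simp add: algebra_simps)
  ultimately show ?thesis unfolding dt_def by (intro homog_der)
qed

text \<open>The series \<open>Yf n\<close> of the \<open>kY a n\<close> and the derivative of \<open>Bf\<close> along the \<open>n\<close>-th flow solve
  the same linear equation, whose solution is unique; this makes the derivative symmetric.\<close>
fun kY :: "nat \<Rightarrow> nat \<Rightarrow> kdv" where
  "kY 0 n = 0"
| "kY (Suc a) n = kY a (Suc n) - cst (1/2) * (dx (kS n) * kS a - kS n * dx (kS a))"

definition Yf :: "nat \<Rightarrow> kdv fps" where "Yf n = Abs_fps (\<lambda>a. kY a n)"

text \<open>The linearization at \<open>Bf\<close> of the left-hand side of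
  \<open>Bf_quadratic\<close>.\<close>

definition lin :: "kdv fps \<Rightarrow> kdv fps" where
  "lin Z = 2 * Bf * Z + fps_X * (2 * Uf * Bf * Z - hf * (Z * B2 + Bf * fmap dx (fmap dx Z)) + hf * (B1 * fmap dx Z))"

lemma lin_diff: "lin (F - G) = lin F - lin G"
  by (simp add: lin_def fmap_dx_simps algebra_simps)

lemma lin_X: "lin (fps_X * F) = fps_X * lin F"
  unfolding lin_def fmap_dx_simps by (simp add: algebra_simps)

lemma lin_const: "lin (fps_const c * F) = fps_const c * lin F" if "dx c = 0"
proof -
  have *: "fmap dx (fps_const c * F) = fps_const c * fmap dx F" for F
    using that by (simp add: fmap_dx_mult)
  show ?thesis unfolding lin_def * by (simp add: algebra_simps)
qed

text \<open>\<open>Bf\<close> has constant term 1, so the k-th coefficient of \<open>lin Z\<close>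
  is twice that of \<open>Z\<close> plus terms in lower coefficients, which enter through the factor
  \<open>fps_X\<close>.\<close>

lemma lin_inj:
  assumes "lin Z = 0"
  shows "Z = 0"
proof -
  have "Z $ k = 0" for k
  proof (induction k rule: less_induct)
    case (less k)
    have m: "(F * G) $ j = 0" if "\<And>i. i \<le> j \<Longrightarrow> G $ i = 0" for F G :: "kdv fps" and j
      using that by (simp add: fps_mult_nth)
    define R where "R = 2 * Uf * Bf * Z - hf * (Z * B2 + Bf * fmap dx (fmap dx Z)) + hf * (B1 * fmap dx Z)"
    have R: "(fps_X * R) $ k = 0"
    proof (cases k)
      case (Suc j)
      have z: "Z $ i = 0" if "i \<le> j" for i using less that Suc by simp
      have "(2 * Uf * Bf * Z) $ j = 0" by (rule m) (use z in simp)
      moreover have "(hf * (Z * B2 + Bf * fmap dx (fmap dx Z))) $ j = 0"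
        by (rule m) (use z in \<open>simp add: fps_mult_nth\<close>)
      moreover have "(hf * (B1 * fmap dx Z)) $ j = 0" 
        by (rule m) (use z in \<open>simp add: fps_mult_nth\<close>)
      ultimately show ?thesis using Suc by (simp add: R_def)
    qed simp
    have "(2 * Bf * Z) $ k = 2 * Z $ k"
    proof -
      have "(Bf * Z) $ k = (\<Sum>i\<in>{0..k}. if i = 0 then Z $ k else 0)"
        unfolding fps_mult_nth by (intro sum.cong) (use less in auto)
      then show ?thesis by (simp add: mult.assoc numeral_fps_const)
    qed
    moreover have "(2 * Bf * Z) $ k + (fps_X * R) $ k = 0"
      using arg_cong[OF assms, of "\<lambda>F. F $ k"] by (simp add: lin_def R_def)
    ultimately show ?case using R by simp
  qed
  then show ?thesis by (simp add: fps_eq_iff)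
qed

text \<open>The two sides differ by \<open>X * B * B\<close> times the equation for \<open>s\<close>
  minus \<open>B * s\<close> times the equation for \<open>B\<close>.\<close>

lemma idom_wronskian:
  fixes B Ba Bb Bc X U Ua h s sa sb sc ta :: "'a::idom"
  assumes h: "2 * h = 1"
    and ode: "2 * Ba + X * (Ua * B + 2 * U * Ba - h * Bc) = 0"
    and sode: "2 * ta + (Ua * s + 2 * U * sa - h * sc) = 0"
  shows "2 * B * (sa * B - s * Ba) + X * (2 * U * B * (sa * B - s * Ba)
      - h * ((sa * B - s * Ba) * Bb + B * (sc * B + sb * Ba - (sa * Bb + s * Bc)))
      + h * (Ba * (sb * B - s * Bb))) = 2 * sa * B * B - 2 * X * ta * B * B"
proof -
  have "2 * B * (sa * B - s * Ba) + X * (2 * U * B * (sa * B - s * Ba)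
      - h * ((sa * B - s * Ba) * Bb + B * (sc * B + sb * Ba - (sa * Bb + s * Bc)))
      + h * (Ba * (sb * B - s * Bb))) - (2 * sa * B * B - 2 * X * ta * B * B)
    = X * B * B * (2 * ta + (Ua * s + 2 * U * sa - h * sc))
      - B * s * (2 * Ba + X * (Ua * B + 2 * U * Ba - h * Bc))"
    by (simp add: algebra_simps)
  then show ?thesis using ode sode by simp
qed

lemma lin_wronskian:
  "lin (fps_const (dx (kS n)) * Bf - fps_const (kS n) * B1)
     = 2 * fps_const (dx (kS n)) * Bf * Bf - 2 * fps_X * fps_const (dx (kS (Suc n))) * Bf * Bf"
proof -
  let ?s = "\<lambda>k. fps_const ((dx ^^ k) (kS n))"
  have 1: "fmap dx (?s 1 * Bf - ?s 0 * B1) = ?s 2 * Bf - ?s 0 * B2"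
    by (simp add: fmap_dx_simps fmap_dx_mult eval_nat_numeral)
  have 2: "fmap dx (?s 2 * Bf - ?s 0 * B2) = ?s 3 * Bf + ?s 2 * B1 - (?s 1 * B2 + ?s 0 * B3)"
    by (simp add: fmap_dx_simps fmap_dx_mult eval_nat_numeral)
  have sode: "2 * fps_const (dx (kS (Suc n))) + (fps_const (uvar 1) * ?s 0 + 2 * Uf * ?s 1 - hf * ?s 3) = 0"
    using arg_cong[OF kS_ode[of n], of fps_const] by (simp add: eval_nat_numeral numeral_fps_const)
  have "lin (?s 1 * Bf - ?s 0 * B1) = 2 * ?s 1 * Bf * Bf - 2 * fps_X * fps_const (dx (kS (Suc n))) * Bf * Bf"
    unfolding lin_def 1 2
    by (rule idom_wronskian[OF hf2 Bf_ode sode])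
  then show ?thesis by simp
qed

lemma Yf_rec: "Yf n = fps_X * Yf (Suc n) - fps_X * (hf * (fps_const (dx (kS n)) * Bf - fps_const (kS n) * B1))"
proof (rule fps_ext)
  fix a
  show "Yf n $ a = (fps_X * Yf (Suc n) - fps_X * (hf * (fps_const (dx (kS n)) * Bf - fps_const (kS n) * B1))) $ a"
    by (cases a) (simp_all add: Yf_def)
qed

text \<open>Each \<open>E n\<close> is divisible by every power of X. This takes the place of an
  induction on \<open>n\<close>, which has no starting point since the relation leads
  upwards.\<close>

lemma fps_X_chain_0:
  fixes E :: "nat \<Rightarrow> 'a::comm_ring_1 fps"
  assumes "\<And>n. E n = fps_X * E (Suc n)"
  shows "E n = 0"
proof -
  have "E n $ k = 0" for k
  proof (induction k arbitrary: n)
    case 0 show ?case by (subst assms) simp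
  next
    case (Suc k) show ?case by (subst assms) (simp add: Suc)
  qed
  then show ?thesis by (simp add: fps_eq_iff)
qed

text \<open>\<open>lin_wronskian\<close> turns the bracket in \<open>Yf_rec\<close> into exactly the
  difference of the inhomogeneous terms for \<open>n\<close> and \<open>Suc n\<close>; the errors
  then form a chain as in \<open>fps_X_chain_0\<close>.\<close>

lemma lin_Yf: "lin (Yf n) + fps_X * (fps_const (dx (kS n)) * Bf * Bf) = 0"
proof (rule fps_X_chain_0[where E="\<lambda>n. lin (Yf n) + fps_X * (fps_const (dx (kS n)) * Bf * Bf)"])
  fix n
  have "lin (Yf n) = fps_X * lin (Yf (Suc n)) - fps_X * (hf * (2 * fps_const (dx (kS n)) * Bf * Bf
     - 2 * fps_X * fps_const (dx (kS (Suc n))) * Bf * Bf))"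
    by (subst Yf_rec) (simp only: lin_diff[of "fps_X * Yf (Suc n)"] lin_X lin_const[OF dx_cst] lin_wronskian)
  also have "\<dots> = fps_X * lin (Yf (Suc n)) - fps_X * ((2 * hf) * (fps_const (dx (kS n)) * Bf * Bf
     - fps_X * fps_const (dx (kS (Suc n))) * Bf * Bf))"
    by (simp add: algebra_simps)
  finally show "lin (Yf n) + fps_X * (fps_const (dx (kS n)) * Bf * Bf) =
       fps_X * (lin (Yf (Suc n)) + fps_X * (fps_const (dx (kS (Suc n))) * Bf * Bf))"
    unfolding hf2 by (simp add: algebra_simps)
qed

lemma fmap_dt_fmap_dx: "fmap (dt n) (fmap dx F) = fmap dx (fmap (dt n) F)"
  by (simp add: fps_eq_iff dt_dx)

text \<open>Apply the flow to \<open>Bf_quadratic\<close>. The only contribution not linear in the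
  derivative of \<open>Bf\<close> comes from the flow of u itself.\<close>

lemma lin_dt_Bf: "lin (fmap (dt n) Bf) + fps_X * (fps_const (dx (kS n)) * Bf * Bf) = 0"
proof -
  let ?Z = "fmap (dt n) Bf"
  have "fmap (dt n) (Bf * Bf + fps_X * (Uf * Bf * Bf - hf * (Bf * B2) + hf * hf * (B1 * B1))) = 0"
    unfolding Bf_quadratic by (rule fmap_dt_simps)
  then have e: "?Z * Bf + Bf * ?Z + fps_X * (fps_const (dx (kS n)) * Bf * Bf + Uf * ?Z * Bf + Uf * Bf * ?Z
    - hf * (?Z * B2 + Bf * fmap dx (fmap dx ?Z)) + hf * hf * (fmap dx ?Z * B1 + B1 * fmap dx ?Z)) = 0"
    unfolding fmap_dt_simps(1,2,4,9) fmap_dt_mult fmap_dt_simps(5) fmap_dt_fmap_dx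
    by (simp add: algebra_simps dt_uvar del: fps_const_mult)
  have "hf * hf * (fmap dx ?Z * B1 + B1 * fmap dx ?Z) = (2 * hf) * (hf * (B1 * fmap dx ?Z))"
    by (simp add: algebra_simps del: fps_const_mult)
  then have *: "hf * hf * (fmap dx ?Z * B1 + B1 * fmap dx ?Z) = hf * (B1 * fmap dx ?Z)"
    by (simp add: hf2)
  show ?thesis using e[unfolded *] unfolding lin_def by (simp add: algebra_simps)
qed

lemma dt_kS: "dt n (kS a) = kY a n"
proof -
  have "lin (fmap (dt n) Bf - Yf n) = 0"
    using lin_dt_Bf[of n] lin_Yf[of n] unfolding lin_diff by (metis add_right_cancel diff_self)
  then have "fmap (dt n) Bf = Yf n" using lin_inj by fastforce
  then have "fmap (dt n) Bf $ a = Yf n $ a" by simp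
  then show ?thesis by (simp add: Yf_def)
qed

text \<open>The bracket in the recursion changes sign when \<open>a\<close> and \<open>n\<close> are
  exchanged, so symmetry passes from \<open>a\<close> to \<open>Suc a\<close>. The missing case,
  second index 0, is the zero flow.\<close>

lemma kY_sym: "kY a n = kY n a"
proof -
  have 0: "kY a 0 = 0" for a
    by (metis dt_kS dt_zero)
  show ?thesis
  proof (induction a arbitrary: n)
    case (Suc a)
    have "kY (Suc n) a = kY n (Suc a) - cst (1/2) * (dx (kS a) * kS n - kS a * dx (kS n))" by simp
    moreover have "kY (Suc n) a = kY a (Suc n)" using Suc by simp
    ultimately show ?case by (simp add: algebra_simps)
  qed (simp add: 0)
qed

lemma dt_kS_sym: "dt n (kS a) = dt a (kS n)"
  by (simp add: dt_kS kY_sym)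

lemma dt_commute: "dt m (dt n p) = dt n (dt m p)"
proof -
  have "dt m ((dx ^^ Suc k) (kS n)) = dt n ((dx ^^ Suc k) (kS m))" for k
    by (simp only: dt_dx_pow dt_kS_sym)
  then show ?thesis unfolding dt_def by (intro der_commute) (simp only: dt_def)
qed

section \<open>Hook functions and second derivatives of the tau function\<close>

text \<open>Up to signs, \<open>kH (Suc a) (Suc n)\<close> is a hook Schur function if the \<open>kS\<close> are read as complete
  symmetric functions and the \<open>kW\<close> as signed elementary ones.\<close>
fun kW :: "nat \<Rightarrow> kdv" where
  "kW 0 = 1"
| "kW (Suc n) = - (\<Sum>i\<in>{0..n}. kW i * kS (Suc n - i))"

declare kW.simps(2) [simp del]

fun kH :: "nat \<Rightarrow> nat \<Rightarrow> kdv" where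
  "kH 0 n = 0"
| "kH (Suc a) n = kH a (Suc n) + kW a * kS n"

definition Wf :: "kdv fps" where "Wf = Abs_fps kW"
definition Vf :: "nat \<Rightarrow> kdv fps" where "Vf n = Abs_fps (\<lambda>a. kH a n)"

lemma Wf_nth [simp]: "Wf $ n = kW n"
  by (simp add: Wf_def)

lemma Wf_Bf: "Wf * Bf = 1"
proof (rule fps_ext)
  fix n show "(Wf * Bf) $ n = 1 $ n"
    by (cases n) (simp_all add: fps_mult_nth kW.simps(2))
qed

lemma homog_kW: "homog (2 * n) (kW n)"
proof (induction n rule: less_induct)
  case (less n)
  show ?case
  proof (cases n)
    case (Suc m)
    have "homog (2 * n) (kW i * kS (Suc m - i))" if "i \<in> {0..m}" for i
      by (rule homog_mult[OF less homog_kS]) (use that Suc in auto)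
    then show ?thesis unfolding Suc kW.simps(2) by (intro homog_uminus homog_sum) (simp add: Suc)
  qed simp
qed

lemma homog_kH: "homog (2 * a + 2 * n - 2) (kH a n)"
proof (induction a arbitrary: n)
  case (Suc a)
  have "homog (2 * Suc a + 2 * n - 2) (kH a (Suc n))" using Suc[of "Suc n"] by simp
  moreover have "homog (2 * Suc a + 2 * n - 2) (kW a * kS n)"
    by (rule homog_mult[OF homog_kW homog_kS]) simp
  ultimately show ?case by (simp add: homog_add)
qed simp

lemma idom_inverse_derivative:
  fixes W :: "'a::idom"
  assumes "W * B = 1" "Wa * B + W * Ba = 0"
  shows "Wa = - W * W * Ba"
proof -
  have "Wa = Wa * (W * B)" using assms by simp
  also have "\<dots> = W * (Wa * B)" by (simp add: algebra_simps)
  also have "Wa * B = - W * Ba" using assms by (simp add: eq_neg_iff_add_eq_0)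
  finally show ?thesis by simp
qed

lemma dx_Wf: "fmap dx Wf = - Wf * Wf * B1"
proof (rule idom_inverse_derivative[OF Wf_Bf])
  show "fmap dx Wf * Bf + Wf * B1 = 0"
    unfolding fmap_dx_mult[symmetric] Wf_Bf by (rule fmap_dx_simps)
qed

lemma dt_Bf: "fmap (dt n) Bf = Yf n"
  by (simp add: fps_eq_iff dt_kS Yf_def)

lemma dt_Wf: "fmap (dt n) Wf = - Wf * Wf * Yf n"
proof (rule idom_inverse_derivative[OF Wf_Bf])
  show "fmap (dt n) Wf * Bf + Wf * Yf n = 0"
    unfolding dt_Bf[symmetric] fmap_dt_mult[symmetric] Wf_Bf by (rule fmap_dt_simps)
qed

lemma Vf_rec: "Vf n = fps_X * Vf (Suc n) + fps_X * (Wf * fps_const (kS n))"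
proof (rule fps_ext)
  fix a
  show "Vf n $ a = (fps_X * Vf (Suc n) + fps_X * (Wf * fps_const (kS n))) $ a"
    by (cases a) (simp_all add: Vf_def)
qed

text \<open>The coefficients of \<open>Wf\<close> are conserved densities with flux one half of
  \<open>kH\<close>. Dividing \<open>Yf_rec\<close> by the square of \<open>Bf\<close> gives, up to
  the factor 1/2, the x-derivative of the recursion of \<open>Vf\<close>, so the difference of the
  two sides is an X-chain.\<close>

lemma dt_kW: "dt n (kW a) = cst (1/2) * dx (kH a n)"
proof -
  have "fmap (dt n) Wf - hf * fmap dx (Vf n) = 0"
  proof (rule fps_X_chain_0[where E="\<lambda>n. fmap (dt n) Wf - hf * fmap dx (Vf n)"])
    fix n
    let ?s = "fps_const (kS n)" and ?t = "fps_const (dx (kS n))"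
    have v: "fmap dx (Vf n) = fps_X * fmap dx (Vf (Suc n)) + fps_X * (fmap dx Wf * ?s + Wf * ?t)"
      by (subst Vf_rec) (simp add: fmap_dx_simps fmap_dx_mult)
    have "- Wf * Wf * Yf n = fps_X * (- Wf * Wf * Yf (Suc n))
       + fps_X * (hf * (Wf * (Wf * Bf) * ?t - Wf * Wf * B1 * ?s))"
      by (subst Yf_rec) (simp add: algebra_simps)
    then have "fmap (dt n) Wf = fps_X * fmap (dt (Suc n)) Wf + fps_X * (hf * (Wf * ?t - Wf * Wf * B1 * ?s))"
      by (simp add: dt_Wf Wf_Bf)
    then show "fmap (dt n) Wf - hf * fmap dx (Vf n)
      = fps_X * (fmap (dt (Suc n)) Wf - hf * fmap dx (Vf (Suc n)))"
      unfolding v dx_Wf by (simp add: algebra_simps del: fps_const_mult)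
  qed
  then have "fmap (dt n) Wf $ a = (hf * fmap dx (Vf n)) $ a" by simp
  then show ?thesis by (simp add: Vf_def)
qed

section \<open>The Euler operator in the series variable and the Riccati equation\<close>

definition theta :: "kdv fps \<Rightarrow> kdv fps" where
  "theta F = fps_X * fps_deriv F"

lemma theta_simps: "theta (F + G) = theta F + theta G" "theta (F - G) = theta F - theta G"
  "theta (F * G) = theta F * G + F * theta G" "theta (fps_const c) = 0" "theta fps_X = fps_X" "theta 1 = 0"
  by (simp_all add: theta_def algebra_simps)

lemma theta_nth: "theta F $ n = of_nat n * F $ n"
  by (cases n) (simp_all add: theta_def)

lemma dx_theta: "fmap dx (theta F) = theta (fmap dx F)"
proof -
  have "dx (of_nat n * p) = of_nat n * dx p" for n p
    using dx_cst_mult[of "of_nat n" p] by simp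
  then show ?thesis by (simp add: fps_eq_iff theta_nth)
qed

text \<open>The logarithmic x-derivative of \<open>Bf\<close>.\<close>

definition yf :: "kdv fps" where "yf = B1 * Wf"
definition kG :: "nat \<Rightarrow> kdv" where "kG n = - (hf * (fps_X * (Bf * theta yf))) $ n"

text \<open>Divide the quadratic relation by the square of \<open>B\<close>. If y is the logarithmic
  derivative, then B''/B is y' + y^2, and the quadratic relation becomes a Riccati equation.\<close>

lemma idom_riccati:
  fixes h :: "'a::idom"
  assumes h: "2 * h = 1" and W: "W * B = 1" and y: "y = Ba * W"
    and Bb: "Bb = ya * B + y * Ba"
    and I: "B * B + X * (U * B * B - h * (B * Bb) + h * h * (Ba * Ba)) = 1"
  shows "W * W = 1 + X * U - X * (h * ya + h * h * (y * y))"
proof -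
  have Ba: "Ba = y * B" using y W by (simp add: mult.assoc)
  have hh: "h * (y * y) = h * h * (y * y) + h * h * (y * y)"
  proof -
    have "h * h * (y * y) + h * h * (y * y) = (2 * h) * (h * (y * y))" by (simp add: algebra_simps)
    then show ?thesis using h by simp
  qed
  have "1 = B * B * (1 + X * U - X * (h * ya + (h * (y * y) - h * h * (y * y))))"
    using I unfolding Bb Ba by (simp add: algebra_simps)
  also have "\<dots> = B * B * (1 + X * U - X * (h * ya + h * h * (y * y)))"
    using hh by simp
  finally have "W * W * 1 = (W * B) * (W * B) * (1 + X * U - X * (h * ya + h * h * (y * y)))"
    by (metis (no_types, opaque_lifting) mult.assoc mult.commute)
  then show ?thesis using W by simp
qed

lemma Wf_sq: "Wf * Wf = 1 + fps_X * Uf - fps_X * (hf * fmap dx yf + hf * hf * (yf * yf))"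
proof (rule idom_riccati[OF hf2 Wf_Bf _ _ Bf_quadratic])
  have "yf * Bf = B1" unfolding yf_def using Wf_Bf by (simp add: mult.assoc)
  then show "B2 = fmap dx yf * Bf + yf * B1" using fmap_dx_mult[of yf Bf] by simp
qed (simp add: yf_def)

text \<open>Apply the Euler operator to the Riccati equation. A term with explicit factor
  \<open>X\<close> reproduces itself, and these copies add up to \<open>W * W - 1\<close>; after
  multiplication by \<open>B\<close> they become \<open>W - B\<close>. The remaining terms form an
  x-derivative.\<close>

lemma idom_gradient:
  fixes h :: "'a::idom"
  assumes h: "2 * h = 1" and W: "W * B = 1" and Ba: "Ba = y * B"
    and sq: "W * W = 1 + X * U - X * (h * ya + h * h * (y * y))"
    and der: "Wt * W + W * Wt = X * U - (X * (h * ya + h * h * (y * y)) + X * (h * yat + h * h * (yt * y + y * yt)))"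
  shows "W - B = 2 * Wt + h * (X * (Ba * yt + B * yat))"
proof -
  have "h * h * (yt * y + y * yt) = (2 * h) * (h * (y * yt))" by (simp add: algebra_simps)
  then have hh: "h * h * (yt * y + y * yt) = h * (y * yt)" using h by simp
  have "X * U - X * (h * ya + h * h * (y * y)) = W * W - 1" unfolding sq by simp
  moreover have "2 * (W * Wt) = (X * U - X * (h * ya + h * h * (y * y))) - h * (X * (yat + y * yt))"
    using der[unfolded hh] by (simp add: algebra_simps)
  ultimately have "2 * (W * Wt) = W * W - 1 - h * (X * (yat + y * yt))" by simp
  then have "B * (2 * (W * Wt)) = B * (W * W - 1 - h * (X * (yat + y * yt)))" by simp
  then have "(W * B) * (2 * Wt) = W * (W * B) - B - h * (X * (B * yat + y * B * yt))"
    by (simp add: algebra_simps)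
  then show ?thesis unfolding W Ba by (simp add: algebra_simps)
qed

text \<open>The Euler operator multiplies the n-th coefficient by \<open>n\<close>, whence the
  factor 1 - 2n. The lemma lets the known flux of \<open>kW\<close> be used for
  \<open>kS\<close>.\<close>

lemma kS_gradient: "kS n = cst (1 - 2 * of_nat n) * kW n + dx (kG n)"
proof -
  have y: "B1 = yf * Bf" unfolding yf_def using Wf_Bf by (simp add: mult.assoc)
  have "Wf - Bf = 2 * theta Wf + hf * (fps_X * (B1 * theta yf + Bf * theta (fmap dx yf)))"
  proof (rule idom_gradient[OF hf2 Wf_Bf y Wf_sq])
    show "theta Wf * Wf + Wf * theta Wf = fps_X * Uf - (fps_X * (hf * fmap dx yf + hf * hf * (yf * yf)) +
      fps_X * (hf * theta (fmap dx yf) + hf * hf * (theta yf * yf + yf * theta yf)))"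
      using arg_cong[OF Wf_sq, of theta] unfolding theta_simps by (simp add: algebra_simps del: fps_const_mult)
  qed
  also have "B1 * theta yf + Bf * theta (fmap dx yf) = fmap dx (Bf * theta yf)"
    by (simp only: fmap_dx_mult dx_theta)
  finally have "Wf - Bf = 2 * theta Wf + fmap dx (hf * (fps_X * (Bf * theta yf)))"
    by (simp add: fmap_dx_mult[of hf] fmap_dx_simps)
  then have "(Wf - Bf) $ n = (2 * theta Wf + fmap dx (hf * (fps_X * (Bf * theta yf)))) $ n" by simp
  then have "kW n - kS n = 2 * (of_nat n * kW n) - dx (kG n)"
    unfolding kG_def by (simp add: theta_nth numeral_fps_const dx_simps)
  then show ?thesis by (simp add: algebra_simps)
qed

definition fhomog :: "nat \<Rightarrow> kdv fps \<Rightarrow> bool" where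
  "fhomog e F \<longleftrightarrow> (\<forall>n. homog (2 * n + e) (F $ n))"

lemma fhomog_mult: "fhomog d F \<Longrightarrow> fhomog e G \<Longrightarrow> d + e = f \<Longrightarrow> fhomog f (F * G)"
  unfolding fhomog_def fps_mult_nth
proof (intro allI homog_sum)
  fix n i :: nat assume "\<forall>n. homog (2 * n + d) (F $ n)" "\<forall>n. homog (2 * n + e) (G $ n)" "d + e = f" "i \<in> {0..n}"
  then show "homog (2 * n + f) (F $ i * G $ (n - i))"
    by (intro homog_mult[of "2 * i + d" _ "2 * (n - i) + e"]) auto
qed

lemma homog_kG: "homog (2 * n - 1) (kG n)"
proof -
  have B: "fhomog 0 Bf" and W: "fhomog 0 Wf" by (simp_all add: fhomog_def homog_kS homog_kW)
  have B1: "fhomog 1 B1" using homog_dx[OF homog_kS] by (simp add: fhomog_def)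
  have y: "fhomog 1 yf" unfolding yf_def by (rule fhomog_mult[OF B1 W]) simp
  have "fhomog 1 (theta yf)"
    unfolding fhomog_def theta_nth using y homog_cst_mult[of _ _ "of_nat n" for n] by (auto simp: fhomog_def)
  then have F: "fhomog 1 (Bf * theta yf)" by (rule fhomog_mult[OF B]) simp
  show ?thesis
  proof (cases n)
    case (Suc m)
    then show ?thesis using F unfolding kG_def fhomog_def
      by (auto intro!: homog_uminus homog_cst_mult)
  qed (simp add: kG_def)
qed

text \<open>With the normalisation S_2 = -u/2 the first flow is -1/2 times \<open>dx\<close>. It
  inherits from \<open>dx\<close> that an element is determined by its image and its constant
  term.\<close>

lemma dt_1_dx: "dt 1 p = cst (-1/2) * dx p"
proof (rule derivation_eqI[where D="dt 1" and E="\<lambda>p. cst (-1/2) * dx p"])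
  have 1: "kS 1 = cst (-1/2) * uvar 0" using S_odd_even[of 0] by (simp add: S.simps)
  have 2: "(dx ^^ k) (cst c * p) = cst c * (dx ^^ k) p" for k c p by (induction k) simp_all
  have 3: "(dx ^^ k) (uvar 0) = uvar k" for k by (induction k) simp_all
  show "dt 1 (uvar k) = cst (-1/2) * dx (uvar k)" for k by (simp only: dt_uvar 1 2 3 dx_uvar)
qed (auto simp: additive_dt dt_simps dx_simps additive_def algebra_simps simp del: cst_simps)

lemma lookup_mult_0: "lk (p * q :: kdv) 0 = lk p 0 * lk q 0"
proof -
  have z: "m + n = 0 \<longleftrightarrow> m = 0 \<and> n = 0" for m n :: "nat \<Rightarrow>\<^sub>0 nat"
    by (auto simp: poly_mapping_eq_iff lookup_add fun_eq_iff)
  have 1: "lk (sg m c * sg n d :: kdv) 0 = lk (sg m c) 0 * lk (sg n d) 0" for m n c d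
    using z[of m n] by (auto simp: mult_single lookup_single when_def)
  have 2: "lk (sg m c * q) 0 = lk (sg m c) 0 * lk q 0" for m c
    by (rule additive_ext[where x=q], simp_all only: 1) (auto simp: additive_def algebra_simps lookup_add)
  show ?thesis
    by (rule additive_ext[where x=p], simp_all only: 2) (auto simp: additive_def algebra_simps lookup_add)
qed

lemma lookup_dt_0: "lk (dt n p) 0 = 0"
proof (cases "n = 0")
  case False
  have "lk ((dx ^^ Suc k) (kS n)) 0 = 0" for k
    by (rule homog_lookup_0[OF homog_dx_pow[OF homog_kS]]) simp
  then show ?thesis
    unfolding dt_def der_alt dmono_def by (simp add: lookup_sum lookup_mult_0 del: funpow.simps)
qed (simp add: dt_zero)

lemma dt_1_inj: "dt 1 p = dt 1 q \<Longrightarrow> lk p 0 = lk q 0 \<Longrightarrow> p = q"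
  unfolding dt_1_dx by (rule dx_inj) (simp_all del: cst_simps)

text \<open>Obtained by integrating \<open>dt a (kS b)\<close> by means of \<open>kS_gradient\<close>; it is $\zeta_{2a-1,2b-1}$ for positive
  \<open>a\<close> and \<open>b\<close>.\<close>
definition kZ :: "nat \<Rightarrow> nat \<Rightarrow> kdv" where
  "kZ a b = cst (2 * of_nat b - 1) * kH b a - cst 2 * dt a (kG b)"

text \<open>Apply the flow \<open>dt a\<close> to \<open>kS_gradient\<close> and insert the flux
  from \<open>dt_kW\<close>: everything is an x-derivative, and the coefficients in
  \<open>kZ\<close> absorb the factor -1/2 of \<open>dt_1_dx\<close>.\<close>

lemma dt_1_kZ: "dt 1 (kZ a b) = dt a (kS b)"
proof -
  have "cst (-1/2) * cst (2 * of_nat b - 1) = cst (1 - 2 * of_nat b) * cst (1/2)"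
  proof -
    have "(-1/2) * (2 * of_nat b - 1) = (1 - 2 * of_nat b) * (1/2 :: complex)" by (simp add: field_simps)
    then show ?thesis by (simp only: cst_simps(4)[symmetric])
  qed
  then have "cst (-1/2) * (cst (2 * of_nat b - 1) * dx (kH b a)) = cst (1 - 2 * of_nat b) * (cst (1/2) * dx (kH b a))"
    by (simp only: mult.assoc[symmetric])
  moreover have "cst (-1/2) * (cst 2 * p) = - p" for p
  proof -
    have "cst (-1/2) * cst 2 = cst (-1)" by (simp only: cst_simps(4)[symmetric]) simp
    then show ?thesis by (simp add: mult.assoc[symmetric])
  qed
  ultimately show ?thesis
    unfolding dt_1_dx kZ_def
    by (subst kS_gradient) (simp add: dx_simps dt_simps dt_kW right_diff_distrib dt_dx del: cst_simps)
qed

lemma homog_kZ: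
  assumes "a > 0" "b > 0"
  shows "homog (2 * a + 2 * b - 2) (kZ a b)"
proof -
  have "2 * b - 1 + (2 * a - 1) = 2 * a + 2 * b - 2" using assms by simp
  then show ?thesis unfolding kZ_def
    using homog_kH[of b a] homog_dt[OF homog_kG, of b a]
    by (intro homog_diff homog_cst_mult) (simp_all add: add.commute)
qed

lemma lookup_kZ_0: "a > 0 \<Longrightarrow> b > 0 \<Longrightarrow> lk (kZ a b) 0 = 0"
  by (rule homog_lookup_0[OF homog_kZ]) auto

lemma zeta_kZ: "zeta (2 * a + 1) (2 * b + 1) = kZ (Suc a) (Suc b)"
  unfolding zeta_def
proof (rule the_equality)
  have d: "dd 1 = dt 1" using dd_dt[of 0] by simp
  have e: "dd (2 * a + 1) (S (2 * b + 1 + 1)) = dt (Suc a) (kS (Suc b))"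
    using S_odd_even[of b] by (simp add: dd_dt[simplified])
  show "lk (kZ (Suc a) (Suc b)) 0 = 0 \<and> dd 1 (kZ (Suc a) (Suc b)) = dd (2 * a + 1) (S (2 * b + 1 + 1))"
    unfolding d e by (simp add: lookup_kZ_0 dt_1_kZ del: One_nat_def)
  show "z = kZ (Suc a) (Suc b)" if "lk z 0 = 0 \<and> dd 1 z = dd (2 * a + 1) (S (2 * b + 1 + 1))" for z
    using that unfolding d e by - (rule dt_1_inj, simp_all add: lookup_kZ_0 dt_1_kZ del: One_nat_def)
qed

text \<open>Compared after the first flow, the two sides are the two sides of
  \<open>dt_kS_sym\<close>.\<close>

lemma kZ_sym: "a > 0 \<Longrightarrow> b > 0 \<Longrightarrow> kZ a b = kZ b a"
  by (rule dt_1_inj) (simp_all only: lookup_kZ_0 dt_1_kZ dt_kS_sym[of a b])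

lemma dt_kZ: "a > 0 \<Longrightarrow> b > 0 \<Longrightarrow> c > 0 \<Longrightarrow> dt c (kZ a b) = dt a (kZ c b)"
  by (rule dt_1_inj) (simp_all only: lookup_dt_0 dt_commute[of 1] dt_1_kZ dt_commute[of a c])

text \<open>The definition of \<open>kZ\<close> solved for the hook function. The point is the order
  of quantifiers: one \<open>g\<close>, depending on \<open>b\<close> only, serves all
  \<open>a\<close>.\<close>

lemma kH_kZ:
  assumes "a > 0" "b > 0"
  obtains g where "\<And>a. kH b a = cst (1 / (2 * of_nat b - 1)) * kZ a b + dt a g"
proof -
  define c :: complex where "c = 2 * of_nat b - 1"
  have "c = of_nat (2 * b - 1)" using assms by (simp add: c_def of_nat_diff)
  moreover have "2 * b - 1 \<noteq> 0" using assms by simp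
  ultimately have c: "c \<noteq> 0" by (metis of_nat_eq_0_iff)
  show ?thesis
  proof (rule that[of "cst (2 / c) * kG b"])
    fix a
    have "cst (1 / c) * kZ a b = cst (1 / c) * (cst c * kH b a) - cst (1 / c) * (cst 2 * dt a (kG b))"
      unfolding kZ_def c_def by (simp add: right_diff_distrib del: cst_simps)
    also have "\<dots> = kH b a - cst (2 / c) * dt a (kG b)"
      using c by (simp add: mult.assoc[symmetric] cst_simps(4)[symmetric] del: cst_simps) simp
    finally show "kH b a = cst (1 / (2 * of_nat b - 1)) * kZ a b + dt a (cst (2 / c) * kG b)"
      by (simp add: c_def[symmetric])
  qed
qed

section \<open>Determinants indexed by finite sets\<close>

abbreviation nths_of :: "'a::linorder set \<Rightarrow> nat \<Rightarrow> 'a" where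
  "nths_of L a \<equiv> sorted_list_of_set L ! a"

definition below :: "'a::linorder set \<Rightarrow> 'a \<Rightarrow> nat" where
  "below L l = card {x\<in>L. x < l}"

text \<open>Rows and columns are taken in increasing order; the size is \<open>card L\<close>, whatever \<open>card J\<close> is.\<close>
definition sdet :: "('a::linorder \<Rightarrow> 'b::linorder \<Rightarrow> 'c::comm_ring_1) \<Rightarrow> 'a set \<Rightarrow> 'b set \<Rightarrow> 'c" where
  "sdet f L J = det (mat (card L) (card L) (\<lambda>(a, b). f (nths_of L a) (nths_of J b)))"

lemma nths_of_mem: "finite L \<Longrightarrow> a < card L \<Longrightarrow> nths_of L a \<in> L"
  by (metis nth_mem set_sorted_list_of_set length_sorted_list_of_set)

lemma sdet_cong:
  assumes "finite L" "finite J" "card L = card J" "\<And>l j. l \<in> L \<Longrightarrow> j \<in> J \<Longrightarrow> f l j = g l j"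
  shows "sdet f L J = sdet g L J"
proof -
  have "mat (card L) (card L) (\<lambda>(a, b). f (nths_of L a) (nths_of J b))
      = mat (card L) (card L) (\<lambda>(a, b). g (nths_of L a) (nths_of J b))"
    by (intro eq_matI) (use assms(1-3) in \<open>auto intro!: assms(4) nths_of_mem\<close>)
  then show ?thesis by (simp add: sdet_def)
qed

lemma sdet_empty [simp]: "sdet f {} J = 1"
  by (simp add: sdet_def)

lemma below_nths_of:
  assumes "finite L" "p < card L"
  shows "below L (nths_of L p) = p"
proof -
  let ?xs = "sorted_list_of_set L"
  have len: "length ?xs = card L" by simp
  have "{x\<in>L. x < ?xs ! p} = (\<lambda>i. ?xs ! i) ` {..<p}"
  proof (intro equalityI subsetI)
    fix x assume x: "x \<in> {x\<in>L. x < ?xs ! p}"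
    then obtain i where i: "i < card L" "x = ?xs ! i"
      using assms(1) by (metis (no_types, lifting) in_set_conv_nth len mem_Collect_eq set_sorted_list_of_set)
    have "i < p"
    proof (rule ccontr)
      assume "\<not> i < p"
      then have "?xs ! p \<le> ?xs ! i" using i by (intro sorted_nth_mono) auto
      then show False using x i by auto
    qed
    then show "x \<in> (\<lambda>i. ?xs ! i) ` {..<p}" using i by auto
  next
    fix x assume "x \<in> (\<lambda>i. ?xs ! i) ` {..<p}"
    then obtain i where i: "i < p" "x = ?xs ! i" by auto
    have "?xs ! i < ?xs ! p"
      using strict_sorted_list_of_set[of L] i(1) assms(2) by (intro sorted_wrt_nth_less[of "(<)"]) auto
    moreover have "x \<in> L" using i assms by (metis len nth_mem order_less_trans set_sorted_list_of_set)
    ultimately show "x \<in> {x\<in>L. x < ?xs ! p}" using i by auto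
  qed
  moreover have "inj_on (\<lambda>i. ?xs ! i) {..<p}"
    using assms by (intro inj_onI) (auto simp: nth_eq_iff_index_eq)
  ultimately show ?thesis by (simp add: below_def card_image)
qed

lemma below_less: "finite L \<Longrightarrow> l \<in> L \<Longrightarrow> below L l < card L"
  unfolding below_def by (intro psubset_card_mono) auto

lemma nths_of_below:
  assumes "finite L" "l \<in> L"
  shows "nths_of L (below L l) = l"
proof -
  obtain p where "p < card L" "l = nths_of L p"
    using assms by (metis in_set_conv_nth length_sorted_list_of_set set_sorted_list_of_set)
  then show ?thesis using below_nths_of[OF assms(1)] by simp
qed

lemma bij_betw_below: "finite L \<Longrightarrow> bij_betw (below L) L {..<card L}"
  by (rule bij_betw_byWitness[where f'="nths_of L"])
     (auto simp: below_less nths_of_below below_nths_of nths_of_mem)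

lemma nths_of_remove:
  assumes "finite L" "l \<in> L" "a < card L - 1"
  shows "nths_of (L - {l}) a = nths_of L (if a < below L l then a else Suc a)"
proof -
  let ?xs = "sorted_list_of_set L" and ?p = "below L l"
  have p: "?p < length ?xs" using below_less assms by simp
  have "?xs = take ?p ?xs @ l # drop (Suc ?p) ?xs"
    using id_take_nth_drop[OF p] nths_of_below[OF assms(1,2)] by simp
  moreover have "l \<notin> set (take ?p ?xs)"
  proof
    assume "l \<in> set (take ?p ?xs)"
    then obtain i where "i < ?p" "?xs ! i = l" using p by (auto simp: in_set_conv_nth)
    then show False using below_nths_of[OF assms(1), of i] p by simp
  qed
  ultimately have "remove1 l ?xs = take ?p ?xs @ drop (Suc ?p) ?xs"
    by (metis remove1.simps(2) remove1_append)
  then have "sorted_list_of_set (L - {l}) = take ?p ?xs @ drop (Suc ?p) ?xs"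
    using assms by (simp add: sorted_list_of_set_remove)
  then show ?thesis using p assms by (auto simp: nth_append)
qed

lemma sdet_column:
  assumes "finite L" "finite J" "card L = card J" "j \<in> J"
  shows "sdet f L J = (\<Sum>l\<in>L. (-1) ^ (below L l + below J j) * f l j * sdet f (L - {l}) (J - {j}))"
proof -
  let ?n = "card L"
  let ?A = "mat ?n ?n (\<lambda>(a, b). f (nths_of L a) (nths_of J b))"
  have A: "?A \<in> carrier_mat ?n ?n" by simp
  have j: "below J j < ?n" using below_less assms by metis
  have "sdet f L J = (\<Sum>i<?n. ?A $$ (i, below J j) * cofactor ?A i (below J j))"
    unfolding sdet_def by (rule laplace_expansion_column[OF A j])
  also have "\<dots> = (\<Sum>l\<in>L. ?A $$ (below L l, below J j) * cofactor ?A (below L l) (below J j))"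
    by (rule sum.reindex_bij_betw[OF bij_betw_below[OF assms(1)], symmetric])
  also have "\<dots> = (\<Sum>l\<in>L. (-1) ^ (below L l + below J j) * f l j * sdet f (L - {l}) (J - {j}))"
  proof (rule sum.cong)
    fix l assume l: "l \<in> L"
    have "mat_delete ?A (below L l) (below J j)
       = mat (card (L - {l})) (card (L - {l})) (\<lambda>(a, b). f (nths_of (L - {l}) a) (nths_of (J - {j}) b))"
      unfolding mat_delete_def using assms l
      by (intro eq_matI) (auto simp: nths_of_remove)
    then have "cofactor ?A (below L l) (below J j) = (-1) ^ (below L l + below J j) * sdet f (L - {l}) (J - {j})"
      by (simp add: cofactor_def sdet_def)
    moreover have "?A $$ (below L l, below J j) = f l j"
      using j below_less[OF assms(1) l] l assms by (simp add: nths_of_below)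
    ultimately show "?A $$ (below L l, below J j) * cofactor ?A (below L l) (below J j)
      = (-1) ^ (below L l + below J j) * f l j * sdet f (L - {l}) (J - {j})"
      by (simp add: algebra_simps)
  qed simp
  finally show ?thesis .
qed

lemma sdet_transpose:
  assumes "card L = card J"
  shows "sdet f L J = sdet (\<lambda>j l. f l j) J L"
proof -
  let ?A = "mat (card L) (card L) (\<lambda>(a, b). f (nths_of L a) (nths_of J b))"
  have "transpose_mat ?A = mat (card J) (card J) (\<lambda>(a, b). f (nths_of L b) (nths_of J a))"
    using assms by (intro eq_matI) auto
  then show ?thesis unfolding sdet_def using det_transpose[of ?A "card L"] by simp
qed

lemma sdet_row:
  assumes "finite L" "finite J" "card L = card J" "l \<in> L"
  shows "sdet f L J = (\<Sum>j\<in>J. (-1) ^ (below L l + below J j) * f l j * sdet f (L - {l}) (J - {j}))"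
proof -
  have "sdet f L J = (\<Sum>j\<in>J. (-1) ^ (below J j + below L l) * f l j * sdet (\<lambda>j l. f l j) (J - {j}) (L - {l}))"
    unfolding sdet_transpose[OF assms(3), of f] by (rule sdet_column) (use assms in auto)
  also have "\<dots> = (\<Sum>j\<in>J. (-1) ^ (below L l + below J j) * f l j * sdet f (L - {l}) (J - {j}))"
  proof (rule sum.cong)
    fix j assume "j \<in> J"
    then have "sdet (\<lambda>j l. f l j) (J - {j}) (L - {l}) = sdet f (L - {l}) (J - {j})"
      using assms by (intro sdet_transpose[symmetric]) simp
    then show "(-1) ^ (below J j + below L l) * f l j * sdet (\<lambda>j l. f l j) (J - {j}) (L - {l}) =
      (-1) ^ (below L l + below J j) * f l j * sdet f (L - {l}) (J - {j})" by (simp add: add.commute)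
  qed simp
  finally show ?thesis .
qed

lemma sdet_reindex:
  assumes "finite L" "strict_mono_on L g" "finite J" "strict_mono_on J h" "card L = card J"
  shows "sdet f (g ` L) (h ` J) = sdet (\<lambda>l j. f (g l) (h j)) L J"
proof -
  have s: "sorted_list_of_set (g ` L) = map g (sorted_list_of_set L)"
    if "finite L" "strict_mono_on L g" for g :: "'x::linorder \<Rightarrow> 'y::linorder" and L
  proof (rule sorted_list_of_set_unique[THEN iffD1])
    show "finite (g ` L)" using that by simp
    have "sorted_wrt (\<lambda>x y. g x < g y) (sorted_list_of_set L)"
      using strict_sorted_list_of_set[of L] that 
      by (elim sorted_wrt_mono_rel[rotated]) (auto simp: strict_mono_on_def)
    then show "sorted_wrt (<) (map g (sorted_list_of_set L)) \<and> set (map g (sorted_list_of_set L)) = g ` L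
       \<and> length (map g (sorted_list_of_set L)) = card (g ` L)"
      using that by (simp add: sorted_wrt_map card_image strict_mono_on_imp_inj_on)
  qed
  have "card (g ` L) = card L" using assms by (simp add: card_image strict_mono_on_imp_inj_on)
  then show ?thesis unfolding sdet_def s[OF assms(1,2)] s[OF assms(3,4)] using assms(5)
    by (intro arg_cong[where f=det] eq_matI) auto
qed

text \<open>Deleting the smaller element first lowers the rank of the larger one by one; in the
  other order no rank changes.\<close>

lemma below_remove:
  assumes "finite L" "l \<in> L" "l' \<in> L" "l \<noteq> l'"
  shows "(-1) ^ below L l * (-1) ^ below (L - {l}) l' = - ((-1) ^ below L l' * (-1) ^ below (L - {l'}) l :: 'a::comm_ring_1)"
proof -
  have *: "(-1) ^ below L l * (-1) ^ below (L - {l}) l' = - ((-1) ^ below L l' * (-1) ^ below (L - {l'}) l :: 'a)"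
    if "l \<in> L" "l' \<in> L" "l < l'" for l l'
  proof -
    have "{x\<in>L. x < l'} = insert l {x\<in>L - {l}. x < l'}" using that by auto
    then have 1: "below L l' = Suc (below (L - {l}) l')" unfolding below_def using assms(1) by simp
    have "{x\<in>L - {l'}. x < l} = {x\<in>L. x < l}" using that by auto
    then have 2: "below (L - {l'}) l = below L l" by (simp add: below_def)
    show ?thesis unfolding 1 2 by simp
  qed
  show ?thesis
  proof (cases "l < l'")
    case True then show ?thesis using * assms by blast
  next
    case False
    then have "l' < l" using assms(4) by simp
    from *[OF assms(3,2) this] show ?thesis by simp
  qed
qed

section \<open>Vanishing sums of minors\<close>

lemma antisym_sum_0:
  fixes g :: "'a \<Rightarrow> 'a \<Rightarrow> 'b::{idom,ring_char_0}"
  assumes "finite L" "\<And>l l'. l \<in> L \<Longrightarrow> l' \<in> L \<Longrightarrow> l \<noteq> l' \<Longrightarrow> g l l' = - g l' l"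
  shows "(\<Sum>l\<in>L. \<Sum>l'\<in>L - {l}. g l l') = 0"
proof -
  let ?S = "\<Sum>l\<in>L. \<Sum>l'\<in>L - {l}. g l l'"
  have r: "(\<Sum>l\<in>L. \<Sum>l'\<in>L - {l}. h l l') = (\<Sum>l\<in>L. \<Sum>l'\<in>L. if l = l' then 0 else h l l')" for h :: "'a \<Rightarrow> 'a \<Rightarrow> 'b"
    using assms(1) by (intro sum.cong sum.mono_neutral_cong_left) auto
  have "?S = (\<Sum>l\<in>L. \<Sum>l'\<in>L. if l = l' then 0 else - g l' l)"
    unfolding r
  proof (intro sum.cong refl)
    fix l l' assume "l \<in> L" "l' \<in> L"
    then show "(if l = l' then 0 else g l l') = (if l = l' then 0 else - g l' l)"
      using assms(2)[of l l'] by (cases "l = l'") simp_all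
  qed
  also have "\<dots> = (\<Sum>l'\<in>L. \<Sum>l\<in>L. if l = l' then 0 else - g l' l)" by (rule sum.swap)
  also have "\<dots> = - ?S" unfolding r sum_negf[symmetric] by (intro sum.cong) auto
  finally have "2 * ?S = 0" by simp
  then show ?thesis by simp
qed

lemma double_sum_swap:
  assumes "finite L"
  shows "(\<Sum>l\<in>L. \<Sum>l'\<in>L - {l}. g l l') = (\<Sum>l'\<in>L. \<Sum>l\<in>L - {l'}. g l l' :: 'b::comm_monoid_add)"
proof -
  have "(\<Sum>l\<in>L. \<Sum>l'\<in>L - {l}. g l l') = (\<Sum>l\<in>L. \<Sum>l'\<in>L. if l = l' then 0 else g l l')"
    using assms by (intro sum.cong sum.mono_neutral_cong_left) auto
  also have "\<dots> = (\<Sum>l'\<in>L. \<Sum>l\<in>L. if l = l' then 0 else g l l')" by (rule sum.swap)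
  also have "\<dots> = (\<Sum>l'\<in>L. \<Sum>l\<in>L - {l'}. g l l')"
    using assms by (intro sum.cong sum.mono_neutral_cong_right) auto
  finally show ?thesis .
qed

text \<open>Cofactors of a Jacobian matrix are divergence free. Expand along a column
  \<open>j\<close>. Where \<open>D\<close> hits the entry, the closedness hypothesis makes the term
  symmetric in the two rows while the sign is antisymmetric. Where it hits the minor, the terms with
  a fixed second row are the identity for one row and one column less.\<close>

lemma sdet_jacobian:
  fixes f :: "'a::linorder \<Rightarrow> 'b::linorder \<Rightarrow> 'c::{idom,ring_char_0}"
  assumes D: "\<And>l. l \<in> L \<Longrightarrow> Modules.additive (D l)" "\<And>l p q. l \<in> L \<Longrightarrow> D l (p * q) = D l p * q + p * D l q"
    and c: "\<And>l l' j. l \<in> L \<Longrightarrow> l' \<in> L \<Longrightarrow> j \<in> J \<Longrightarrow> D l (f l' j) = D l' (f l j)"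
    and "finite L" "finite J" "card L = Suc (card J)"
  shows "(\<Sum>l\<in>L. (-1) ^ below L l * D l (sdet f (L - {l}) J)) = 0"
  using assms
proof (induction "card J" arbitrary: J L)
  case 0
  then obtain l where "L = {l}" by (metis card_1_singletonE One_nat_def)
  moreover have "D l 1 = 0" using 0(3)[of l 1 1] \<open>L = {l}\<close> by simp
  ultimately show ?case using 0 by simp
next
  case (Suc n)
  from Suc.hyps(2) obtain j where j: "j \<in> J" by (metis card.empty equals0I nat.distinct(1))
  define e :: "'a set \<Rightarrow> 'a \<Rightarrow> 'c" where "e L l = (-1) ^ below L l" for L l
  define c :: 'c where "c = (-1) ^ below J j"
  define M where "M l l' = sdet f (L - {l} - {l'}) (J - {j})" for l l'
  note DA = additive_imps[OF Suc.prems(1)]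
  have D1: "D l ((-1) ^ k) = 0" if "l \<in> L" for l k
  proof -
    have "D l 1 = 0" using Suc.prems(2)[of l 1 1] that by simp
    then have "D l (-1) = 0" using DA(4)[OF that, of 1] by simp
    then show ?thesis by (induction k) (use \<open>D l 1 = 0\<close> in \<open>simp_all add: DA(4)[OF that]\<close>)
  qed
  have "(-1) ^ below L l * D l (sdet f (L - {l}) J)
    = (\<Sum>l'\<in>L - {l}. c * (e L l * e (L - {l}) l' * (D l (f l' j) * M l l')))
    + (\<Sum>l'\<in>L - {l}. c * (f l' j * (e L l * e (L - {l}) l' * D l (M l l'))))" if l: "l \<in> L" for l
  proof -
    have "sdet f (L - {l}) J = (\<Sum>l'\<in>L - {l}. (e (L - {l}) l' * c) * (f l' j * M l l'))"
      unfolding M_def e_def c_def power_add[symmetric] mult.assoc[symmetric]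
      by (rule sdet_column) (use Suc l j in auto)
    moreover have "D l ((e (L - {l}) l' * c) * q) = (e (L - {l}) l' * c) * D l q" for l' q
    proof -
      have "D l (e (L - {l}) l' * c) = 0"
        unfolding e_def c_def power_add[symmetric] using D1[OF l] .
      then show ?thesis using l by (simp add: Suc.prems(2))
    qed
    ultimately have "D l (sdet f (L - {l}) J)
      = (\<Sum>l'\<in>L - {l}. (e (L - {l}) l' * c) * (D l (f l' j) * M l l' + f l' j * D l (M l l')))"
      using l by (simp only: DA(5)[OF l] Suc.prems(2)[OF l, of "f l' j" for l'])
    then show ?thesis
      unfolding e_def[symmetric]
      by (simp add: sum_distrib_left sum.distrib[symmetric] algebra_simps)
  qed
  then have "(\<Sum>l\<in>L. (-1) ^ below L l * D l (sdet f (L - {l}) J))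
    = (\<Sum>l\<in>L. \<Sum>l'\<in>L - {l}. c * (e L l * e (L - {l}) l' * (D l (f l' j) * M l l')))
    + (\<Sum>l\<in>L. \<Sum>l'\<in>L - {l}. c * (f l' j * (e L l * e (L - {l}) l' * D l (M l l'))))"
    by (simp add: sum.distrib)
  also have "(\<Sum>l\<in>L. \<Sum>l'\<in>L - {l}. c * (e L l * e (L - {l}) l' * (D l (f l' j) * M l l'))) = 0"
  proof (rule antisym_sum_0)
    fix l l' assume l: "l \<in> L" "l' \<in> L" "l \<noteq> l'"
    have 1: "e L l * e (L - {l}) l' = - (e L l' * e (L - {l'}) l)"
      unfolding e_def by (rule below_remove) (use l Suc in auto)
    have 2: "D l (f l' j) = D l' (f l j)" using Suc.prems(3) l j by simp
    have 3: "M l l' = M l' l" by (simp add: M_def Diff_insert2[symmetric] insert_commute)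
    show "c * (e L l * e (L - {l}) l' * (D l (f l' j) * M l l')) = - (c * (e L l' * e (L - {l'}) l * (D l' (f l j) * M l' l)))"
      unfolding 1 2 3 by simp
  qed (use Suc in simp)
  also have "(\<Sum>l\<in>L. \<Sum>l'\<in>L - {l}. c * (f l' j * (e L l * e (L - {l}) l' * D l (M l l'))))
    = (\<Sum>l'\<in>L. \<Sum>l\<in>L - {l'}. c * (f l' j * (e L l * e (L - {l}) l' * D l (M l l'))))"
    by (rule double_sum_swap) (use Suc in simp)
  also have "\<dots> = (\<Sum>l'\<in>L. - (c * f l' j * e L l') * (\<Sum>l\<in>L - {l'}. e (L - {l'}) l * D l (M l' l)))"
  proof (rule sum.cong, simp, unfold sum_distrib_left, rule sum.cong, simp)
    fix l l' assume l: "l' \<in> L" "l \<in> L - {l'}"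
    have 1: "e L l * e (L - {l}) l' = - (e L l' * e (L - {l'}) l)"
      unfolding e_def by (rule below_remove) (use l Suc in auto)
    have 3: "M l l' = M l' l" by (simp add: M_def Diff_insert2[symmetric] insert_commute)
    show "c * (f l' j * (e L l * e (L - {l}) l' * D l (M l l'))) = - (c * f l' j * e L l') * (e (L - {l'}) l * D l (M l' l))"
      unfolding 1 3 by (simp add: algebra_simps)
  qed
  also have "\<dots> = 0"
  proof (rule sum.neutral, intro ballI)
    fix l' assume l': "l' \<in> L"
    have "(\<Sum>l\<in>L - {l'}. (-1) ^ below (L - {l'}) l * D l (sdet f (L - {l'} - {l}) (J - {j}))) = 0"
      by (rule Suc.hyps(1)) (use Suc l' j in auto)
    then show "- (c * f l' j * e L l') * (\<Sum>l\<in>L - {l'}. e (L - {l'}) l * D l (M l' l)) = 0"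
      unfolding M_def e_def by simp
  qed
  finally show ?case by simp
qed

text \<open>This is the expansion of a determinant with column \<open>j\<close> occurring twice.
  Column sets cannot express the repetition, so the sum is expanded once more and cancelled in
  pairs.\<close>

lemma sdet_repeated_column:
  fixes f :: "'a::linorder \<Rightarrow> 'b::linorder \<Rightarrow> 'c::{idom,ring_char_0}"
  assumes "finite L" "finite J" "card L = Suc (card J)" "j \<in> J"
  shows "(\<Sum>l\<in>L. (-1) ^ below L l * f l j * sdet f (L - {l}) J) = 0"
proof -
  define e :: "'a set \<Rightarrow> 'a \<Rightarrow> 'c" where "e L l = (-1) ^ below L l" for L l
  have "(\<Sum>l\<in>L. (-1) ^ below L l * f l j * sdet f (L - {l}) J) =
     (\<Sum>l\<in>L. \<Sum>l'\<in>L - {l}. (-1) ^ below J j * ((e L l * e (L - {l}) l') * (f l j * f l' j * sdet f (L - {l} - {l'}) (J - {j}))))"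
  proof (rule sum.cong)
    fix l assume l: "l \<in> L"
    have "sdet f (L - {l}) J = (\<Sum>l'\<in>L - {l}. (-1) ^ (below (L - {l}) l' + below J j) * f l' j * sdet f (L - {l} - {l'}) (J - {j}))"
      by (rule sdet_column) (use assms l in auto)
    then show "(-1) ^ below L l * f l j * sdet f (L - {l}) J = (\<Sum>l'\<in>L - {l}. (-1) ^ below J j * ((e L l * e (L - {l}) l') * (f l j * f l' j * sdet f (L - {l} - {l'}) (J - {j}))))"
      by (simp add: sum_distrib_left power_add e_def algebra_simps)
  qed simp
  also have "\<dots> = 0"
  proof (rule antisym_sum_0)
    fix l l' assume l: "l \<in> L" "l' \<in> L" "l \<noteq> l'"
    have 1: "e L l * e (L - {l}) l' = - (e L l' * e (L - {l'}) l)"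
      unfolding e_def by (rule below_remove) (use l assms in auto)
    have 3: "L - {l} - {l'} = L - {l'} - {l}" by auto
    show "(-1) ^ below J j * ((e L l * e (L - {l}) l') * (f l j * f l' j * sdet f (L - {l} - {l'}) (J - {j}))) =
      - ((-1) ^ below J j * ((e L l' * e (L - {l'}) l) * (f l' j * f l j * sdet f (L - {l'} - {l}) (J - {j}))))"
      unfolding 1 3 by (simp add: algebra_simps)
  qed (use assms in simp)
  finally show ?thesis .
qed

text \<open>Expand each determinant along its new column \<open>n\<close>. The result is a sum over
  ordered pairs of rows of a symmetric entry times an antisymmetric sign. This is the identity
  behind the vanishing of \<open>ev2\<close> on the image of \<open>Cop\<close>.\<close>

lemma sdet_symmetric_contraction:
  fixes f :: "'a::linorder \<Rightarrow> 'a \<Rightarrow> 'c::{idom,ring_char_0}"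
  assumes "finite L" "finite J" "card L = Suc (Suc (card J))"
    and sym: "\<And>l l'. l \<in> L \<Longrightarrow> l' \<in> L \<Longrightarrow> f l l' = f l' l"
  shows "(\<Sum>n\<in>L - J. (-1) ^ (below L n + below J n) * sdet f (L - {n}) (insert n J)) = 0"
proof -
  define e :: "'a set \<Rightarrow> 'a \<Rightarrow> 'c" where "e L l = (-1) ^ below L l" for L l
  have sq: "(-1) ^ k * (-1) ^ k = (1::'c)" for k by (simp flip: power_add)
  have 1: "(-1) ^ (below L n + below J n) * sdet f (L - {n}) (insert n J)
     = (\<Sum>l\<in>L - {n}. (e L n * e (L - {n}) l) * (f l n * sdet f (L - {n} - {l}) J))" if n: "n \<in> L - J" for n
  proof -
    have b: "below (insert n J) n = below J n" unfolding below_def by (rule arg_cong[where f=card]) auto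
    have "sdet f (L - {n}) (insert n J) =
      (\<Sum>l\<in>L - {n}. (-1) ^ (below (L - {n}) l + below (insert n J) n) * f l n * sdet f (L - {n} - {l}) (insert n J - {n}))"
      by (rule sdet_column) (use assms n in auto)
    moreover have "insert n J - {n} = J" using n by auto
    ultimately have "sdet f (L - {n}) (insert n J) = (-1) ^ below J n * (\<Sum>l\<in>L - {n}. e (L - {n}) l * (f l n * sdet f (L - {n} - {l}) J))"
      by (simp add: b power_add e_def sum_distrib_left algebra_simps)
    then have "(-1) ^ (below L n + below J n) * sdet f (L - {n}) (insert n J) = 
      ((-1) ^ below J n * (-1) ^ below J n) * e L n * (\<Sum>l\<in>L - {n}. e (L - {n}) l * (f l n * sdet f (L - {n} - {l}) J))"
      by (simp add: power_add e_def algebra_simps)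
    then show ?thesis unfolding sq by (simp add: sum_distrib_left algebra_simps)
  qed
  have 2: "(\<Sum>l\<in>L - {n}. (e L n * e (L - {n}) l) * (f l n * sdet f (L - {n} - {l}) J)) = 0" if n: "n \<in> L \<inter> J" for n
  proof -
    have "(\<Sum>l\<in>L - {n}. (-1) ^ below (L - {n}) l * f l n * sdet f (L - {n} - {l}) J) = 0"
      by (rule sdet_repeated_column) (use assms n in auto)
    moreover have "(\<Sum>l\<in>L - {n}. (e L n * e (L - {n}) l) * (f l n * sdet f (L - {n} - {l}) J))
      = e L n * (\<Sum>l\<in>L - {n}. (-1) ^ below (L - {n}) l * f l n * sdet f (L - {n} - {l}) J)"
      by (simp add: e_def sum_distrib_left algebra_simps)
    ultimately show ?thesis by simp
  qed
  have "(\<Sum>n\<in>L - J. (-1) ^ (below L n + below J n) * sdet f (L - {n}) (insert n J)) =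
     (\<Sum>n\<in>L - J. \<Sum>l\<in>L - {n}. (e L n * e (L - {n}) l) * (f l n * sdet f (L - {n} - {l}) J))"
    by (rule sum.cong) (simp_all add: 1)
  \<comment> \<open>The summands with \<open>n\<close> in \<open>J\<close>, excluded so far, vanish
    by the repeated column and may be added.\<close>
  also have "\<dots> = (\<Sum>n\<in>L. \<Sum>l\<in>L - {n}. (e L n * e (L - {n}) l) * (f l n * sdet f (L - {n} - {l}) J))"
    using assms(1) 2 by (intro sum.mono_neutral_left) auto
  also have "\<dots> = 0"
  proof (rule antisym_sum_0)
    fix l l' assume l: "l \<in> L" "l' \<in> L" "l \<noteq> l'"
    have 1: "e L l * e (L - {l}) l' = - (e L l' * e (L - {l'}) l)"
      unfolding e_def by (rule below_remove) (use l assms in auto)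
    have 3: "L - {l} - {l'} = L - {l'} - {l}" by auto
    show "(e L l * e (L - {l}) l') * (f l' l * sdet f (L - {l} - {l'}) J) = - ((e L l' * e (L - {l'}) l) * (f l l' * sdet f (L - {l'} - {l}) J))"
      unfolding 1 3 using sym[OF l(1,2)] by simp
  qed (use assms in simp)
  finally show ?thesis .
qed

lemma sdet_unit_column:
  assumes "finite L" "finite J" "card L = card J" "j \<in> J" "l \<in> L" "f l j = 1" "\<And>l'. l' \<in> L \<Longrightarrow> l' \<noteq> l \<Longrightarrow> f l' j = 0"
  shows "sdet f L J = (-1) ^ (below L l + below J j) * sdet f (L - {l}) (J - {j})"
proof -
  have "sdet f L J = (\<Sum>l'\<in>L. if l' = l then (-1) ^ (below L l + below J j) * sdet f (L - {l}) (J - {j}) else 0)"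
    unfolding sdet_column[OF assms(1-4)] by (intro sum.cong) (use assms in auto)
  then show ?thesis using assms by simp
qed

lemma sdet_unitriangular_mult:
  fixes h :: "nat \<Rightarrow> 'b::linorder \<Rightarrow> 'c::comm_ring_1"
  assumes "card X = N" "finite X" "\<And>r. r < N \<Longrightarrow> u r r = 1" "\<And>r s. r < s \<Longrightarrow> s < N \<Longrightarrow> u r s = 0"
    and f: "\<And>r x. r < N \<Longrightarrow> x \<in> X \<Longrightarrow> f r x = (\<Sum>s<N. u r s * h s x)"
  shows "sdet f {0..<N} X = sdet h {0..<N} X"
proof -
  let ?U = "mat N N (\<lambda>(r, s). u r s)" and ?H = "mat N N (\<lambda>(a, b). h a (nths_of X b))"
  have m: "nths_of X b \<in> X" if "b < N" for b
    using that assms by (metis nth_mem length_sorted_list_of_set set_sorted_list_of_set)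
  have "mat N N (\<lambda>(a, b). f a (nths_of X b)) = ?U * ?H"
    by (intro eq_matI) (auto simp: f m scalar_prod_def atLeast0LessThan)
  moreover have "det ?U = 1"
  proof -
    have "diag_mat ?U = map (\<lambda>_. 1) [0..<N]" by (auto simp: diag_mat_def assms(3))
    moreover have "prod_list (map (\<lambda>_. 1) xs) = (1::'c)" for xs :: "nat list" by (induction xs) auto
    ultimately show ?thesis using assms(4) by (subst det_lower_triangular[of N]) auto
  qed
  moreover have "det (?U * ?H) = det ?U * det ?H" by (rule det_mult) auto
  moreover have "sdet g {0..<N} X = det (mat N N (\<lambda>(a, b). g a (nths_of X b)))" for g :: "nat \<Rightarrow> 'b \<Rightarrow> 'c"
    unfolding sdet_def by (intro arg_cong[where f=det] eq_matI) auto
  ultimately show ?thesis by simp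
qed

section \<open>Hook determinants span the polynomials in the Lenard densities\<close>

inductive_set cspan :: "kdv set \<Rightarrow> kdv set" for B where
  zero: "0 \<in> cspan B"
| step: "b \<in> B \<Longrightarrow> x \<in> cspan B \<Longrightarrow> cst c * b + x \<in> cspan B"

lemma cspan_add: "x \<in> cspan B \<Longrightarrow> y \<in> cspan B \<Longrightarrow> x + y \<in> cspan B"
  by (induction rule: cspan.induct) (auto simp: add.assoc intro: cspan.step)

lemma cspan_base: "b \<in> B \<Longrightarrow> b \<in> cspan B"
  using cspan.step[of b B 0 1] cspan.zero by simp

lemma cspan_cst_mult: "x \<in> cspan B \<Longrightarrow> cst a * x \<in> cspan B"
proof (induction rule: cspan.induct)
  case (step b x c)
  then have "cst (a * c) * b + cst a * x \<in> cspan B" by (intro cspan.step)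
  then show ?case by (simp add: distrib_left mult.assoc)
qed (simp add: cspan.zero)

lemma cspan_uminus: "x \<in> cspan B \<Longrightarrow> - x \<in> cspan B"
  using cspan_cst_mult[of x B "-1"] by simp

lemma cspan_diff: "x \<in> cspan B \<Longrightarrow> y \<in> cspan B \<Longrightarrow> x - y \<in> cspan B"
  using cspan_add[of x B "- y"] cspan_uminus by simp

lemma cspan_sum: "(\<And>a. a \<in> A \<Longrightarrow> f a \<in> cspan B) \<Longrightarrow> (\<Sum>a\<in>A. f a) \<in> cspan B"
  by (induction A rule: infinite_finite_induct) (auto intro: cspan_add cspan.zero)

lemma cspan_sign: "x \<in> cspan B \<Longrightarrow> (-1) ^ k * x \<in> cspan B"
  by (cases "even k") (auto intro: cspan_uminus)

definition hk :: "nat \<Rightarrow> nat \<Rightarrow> kdv" where "hk r m = kH (Suc r) (Suc m)"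

definition Hooks :: "kdv set" where
  "Hooks = {sdet hk L J | L J. finite L \<and> finite J \<and> card L = card J}"

text \<open>The semi-infinite Toeplitz matrix \<open>toep\<close> of Jacobi-Trudi is a unitriangular matrix times \<open>uhk\<close>,
  whose columns of negative index form a (reversed) identity block; minors of \<open>uhk\<close> are hence hook determinants.\<close>
definition sS :: "int \<Rightarrow> kdv" where "sS k = (if k < 0 then 0 else kS (nat k))"

definition toep :: "nat \<Rightarrow> int \<Rightarrow> kdv" where "toep r n = sS (int r + 1 + n)"

definition uhk :: "nat \<Rightarrow> int \<Rightarrow> kdv" where
  "uhk r n = (if n < 0 then (if int r + 1 = - n then 1 else 0) else hk r (nat n))"

lemma kS_kW_convolution: "(\<Sum>s\<in>{0..r}. kS (r - s) * kW s) = (if r = 0 then 1 else 0)"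
proof -
  have "(Wf * Bf) $ r = (1 :: kdv fps) $ r" by (simp add: Wf_Bf)
  then show ?thesis by (simp add: fps_mult_nth mult.commute[of "kS x" "kW y" for x y])
qed

text \<open>Induction on \<open>r\<close>: the recursion of \<open>kH\<close> trades a row step for
  a shift of \<open>m\<close>, and the extra terms carry a positive coefficient of
  \<open>Wf * Bf\<close>, which is 0.\<close>

lemma kS_kH_convolution: "(\<Sum>s\<in>{0..r}. kS (r - s) * kH (Suc s) m) = kS (r + m)"
proof (induction r arbitrary: m)
  case (Suc r)
  have "(\<Sum>s\<in>{0..Suc r}. kS (Suc r - s) * kH (Suc s) m)
     = (\<Sum>s\<in>{0..Suc r}. kS (Suc r - s) * kH s (Suc m)) + (\<Sum>s\<in>{0..Suc r}. kS (Suc r - s) * kW s) * kS m"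
    by (simp only: kH.simps sum_distrib_right distrib_left sum.distrib mult.assoc)
  also have "(\<Sum>s\<in>{0..Suc r}. kS (Suc r - s) * kH s (Suc m)) = (\<Sum>s\<in>{0..r}. kS (r - s) * kH (Suc s) (Suc m))"
    by (subst sum.atLeast0_atMost_Suc_shift) (simp del: kH.simps(2) add: kH.simps(1))
  finally show ?case unfolding Suc kS_kW_convolution by simp
qed simp

lemma toep_uhk:
  assumes "r < N" "- int N \<le> n"
  shows "toep r n = (\<Sum>s<N. (if s \<le> r then kS (r - s) else 0) * uhk s n)"
proof -
  have "(\<Sum>s<N. (if s \<le> r then kS (r - s) else 0) * uhk s n) = (\<Sum>s\<in>{0..r}. kS (r - s) * uhk s n)"
    using assms(1) by (intro sum.mono_neutral_cong_right) auto
  also have "\<dots> = toep r n"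
  proof (cases "n < 0")
    case True
    then have "(\<Sum>s\<in>{0..r}. kS (r - s) * uhk s n) = (\<Sum>s\<in>{0..r}. if s = nat (- n - 1) then kS (r - s) else 0)"
      by (intro sum.cong) (auto simp: uhk_def)
    also have "\<dots> = toep r n"
      using True by (auto simp: toep_def sS_def nat_diff_distrib' intro!: arg_cong[where f=kS])
    finally show ?thesis .
  next
    case False
    then have "(\<Sum>s\<in>{0..r}. kS (r - s) * uhk s n) = kS (r + Suc (nat n))"
      unfolding kS_kH_convolution[symmetric] by (intro sum.cong) (auto simp: uhk_def hk_def)
    also have "r + Suc (nat n) = nat (int r + 1 + n)" using False by auto
    finally show ?thesis using False by (simp add: toep_def sS_def)
  qed
  finally show ?thesis by simp
qed

text \<open>A column of negative index is a unit vector, so expanding along it deletes one row and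
  one column at the cost of a sign. When only nonnegative columns remain, the minor is a hook
  determinant, as in Giambelli's formula.\<close>

lemma sdet_uhk_in_Hooks:
  assumes "finite L" "finite X" "card L = card X" "\<And>n. n \<in> X \<Longrightarrow> n < 0 \<Longrightarrow> nat (- n - 1) \<in> L"
  shows "sdet uhk L X \<in> cspan Hooks"
  using assms
proof (induction "card {n\<in>X. n < 0}" arbitrary: L X)
  case 0
  then have pos: "n \<ge> 0" if "n \<in> X" for n using that by (auto simp: card_eq_0_iff)
  have X: "int ` nat ` X = X" using pos by (force simp: image_iff)
  have c: "card (nat ` X) = card X" by (rule card_image) (use pos in \<open>auto simp: inj_on_def eq_nat_nat_iff\<close>)
  have "sdet uhk L X = sdet uhk ((\<lambda>r. r) ` L) (int ` (nat ` X))" unfolding X by simp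
  also have "\<dots> = sdet (\<lambda>r m. uhk r (int m)) L (nat ` X)"
    by (rule sdet_reindex) (use 0 c in \<open>auto simp: strict_mono_on_def\<close>)
  also have "\<dots> = sdet hk L (nat ` X)"
    by (rule sdet_cong) (use 0 c in \<open>auto simp: uhk_def\<close>)
  finally have e: "sdet uhk L X = sdet hk L (nat ` X)" .
  show ?case unfolding e
    by (rule cspan_base, unfold Hooks_def, intro CollectI exI[of _ L] exI[of _ "nat ` X"])
      (use 0 c in auto)
next
  case (Suc k)
  then obtain n where n: "n \<in> X" "n < 0"
    by (metis (no_types, lifting) card.empty empty_Collect_eq nat.distinct(1))
  let ?l = "nat (- n - 1)"
  have l: "?l \<in> L" using Suc n by blast
  have "sdet uhk L X = (-1) ^ (below L ?l + below X n) * sdet uhk (L - {?l}) (X - {n})"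
    by (rule sdet_unit_column) (use Suc n l in \<open>auto simp: uhk_def\<close>)
  moreover have "sdet uhk (L - {?l}) (X - {n}) \<in> cspan Hooks"
  proof (rule Suc.hyps(1))
    have "{m\<in>X - {n}. m < 0} = {m\<in>X. m < 0} - {n}" by auto
    then show "k = card {m\<in>X - {n}. m < 0}" using Suc.hyps(2) n Suc.prems(2) by simp
  qed (use Suc n l in auto)
  ultimately show ?case by (simp add: cspan_sign)
qed

lemma sdet_toep_in_Hooks:
  assumes "finite X" "card X = N" "\<And>n. n \<in> X \<Longrightarrow> - int N \<le> n"
  shows "sdet toep {0..<N} X \<in> cspan Hooks"
proof -
  have "sdet toep {0..<N} X = sdet uhk {0..<N} X"
    by (rule sdet_unitriangular_mult[where u="\<lambda>r s. if s \<le> r then kS (r - s) else 0"])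
       (use assms toep_uhk in auto)
  moreover have "nat (- n - 1) \<in> {0..<N}" if "n \<in> X" "n < 0" for n
    using assms(3)[OF that(1)] that(2) by auto
  ultimately show ?thesis using sdet_uhk_in_Hooks[of "{0..<N}" X] assms by simp
qed

section \<open>The rearrangement inequality and Jacobi-Trudi triangularity\<close>

lemma permutes_decreasing_unique:
  fixes p :: "nat \<Rightarrow> nat"
  assumes p: "p permutes {..<N}" and anti: "\<And>i j. i < j \<Longrightarrow> j < N \<Longrightarrow> p j < p i" and r: "r < N"
  shows "p r = N - 1 - r"
proof -
  have im: "p ` {..<N} = {..<N}" using p by (rule permutes_image)
  have "{z. z < p r} = p ` {r<..<N}"
  proof (intro equalityI subsetI)
    fix z assume z: "z \<in> {z. z < p r}"
    have "p r < N" using im r by auto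
    then have "z \<in> p ` {..<N}" using z \<open>p r < N\<close> unfolding im by auto
    then obtain s where s: "s < N" "z = p s" by auto
    have "s > r" using z s anti[of s r] r by (cases "s = r"; cases "s < r") auto
    then show "z \<in> p ` {r<..<N}" using s by auto
  qed (use anti in auto)
  then have "card {z. z < p r} = card {r<..<N}"
    using card_image[of p "{r<..<N}"] permutes_inj[OF p] by (metis inj_on_subset subset_UNIV)
  then show ?thesis by simp
qed

text \<open>Swapping the values at a pair on which \<open>q\<close> increases strictly lowers the
  sum. A minimizer among the finitely many permutations thus has no such pair and is the
  reversal.\<close>

lemma rearrangement_strict:
  fixes y :: "nat \<Rightarrow> int"
  assumes y: "\<And>i j. i < j \<Longrightarrow> j < N \<Longrightarrow> y i < y j" and p: "p permutes {..<N}" and ne: "\<exists>r<N. p r \<noteq> N - 1 - r"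
  shows "(\<Sum>r<N. int r * y (N - 1 - r)) < (\<Sum>r<N. int r * y (p r))"
proof -
  define F where "F q = (\<Sum>r<N. int r * y (q r))" for q
  let ?P = "{q. q permutes {..<N}}"
  have fin: "finite (F ` ?P)" "F ` ?P \<noteq> {}" using p by (auto simp: finite_permutations)
  obtain m where m: "m permutes {..<N}" "F m = Min (F ` ?P)" using Min_in[OF fin] by auto
  have min: "F m \<le> F q" if "q permutes {..<N}" for q using m fin that by simp
  have dec: "\<exists>q'. q' permutes {..<N} \<and> F q' < F q"
    if q: "q permutes {..<N}" and ij: "i < j" "j < N" "q i < q j" for q i j
  proof (intro exI conjI)
    let ?q = "q \<circ> transpose i j"
    show "?q permutes {..<N}" using ij by (intro permutes_compose[OF _ q] permutes_swap_id) auto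
    have "F ?q = (\<Sum>r\<in>{..<N} - {i} - {j}. int r * y (q r)) + int j * y (q i) + int i * y (q j)"
    proof -
      have "F ?q = int i * y (?q i) + (int j * y (?q j) + (\<Sum>r\<in>{..<N} - {i} - {j}. int r * y (?q r)))"
        unfolding F_def using ij by (subst sum.remove[of _ i], simp, simp, subst sum.remove[of _ j]) auto
      moreover have "(\<Sum>r\<in>{..<N} - {i} - {j}. int r * y (?q r)) = (\<Sum>r\<in>{..<N} - {i} - {j}. int r * y (q r))"
        by (intro sum.cong) (auto simp: transpose_def)
      ultimately show ?thesis by simp
    qed
    moreover have "F q = (\<Sum>r\<in>{..<N} - {i} - {j}. int r * y (q r)) + int i * y (q i) + int j * y (q j)"
      unfolding F_def using ij by (subst sum.remove[of _ i], simp, simp, subst sum.remove[of _ j]) auto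
    moreover have "int j * y (q i) + int i * y (q j) < int i * y (q i) + int j * y (q j)"
    proof -
      have "q j < N" using q ij by (metis lessThan_iff permutes_in_image)
      then have "y (q i) < y (q j)" using y ij by blast
      then have "0 < (int j - int i) * (y (q j) - y (q i))" using ij by simp
      then show ?thesis by (simp add: algebra_simps)
    qed
    ultimately show "F ?q < F q" by linarith
  qed
  have anti: "q r = N - 1 - r" if q: "q permutes {..<N}" "F q = F m" "r < N" for q r
  proof (rule permutes_decreasing_unique[OF q(1) _ q(3)])
    fix i j assume ij: "i < j" "j < N"
    have "\<not> q i < q j" using dec[OF q(1) ij] min q(2) by (metis not_less)
    moreover have "q i \<noteq> q j" using permutes_inj[OF q(1)] ij by (metis injD less_irrefl)
    ultimately show "q j < q i" by simp
  qed
  have "F p \<noteq> F m" using anti[OF p] ne by blast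
  then have "F m < F p" using min[OF p] by simp
  moreover have "F m = (\<Sum>r<N. int r * y (N - 1 - r))"
    unfolding F_def by (intro sum.cong) (auto simp: anti m)
  ultimately show ?thesis by (simp add: F_def)
qed

lemma sum_sorted_squares:
  fixes x y :: "nat \<Rightarrow> int"
  assumes "p permutes {..<N}"
  shows "(\<Sum>r<N. (x r + y (p r))\<^sup>2) = (\<Sum>r<N. (x r)\<^sup>2) + (\<Sum>r<N. (y r)\<^sup>2) + 2 * (\<Sum>r<N. x r * y (p r))"
proof -
  have "(\<Sum>r<N. (y (p r))\<^sup>2) = (\<Sum>r<N. (y r)\<^sup>2)"
    by (rule sum.permute[OF assms, symmetric, unfolded o_def])
  then show ?thesis by (simp add: power2_sum sum.distrib sum_distrib_left algebra_simps)
qed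

abbreviation kmon :: "nat list \<Rightarrow> kdv" where "kmon \<nu> \<equiv> prod_list (map kS \<nu>)"

abbreviation sqsum :: "nat list \<Rightarrow> nat" where "sqsum \<nu> \<equiv> sum_list (map (\<lambda>n. n * n) \<nu>)"

lemma sqsum_le: "sqsum \<nu> \<le> sum_list \<nu> * sum_list \<nu>"
  by (induction \<nu>) (auto simp: algebra_simps)

text \<open>The Jacobi-Trudi determinant is a signed sum of monomials in the \<open>kS\<close>, one
  of them the given one. All nonzero terms have the same index sum, and the others have a larger sum
  of squares; by \<open>sqsum_le\<close> that sum is bounded, so the induction terminates. The
  determinant itself lies in the span by \<open>sdet_toep_in_Hooks\<close>.\<close>

lemma kmon_in_Hooks: "kmon \<nu> \<in> cspan Hooks"
proof (induction "sum_list \<nu> * sum_list \<nu> - sqsum \<nu>" arbitrary: \<nu> rule: less_induct)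
  case less
  define \<mu> where "\<mu> = sort \<nu>"
  have mset: "mset \<mu> = mset \<nu>" by (simp add: \<mu>_def)
  have \<mu>: "kmon \<mu> = kmon \<nu>" "sqsum \<mu> = sqsum \<nu>" "sum_list \<mu> = sum_list \<nu>"
  proof -
    have k: "mset (map kS \<mu>) = mset (map kS \<nu>)" and q: "mset (map (\<lambda>n. n * n) \<mu>) = mset (map (\<lambda>n. n * n) \<nu>)"
      using mset by simp_all
    show "kmon \<mu> = kmon \<nu>" using arg_cong[OF k, of prod_mset] by (simp only: prod_mset_prod_list)
    show "sqsum \<mu> = sqsum \<nu>" using arg_cong[OF q, of sum_mset] by (simp only: sum_mset_sum_list)
    show "sum_list \<mu> = sum_list \<nu>" using arg_cong[OF mset, of sum_mset] by (simp only: sum_mset_sum_list)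
  qed
  define N where "N = length \<mu>"
  \<comment> \<open>The index in row \<open>r\<close>, column \<open>b\<close> is
    \<open>x r + y b\<close>. Making \<open>y\<close> strictly increasing turns the parts, which may
    repeat, into a set of columns; on the antidiagonal the offsets cancel and leave the parts of the
    partition.\<close>
  define y where "y b = int (\<mu> ! b) + int b" for b
  define x where "x r = int r + 1 - int N" for r
  define n where "n b = y b - int N" for b
  have ymono: "y i < y j" if "i < j" "j < N" for i j
    using sorted_nth_mono[of \<mu> i j] that unfolding y_def N_def \<mu>_def by simp
  define X where "X = n ` {..<N}"
  have inj: "inj_on n {..<N}"
  proof (rule inj_onI)
    fix i j assume "i \<in> {..<N}" "j \<in> {..<N}" "n i = n j"
    then show "i = j" using ymono[of i j] ymono[of j i] by (cases i j rule: linorder_cases) (auto simp: n_def)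
  qed
  then have X: "finite X" "card X = N" by (auto simp: X_def card_image)
  have sl: "sorted_list_of_set X = map n [0..<N]"
  proof (rule sorted_list_of_set_unique[THEN iffD1])
    have "sorted_wrt (\<lambda>a b. n a < n b) [0..<N]"
      by (rule sorted_wrt_mono_rel[OF _ sorted_wrt_upt]) (auto simp: n_def ymono)
    then show "sorted_wrt (<) (map n [0..<N]) \<and> set (map n [0..<N]) = X \<and> length (map n [0..<N]) = card X"
      using X by (auto simp: sorted_wrt_map X_def)
  qed (rule X)
  let ?P = "{p. p permutes {..<N}}"
  define T where "T p = (\<Prod>r<N. sS (x r + y (p r)))" for p
  have S: "sdet toep {0..<N} X = (\<Sum>p\<in>?P. of_int (sign p) * T p)"
  proof -
    have "sdet toep {0..<N} X = det (mat N N (\<lambda>(r, b). sS (x r + y b)))"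
      unfolding sdet_def sl by (intro arg_cong[where f=det] eq_matI) (auto simp: toep_def x_def n_def algebra_simps)
    also have "\<dots> = (\<Sum>p\<in>?P. of_int (sign p) * T p)"
      unfolding det_def T_def by (auto simp: atLeast0LessThan intro!: sum.cong prod.cong)
    finally show ?thesis .
  qed
  define p0 where "p0 r = (if r < N then N - 1 - r else r)" for r
  have p0: "p0 permutes {..<N}"
    by (rule bij_imp_permutes) (auto simp: p0_def intro!: bij_betw_byWitness[where f'=p0])
  have T0: "T p0 = kmon \<mu>"
  proof -
    have "T p0 = (\<Prod>r<N. kS (\<mu> ! (N - 1 - r)))"
      unfolding T_def by (intro prod.cong) (auto simp: p0_def sS_def x_def y_def intro!: arg_cong[where f=kS])
    also have "\<dots> = (\<Prod>r<N. kS (\<mu> ! r))"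
      using prod.nat_diff_reindex[of "\<lambda>r. kS (\<mu> ! r)" N] by simp
    also have "\<dots> = kmon \<mu>"
      by (simp add: prod.list_conv_set_nth N_def atLeast0LessThan)
    finally show ?thesis .
  qed
  have Tp: "T p \<in> cspan Hooks" if p: "p permutes {..<N}" "p \<noteq> p0" for p
  proof (cases "\<exists>r<N. x r + y (p r) < 0")
    case True
    then have "T p = 0" unfolding T_def by (intro prod_zero) (auto simp: sS_def)
    then show ?thesis by (simp add: cspan.zero)
  next
    case False
    then have nn: "x r + y (p r) \<ge> 0" if "r < N" for r using that by (meson not_less)
    define \<nu>' where "\<nu>' = map (\<lambda>r. nat (x r + y (p r))) [0..<N]"
    have "T p = kmon \<nu>'"
      unfolding T_def \<nu>'_def by (simp add: prod.list_conv_set_nth atLeast0LessThan sS_def) (intro prod.cong, auto dest: nn)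
    have s1: "int (sum_list \<nu>') = (\<Sum>r<N. x r + y (p r))"
      unfolding \<nu>'_def by (simp add: sum_list_sum_nth atLeast0LessThan nn)
    have s2: "int (sqsum \<nu>') = (\<Sum>r<N. (x r + y (p r))\<^sup>2)"
      unfolding \<nu>'_def by (simp add: sum_list_sum_nth atLeast0LessThan nn power2_eq_square)
    have m: "x r + y (p0 r) = int (\<mu> ! (N - 1 - r))" if "r < N" for r using that by (simp add: p0_def x_def y_def)
    have t1: "int (sum_list \<mu>) = (\<Sum>r<N. x r + y (p0 r))"
    proof -
      have "(\<Sum>r<N. x r + y (p0 r)) = (\<Sum>r<N. int (\<mu> ! (N - 1 - r)))" by (intro sum.cong) (auto simp: m)
      also have "\<dots> = (\<Sum>r<N. int (\<mu> ! r))" using sum.nat_diff_reindex[of "\<lambda>r. int (\<mu> ! r)" N] by simp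
      finally show ?thesis by (simp add: sum_list_sum_nth N_def atLeast0LessThan)
    qed
    have t2: "int (sqsum \<mu>) = (\<Sum>r<N. (x r + y (p0 r))\<^sup>2)"
    proof -
      have "(\<Sum>r<N. (x r + y (p0 r))\<^sup>2) = (\<Sum>r<N. (int (\<mu> ! (N - 1 - r)))\<^sup>2)" by (intro sum.cong) (auto simp: m)
      also have "\<dots> = (\<Sum>r<N. (int (\<mu> ! r))\<^sup>2)" using sum.nat_diff_reindex[of "\<lambda>r. (int (\<mu> ! r))\<^sup>2" N] by simp
      finally show ?thesis by (simp add: sum_list_sum_nth N_def atLeast0LessThan power2_eq_square)
    qed
    have yp: "(\<Sum>r<N. y (q r)) = (\<Sum>r<N. y r)" if "q permutes {..<N}" for q
      by (rule sum.permute[OF that, symmetric, unfolded o_def])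
    have sum_eq: "sum_list \<nu>' = sum_list \<mu>"
      using s1 t1 yp[OF p(1)] yp[OF p0] by (simp add: sum.distrib)
    have ex: "\<exists>r<N. p r \<noteq> N - 1 - r"
    proof (rule ccontr)
      assume "\<not> ?thesis"
      then have "p r = p0 r" for r using permutes_not_in[OF p(1), of r] by (cases "r < N") (auto simp: p0_def)
      then show False using p(2) by auto
    qed
    have "(\<Sum>r<N. int r * y (N - 1 - r)) < (\<Sum>r<N. int r * y (p r))"
      by (rule rearrangement_strict[OF _ p(1) ex]) (rule ymono)
    also have "(\<Sum>r<N. int r * y (N - 1 - r)) = (\<Sum>r<N. int r * y (p0 r))" by (intro sum.cong) (auto simp: p0_def)
    \<comment> \<open>The sums of squares differ only in the cross terms, and \<open>x r\<close>
      differs from \<open>r\<close> by a constant, which does not matter because all permutations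
      give the same sum of the \<open>y\<close>.\<close>
    finally have "(\<Sum>r<N. x r * y (p0 r)) < (\<Sum>r<N. x r * y (p r))"
      using yp[OF p(1)] yp[OF p0] by (simp add: x_def algebra_simps sum.distrib sum_subtractf flip: sum_distrib_left)
    then have "int (sqsum \<mu>) < int (sqsum \<nu>')"
      unfolding s2 t2 sum_sorted_squares[OF p(1)] sum_sorted_squares[OF p0] by simp
    then have "sum_list \<nu>' * sum_list \<nu>' - sqsum \<nu>' < sum_list \<nu> * sum_list \<nu> - sqsum \<nu>"
      using sqsum_le[of \<nu>'] \<mu> sum_eq by simp
    from less[OF this] show ?thesis using \<open>T p = kmon \<nu>'\<close> by simp
  qed
  have sgn: "of_int (sign p) * z \<in> cspan Hooks \<longleftrightarrow> z \<in> cspan Hooks" for p :: "nat \<Rightarrow> nat" and z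
    using cspan_uminus[of z Hooks] cspan_uminus[of "- z" Hooks] by (auto simp: sign_def)
  have "of_int (sign p0) * T p0 = sdet toep {0..<N} X - (\<Sum>p\<in>?P - {p0}. of_int (sign p) * T p)"
    unfolding S using p0 by (subst sum.remove[of _ p0]) (auto simp: finite_permutations)
  also have "\<dots> \<in> cspan Hooks"
  proof (intro cspan_diff cspan_sum)
    show "sdet toep {0..<N} X \<in> cspan Hooks"
      by (rule sdet_toep_in_Hooks) (auto simp: X, auto simp: X_def n_def y_def)
  qed (use Tp sgn in auto)
  finally have "T p0 \<in> cspan Hooks" using sgn by blast
  then show ?case using T0 \<mu> by simp
qed

lemma Smon_in_Hooks: "Smon e \<in> cspan Hooks"
proof -
  have "\<exists>\<nu>. (\<Prod>n\<in>A. kS (Suc n) ^ lk e n) = kmon \<nu>" for A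
  proof (induction A rule: infinite_finite_induct)
    case (insert a A)
    then obtain \<nu> where "(\<Prod>n\<in>A. kS (Suc n) ^ lk e n) = kmon \<nu>" by auto
    moreover have "kS (Suc a) ^ k = kmon (replicate k (Suc a))" for k by (induction k) auto
    ultimately have "(\<Prod>n\<in>insert a A. kS (Suc n) ^ lk e n) = kmon (replicate (lk e a) (Suc a) @ \<nu>)"
      using insert.hyps by (simp del: map_replicate)
    then show ?case by blast
  qed (auto intro: exI[of _ "[]"])
  then obtain \<nu> where \<nu>: "(\<Prod>n\<in>ks e. kS (Suc n) ^ lk e n) = kmon \<nu>" by blast
  have S: "S (2 * n + 2) = kS (Suc n)" for n using S_odd_even[of n] by simp
  show ?thesis unfolding Smon_def S \<nu> by (rule kmon_in_Hooks)
qed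

section \<open>Reduction modulo total derivatives\<close>

text \<open>The image of the augmentation ideal of the operator ring acting on A.\<close>

inductive_set Dplus :: "kdv set" where
  zero: "0 \<in> Dplus"
| step: "x \<in> Dplus \<Longrightarrow> dt (Suc n) p + x \<in> Dplus"

lemma Dplus_add: "x \<in> Dplus \<Longrightarrow> y \<in> Dplus \<Longrightarrow> x + y \<in> Dplus"
  by (induction rule: Dplus.induct) (auto simp: add.assoc intro: Dplus.step)

lemma Dplus_dt: "dt (Suc n) p \<in> Dplus"
  using Dplus.step[OF Dplus.zero, of n p] by simp

lemma Dplus_cst_mult: "x \<in> Dplus \<Longrightarrow> cst a * x \<in> Dplus"
proof (induction rule: Dplus.induct)
  case (step x n p)
  then have "dt (Suc n) (cst a * p) + cst a * x \<in> Dplus" by (intro Dplus.step)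
  then show ?case by (simp add: distrib_left)
qed (simp add: Dplus.zero)

lemma Dplus_sum: "(\<And>a. a \<in> A \<Longrightarrow> f a \<in> Dplus) \<Longrightarrow> (\<Sum>a\<in>A. f a) \<in> Dplus"
  by (induction A rule: infinite_finite_induct) (auto intro: Dplus_add Dplus.zero)

definition zt :: "nat \<Rightarrow> nat \<Rightarrow> kdv" where "zt r m = kZ (Suc r) (Suc m)"

lemma zt_sym: "zt r m = zt m r"
  unfolding zt_def by (rule kZ_sym) simp_all

lemma dt_zt: "dt (Suc n) (zt r m) = dt (Suc r) (zt n m)"
  unfolding zt_def by (rule dt_kZ) simp_all

lemma homog_zt: "homog (2 * r + 1 + (2 * m + 1)) (zt r m)"
  using homog_kZ[of "Suc r" "Suc m"] by (simp add: zt_def algebra_simps)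

lemma hk_zt:
  obtains g c where "\<And>r. c r \<noteq> 0" "\<And>r m. hk r m = cst (c r) * zt r m + dt (Suc m) (g r)"
proof -
  have "\<exists>g. \<forall>m. hk r m = cst (1 / (2 * of_nat (Suc r) - 1)) * zt r m + dt (Suc m) g" for r
    using kH_kZ[of 1 "Suc r"] by (metis hk_def kZ_sym zero_less_Suc zt_def One_nat_def)
  then obtain g where g: "\<And>r m. hk r m = cst (1 / (2 * of_nat (Suc r) - 1)) * zt r m + dt (Suc m) (g r)" by metis
  have "2 * of_nat (Suc r) - 1 \<noteq> (0::complex)" for r
  proof -
    have "2 * of_nat (Suc r) - 1 = (of_nat (Suc (2 * r)) :: complex)" by simp
    then show ?thesis by (metis of_nat_eq_0_iff nat.distinct(1))
  qed
  then show ?thesis using g by (intro that[of "\<lambda>r. 1 / (2 * of_nat (Suc r) - 1)" g]) auto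
qed

lemma sdet_scale_rows:
  assumes "finite L" "finite J" "card L = card J"
  shows "sdet (\<lambda>l j. c l * f l j) L J = (\<Prod>l\<in>L. c l) * sdet f L J"
  using assms
proof (induction "card L" arbitrary: L J)
  case (Suc n)
  then obtain l where l: "l \<in> L" by (metis card.empty equals0I nat.distinct(1))
  have "sdet (\<lambda>l j. c l * f l j) (L - {l}) (J - {j}) = (\<Prod>l\<in>L - {l}. c l) * sdet f (L - {l}) (J - {j})" if "j \<in> J" for j
    by (rule Suc.hyps(1)) (use Suc l that in auto)
  then have "sdet (\<lambda>l j. c l * f l j) L J = (\<Sum>j\<in>J. (-1) ^ (below L l + below J j) * (c l * f l j) * ((\<Prod>l\<in>L - {l}. c l) * sdet f (L - {l}) (J - {j})))"
    unfolding sdet_row[OF Suc.prems l] by (intro sum.cong) auto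
  also have "\<dots> = (\<Prod>l\<in>L. c l) * sdet f L J"
    unfolding sdet_row[OF Suc.prems l, of f] prod.remove[OF Suc.prems(1) l] sum_distrib_left
    by (intro sum.cong) (auto simp: algebra_simps)
  finally show ?case .
qed simp

text \<open>The rows are replaced one at a time. Changing row \<open>l\<close> changes the
  determinant by a signed sum of flow derivatives of \<open>g l\<close> times minors; by the product
  rule and \<open>sdet_jacobian\<close>, applied to columns, this is a sum of flow
  derivatives.\<close>

lemma Hooks_reduction:
  assumes "finite L" "finite J" "card L = card J"
  shows "\<exists>a. sdet hk L J - cst a * sdet zt L J \<in> Dplus"
proof -
  obtain g c where c: "\<And>r. c r \<noteq> 0" and g: "\<And>r m. hk r m = cst (c r) * zt r m + dt (Suc m) (g r)"
    using hk_zt by metis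
  define f where "f K r m = (if r \<in> K then cst (c r) * zt r m else hk r m)" for K r m
  \<comment> \<open>Closedness in the column index holds for rows of either kind, as it must at
    every intermediate stage.\<close>
  have sym: "dt (Suc m) (f K r m') = dt (Suc m') (f K r m)" for K r m m'
  proof -
    have "dt (Suc m) (zt r m') = dt (Suc m') (zt r m)" for r m m'
      using dt_zt[of m m' r] by (simp add: zt_sym)
    then show ?thesis by (simp add: f_def g dt_simps dt_commute[of "Suc m" "Suc m'"])
  qed
  have "sdet hk L J - sdet (f K) L J \<in> Dplus" if "finite K" "K \<subseteq> L" for K
    using that
  proof (induction K rule: finite_induct)
    case empty
    have "f {} = hk" by (intro ext) (simp add: f_def)
    then show ?case by (simp add: Dplus.zero)
  next
    case (insert l K)
    then have l: "l \<in> L" "l \<notin> K" by auto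
    define M where "M j = sdet (f K) (L - {l}) (J - {j})" for j
    have M: "sdet (f (insert l K)) (L - {l}) (J - {j}) = M j" if "j \<in> J" for j
      unfolding M_def by (rule sdet_cong) (use assms l that in \<open>auto simp: f_def\<close>)
    have "sdet (f K) L J - sdet (f (insert l K)) L J
       = (\<Sum>j\<in>J. (-1) ^ (below L l + below J j) * (dt (Suc j) (g l) * M j))"
      unfolding sdet_row[OF assms l(1)] sum_subtractf[symmetric]
      by (intro sum.cong) (use l M in \<open>auto simp: f_def g M_def[symmetric] algebra_simps\<close>)
    \<comment> \<open>The product rule, using that \<open>g l\<close> does not depend on
      \<open>j\<close> and can be taken out of the second sum.\<close>
    also have "\<dots> = (\<Sum>j\<in>J. dt (Suc j) (cst ((-1) ^ (below L l + below J j)) * (g l * M j)))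
        - (-1) ^ below L l * g l * (\<Sum>j\<in>J. (-1) ^ below J j * dt (Suc j) (M j))"
      by (simp add: dt_simps sum_distrib_left sum_subtractf[symmetric] algebra_simps power_add del: cst_simps(4))
         (simp add: algebra_simps)
    also have "(\<Sum>j\<in>J. (-1) ^ below J j * dt (Suc j) (M j)) = 0"
    proof -
      have "(\<Sum>j\<in>J. (-1) ^ below J j * dt (Suc j) (sdet (\<lambda>j r. f K r j) (J - {j}) (L - {l}))) = 0"
      proof (rule sdet_jacobian[where D="\<lambda>j. dt (Suc j)"])
        show "card J = Suc (card (L - {l}))" using assms l by (metis card_Suc_Diff1)
      qed (use assms sym additive_dt dt_simps in auto)
      moreover have "sdet (\<lambda>j r. f K r j) (J - {j}) (L - {l}) = M j" if "j \<in> J" for j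
        unfolding M_def by (rule sdet_transpose[symmetric]) (use assms l that in simp)
      ultimately show ?thesis by simp
    qed
    finally have "sdet (f K) L J - sdet (f (insert l K)) L J \<in> Dplus"
      by (simp add: Dplus_sum Dplus_dt Dplus_cst_mult del: cst_simps)
    moreover have "sdet hk L J - sdet (f K) L J \<in> Dplus" using insert by simp
    ultimately show ?case using Dplus_add by fastforce
  qed
  from this[OF assms(1) subset_refl]
  have "sdet hk L J - sdet (f L) L J \<in> Dplus" .
  moreover have "sdet (f L) L J = sdet (\<lambda>l j. cst (c l) * zt l j) L J"
    by (rule sdet_cong) (use assms in \<open>auto simp: f_def\<close>)
  moreover have "(\<Prod>l\<in>L. cst (c l)) = cst (\<Prod>l\<in>L. c l)"
    by (induction L rule: infinite_finite_induct) simp_all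
  ultimately show ?thesis unfolding sdet_scale_rows[OF assms] by metis
qed

lemma Smon_reduction:
  "\<exists>x\<in>cspan {sdet zt L J | L J. finite L \<and> finite J \<and> card L = card J}. Smon e - x \<in> Dplus"
  using Smon_in_Hooks[of e]
proof (induction rule: cspan.induct)
  case zero
  then show ?case by (intro bexI[of _ 0]) (auto intro: cspan.zero Dplus.zero)
next
  case (step b x a)
  obtain x' where x': "x' \<in> cspan {sdet zt L J | L J. finite L \<and> finite J \<and> card L = card J}" "x - x' \<in> Dplus"
    using step by blast
  obtain L J where b: "b = sdet hk L J" and LJ: "finite L" "finite J" "card L = card J"
    using step by (auto simp: Hooks_def)
  obtain c where c: "b - cst c * sdet zt L J \<in> Dplus" unfolding b using Hooks_reduction[OF LJ] by blast
  have "cst a * (b - cst c * sdet zt L J) + (x - x') \<in> Dplus" by (intro Dplus_add Dplus_cst_mult c x')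
  then have "cst a * b + x - (cst (a * c) * sdet zt L J + x') \<in> Dplus" by (simp add: algebra_simps)
  then show ?case using LJ x' by (intro bexI[of _ "cst (a * c) * sdet zt L J + x'"] cspan.step) (auto simp del: cst_simps)
qed

section \<open>The module structure and graded truncation\<close>

abbreviation pw :: "(nat \<Rightarrow>\<^sub>0 nat) \<Rightarrow> nat list \<Rightarrow> kdv \<Rightarrow> kdv" where
  "pw a xs \<equiv> foldr (\<lambda>j f. (dt (Suc j) ^^ lk a j) \<circ> f) xs id"

lemma dt_pow_commute: "(dt m ^^ k) ((dt n ^^ l) p) = (dt n ^^ l) ((dt m ^^ k) p)"
proof -
  have 1: "dt m ((dt n ^^ l) p) = (dt n ^^ l) (dt m p)" for p
    by (induction l) (simp_all add: dt_commute[of m n])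
  show ?thesis by (induction k) (simp_all add: 1)
qed

lemma pw_dt_commute: "pw a xs ((dt n ^^ l) p) = (dt n ^^ l) (pw a xs p)"
  by (induction xs arbitrary: p) (simp_all add: dt_pow_commute)

lemma pw_add: "pw (a + b) xs p = pw a xs (pw b xs p)"
  by (induction xs arbitrary: p) (simp_all add: lookup_add funpow_add pw_dt_commute)

lemma pw_filter: "pw a (filter (\<lambda>j. lk a j \<noteq> 0) xs) p = pw a xs p"
  by (induction xs arbitrary: p) simp_all

text \<open>Variables with exponent 0 act as the identity, so the factors may be listed over any
  finite superset. Two operator monomials can then be compared over a common list of
  variables.\<close>

lemma dmon_pw:
  assumes "finite K" "ks a \<subseteq> K"
  shows "dmon a = pw a (sorted_list_of_set K)"
proof -
  have "sorted_list_of_set (ks a) = filter (\<lambda>j. lk a j \<noteq> 0) (sorted_list_of_set K)"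
    by (rule sorted_distinct_set_unique) (use assms in \<open>auto simp: in_keys_iff sorted_wrt_filter subset_iff\<close>)
  then show ?thesis unfolding dmon_def dd_dt by (intro ext) (simp only: pw_filter)
qed

lemma dmon_add: "dmon (a + b) p = dmon a (dmon b p)"
proof -
  let ?K = "ks a \<union> ks b"
  have "ks (a + b) \<subseteq> ?K" by (rule keys_add)
  then show ?thesis by (simp add: dmon_pw[of ?K] pw_add)
qed

lemma dmon_0 [simp]: "dmon 0 p = p"
  by (simp add: dmon_def)

lemma dmon_single: "dmon (sg j 1) p = dt (Suc j) p"
  using dd_dt[of j] by (simp add: dmon_def)

lemma additive_dt_pow: "Modules.additive (dt n ^^ k)"
  by (induction k) (auto simp: additive_def dt_simps)

lemma additive_pw: "Modules.additive (pw a xs)"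
  by (induction xs) (auto simp: additive_def additive_imps[OF additive_dt_pow])

lemma additive_dmon: "Modules.additive (dmon a)"
  by (simp add: dmon_pw[OF finite_keys subset_refl] additive_pw)

lemma dmon_cst_mult: "dmon a (cst c * p) = cst c * dmon a p"
proof -
  have 1: "(dt n ^^ k) (cst c * p) = cst c * (dt n ^^ k) p" for n k p
    by (induction k) simp_all
  have "pw a xs (cst c * p) = cst c * pw a xs p" for xs
    by (induction xs) (simp_all add: 1)
  then show ?thesis by (simp add: dmon_pw[OF finite_keys subset_refl])
qed

lemma additive_dact_left: "Modules.additive (\<lambda>P. dact P f)"
  unfolding dact_def by (intro additive_keys_sum) (simp add: additive_def algebra_simps)

lemma additive_dact: "Modules.additive (dact P)"
  unfolding dact_def[abs_def] by (intro additive_sum additive_comp[OF additive_mult additive_dmon])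

lemmas dact_add_left = additive_imps[OF additive_dact_left]
lemmas dact_add_right = additive_imps[OF additive_dact]

lemma dact_single: "dact (sg a c) f = cst c * dmon a f"
  unfolding dact_def by (subst keys_sum_single[where g="\<lambda>a c. cst c * dmon a f"]) auto

lemma dact_mult: "dact (P * Q) f = dact P (dact Q f)"
proof -
  have 1: "dact (sg a c * sg b d) f = dact (sg a c) (dact (sg b d) f)" for a b c d
    by (simp add: mult_single dact_single dmon_add dmon_cst_mult mult.assoc)
  have 2: "dact (sg a c * Q) f = dact (sg a c) (dact Q f)" for a c
    by (rule additive_ext[where x=Q], rule additive_comp[OF additive_dact_left additive_mult],
      rule additive_comp[OF additive_dact additive_dact_left]) (rule 1)
  show ?thesis
  proof (rule additive_ext[where x=P and F="\<lambda>P. dact (P * Q) f"])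
    show "Modules.additive (\<lambda>P. dact (P * Q) f)" by (simp add: additive_def distrib_right dact_add_left(2))
  qed (rule additive_dact_left, rule 2)
qed

lemma dact_1 [simp]: "dact 1 f = f"
  using dact_single[of 0 1 f] by simp

lemma dact_uvar: "dact (sg (sg j 1) 1) f = dt (Suc j) f"
  by (simp add: dact_single dmon_single del: One_nat_def)

lemma dact_sign: "dact ((-1) ^ k * P) f = (-1) ^ k * dact P f"
  by (induction k) (simp_all add: dact_add_left)

lemma dt_dact: "dt (Suc n) (dact P f) = dact P (dt (Suc n) f)"
  by (simp only: dact_uvar[symmetric] dact_mult[symmetric] mult.commute)

section \<open>Weights of operator monomials and truncation\<close>

definition wtd :: "(nat \<Rightarrow>\<^sub>0 nat) \<Rightarrow> nat" where
  "wtd a = (\<Sum>j\<in>ks a. lk a j * (2 * j + 1))"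

lemma wtd_superset: "finite K \<Longrightarrow> ks m \<subseteq> K \<Longrightarrow> wtd m = (\<Sum>k\<in>K. lk m k * (2 * k + 1))"
  unfolding wtd_def by (intro sum.mono_neutral_left) (auto simp: in_keys_iff)

lemma wtd_0 [simp]: "wtd 0 = 0"
  by (simp add: wtd_def)

lemma wtd_single [simp]: "wtd (sg k a) = a * (2 * k + 1)"
  by (simp add: wtd_def)

lemma wtd_add [simp]: "wtd (m + n) = wtd m + wtd n"
proof -
  let ?K = "ks m \<union> ks n"
  have "wtd (m + n) = (\<Sum>k\<in>?K. lk (m + n) k * (2 * k + 1))" by (rule wtd_superset) (auto simp: keys_add)
  also have "\<dots> = wtd m + wtd n"
    by (simp add: lookup_add algebra_simps sum.distrib wtd_superset[of ?K])
  finally show ?thesis .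
qed

lemma homog_dmon: "homog d f \<Longrightarrow> homog (d + wtd a) (dmon a f)"
proof (induction a rule: monomial_induct)
  case (2 a k)
  then have "homog (d + wtd a + (2 * Suc k - 1)) (dt (Suc k) (dmon a f))" by (intro homog_dt) auto
  moreover have "dmon (a + sg k 1) f = dt (Suc k) (dmon a f)"
    using dmon_add[of "sg k 1" a f] by (simp add: add.commute dmon_single del: One_nat_def)
  moreover have "d + wtd a + (2 * Suc k - 1) = d + wtd (a + sg k 1)" by simp
  ultimately show ?case by (simp only:)
qed simp

text \<open>Cutting by a predicate on weights instead of a bound lets a flow pass through by
  shifting the predicate, without subtraction of natural numbers.\<close>

definition trunc :: "(nat \<Rightarrow> bool) \<Rightarrow> kdv \<Rightarrow> kdv" where
  "trunc T p = (\<Sum>m\<in>ks p. if T (wt m) then sg m (lk p m) else 0)"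

lemma additive_trunc: "Modules.additive (trunc T)"
  unfolding trunc_def[abs_def] by (intro additive_keys_sum) (auto simp: additive_def single_add)

lemmas trunc_add = additive_imps[OF additive_trunc]

lemma trunc_homog: "homog d p \<Longrightarrow> trunc T p = (if T d then p else 0)"
proof -
  assume "homog d p"
  then have "trunc T p = (\<Sum>m\<in>ks p. if T d then sg m (lk p m) else 0)"
    unfolding trunc_def homog_def by (intro sum.cong) auto
  then show ?thesis using pm_sum_singles[of p] by simp
qed

lemma trunc_eq: "(\<And>m. m \<in> ks p \<Longrightarrow> T (wt m)) \<Longrightarrow> trunc T p = p"
proof -
  assume "\<And>m. m \<in> ks p \<Longrightarrow> T (wt m)"
  then have "trunc T p = (\<Sum>m\<in>ks p. sg m (lk p m))" unfolding trunc_def by (intro sum.cong) auto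
  then show ?thesis using pm_sum_singles[of p] by simp
qed

lemma keys_trunc: "m \<in> ks (trunc T p) \<Longrightarrow> T (wt m)"
proof -
  assume "m \<in> ks (trunc T p)"
  then have "m \<in> ks (\<Sum>n\<in>ks p. if T (wt n) then sg n (lk p n) else 0)" by (simp add: trunc_def)
  then have "m \<in> (\<Union>n\<in>ks p. ks (if T (wt n) then sg n (lk p n) else 0))"
    by (rule subsetD[OF keys_sum])
  then show ?thesis by (auto split: if_splits)
qed

lemma trunc_dt: "trunc T (dt (Suc n) p) = dt (Suc n) (trunc (\<lambda>e. T (e + (2 * n + 1))) p)"
proof (rule additive_ext[where x=p])
  show "Modules.additive (\<lambda>p. trunc T (dt (Suc n) p))" 
    by (rule additive_comp[OF additive_trunc additive_dt])
  show "Modules.additive (\<lambda>p. dt (Suc n) (trunc (\<lambda>e. T (e + (2 * n + 1))) p))"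
    by (rule additive_comp[OF additive_dt additive_trunc])
  fix m c
  have "homog (wt m + (2 * Suc n - 1)) (dt (Suc n) (sg m c))" by (rule homog_dt[OF homog_single])
  then have "homog (wt m + (2 * n + 1)) (dt (Suc n) (sg m c))" by simp
  then show "trunc T (dt (Suc n) (sg m c)) = dt (Suc n) (trunc (\<lambda>e. T (e + (2 * n + 1))) (sg m c))"
    by (simp add: trunc_homog[OF homog_single] trunc_homog)
qed

lemma homog_sdet_zt:
  assumes "finite L" "finite J" "card L = card J"
  shows "homog ((\<Sum>l\<in>L. 2 * l + 1) + (\<Sum>j\<in>J. 2 * j + 1)) (sdet zt L J)"
  using assms
proof (induction "card L" arbitrary: L J)
  case (Suc n)
  then obtain l where l: "l \<in> L" by (metis card.empty equals0I nat.distinct(1))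
  show ?case unfolding sdet_row[OF Suc.prems l]
  proof (rule homog_sum)
    fix j assume j: "j \<in> J"
    have "homog ((\<Sum>l\<in>L - {l}. 2 * l + 1) + (\<Sum>j\<in>J - {j}. 2 * j + 1)) (sdet zt (L - {l}) (J - {j}))"
      by (rule Suc.hyps(1)) (use Suc l j in auto)
    then have "homog ((\<Sum>l\<in>L. 2 * l + 1) + (\<Sum>j\<in>J. 2 * j + 1)) (zt l j * sdet zt (L - {l}) (J - {j}))"
      by (rule homog_mult[OF homog_zt])
        (use sum.remove[OF Suc.prems(1) l, of "\<lambda>l. 2 * l + 1"] sum.remove[OF Suc.prems(2) j, of "\<lambda>j. 2 * j + 1"] in simp)
    then have "homog ((\<Sum>l\<in>L. 2 * l + 1) + (\<Sum>j\<in>J. 2 * j + 1)) (cst ((-1) ^ (below L l + below J j)) * (zt l j * sdet zt (L - {l}) (J - {j})))"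
      by (rule homog_cst_mult)
    then show "homog ((\<Sum>l\<in>L. 2 * l + 1) + (\<Sum>j\<in>J. 2 * j + 1)) ((-1) ^ (below L l + below J j) * zt l j * sdet zt (L - {l}) (J - {j}))"
      by (simp add: mult.assoc)
  qed
qed simp

section \<open>The submodule generated by the determinants of zeta\<close>

inductive_set Dets :: "kdv set" where
  zero: "0 \<in> Dets"
| step: "finite L \<Longrightarrow> finite J \<Longrightarrow> card L = card J \<Longrightarrow> x \<in> Dets \<Longrightarrow> dact P (sdet zt L J) + x \<in> Dets"

lemma Dets_add: "x \<in> Dets \<Longrightarrow> y \<in> Dets \<Longrightarrow> x + y \<in> Dets"
  by (induction rule: Dets.induct) (auto simp: add.assoc intro: Dets.step)

lemma Dets_dact_sdet: "finite L \<Longrightarrow> finite J \<Longrightarrow> card L = card J \<Longrightarrow> dact P (sdet zt L J) \<in> Dets"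
  using Dets.step[OF _ _ _ Dets.zero] by simp

lemma Dets_sum: "(\<And>a. a \<in> A \<Longrightarrow> f a \<in> Dets) \<Longrightarrow> (\<Sum>a\<in>A. f a) \<in> Dets"
  by (induction A rule: infinite_finite_induct) (auto intro: Dets_add Dets.zero)

lemma Dets_dact: "x \<in> Dets \<Longrightarrow> dact P x \<in> Dets"
proof (induction rule: Dets.induct)
  case (step L J x Q)
  then have "dact (P * Q) (sdet zt L J) + dact P x \<in> Dets" by (intro Dets.step)
  then show ?case by (simp add: dact_add_right dact_mult)
qed (simp add: dact_add_right Dets.zero)

lemma Dets_cspan: "x \<in> cspan {sdet zt L J | L J. finite L \<and> finite J \<and> card L = card J} \<Longrightarrow> x \<in> Dets"
proof (induction rule: cspan.induct)
  case (step b x c)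
  then obtain L J where "b = sdet zt L J" "finite L" "finite J" "card L = card J" by auto
  moreover from this have "dact (sg 0 c) (sdet zt L J) + x \<in> Dets" using step by (intro Dets.step)
  ultimately show ?case by (simp add: dact_single)
qed (rule Dets.zero)

lemma Dets_trunc: "x \<in> Dets \<Longrightarrow> trunc T x \<in> Dets"
proof (induction rule: Dets.induct)
  case (step L J x P)
  let ?d = "(\<Sum>l\<in>L. 2 * l + 1) + (\<Sum>j\<in>J. 2 * j + 1)"
  have h: "homog ?d (sdet zt L J)" using step by (intro homog_sdet_zt)
  have "trunc T (dact P (sdet zt L J)) = (\<Sum>a\<in>ks P. trunc T (dact (sg a (lk P a)) (sdet zt L J)))"
    by (simp add: dact_def[of P] trunc_add dact_single)
  also have "\<dots> \<in> Dets"
  proof (rule Dets_sum)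
    fix a
    have "homog (?d + wtd a) (dact (sg a (lk P a)) (sdet zt L J))"
      unfolding dact_single by (intro homog_cst_mult homog_dmon h)
    then show "trunc T (dact (sg a (lk P a)) (sdet zt L J)) \<in> Dets"
      using step by (auto simp: trunc_homog intro: Dets.zero Dets_dact_sdet)
  qed
  finally show ?case using step by (simp add: trunc_add Dets_add)
qed (simp add: trunc_add Dets.zero)

lemma Dplus_dact: "x \<in> Dplus \<Longrightarrow> dact P x \<in> Dplus"
proof (induction rule: Dplus.induct)
  case (step x n p)
  then show ?case using Dplus.step[of "dact P x" n "dact P p"] by (simp add: dact_add_right dt_dact)
qed (simp add: dact_add_right Dplus.zero)

text \<open>A graded Nakayama argument: determinants generate A modulo the images of the flows, and
  flows strictly raise the weight. Induction on a bound for the weights therefore generates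
  everything.\<close>

lemma Dets_UNIV:
  assumes "surj ev1"
  shows "f \<in> Dets"
proof -
  have "f \<in> Dets" if "\<And>m. m \<in> ks f \<Longrightarrow> wt m \<le> d" for d
    using that
  proof (induction d arbitrary: f rule: less_induct)
    case (less d)
    obtain x where "f = ev1 x" using assms by (metis surjD)
    have "\<exists>w\<in>Dets. dact P (Smon e) - w \<in> Dplus" for P e
    proof -
      obtain y where y: "y \<in> Dets" "Smon e - y \<in> Dplus" using Smon_reduction[of e] Dets_cspan by blast
      then have "dact P (Smon e) - dact P y \<in> Dplus" using Dplus_dact[of "Smon e - y" P] by (simp add: dact_add_right)
      then show ?thesis using Dets_dact[OF y(1)] by blast
    qed
    then obtain w where w: "\<And>P e. w P e \<in> Dets" "\<And>P e. dact P (Smon e) - w P e \<in> Dplus" by metis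
    define W where "W = (\<Sum>e\<in>ks x. w (lk x e) e)"
    have W: "W \<in> Dets" unfolding W_def by (intro Dets_sum w)
    have "f - W = (\<Sum>e\<in>ks x. dact (lk x e) (Smon e) - w (lk x e) e)"
      unfolding \<open>f = ev1 x\<close> ev1_def W_def by (simp add: sum_subtractf)
    also have "\<dots> \<in> Dplus" by (intro Dplus_sum w)
    finally have "f - W \<in> Dplus" .
    \<comment> \<open>The weight \<open>d\<close> part of a flow derivative is the flow derivative
      of a part of weight at most \<open>d - (2 * n + 1)\<close>, which the induction hypothesis
      covers.\<close>
    moreover have "trunc (\<lambda>e. e \<le> d) y \<in> Dets" if "y \<in> Dplus" for y
      using that
    proof (induction rule: Dplus.induct)
      case (step y n p)
      have "trunc (\<lambda>e. e \<le> d) (dt (Suc n) p) \<in> Dets"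
      proof (cases "2 * n + 1 \<le> d")
        case True
        let ?q = "trunc (\<lambda>e. e + (2 * n + 1) \<le> d) p"
        have "?q \<in> Dets"
        proof (rule less.IH)
          show "d - (2 * n + 1) < d" using True by simp
          show "wt m \<le> d - (2 * n + 1)" if "m \<in> ks ?q" for m using keys_trunc[OF that] by simp
        qed
        then have "dt (Suc n) ?q \<in> Dets" unfolding dact_uvar[symmetric] by (rule Dets_dact)
        then show ?thesis by (simp only: trunc_dt)
      next
        case False
        then have "trunc (\<lambda>e. e + (2 * n + 1) \<le> d) p = 0" by (simp add: trunc_def)
        then show ?thesis unfolding trunc_dt by (simp add: Dets.zero)
      qed
      then show ?case using step by (simp add: trunc_add Dets_add)
    qed (simp add: trunc_add Dets.zero)
    ultimately have "trunc (\<lambda>e. e \<le> d) (f - W) \<in> Dets" by blast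
    then have "trunc (\<lambda>e. e \<le> d) (f - W) + trunc (\<lambda>e. e \<le> d) W \<in> Dets"
      by (rule Dets_add) (rule Dets_trunc[OF W])
    then have "trunc (\<lambda>e. e \<le> d) f \<in> Dets" by (simp add: trunc_add)
    then show ?case using trunc_eq[of f "\<lambda>e. e \<le> d"] less.prems by simp
  qed
  from this[of "Max (wt ` ks f)"] show ?thesis by simp
qed

section \<open>Holes and particles\<close>

abbreviation od :: "nat \<Rightarrow> int" where "od r \<equiv> 2 * int r + 1"

text \<open>Holes and particles are taken relative to the vacuum of charge -1 whatever the charge at
  hand, and are numbered by \<open>r\<close> for the place of absolute value
  \<open>od r\<close>.\<close>

definition holes :: "int set \<Rightarrow> nat set" where "holes X = {r. - od r \<notin> X}"
definition parts :: "int set \<Rightarrow> nat set" where "parts X = {r. od r \<in> X}"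
definition mkX :: "nat set \<Rightarrow> nat set \<Rightarrow> int set" where
  "mkX L J = {- od r |r. r \<notin> L} \<union> od ` J"

definition odds :: "int set \<Rightarrow> bool" where "odds X \<longleftrightarrow> (\<forall>s\<in>X. odd s)"

lemma odd_cases: "odd s \<Longrightarrow> (\<exists>r. s = od r) \<or> (\<exists>r. s = - od r)" for s :: int
proof -
  assume "odd s"
  then obtain t where t: "s = 2 * t + 1" by (auto elim: oddE)
  show ?thesis
  proof (cases "t \<ge> 0")
    case True
    then have "s = od (nat t)" using t by simp
    then show ?thesis by blast
  next
    case False
    then have "s = - od (nat (- t - 1))" using t by simp
    then show ?thesis by blast
  qed
qed

lemma od_eq [simp]: "od r = od s \<longleftrightarrow> r = s" "- od r = - od s \<longleftrightarrow> r = s" "od r \<noteq> - od s" "- od r \<noteq> od s"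
  by auto

lemma holes_mkX [simp]: "holes (mkX L J) = L" and parts_mkX [simp]: "parts (mkX L J) = J"
  by (auto simp: holes_def parts_def mkX_def)

lemma odds_mkX [simp]: "odds (mkX L J)"
  by (auto simp: odds_def mkX_def)

lemma mkX_holes_parts: "odds X \<Longrightarrow> mkX (holes X) (parts X) = X"
proof (intro equalityI subsetI)
  fix s assume "odds X" "s \<in> X"
  then show "s \<in> mkX (holes X) (parts X)"
    using odd_cases[of s] by (auto simp: odds_def mkX_def holes_def parts_def)
qed (auto simp: mkX_def holes_def parts_def)

lemma holes_insert: "holes (insert (- od r) X) = holes X - {r}" "holes (insert (od r) X) = holes X"
  by (auto simp: holes_def)

lemma parts_insert: "parts (insert (- od r) X) = parts X" "parts (insert (od r) X) = insert r (parts X)"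
  by (auto simp: parts_def)

lemma odds_insert: "odds (insert (- od r) X) = odds X" "odds (insert (od r) X) = odds X"
  by (simp_all add: odds_def)

lemma inj_od: "inj_on od A" "inj_on (\<lambda>r. - od r) A"
  by (auto simp: inj_on_def)

lemma card_od [simp]: "card (od ` A) = card A" "card ((\<lambda>r. - (2 * int r) - 1) ` A) = card A"
  by (simp_all add: card_image inj_on_def)

text \<open>\<open>valid\<close> compares with the vacuum of the given charge, \<open>holes\<close>
  and \<open>parts\<close> with that of charge -1. The \<open>k\<close> places between the two vacua
  account for the surplus of holes.\<close>

lemma valid_iff:
  "valid (- 2 * int k - 1) X \<longleftrightarrow> odds X \<and> finite (holes X) \<and> finite (parts X) \<and> card (holes X) = card (parts X) + k"
proof (cases "odds X")
  case False then show ?thesis by (auto simp: valid_def odds_def)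
next
  case odds: True
  let ?m = "- 2 * int k - 1"
  have 1: "X - vac ?m = od ` parts X \<union> (\<lambda>r. - od r) ` ({..<k} - holes X)"
  proof (intro equalityI subsetI)
    fix s assume s: "s \<in> X - vac ?m"
    then have "odd s" using odds by (auto simp: odds_def)
    then show "s \<in> od ` parts X \<union> (\<lambda>r. - od r) ` ({..<k} - holes X)"
      using odd_cases[of s] s by (auto simp: vac_def parts_def holes_def)
  qed (auto simp: parts_def holes_def vac_def)
  have 2: "vac ?m - X = (\<lambda>r. - od r) ` (holes X - {..<k})"
  proof (intro equalityI subsetI)
    fix s assume s: "s \<in> vac ?m - X"
    then show "s \<in> (\<lambda>r. - od r) ` (holes X - {..<k})"
      using odd_cases[of s] by (auto simp: vac_def holes_def)
  qed (auto simp: holes_def vac_def)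
  have f1: "finite (X - vac ?m) \<longleftrightarrow> finite (parts X)"
    unfolding 1 finite_Un finite_image_iff[OF inj_od(1)] by simp
  have f2: "finite (vac ?m - X) \<longleftrightarrow> finite (holes X)"
    unfolding 2 finite_image_iff[OF inj_od(2)] by simp
  have "card (X - vac ?m) = card (vac ?m - X) \<longleftrightarrow> card (holes X) = card (parts X) + k"
    if f: "finite (parts X)" "finite (holes X)"
  proof -
    have "card (X - vac ?m) = card (parts X) + card ({..<k} - holes X)"
      unfolding 1 using f by (subst card_Un_disjoint) auto
    moreover have "card (vac ?m - X) = card (holes X - {..<k})"
      unfolding 2 by simp
    moreover have "card {..<k} = card ({..<k} - holes X) + card ({..<k} \<inter> holes X)"
      using card_Int_Diff[of "{..<k}" "holes X"] by simp
    moreover have "card (holes X) = card (holes X - {..<k}) + card ({..<k} \<inter> holes X)"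
      using card_Int_Diff[OF f(2), of "{..<k}"] by (simp add: Int_commute)
    ultimately show ?thesis unfolding card_lessThan by arith
  qed
  then show ?thesis using odds f1 f2 by (auto simp: valid_def odds_def)
qed

lemma valid_0: "valid (-1) X \<longleftrightarrow> odds X \<and> finite (holes X) \<and> finite (parts X) \<and> card (holes X) = card (parts X)"
  and valid_1: "valid (-3) X \<longleftrightarrow> odds X \<and> finite (holes X) \<and> finite (parts X) \<and> card (holes X) = card (parts X) + 1"
  and valid_2: "valid (-5) X \<longleftrightarrow> odds X \<and> finite (holes X) \<and> finite (parts X) \<and> card (holes X) = card (parts X) + 2"
  using valid_iff[of 0 X] valid_iff[of 1 X] valid_iff[of 2 X] by simp_all

lemma Jset_holes: "Jset X = od ` holes X"
proof (intro equalityI subsetI)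
  fix j assume "j \<in> Jset X"
  then show "j \<in> od ` holes X" using odd_cases[of j] by (auto simp: Jset_def holes_def)
qed (auto simp: Jset_def holes_def)

lemma dvar_od: "dvar (od r) = sg (sg r 1) 1"
  by (simp add: dvar_def)

lemma card_above_neg:
  assumes "odds X" "finite (parts X)"
  shows "{s\<in>X. s > - od r} = od ` parts X \<union> (\<lambda>r. - od r) ` ({..<r} - holes X)"
    and "card {s\<in>X. s > - od r} = card (parts X) + (r - below (holes X) r)"
proof -
  show 1: "{s\<in>X. s > - od r} = od ` parts X \<union> (\<lambda>r. - od r) ` ({..<r} - holes X)"
  proof (intro equalityI subsetI)
    fix s assume s: "s \<in> {s\<in>X. s > - od r}"
    then have "odd s" using assms by (auto simp: odds_def)
    then show "s \<in> od ` parts X \<union> (\<lambda>r. - od r) ` ({..<r} - holes X)"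
      using odd_cases[of s] s by (auto simp: parts_def holes_def)
  qed (auto simp: parts_def holes_def)
  have "card ({..<r} - holes X) = r - below (holes X) r"
  proof -
    have "{..<r} - holes X = {..<r} - {x\<in>holes X. x < r}" by auto
    moreover have "card ({..<r} - {x\<in>holes X. x < r}) = r - card {x\<in>holes X. x < r}"
      by (subst card_Diff_subset) (auto intro: finite_subset[of _ "{..<r}"])
    ultimately show ?thesis by (simp add: below_def)
  qed
  moreover have "card (od ` parts X \<union> (\<lambda>r. - od r) ` ({..<r} - holes X))
     = card (od ` parts X) + card ((\<lambda>r. - od r) ` ({..<r} - holes X))"
    using assms by (intro card_Un_disjoint) auto
  ultimately show "card {s\<in>X. s > - od r} = card (parts X) + (r - below (holes X) r)"
    by (simp only: 1 card_image[OF inj_od(1)] card_image[OF inj_od(2)])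
qed

lemma below_le: "below L r \<le> r" for r :: nat
proof -
  have "card {x\<in>L. x < r} \<le> card {..<r}" by (rule card_mono) auto
  then show ?thesis by (simp add: below_def)
qed

lemma card_above_pos:
  assumes "odds X"
  shows "{s\<in>X. s > od r} = od ` {p\<in>parts X. p > r}"
    and "card {s\<in>X. s > od r} = card {p\<in>parts X. p > r}"
proof -
  show 1: "{s\<in>X. s > od r} = od ` {p\<in>parts X. p > r}"
  proof (intro equalityI subsetI)
    fix s assume s: "s \<in> {s\<in>X. s > od r}"
    then have "odd s" using assms by (auto simp: odds_def)
    then show "s \<in> od ` {p\<in>parts X. p > r}"
      using odd_cases[of s] s by (auto simp: parts_def)
  qed (auto simp: parts_def)
  show "card {s\<in>X. s > od r} = card {p\<in>parts X. p > r}" unfolding 1 by (simp add: card_image inj_od)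
qed

lemma above_below: "finite J \<Longrightarrow> r \<notin> J \<Longrightarrow> card {p\<in>J. p > r} + below J r = card J" for r :: nat
proof -
  assume J: "finite J" "r \<notin> J"
  have "{p\<in>J. p > r} \<union> {x\<in>J. x < r} = J"
  proof (intro equalityI subsetI)
    fix x assume "x \<in> J"
    then have "x \<noteq> r" using J by auto
    then show "x \<in> {p\<in>J. p > r} \<union> {x\<in>J. x < r}" using \<open>x \<in> J\<close> by auto
  qed auto
  moreover have "card ({p\<in>J. p > r} \<union> {x\<in>J. x < r}) = card {p\<in>J. p > r} + card {x\<in>J. x < r}"
    using J by (intro card_Un_disjoint) auto
  ultimately show ?thesis by (simp add: below_def)
qed

lemma rpsi_single:
  "rpsi n (sg X c) = (if n \<in> X then 0 else sg (insert n X) ((-1) ^ card {s\<in>X. s > n} * c))"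
  by (cases "c = 0") (simp_all add: rpsi_def)

lemma additive_rpsi: "Modules.additive (rpsi n)"
  unfolding rpsi_def[abs_def] by (intro additive_keys_sum) (auto simp: additive_def single_add distrib_left)

section \<open>Signs of the basis vectors\<close>

text \<open>Each place is added above all occupied ones, so no sign arises.\<close>

lemma foldl_rpsi_neg:
  assumes "sorted_wrt (>) xs" "\<forall>s\<in>Y. \<forall>x\<in>set xs. s < - int x"
  shows "foldl (\<lambda>v i. rpsi (- int i) v) (sg Y c) xs = sg (Y \<union> (\<lambda>i. - int i) ` set xs) c"
  using assms
proof (induction xs arbitrary: Y)
  case (Cons x xs)
  have e: "{s\<in>Y. s > - int x} = {}" and n: "- int x \<notin> Y" using Cons.prems by force+
  have "rpsi (- int x) (sg Y c) = sg (insert (- int x) Y) c" unfolding rpsi_single e using n by simp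
  moreover have "\<forall>s\<in>insert (- int x) Y. \<forall>x\<in>set xs. s < - int x" using Cons.prems by auto
  ultimately show ?case using Cons.IH[of "insert (- int x) Y"] Cons.prems by simp
qed simp

text \<open>Particles enter in decreasing order, so each one passes all positive places filled
  before it: those of \<open>Y\<close> and the earlier members of the list.\<close>

lemma foldl_rpsi_pos:
  assumes "sorted_wrt (>) xs" "\<forall>x\<in>set xs. x > 0" "finite {s\<in>Y. s > 0}" "\<forall>s\<in>Y. s > 0 \<longrightarrow> (\<forall>x\<in>set xs. s > int x)"
  shows "foldl (\<lambda>v i. rpsi (int i) v) (sg Y c) xs
    = sg (Y \<union> int ` set xs) ((-1) ^ (\<Sum>p<length xs. card {s\<in>Y. s > 0} + p) * c)"
  using assms
proof (induction xs arbitrary: Y c)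
  case (Cons x xs)
  have "{s\<in>Y. s > int x} = {s\<in>Y. s > 0}" "int x \<notin> Y" using Cons.prems by force+
  then have r: "rpsi (int x) (sg Y c) = sg (insert (int x) Y) ((-1) ^ card {s\<in>Y. s > 0} * c)" by (simp add: rpsi_single)
  define a where "a = card {s\<in>Y. s > 0}"
  have i: "{s\<in>insert (int x) Y. s > 0} = insert (int x) {s\<in>Y. s > 0}" using Cons.prems by auto
  have k: "card {s\<in>insert (int x) Y. s > 0} = Suc a"
    unfolding i a_def using \<open>int x \<notin> Y\<close> Cons.prems(3) by simp
  have IH: "foldl (\<lambda>v i. rpsi (int i) v) (sg (insert (int x) Y) ((-1) ^ card {s\<in>Y. s > 0} * c)) xs
    = sg (insert (int x) Y \<union> int ` set xs) ((-1) ^ (\<Sum>p<length xs. card {s\<in>insert (int x) Y. s > 0} + p) * ((-1) ^ card {s\<in>Y. s > 0} * c))"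
  proof (rule Cons.IH)
    show "finite {s \<in> insert (int x) Y. 0 < s}" unfolding i using Cons.prems by simp
  qed (use Cons.prems in auto)
  have "(\<Sum>p<length (x # xs). a + p) = a + (\<Sum>p<length xs. Suc a + p)"
    by (simp only: length_Cons sum.lessThan_Suc_shift) simp
  then have "(-1) ^ (\<Sum>p<length (x # xs). a + p) * c = (-1) ^ (\<Sum>p<length xs. Suc a + p) * ((-1) ^ a * c)"
    by (simp only: power_add mult_ac)
  then show ?case using IH unfolding k a_def[symmetric] by (simp add: r a_def[symmetric])
qed simp

lemma sorted_rev_desc: "sorted_wrt (>) (rev (sorted_list_of_set I))" for I :: "nat set"
  by (simp add: sorted_wrt_rev strict_sorted_list_of_set)

text \<open>Both blocks are decreasing, so an inversion consists of one entry from each.\<close>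

lemma card_inversions:
  assumes "finite I" "finite L" "I \<inter> L = {}"
  defines "xs \<equiv> rev (sorted_list_of_set I) @ rev (sorted_list_of_set (L :: nat set))"
  shows "card {(p, q). p < q \<and> q < length xs \<and> xs ! p < xs ! q} = (\<Sum>l\<in>L. card {i\<in>I. i < l})"
proof -
  let ?A = "rev (sorted_list_of_set I)" and ?B = "rev (sorted_list_of_set L)"
  let ?S = "{(p, q). p < q \<and> q < length xs \<and> xs ! p < xs ! q}"
  have A: "?A ! p > ?A ! q" if "p < q" "q < length ?A" for p q
    using sorted_wrt_nth_less[OF sorted_rev_desc that] .
  have B: "?B ! p > ?B ! q" if "p < q" "q < length ?B" for p q
    using sorted_wrt_nth_less[OF sorted_rev_desc that] .
  have d: "distinct xs" unfolding xs_def using assms by auto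
  have inj: "inj_on (\<lambda>(p, q). (xs ! p, xs ! q)) ?S"
    using d by (auto simp: inj_on_def nth_eq_iff_index_eq)
  have im: "(\<lambda>(p, q). (xs ! p, xs ! q)) ` ?S = (\<lambda>(l, i). (i, l)) ` Sigma L (\<lambda>l. {i\<in>I. i < l})"
    proof (intro equalityI subsetI)
      fix z assume "z \<in> (\<lambda>(p, q). (xs ! p, xs ! q)) ` ?S"
      then obtain p q where pq: "p < q" "q < length xs" "xs ! p < xs ! q" "z = (xs ! p, xs ! q)" by auto
      have "p < length ?A \<and> \<not> q < length ?A"
      proof (rule ccontr)
        assume "\<not> ?thesis"
        then consider "q < length ?A" | "\<not> p < length ?A" by blast
        then show False
        proof cases
          case 1 then show False using A[of p q] pq by (simp add: xs_def nth_append del: length_rev)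
        next
          case 2 
          then have "?B ! (p - length ?A) > ?B ! (q - length ?A)" using pq by (intro B) (auto simp: xs_def)
          then show False using pq 2 by (simp add: xs_def nth_append)
        qed
      qed
      then have "xs ! p = ?A ! p" "xs ! q = ?B ! (q - length ?A)" "p < length ?A" "q - length ?A < length ?B"
        using pq by (auto simp: xs_def nth_append)
      then have "xs ! p \<in> I" "xs ! q \<in> L" 
        using assms nth_mem[of p ?A] nth_mem[of "q - length ?A" ?B] by auto
      then show "z \<in> (\<lambda>(l, i). (i, l)) ` Sigma L (\<lambda>l. {i\<in>I. i < l})" using pq by force
    next
      fix z assume "z \<in> (\<lambda>(l, i). (i, l)) ` Sigma L (\<lambda>l. {i\<in>I. i < l})"
      then obtain i l where il: "i \<in> I" "l \<in> L" "i < l" "z = (i, l)" by auto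
      obtain p where p: "p < length ?A" "?A ! p = i" using il assms by (metis in_set_conv_nth set_rev set_sorted_list_of_set)
      obtain q where q: "q < length ?B" "?B ! q = l" using il assms by (metis in_set_conv_nth set_rev set_sorted_list_of_set)
      have "(p, length ?A + q) \<in> ?S" "z = (xs ! p, xs ! (length ?A + q))"
        using p q il by (auto simp: xs_def nth_append simp del: length_rev)
      then show "z \<in> (\<lambda>(p, q). (xs ! p, xs ! q)) ` ?S" by force
    qed
  have "card ?S = card ((\<lambda>(l, i). (i, l)) ` Sigma L (\<lambda>l. {i\<in>I. i < l}))"
    unfolding im[symmetric] by (rule card_image[OF inj, symmetric])
  also have "\<dots> = card (Sigma L (\<lambda>l. {i\<in>I. i < l}))" by (rule card_image) (auto simp: inj_on_def)
  also have "\<dots> = (\<Sum>l\<in>L. card {i\<in>I. i < l})" using assms by (subst card_SigmaI) auto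
  finally show ?thesis .
qed

lemma sum_below: "finite L \<Longrightarrow> (\<Sum>l\<in>L. below L l) = (\<Sum>p<card L. p)"
  using sum.reindex_bij_betw[OF bij_betw_below, of L "\<lambda>p. p"] by simp

lemma strict_mono_od: "strict_mono_on A (\<lambda>r::nat. 2 * r + 1)"
  by (auto simp: strict_mono_on_def)

text \<open>Inserting the particles costs the sum of all \<open>p\<close> below
  \<open>card J\<close>; the shuffle of \<open>I\<close> and its complement costs the sum of
  \<open>l - below L l\<close>. As \<open>l\<close> runs through \<open>L\<close>, the ranks
  \<open>below L l\<close> run through all those \<open>p\<close>, so the exponents add up to the
  sum of \<open>L\<close>.\<close>

lemma ev2_basis_mkX:
  assumes "finite L" "finite J" "card L = card J"
  shows "ev2_basis (mkX L J) = (-1) ^ (\<Sum>l\<in>L. l) * sdet zt L J"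
proof -
  let ?o = "\<lambda>r::nat. 2 * r + 1"
  let ?X = "mkX L J"
  define L' where "L' = nat ` uminus ` (vac (-1) - ?X)"
  define J' where "J' = nat ` (?X - vac (-1))"
  define N where "N = (if L' = {} then 0 else (Max L' + 1) div 2)"
  define I where "I = {i. odd i \<and> i < 2 * N} - L'"
  have L': "L' = ?o ` L"
  proof -
    have "vac (-1) - ?X = (\<lambda>r. - od r) ` L"
    proof (intro equalityI subsetI)
      fix s assume s: "s \<in> vac (-1) - ?X"
      then show "s \<in> (\<lambda>r. - od r) ` L" using odd_cases[of s] by (auto simp: vac_def mkX_def)
    qed (auto simp: vac_def mkX_def)
    then have "L' = (\<lambda>r. nat (- (- od r))) ` L" by (simp only: L'_def image_image)
    also have "\<dots> = ?o ` L" by (intro image_cong) auto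
    finally show ?thesis .
  qed
  have J': "J' = ?o ` J"
  proof -
    have "?X - vac (-1) = od ` J" by (auto simp: vac_def mkX_def)
    then have "J' = (\<lambda>r. nat (od r)) ` J" by (simp only: J'_def image_image)
    also have "\<dots> = ?o ` J" by (intro image_cong) auto
    finally show ?thesis .
  qed
  have N: "l < N" if "l \<in> L" for l
  proof -
    have "?o l \<le> Max L'" using that assms by (intro Max_ge) (auto simp: L')
    moreover have "L' \<noteq> {}" using that by (auto simp: L')
    ultimately show ?thesis by (simp add: N_def)
  qed
  have I: "I = ?o ` ({..<N} - L)"
    unfolding I_def L' by (auto simp: image_iff elim!: oddE)
  have fin: "finite I" "finite L'" "finite J'" using assms by (simp_all add: I L' J')
  have k: "card J' = card J" unfolding J' by (rule card_image) (auto simp: inj_on_def)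
  let ?Y = "vac (- 2 * int N - 1) \<union> (\<lambda>i. - int i) ` I"
  have f1: "foldl (\<lambda>v i. rpsi (- int i) v) (sg (vac (- 2 * int N - 1)) (1::complex)) (rev (sorted_list_of_set I)) = sg ?Y 1"
    by (subst foldl_rpsi_neg[OF sorted_rev_desc]) (use fin in \<open>auto simp: vac_def I\<close>)
  have Y: "{s\<in>?Y. s > 0} = {}" by (auto simp: vac_def)
  have "foldl (\<lambda>v i. rpsi (int i) v) (sg ?Y (1::complex)) (rev (sorted_list_of_set J'))
    = sg (?Y \<union> int ` set (rev (sorted_list_of_set J'))) ((-1) ^ (\<Sum>p<length (rev (sorted_list_of_set J')). card {s\<in>?Y. s > 0} + p) * 1)"
  proof (rule foldl_rpsi_pos[OF sorted_rev_desc])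
    show "\<forall>x\<in>set (rev (sorted_list_of_set J')). 0 < x" using fin by (auto simp: J')
    show "finite {s\<in>?Y. s > 0}" unfolding Y by simp
    show "\<forall>s\<in>?Y. 0 < s \<longrightarrow> (\<forall>x\<in>set (rev (sorted_list_of_set J')). int x < s)" using Y by blast
  qed
  then have f2: "paper_vec N I J' = sg (?Y \<union> int ` J') ((-1) ^ (\<Sum>p<card J. p))"
    unfolding paper_vec_def f1 Y using fin(3) by (simp add: k)
  have X: "?Y \<union> int ` J' = ?X"
  proof -
    have v: "vac (- 2 * int N - 1) = {- od r |r. r \<ge> N}"
    proof (intro equalityI subsetI)
      fix s assume s: "s \<in> vac (- 2 * int N - 1)"
      then show "s \<in> {- od r |r. r \<ge> N}" using odd_cases[of s] by (auto simp: vac_def)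
    qed (auto simp: vac_def)
    have "(\<lambda>i. - int i) ` I = {- od r |r. r < N \<and> r \<notin> L}" unfolding I by (auto simp: image_iff)
    moreover have "int ` J' = od ` J" unfolding J' by (auto simp: image_iff)
    moreover have "{- od r |r. r \<notin> L} = {- od r |r. r \<ge> N} \<union> {- od r |r. r < N \<and> r \<notin> L}"
    proof (intro equalityI subsetI)
      fix s assume "s \<in> {- od r |r. r \<notin> L}"
      then obtain r where "s = - od r" "r \<notin> L" by blast
      then show "s \<in> {- od r |r. r \<ge> N} \<union> {- od r |r. r < N \<and> r \<notin> L}" by (cases "r < N") auto
    next
      fix s assume "s \<in> {- od r |r. r \<ge> N} \<union> {- od r |r. r < N \<and> r \<notin> L}"
      then obtain r where "s = - od r" "r \<notin> L" using N by (auto simp: not_less[symmetric])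
      then show "s \<in> {- od r |r. r \<notin> L}" by blast
    qed
    ultimately show ?thesis unfolding v mkX_def by simp
  qed
  have e: "lk (paper_vec N I J') ?X = (-1) ^ (\<Sum>p<card J. p)" unfolding f2 X by simp
  have inv: "perm_sgn (rev (sorted_list_of_set I) @ rev (sorted_list_of_set L')) = (-1) ^ (\<Sum>l\<in>L. l - below L l)"
  proof -
    have "(\<Sum>l\<in>L'. card {i\<in>I. i < l}) = (\<Sum>l\<in>L. card {i\<in>I. i < ?o l})"
      unfolding L' by (subst sum.reindex) (auto simp: inj_on_def)
    also have "\<dots> = (\<Sum>l\<in>L. l - below L l)"
    proof (rule sum.cong)
      fix l assume l: "l \<in> L"
      have "{i\<in>I. i < ?o l} = ?o ` ({..<l} - {x\<in>L. x < l})" unfolding I using N[OF l] by auto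
      then have "card {i\<in>I. i < ?o l} = card ({..<l} - {x\<in>L. x < l})" by (simp add: card_image inj_on_def)
      also have "\<dots> = l - below L l"
        unfolding below_def by (subst card_Diff_subset) (auto intro: finite_subset[of _ "{..<l}"])
      finally show "card {i\<in>I. i < ?o l} = l - below L l" .
    qed simp
    finally show ?thesis unfolding perm_sgn_def by (subst card_inversions) (use fin in \<open>auto simp: I_def\<close>)
  qed
  have s: "(\<Sum>p<card J. p) + (\<Sum>l\<in>L. l - below L l) = (\<Sum>l\<in>L. l)"
    unfolding assms(3)[symmetric] sum_below[OF assms(1), symmetric] sum.distrib[symmetric]
    by (intro sum.cong) (auto simp: below_le)
  have "det_zeta (sorted_list_of_set L') (sorted_list_of_set J') = sdet zeta L' J'"
  proof -
    have "card L' = card L" unfolding L' by (rule card_image) (auto simp: inj_on_def)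
    then show ?thesis unfolding det_zeta_def sdet_def det_def 
      by (auto simp: atLeast0LessThan intro!: sum.cong prod.cong)
  qed
  also have "\<dots> = sdet zt L J"
    unfolding L' J' by (subst sdet_reindex[OF assms(1) strict_mono_od assms(2) strict_mono_od assms(3)])
      (simp add: zeta_kZ[simplified] zt_def[symmetric])
  finally have z: "det_zeta (sorted_list_of_set L') (sorted_list_of_set J') = sdet zt L J" .
  have "ev2_basis ?X = cst ((-1) ^ (\<Sum>p<card J. p) * (-1) ^ (\<Sum>l\<in>L. l - below L l)) * sdet zt L J"
    unfolding ev2_basis_def Let_def L'_def[symmetric] J'_def[symmetric] N_def[symmetric] I_def[symmetric] e inv z ..
  also have "(-1) ^ (\<Sum>p<card J. p) * (-1) ^ (\<Sum>l\<in>L. l - below L l) = (-1 :: complex) ^ (\<Sum>l\<in>L. l)"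
    unfolding s[symmetric] power_add ..
  finally show ?thesis by simp
qed

lemma ev2_basis_valid: "valid (-1) X \<Longrightarrow> ev2_basis X = (-1) ^ (\<Sum>l\<in>holes X. l) * sdet zt (holes X) (parts X)"
  using ev2_basis_mkX[of "holes X" "parts X"] by (simp add: valid_0 mkX_holes_parts)

lemma additive_ev2: "Modules.additive ev2"
  unfolding ev2_def[abs_def] by (intro additive_keys_sum additive_dact_left)

lemma ev2_single: "ev2 (sg X p) = dact p (ev2_basis X)"
  unfolding ev2_def by (subst keys_sum_single[where g="\<lambda>X p. dact p (ev2_basis X)"]) (simp_all add: dact_add_left)

lemma additive_single: "Modules.additive (sg X)"
  by (simp add: additive_def single_add)

lemma additive_Qop: "Modules.additive Qop"
  unfolding Qop_def[abs_def]
  by (intro additive_keys_sum additive_sum additive_comp[OF additive_rpsi additive_comp[OF additive_single additive_mult]])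

lemma additive_Cop: "Modules.additive Cop"
  unfolding Cop_def[abs_def]
  by (intro additive_keys_sum additive_sum additive_comp[OF additive_rpsi additive_comp[OF additive_rpsi additive_single]])

lemma Qop_single: "Qop (sg X p) = (\<Sum>r\<in>holes X. rpsi (- od r) (sg X (sg (sg r 1) 1 * p)))"
proof -
  have "Qop (sg X p) = (\<Sum>j\<in>Jset X. rpsi (- j) (sg X (dvar j * p)))"
    unfolding Qop_def
    by (subst keys_sum_single[where g="\<lambda>X p. \<Sum>j\<in>Jset X. rpsi (- j) (sg X (dvar j * p))"])
       (simp_all add: additive_imps[OF additive_rpsi])
  then show ?thesis unfolding Jset_holes by (simp add: sum.reindex inj_od dvar_od del: One_nat_def)
qed

lemma Cop_single: "Cop (sg X p) = (\<Sum>r\<in>holes X. rpsi (- od r) (rpsi (od r) (sg X p)))"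
proof -
  have "Cop (sg X p) = (\<Sum>j\<in>Jset X. rpsi (- j) (rpsi j (sg X p)))"
    unfolding Cop_def
    by (subst keys_sum_single[where g="\<lambda>X p. \<Sum>j\<in>Jset X. rpsi (- j) (rpsi j (sg X p))"])
       (simp_all add: additive_imps[OF additive_rpsi])
  then show ?thesis unfolding Jset_holes by (simp add: sum.reindex inj_od)
qed

lemma power_minus1_add_diff: "b \<le> r \<Longrightarrow> (-1) ^ (k + (r - b)) = (-1) ^ k * (-1) ^ r * (-1 :: 'a::comm_ring_1) ^ b"
proof -
  assume "b \<le> r"
  then have "(-1) ^ r = (-1 :: 'a) ^ (r - b) * (-1) ^ b" by (simp flip: power_add)
  moreover have "(-1) ^ b * (-1) ^ b = (1 :: 'a)" by (simp flip: power_add)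
  ultimately show ?thesis by (simp add: power_add mult.assoc)
qed

lemma dact_sign_1: "dact ((-1) ^ k) f = (-1) ^ k * f"
  using dact_sign[of k 1 f] by simp

lemma dact_sign_right: "dact p ((-1) ^ k * f) = (-1) ^ k * dact p f"
  by (cases "even k") (simp_all add: dact_add_right)

text \<open>Filling the hole \<open>r\<close> deletes row \<open>r\<close>, and the new variable
  acts as the flow with that index. Once a sign common to all \<open>r\<close> is split off,
  \<open>sdet_jacobian\<close> for \<open>zt\<close> remains.\<close>

lemma ev2_Qop:
  assumes "x \<in> Msp (-3)"
  shows "ev2 (Qop x) = 0"
proof (rule additive_ext[where x=x])
  show "Modules.additive (\<lambda>x. ev2 (Qop x))" by (rule additive_comp[OF additive_ev2 additive_Qop])
  show "Modules.additive (\<lambda>_. 0)" by (simp add: additive_def)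
  fix X p assume "X \<in> ks x"
  then have "valid (-3) X" using assms by (simp add: Msp_def)
  then have X: "odds X" "finite (holes X)" "finite (parts X)" "card (holes X) = card (parts X) + 1"
    by (simp_all add: valid_1)
  let ?L = "holes X" and ?J = "parts X"
  define c :: kdv where "c = (-1) ^ card ?J * (-1) ^ (\<Sum>l\<in>?L. l)"
  have "ev2 (rpsi (- od r) (sg X (sg (sg r 1) 1 * p))) = dact p (c * ((-1) ^ below ?L r * dt (Suc r) (sdet zt (?L - {r}) ?J)))"
    if r: "r \<in> ?L" for r
  proof -
    have n: "- od r \<notin> X" using r by (simp add: holes_def)
    have v: "valid (-1) (insert (- od r) X)"
      unfolding valid_0 holes_insert parts_insert odds_insert using X r by simp
    have "rpsi (- od r) (sg X (sg (sg r 1) 1 * p)) = sg (insert (- od r) X) ((-1) ^ (card ?J + (r - below ?L r)) * (sg (sg r 1) 1 * p))"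
      unfolding rpsi_single card_above_neg(2)[OF X(1,3)] using n by simp
    then have "ev2 (rpsi (- od r) (sg X (sg (sg r 1) 1 * p))) =
       (-1) ^ (card ?J + (r - below ?L r)) * dact p (dt (Suc r) ((-1) ^ (\<Sum>l\<in>?L - {r}. l) * sdet zt (?L - {r}) ?J))"
      by (simp only: ev2_single ev2_basis_valid[OF v, unfolded holes_insert parts_insert] dact_sign dact_sign_1 dt_dact
         dact_mult dact_uvar)
    also have "dt (Suc r) ((-1) ^ (\<Sum>l\<in>?L - {r}. l) * sdet zt (?L - {r}) ?J) = (-1) ^ (\<Sum>l\<in>?L - {r}. l) * dt (Suc r) (sdet zt (?L - {r}) ?J)"
      using dt_cst_mult[of "Suc r" "(-1) ^ (\<Sum>l\<in>?L - {r}. l)"] by simp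
    also have "(-1) ^ (card ?J + (r - below ?L r)) * dact p ((-1) ^ (\<Sum>l\<in>?L - {r}. l) * dt (Suc r) (sdet zt (?L - {r}) ?J))
      = dact p ((-1) ^ (card ?J + (r - below ?L r)) * (-1) ^ (\<Sum>l\<in>?L - {r}. l) * dt (Suc r) (sdet zt (?L - {r}) ?J))"
      by (simp add: dact_sign_right mult.assoc)
    also have "(-1) ^ (card ?J + (r - below ?L r)) * (-1) ^ (\<Sum>l\<in>?L - {r}. l) = c * (-1) ^ below ?L r"
    proof -
      have s: "(\<Sum>l\<in>?L. l) = r + (\<Sum>l\<in>?L - {r}. l)" using X r by (simp add: sum.remove)
      show ?thesis unfolding c_def s
        by (simp only: power_minus1_add_diff[OF below_le]) (simp only: power_add mult_ac)
    qed
    finally show ?thesis by (simp add: mult.assoc)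
  qed
  then have "ev2 (Qop (sg X p)) = dact p (c * (\<Sum>r\<in>?L. (-1) ^ below ?L r * dt (Suc r) (sdet zt (?L - {r}) ?J)))"
    by (simp add: Qop_single additive_imps[OF additive_ev2] dact_add_right sum_distrib_left)
  also have "(\<Sum>r\<in>?L. (-1) ^ below ?L r * dt (Suc r) (sdet zt (?L - {r}) ?J)) = 0"
    by (rule sdet_jacobian[where D="\<lambda>r. dt (Suc r)"]) (use X in \<open>auto simp: dt_zt additive_dt dt_simps\<close>)
  finally show "ev2 (Qop (sg X p)) = 0" by (simp add: dact_add_right)
qed

text \<open>Filling the hole \<open>r\<close> and creating the particle \<open>r\<close> deletes a
  row and adds the column with the same index. After a common sign is split off, the symmetry of
  \<open>zt\<close> gives zero by \<open>sdet_symmetric_contraction\<close>.\<close>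

lemma ev2_Cop:
  assumes "x \<in> Msp (-5)"
  shows "ev2 (Cop x) = 0"
proof (rule additive_ext[where x=x])
  show "Modules.additive (\<lambda>x. ev2 (Cop x))" by (rule additive_comp[OF additive_ev2 additive_Cop])
  show "Modules.additive (\<lambda>_. 0)" by (simp add: additive_def)
  fix X p assume "X \<in> ks x"
  then have "valid (-5) X" using assms by (simp add: Msp_def)
  then have X: "odds X" "finite (holes X)" "finite (parts X)" "card (holes X) = card (parts X) + 2"
    by (simp_all add: valid_2)
  let ?L = "holes X" and ?J = "parts X"
  define c :: kdv where "c = (-1) ^ (\<Sum>l\<in>?L. l) * (-1)"
  have "ev2 (rpsi (- od r) (rpsi (od r) (sg X p))) =
     (if r \<in> ?J then 0 else dact p (c * ((-1) ^ (below ?L r + below ?J r) * sdet zt (?L - {r}) (insert r ?J))))"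
    if r: "r \<in> ?L" for r
  proof (cases "r \<in> ?J")
    case True
    then have "od r \<in> X" by (simp add: parts_def)
    then show ?thesis using True by (simp add: rpsi_single additive_imps[OF additive_rpsi] additive_imps[OF additive_ev2])
  next
    case False
    have n: "- od r \<notin> X" "od r \<notin> X" using r False by (simp_all add: holes_def parts_def)
    let ?X = "insert (od r) X"
    have O: "odds ?X" "finite (parts ?X)" unfolding odds_insert parts_insert using X by simp_all
    have v: "valid (-1) (insert (- od r) ?X)"
      unfolding valid_0 holes_insert parts_insert odds_insert using X r False by simp
    have "rpsi (- od r) (rpsi (od r) (sg X p)) = sg (insert (- od r) ?X)
       ((-1) ^ (card (insert r ?J) + (r - below ?L r)) * ((-1) ^ card {q\<in>?J. q > r} * p))"
    proof -
      have a: "rpsi (od r) (sg X p) = sg ?X ((-1) ^ card {q\<in>?J. q > r} * p)"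
        unfolding rpsi_single card_above_pos(2)[OF X(1)] using n by simp
      have "- od r \<notin> ?X" using n by simp
      then have b: "rpsi (- od r) (sg ?X c) = sg (insert (- od r) ?X) ((-1) ^ (card (insert r ?J) + (r - below ?L r)) * c)" for c :: dring
        unfolding rpsi_single card_above_neg(2)[OF O] parts_insert holes_insert by simp
      show ?thesis unfolding a b ..
    qed
    then have "ev2 (rpsi (- od r) (rpsi (od r) (sg X p))) = dact p ((-1) ^ (card (insert r ?J) + (r - below ?L r)) * (-1) ^ card {q\<in>?J. q > r} *
       (-1) ^ (\<Sum>l\<in>?L - {r}. l) * sdet zt (?L - {r}) (insert r ?J))"
      by (simp only: ev2_single ev2_basis_valid[OF v, unfolded holes_insert parts_insert] dact_sign dact_sign_right mult.assoc)
         (simp only: mult_ac)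
    also have "(-1) ^ (card (insert r ?J) + (r - below ?L r)) * (-1) ^ card {q\<in>?J. q > r} * (-1) ^ (\<Sum>l\<in>?L - {r}. l)
      = c * (-1) ^ (below ?L r + below ?J r)"
    proof -
      have s: "(\<Sum>l\<in>?L. l) = r + (\<Sum>l\<in>?L - {r}. l)" using X r by (simp add: sum.remove)
      have k: "card (insert r ?J) = Suc (card {q\<in>?J. q > r} + below ?J r)"
        using above_below[OF X(3) False] X(3) False by simp
      have sq: "(-1) ^ i * ((-1) ^ i * z) = z" "(-1) ^ i * (-1) ^ i = (1::kdv)" for i and z :: kdv
        by (simp_all flip: power_add mult.assoc)
      show ?thesis unfolding c_def s k
        by (simp only: power_minus1_add_diff[OF below_le]) (simp only: power_add power_Suc mult_ac sq mult_1_left)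
    qed
    finally show ?thesis using False by (simp add: mult.assoc)
  qed
  then have "ev2 (Cop (sg X p)) = (\<Sum>r\<in>?L. if r \<in> ?J then 0 else dact p (c * ((-1) ^ (below ?L r + below ?J r) * sdet zt (?L - {r}) (insert r ?J))))"
    by (simp add: Cop_single additive_imps[OF additive_ev2])
  also have "\<dots> = (\<Sum>r\<in>?L - ?J. dact p (c * ((-1) ^ (below ?L r + below ?J r) * sdet zt (?L - {r}) (insert r ?J))))"
    using X by (intro sum.mono_neutral_cong_right) auto
  also have "\<dots> = dact p (c * (\<Sum>r\<in>?L - ?J. (-1) ^ (below ?L r + below ?J r) * sdet zt (?L - {r}) (insert r ?J)))"
    by (simp add: dact_add_right sum_distrib_left)
  also have "(\<Sum>r\<in>?L - ?J. (-1) ^ (below ?L r + below ?J r) * sdet zt (?L - {r}) (insert r ?J)) = 0"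
    by (rule sdet_symmetric_contraction) (use X zt_sym in auto)
  finally show "ev2 (Cop (sg X p)) = 0" by (simp add: dact_add_right)
qed

lemma Msp_single: "valid m X \<Longrightarrow> sg X p \<in> Msp m"
  by (simp add: Msp_def)

lemma Msp_add: "x \<in> Msp m \<Longrightarrow> y \<in> Msp m \<Longrightarrow> x + y \<in> Msp m"
  unfolding Msp_def using keys_add[of x y] by blast

lemma Msp_0 [simp]: "0 \<in> Msp m"
  by (simp add: Msp_def)

lemma Msp_uminus: "x \<in> Msp m \<Longrightarrow> - x \<in> Msp m"
  by (simp add: Msp_def)

lemma Msp_diff: "x \<in> Msp m \<Longrightarrow> y \<in> Msp m \<Longrightarrow> x - y \<in> Msp m"
  using Msp_add[of x m "- y"] Msp_uminus by simp

lemma Msp_sum: "(\<And>a. a \<in> A \<Longrightarrow> f a \<in> Msp m) \<Longrightarrow> (\<Sum>a\<in>A. f a) \<in> Msp m"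
  by (induction A rule: infinite_finite_induct) (auto intro: Msp_add)

lemma ev2_surj:
  assumes "surj ev1"
  shows "ev2 ` Msp (-1) = UNIV"
proof -
  have "f \<in> ev2 ` Msp (-1)" if "f \<in> Dets" for f
    using that
  proof (induction rule: Dets.induct)
    case zero
    show ?case by (rule image_eqI[of _ _ 0]) (simp_all add: additive_imps[OF additive_ev2])
  next
    case (step L J x P)
    then obtain y where y: "y \<in> Msp (-1)" "x = ev2 y" by auto
    let ?z = "sg (mkX L J) ((-1) ^ (\<Sum>l\<in>L. l) * P)"
    have "valid (-1) (mkX L J)" using step by (simp add: valid_0)
    then have "?z \<in> Msp (-1)" by (rule Msp_single)
    moreover have "ev2 ?z = dact P (sdet zt L J)"
    proof -
      have "(-1) ^ k * dact P ((-1) ^ k * z) = dact P z" for k z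
        by (cases "even k") (simp_all add: dact_add_right)
      then show ?thesis using step by (simp add: ev2_single ev2_basis_mkX dact_sign)
    qed
    ultimately show ?case using y
      by (intro image_eqI[of _ _ "?z + y"]) (simp_all add: additive_imps[OF additive_ev2] Msp_add)
  qed
  then show ?thesis using Dets_UNIV[OF assms] by blast
qed

section \<open>Creation and annihilation operators\<close>

definition rphi :: "int \<Rightarrow> fock \<Rightarrow> fock" where
  "rphi n x = (\<Sum>X\<in>ks x. if n \<in> X then sg (X - {n}) ((-1) ^ card {s\<in>X. s > n} * lk x X) else 0)"

definition cmap :: "(dring \<Rightarrow> dring) \<Rightarrow> fock \<Rightarrow> fock" where
  "cmap f x = (\<Sum>X\<in>ks x. sg X (f (lk x X)))"

text \<open>Signs count occupied places above a given one. Were there infinitely many,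
  \<open>card\<close> would be 0 and the anticommutation relations would fail.\<close>

definition upfin :: "int set \<Rightarrow> bool" where "upfin X \<longleftrightarrow> (\<forall>n. finite {s\<in>X. s > n})"

definition Up :: "fock set" where "Up = {x. \<forall>X\<in>ks x. upfin X}"

lemma rphi_single:
  "rphi n (sg X c) = (if n \<in> X then sg (X - {n}) ((-1) ^ card {s\<in>X. s > n} * c) else 0)"
  by (cases "c = 0") (simp_all add: rphi_def)

lemma additive_rphi: "Modules.additive (rphi n)"
  unfolding rphi_def[abs_def] by (intro additive_keys_sum) (auto simp: additive_def single_add distrib_left)

lemma additive_cmap: "Modules.additive f \<Longrightarrow> Modules.additive (cmap f)"
  unfolding cmap_def[abs_def] by (intro additive_keys_sum additive_comp[OF additive_single])

lemma cmap_single: "Modules.additive f \<Longrightarrow> cmap f (sg X c) = sg X (f c)"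
  by (cases "c = 0") (simp_all add: cmap_def additive_imps)

lemma lookup_cmap: "Modules.additive f \<Longrightarrow> lk (cmap f x) X = f (lk x X)"
proof -
  assume f: "Modules.additive f"
  have "lk (cmap f x) X = (\<Sum>Y\<in>ks x. if Y = X then f (lk x Y) else 0)"
    unfolding cmap_def lookup_sum by (intro sum.cong) (auto simp: lookup_single when_def)
  then show ?thesis by (auto simp: in_keys_iff additive_imps[OF f])
qed

lemma dscale_cmap: "dscale P x = cmap ((*) P) x"
  by (rule poly_mapping_eqI) (auto simp: dscale_def lookup_cmap additive_mult map.rep_eq when_def)

lemma additive_sign: "Modules.additive f \<Longrightarrow> f ((-1) ^ k * p) = (-1) ^ k * (f p :: 'a::ring_1)" for p :: "'b::ring_1"
  by (cases "even k") (simp_all add: additive_imps)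

lemma keys_single_subset: "ks (sg X c) \<subseteq> {X}"
  by (cases "c = 0") simp_all

lemma upfin_insert: "upfin X \<Longrightarrow> upfin (insert n X)"
  unfolding upfin_def
proof
  fix m assume "\<forall>n. finite {s\<in>X. s > n}"
  moreover have "{s\<in>insert n X. s > m} \<subseteq> insert n {s\<in>X. s > m}" by auto
  ultimately show "finite {s\<in>insert n X. s > m}" by (meson finite.insertI finite_subset)
qed

lemma upfin_remove: "upfin X \<Longrightarrow> upfin (X - {n})"
  unfolding upfin_def
proof
  fix m assume "\<forall>n. finite {s\<in>X. s > n}"
  moreover have "{s\<in>X - {n}. s > m} \<subseteq> {s\<in>X. s > m}" by auto
  ultimately show "finite {s\<in>X - {n}. s > m}" by (meson finite_subset)
qed

lemma card_above_insert:
  assumes "upfin X" "m \<notin> X"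
  shows "card {s\<in>insert m X. s > n} = (if m > n then 1 else 0) + card {s\<in>X. s > (n::int)}"
proof (cases "m > n")
  case True
  then have "{s\<in>insert m X. s > n} = insert m {s\<in>X. s > n}" by auto
  then show ?thesis using assms True by (simp add: upfin_def)
next
  case False
  then have "{s\<in>insert m X. s > n} = {s\<in>X. s > n}" by auto
  then show ?thesis using False by simp
qed

lemma card_above_remove:
  assumes "upfin X" "m \<in> X"
  shows "card {s\<in>X. s > n} = (if m > n then 1 else 0) + card {s\<in>X - {m}. s > (n::int)}"
  using card_above_insert[OF upfin_remove[OF assms(1), of m], of m n] assms(2) by (simp add: insert_absorb)

lemma psi_psi_single:
  "upfin X \<Longrightarrow> rpsi m (rpsi n (sg X (c::dring))) = - rpsi n (rpsi m (sg X c))"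
proof -
  assume X: "upfin X"
  show ?thesis
  proof (cases "m \<in> X \<or> n \<in> X \<or> m = n")
    case False
    have e: "rpsi m (rpsi n (sg X c)) = sg (insert m (insert n X)) ((-1) ^ card {s\<in>insert n X. s > m} * ((-1) ^ card {s\<in>X. s > n} * c))"
      if "m \<notin> X" "n \<notin> X" "m \<noteq> n" for m n
      using that by (simp add: rpsi_single)
    have "(-1) ^ card {s\<in>insert n X. s > m} * ((-1) ^ card {s\<in>X. s > n} * c)
       = - ((-1) ^ card {s\<in>insert m X. s > n} * ((-1) ^ card {s\<in>X. s > m} * c))"
      using False card_above_insert[OF X, of n m] card_above_insert[OF X, of m n]
      by (cases "n > m") (simp_all add: mult_ac)
    then show ?thesis using e[of m n] e[of n m] False by (simp add: insert_commute single_uminus)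
  qed (auto simp: rpsi_single additive_imps[OF additive_rpsi])
qed

lemma phi_phi_single:
  "upfin X \<Longrightarrow> rphi m (rphi n (sg X c)) = - rphi n (rphi m (sg X c))"
proof -
  assume X: "upfin X"
  show ?thesis
  proof (cases "m \<in> X \<and> n \<in> X \<and> m \<noteq> n")
    case True
    have e: "rphi m (rphi n (sg X c)) = sg (X - {n} - {m}) ((-1) ^ card {s\<in>X - {n}. s > m} * ((-1) ^ card {s\<in>X. s > n} * c))"
      if "m \<in> X" "n \<in> X" "m \<noteq> n" for m n
      using that by (simp add: rphi_single)
    have d: "X - {n} - {m} = X - {m} - {n}" by auto
    have "(-1) ^ card {s\<in>X - {n}. s > m} * ((-1) ^ card {s\<in>X. s > n} * c)
       = - ((-1) ^ card {s\<in>X - {m}. s > n} * ((-1) ^ card {s\<in>X. s > m} * c))"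
      using True card_above_remove[OF X, of n m] card_above_remove[OF X, of m n]
      by (cases "n > m") (simp_all add: mult_ac)
    then show ?thesis using e[of m n] e[of n m] True by (simp add: d single_uminus)
  qed (auto simp: rphi_single additive_imps[OF additive_rphi])
qed

lemma sign_sq: "(-1) ^ k * ((-1) ^ k * z) = (z :: 'a::ring_1)"
  by (cases "even k") simp_all

lemma phi_psi_single:
  assumes "upfin X"
  shows "rphi m (rpsi n (sg X c)) + rpsi n (rphi m (sg X c)) = (if m = n then sg X c else 0)"
proof (cases "m = n")
  case True
  have "{s. (s = n \<or> s \<in> X) \<and> n < s} = {s\<in>X. s > n}" "{s\<in>X. s \<noteq> n \<and> n < s} = {s\<in>X. s > n}" by auto
  then show ?thesis using True
    by (auto simp: rphi_single rpsi_single additive_imps[OF additive_rphi] additive_imps[OF additive_rpsi] sign_sq insert_absorb)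
next
  case False
  show ?thesis
  proof (cases "m \<in> X \<and> n \<notin> X")
    case True
    have e: "insert n (X - {m}) = insert n X - {m}" using False by auto
    have 1: "card {s\<in>insert n X. s > m} = (if n > m then 1 else 0) + card {s\<in>X. s > m}"
      using card_above_insert[OF assms] True by blast
    have 2: "card {s\<in>X. s > n} = (if m > n then 1 else 0) + card {s\<in>X - {m}. s > n}"
      using card_above_remove[OF assms] True by blast
    have "rphi m (rpsi n (sg X c)) = sg (insert n X - {m}) ((-1) ^ card {s\<in>insert n X. s > m} * ((-1) ^ card {s\<in>X. s > n} * c))"
      using True by (simp add: rpsi_single rphi_single)
    moreover have "rpsi n (rphi m (sg X c)) = sg (insert n X - {m}) ((-1) ^ card {s\<in>X - {m}. s > n} * ((-1) ^ card {s\<in>X. s > m} * c))"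
      using True False by (simp add: rpsi_single rphi_single e)
    moreover have "(-1) ^ card {s\<in>insert n X. s > m} * ((-1) ^ card {s\<in>X. s > n} * c)
       = - ((-1) ^ card {s\<in>X - {m}. s > n} * ((-1) ^ card {s\<in>X. s > m} * c))"
      unfolding 1 2 using False by (cases "n > m") (simp_all add: mult_ac)
    ultimately show ?thesis using False by (simp add: single_uminus)
  qed (use False in \<open>auto simp: rphi_single rpsi_single additive_imps[OF additive_rphi] additive_imps[OF additive_rpsi]\<close>)
qed

lemma Up_ext:
  assumes "x \<in> Up" "Modules.additive F" "Modules.additive G" "\<And>X c. upfin X \<Longrightarrow> F (sg X c) = G (sg X c)"
  shows "F x = G x"
proof (rule additive_ext[OF assms(2,3)])
  fix X c assume "X \<in> ks x"
  then show "F (sg X c) = G (sg X c)" using assms(1) by (intro assms(4)) (simp add: Up_def)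
qed

lemma psi_psi: "x \<in> Up \<Longrightarrow> rpsi m (rpsi n x) = - rpsi n (rpsi m (x::fock))"
proof (rule Up_ext[where F="\<lambda>x. rpsi m (rpsi n x)" and G="\<lambda>x. - rpsi n (rpsi m x)"])
  show "Modules.additive (\<lambda>x. - rpsi n (rpsi m (x::fock)))"
    by (simp add: additive_def additive_imps[OF additive_rpsi])
qed (auto intro: additive_comp additive_rpsi psi_psi_single)

lemma phi_phi: "x \<in> Up \<Longrightarrow> rphi m (rphi n x) = - rphi n (rphi m x)"
proof (rule Up_ext[where F="\<lambda>x. rphi m (rphi n x)" and G="\<lambda>x. - rphi n (rphi m x)"])
  show "Modules.additive (\<lambda>x. - rphi n (rphi m x))"
    by (simp add: additive_def additive_imps[OF additive_rphi])
qed (auto intro: additive_comp additive_rphi phi_phi_single)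

lemma phi_psi: "x \<in> Up \<Longrightarrow> rphi m (rpsi n x) = (if m = n then x else 0) - rpsi n (rphi m x)"
proof (rule Up_ext[where F="\<lambda>x. rphi m (rpsi n x)" and G="\<lambda>x. (if m = n then x else 0) - rpsi n (rphi m x)"])
  show "Modules.additive (\<lambda>x. (if m = n then x else 0) - rpsi n (rphi m x))"
    by (simp add: additive_def additive_imps[OF additive_rpsi] additive_imps[OF additive_rphi])
  show "Modules.additive (\<lambda>x. rphi m (rpsi n x))"
    by (rule additive_comp[OF additive_rphi additive_rpsi])
qed (use phi_psi_single in \<open>auto simp: eq_diff_eq\<close>)

lemma keys_rpsi: "Y \<in> ks (rpsi n x) \<Longrightarrow> \<exists>X\<in>ks x. n \<notin> X \<and> Y = insert n X"
proof -
  assume "Y \<in> ks (rpsi n x)"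
  then have "Y \<in> (\<Union>X\<in>ks x. ks (if n \<in> X then 0 else sg (insert n X) ((-1) ^ card {s\<in>X. s > n} * lk x X)))"
    unfolding rpsi_def by (rule subsetD[OF keys_sum])
  then show ?thesis by (auto split: if_splits)
qed

lemma keys_rphi: "Y \<in> ks (rphi n x) \<Longrightarrow> \<exists>X\<in>ks x. n \<in> X \<and> Y = X - {n}"
proof -
  assume "Y \<in> ks (rphi n x)"
  then have "Y \<in> (\<Union>X\<in>ks x. ks (if n \<in> X then sg (X - {n}) ((-1) ^ card {s\<in>X. s > n} * lk x X) else 0))"
    unfolding rphi_def by (rule subsetD[OF keys_sum])
  then show ?thesis by (auto split: if_splits)
qed

lemma keys_cmap: "Y \<in> ks (cmap f x) \<Longrightarrow> Y \<in> ks x"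
proof -
  assume "Y \<in> ks (cmap f x)"
  then have "Y \<in> (\<Union>X\<in>ks x. ks (sg X (f (lk x X))))" unfolding cmap_def by (rule subsetD[OF keys_sum])
  then show ?thesis by (auto split: if_splits)
qed

lemma Up_ops: "x \<in> Up \<Longrightarrow> rpsi n x \<in> Up" "x \<in> Up \<Longrightarrow> rphi n x \<in> Up" "x \<in> Up \<Longrightarrow> cmap f x \<in> Up"
proof -
  assume x: "x \<in> Up"
  show "rpsi n x \<in> Up" unfolding Up_def
  proof (intro CollectI ballI)
    fix Y assume "Y \<in> ks (rpsi n x)"
    then obtain X where "X \<in> ks x" "Y = insert n X" using keys_rpsi by blast
    then show "upfin Y" using x by (simp add: Up_def upfin_insert)
  qed
  show "rphi n x \<in> Up" unfolding Up_def
  proof (intro CollectI ballI)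
    fix Y assume "Y \<in> ks (rphi n x)"
    then obtain X where "X \<in> ks x" "Y = X - {n}" using keys_rphi by blast
    then show "upfin Y" using x by (simp add: Up_def upfin_remove)
  qed
  show "cmap f x \<in> Up" unfolding Up_def
  proof (intro CollectI ballI)
    fix Y assume "Y \<in> ks (cmap f x)"
    then have "Y \<in> ks x" by (rule keys_cmap)
    then show "upfin Y" using x by (simp add: Up_def)
  qed
qed

lemma cmap_rpsi: "Modules.additive f \<Longrightarrow> cmap f (rpsi n x) = rpsi n (cmap f x)"
  by (rule additive_ext[where x=x])
    (auto intro: additive_comp additive_rpsi additive_cmap
       simp: rpsi_single cmap_single additive_sign additive_imps[OF additive_cmap])

lemma cmap_rphi: "Modules.additive f \<Longrightarrow> cmap f (rphi n x) = rphi n (cmap f x)"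
  by (rule additive_ext[where x=x])
    (auto intro: additive_comp additive_rphi additive_cmap
       simp: rphi_single cmap_single additive_sign additive_imps[OF additive_cmap])

lemma cmap_cmap: "Modules.additive f \<Longrightarrow> Modules.additive g \<Longrightarrow> cmap f (cmap g x) = cmap (\<lambda>p. f (g p)) x"
  by (rule poly_mapping_eqI) (simp add: lookup_cmap additive_comp)

lemma cmap_plus: "Modules.additive f \<Longrightarrow> Modules.additive g \<Longrightarrow> cmap (\<lambda>p. f p + g p) x = cmap f x + cmap g x"
  by (rule poly_mapping_eqI) (simp add: lookup_cmap additive_plus lookup_add)

lemma cmap_id: "cmap (\<lambda>p. p) x = x"
  by (rule poly_mapping_eqI) (simp add: lookup_cmap additive_id)

section \<open>The operators on finitely many modes\<close>

abbreviation dv :: "nat \<Rightarrow> dring" where "dv r \<equiv> sg (sg r 1) 1"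

text \<open>The partial derivative by a variable of the operator ring. That ring has the same
  underlying type as A, so \<open>der\<close> applies.\<close>

definition pd :: "nat \<Rightarrow> dring \<Rightarrow> dring" where "pd r = der (\<lambda>k. if k = r then 1 else 0)"

lemma dv_uvar: "dv r = uvar r"
  by (simp add: uvar_def)

lemma additive_pd: "Modules.additive (pd r)"
  unfolding pd_def by (rule additive_der)

lemma pd_dv: "pd r (dv s * p) = (if r = s then p else 0) + dv s * pd r p"
  by (simp add: pd_def dv_uvar der_mult del: One_nat_def)

lemma pd_commute: "pd r (pd s p) = pd s (pd r p)"
  unfolding pd_def by (rule der_commute) simp

text \<open>The restrictions of the operators to the modes in \<open>F\<close>; \<open>KF\<close> is the contracting homotopy for \<open>QF\<close>,
  and \<open>EF\<close>, \<open>CF\<close> generate a copy of $\mathfrak{sl}_2$.\<close>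
definition QF :: "nat set \<Rightarrow> fock \<Rightarrow> fock" where
  "QF F x = (\<Sum>r\<in>F. rpsi (- od r) (cmap ((*) (dv r)) x))"
definition CF :: "nat set \<Rightarrow> fock \<Rightarrow> fock" where
  "CF F x = (\<Sum>r\<in>F. rpsi (- od r) (rpsi (od r) x))"
definition KF :: "nat set \<Rightarrow> fock \<Rightarrow> fock" where
  "KF F x = (\<Sum>r\<in>F. rphi (- od r) (cmap (pd r) x))"
definition EF :: "nat set \<Rightarrow> fock \<Rightarrow> fock" where
  "EF F x = (\<Sum>r\<in>F. rphi (od r) (rphi (- od r) x))"

lemma additive_QF: "Modules.additive (QF F)" and additive_CF: "Modules.additive (CF F)"
  and additive_KF: "Modules.additive (KF F)" and additive_EF: "Modules.additive (EF F)"
  unfolding QF_def[abs_def] CF_def[abs_def] KF_def[abs_def] EF_def[abs_def]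
  by (intro additive_sum additive_comp[OF additive_rpsi] additive_comp[OF additive_rphi] additive_cmap
      additive_mult additive_pd additive_rpsi additive_rphi)+

definition holes_in :: "nat set \<Rightarrow> fock \<Rightarrow> bool" where "holes_in F x \<longleftrightarrow> (\<forall>X\<in>ks x. holes X \<subseteq> F)"

text \<open>A mode of \<open>F\<close> that is no hole of a basis vector is occupied there, so its
  creator contributes zero. A sum whose range varies with the basis vector thus becomes one fixed
  finite sum of operators.\<close>

lemma Qop_QF:
  assumes "finite F" "holes_in F x"
  shows "Qop x = QF F x"
proof (rule additive_ext[where x=x])
  fix X p assume "X \<in> ks x"
  then have h: "holes X \<subseteq> F" using assms by (simp add: holes_in_def)
  have "QF F (sg X p) = (\<Sum>r\<in>F. rpsi (- od r) (sg X (dv r * p)))"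
    by (simp add: QF_def cmap_single additive_mult)
  also have "\<dots> = (\<Sum>r\<in>holes X. rpsi (- od r) (sg X (dv r * p)))"
    using h assms(1) by (intro sum.mono_neutral_right) (auto simp: rpsi_single holes_def)
  finally show "Qop (sg X p) = QF F (sg X p)" by (simp only: Qop_single)
qed (rule additive_Qop additive_QF)+

lemma Cop_CF:
  assumes "finite F" "holes_in F x"
  shows "Cop x = CF F x"
proof (rule additive_ext[where x=x])
  fix X p assume "X \<in> ks x"
  then have h: "holes X \<subseteq> F" using assms by (simp add: holes_in_def)
  have "CF F (sg X p) = (\<Sum>r\<in>holes X. rpsi (- od r) (rpsi (od r) (sg X p)))"
    unfolding CF_def using h assms(1)
    by (intro sum.mono_neutral_right) (auto simp: rpsi_single holes_def additive_imps[OF additive_rpsi])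
  then show "Cop (sg X p) = CF F (sg X p)" by (simp only: Cop_single)
qed (rule additive_Cop additive_CF)+

lemma fock_self_neg: "x = - x \<Longrightarrow> x = (0::fock)"
proof -
  assume x: "x = - x"
  show ?thesis
  proof (rule poly_mapping_eqI)
    fix X
    have "lk x X = - lk x X" using arg_cong[OF x, of "\<lambda>x. lk x X"] by simp
    then have "2 * lk x X = 0" by simp
    then show "lk x X = lk 0 X" by simp
  qed
qed

lemma QF_CF: "x \<in> Up \<Longrightarrow> QF F (CF F x) = CF F (QF F x)"
proof -
  assume x: "x \<in> Up"
  have "rpsi (- od i) (rpsi (- od j) (rpsi (od j) (cmap ((*) (dv i)) x)))
     = rpsi (- od j) (rpsi (od j) (rpsi (- od i) (cmap ((*) (dv i)) x)))" for i j
    using psi_psi[OF Up_ops(1)[OF Up_ops(3)[OF x]], of "- od i" "- od j"] psi_psi[OF Up_ops(3)[OF x], of "- od i" "od j"]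
    by (simp add: additive_imps[OF additive_rpsi])
  then have "QF F (CF F x) = (\<Sum>i\<in>F. \<Sum>j\<in>F. rpsi (- od j) (rpsi (od j) (rpsi (- od i) (cmap ((*) (dv i)) x))))"
    unfolding QF_def CF_def
    by (simp only: additive_imps(5)[OF additive_rpsi] additive_imps(5)[OF additive_cmap[OF additive_mult]] cmap_rpsi[OF additive_mult])
  also have "\<dots> = CF F (QF F x)"
    unfolding QF_def CF_def by (subst sum.swap) (simp only: additive_imps(5)[OF additive_rpsi])
  finally show ?thesis .
qed

text \<open>The variables commute and the creators anticommute, so the double sum equals its own
  negative.\<close>

lemma QF_QF: "x \<in> Up \<Longrightarrow> QF F (QF F x) = 0"
proof -
  assume x: "x \<in> Up"
  have e: "QF F (QF F x) = (\<Sum>i\<in>F. \<Sum>j\<in>F. rpsi (- od i) (rpsi (- od j) (cmap (\<lambda>p. dv i * (dv j * p)) x)))"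
    unfolding QF_def
    by (simp only: additive_imps(5)[OF additive_rpsi] additive_imps(5)[OF additive_cmap[OF additive_mult]]
      cmap_rpsi[OF additive_mult] cmap_cmap[OF additive_mult additive_mult])
  also have "\<dots> = (\<Sum>i\<in>F. \<Sum>j\<in>F. - rpsi (- od j) (rpsi (- od i) (cmap (\<lambda>p. dv j * (dv i * p)) x)))"
  proof (intro sum.cong refl)
    fix i j
    have "(\<lambda>p. dv i * (dv j * p)) = (\<lambda>p. dv j * (dv i * p))" by (simp only: mult.left_commute)
    then show "rpsi (- od i) (rpsi (- od j) (cmap (\<lambda>p. dv i * (dv j * p)) x)) = - rpsi (- od j) (rpsi (- od i) (cmap (\<lambda>p. dv j * (dv i * p)) x))"
      using psi_psi[OF Up_ops(3)[OF x], of "- od i" "- od j"] by (simp only:)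
  qed
  also have "\<dots> = - (\<Sum>j\<in>F. \<Sum>i\<in>F. rpsi (- od j) (rpsi (- od i) (cmap (\<lambda>p. dv j * (dv i * p)) x)))"
    by (subst sum.swap) (simp only: sum_negf)
  finally show ?thesis unfolding e by (rule fock_self_neg)
qed

lemma KF_KF: "x \<in> Up \<Longrightarrow> KF F (KF F x) = 0"
proof -
  assume x: "x \<in> Up"
  have e: "KF F (KF F x) = (\<Sum>i\<in>F. \<Sum>j\<in>F. rphi (- od i) (rphi (- od j) (cmap (\<lambda>p. pd i (pd j p)) x)))"
    unfolding KF_def
    by (simp only: additive_imps(5)[OF additive_rphi] additive_imps(5)[OF additive_cmap[OF additive_pd]]
      cmap_rphi[OF additive_pd] cmap_cmap[OF additive_pd additive_pd])
  also have "\<dots> = (\<Sum>i\<in>F. \<Sum>j\<in>F. - rphi (- od j) (rphi (- od i) (cmap (\<lambda>p. pd j (pd i p)) x)))"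
  proof (intro sum.cong refl)
    fix i j
    have "(\<lambda>p. pd i (pd j p)) = (\<lambda>p. pd j (pd i p))" by (intro ext) (rule pd_commute)
    then show "rphi (- od i) (rphi (- od j) (cmap (\<lambda>p. pd i (pd j p)) x)) = - rphi (- od j) (rphi (- od i) (cmap (\<lambda>p. pd j (pd i p)) x))"
      using phi_phi[OF Up_ops(3)[OF x], of "- od i" "- od j"] by (simp only:)
  qed
  also have "\<dots> = - (\<Sum>j\<in>F. \<Sum>i\<in>F. rphi (- od j) (rphi (- od i) (cmap (\<lambda>p. pd j (pd i p)) x)))"
    by (subst sum.swap) (simp only: sum_negf)
  finally show ?thesis unfolding e by (rule fock_self_neg)
qed

section \<open>Diagonal operators and the number operator\<close>

definition diag_op :: "(int set \<Rightarrow> (nat \<Rightarrow>\<^sub>0 nat) \<Rightarrow> complex) \<Rightarrow> fock \<Rightarrow> fock" where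
  "diag_op g x = (\<Sum>X\<in>ks x. sg X (\<Sum>a\<in>ks (lk x X). sg a (g X a * lk (lk x X) a)))"

lemma additive_diag_op: "Modules.additive (diag_op g)"
proof -
  have "Modules.additive (\<lambda>p. \<Sum>a\<in>ks p. sg a (g X a * lk p a))" for X
    by (intro additive_keys_sum additive_comp[OF additive_single additive_mult])
  from additive_comp[OF additive_single this] show ?thesis unfolding diag_op_def[abs_def]
    by (rule additive_keys_sum)
qed

lemma diag_op_single: "diag_op g (sg X (sg a c)) = sg X (sg a (g X a * c))"
proof (cases "c = 0")
  case False
  then have "sg a c \<noteq> 0" by (metis lookup_single_eq lookup_zero)
  then show ?thesis using False by (simp add: diag_op_def)
qed (simp add: diag_op_def)

lemma fock_ext:
  assumes "Modules.additive F" "Modules.additive G"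
    and "\<And>X a c. X \<in> ks x \<Longrightarrow> F (sg X (sg a c)) = G (sg X (sg a c))"
  shows "F x = G x"
proof (rule additive_ext[OF assms(1,2)])
  fix X p assume "X \<in> ks x"
  then show "F (sg X p) = G (sg X p)"
    by (intro additive_ext[where x=p and F="\<lambda>p. F (sg X p)"] additive_comp[OF _ additive_single] assms)
qed

lemma diag_op_diag_op: "diag_op g (diag_op h x) = diag_op (\<lambda>X a. g X a * h X a) x"
  by (rule fock_ext[where x=x]) (auto intro: additive_comp additive_diag_op simp: diag_op_single mult.assoc)

lemma diag_op_1: "(\<And>X a. X \<in> ks x \<Longrightarrow> g X a = 1) \<Longrightarrow> diag_op g x = x"
  by (rule fock_ext[where x=x]) (auto intro: additive_diag_op additive_id simp: diag_op_single)

lemma keys_diag_op: "Y \<in> ks (diag_op g x) \<Longrightarrow> Y \<in> ks x"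
proof -
  assume "Y \<in> ks (diag_op g x)"
  then have "Y \<in> (\<Union>X\<in>ks x. ks (sg X (\<Sum>a\<in>ks (lk x X). sg a (g X a * lk (lk x X) a))))"
    unfolding diag_op_def by (rule subsetD[OF keys_sum])
  then show ?thesis by (auto split: if_splits)
qed

abbreviation Nlev :: "nat set \<Rightarrow> int set \<Rightarrow> (nat \<Rightarrow>\<^sub>0 nat) \<Rightarrow> complex" where
  "Nlev F X a \<equiv> of_nat ((\<Sum>r\<in>F. lk a r) + card (holes X \<inter> F))"

lemma sum_rphi_rpsi_single:
  assumes "finite F"
  shows "(\<Sum>r\<in>F. rphi (- od r) (rpsi (- od r) (sg X p))) = sg X (of_nat (card (holes X \<inter> F)) * p)"
proof -
  have "rphi (- od r) (rpsi (- od r) (sg X p)) = (if r \<in> holes X then sg X p else 0)" for r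
  proof -
    have "{s. (s = - od r \<or> s \<in> X) \<and> - od r < s} = {s\<in>X. s > - od r}" by auto
    then show ?thesis
      by (auto simp: rphi_single rpsi_single additive_imps[OF additive_rphi] sign_sq insert_absorb holes_def)
  qed
  then have "(\<Sum>r\<in>F. rphi (- od r) (rpsi (- od r) (sg X p))) = (\<Sum>r\<in>F. if r \<in> holes X then sg X p else 0)" by simp
  also have "\<dots> = (\<Sum>r\<in>holes X \<inter> F. sg X p)"
    using assms by (intro sum.mono_neutral_cong_right) auto
  also have "\<dots> = sg X (\<Sum>r\<in>holes X \<inter> F. p)"
    by (simp only: additive_imps(5)[OF additive_single])
  finally show ?thesis by simp
qed

text \<open>The Koszul identity. Terms from two different modes cancel by the anticommutation
  relations; a single mode contributes its exponent in the operator monomial, from multiplying and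
  differentiating, plus 1 if it is a hole.\<close>

lemma QF_KF:
  assumes "finite F" "x \<in> Up"
  shows "QF F (KF F x) + KF F (QF F x) = diag_op (Nlev F) x"
proof -
  let ?M = "\<lambda>i. cmap ((*) (dv i))" and ?P = "\<lambda>j. cmap (pd j)"
  have MP: "?P j (?M i x) = (if j = i then x else 0) + ?M i (?P j x)" for i j
  proof (cases "j = i")
    case True
    have "?P j (?M i x) = cmap (\<lambda>p. p + dv i * pd j p) x"
      using True by (simp only: cmap_cmap[OF additive_pd additive_mult] pd_dv simp_thms if_True)
    then show ?thesis using True
      by (simp add: cmap_plus[OF additive_id additive_comp[OF additive_mult additive_pd]] cmap_id cmap_cmap[OF additive_mult additive_pd] del: One_nat_def)
  next
    case False
    then show ?thesis by (simp add: cmap_cmap additive_pd additive_mult pd_dv del: One_nat_def)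
  qed
  have 1: "QF F (KF F x) = (\<Sum>i\<in>F. \<Sum>j\<in>F. rpsi (- od i) (rphi (- od j) (?M i (?P j x))))"
    unfolding QF_def KF_def
    by (simp only: additive_imps(5)[OF additive_rpsi] additive_imps(5)[OF additive_cmap[OF additive_mult]] cmap_rphi[OF additive_mult])
  have t: "rphi (- od j) (rpsi (- od i) (?P j (?M i x))) = (if j = i then rphi (- od i) (rpsi (- od i) x) + ?M i (?P i x) else 0)
      - rpsi (- od i) (rphi (- od j) (?M i (?P j x)))" for i j
  proof -
    have "rphi (- od j) (rpsi (- od i) (?M i (?P j x))) = (if j = i then ?M i (?P j x) else 0) - rpsi (- od i) (rphi (- od j) (?M i (?P j x)))"
      using phi_psi[OF Up_ops(3)[OF Up_ops(3)[OF assms(2)]], of "- od j" "- od i" "(*) (dv i)" "pd j"]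
      by (simp only: od_eq)
    then show ?thesis unfolding MP
      by (cases "j = i") (simp_all add: additive_imps[OF additive_rpsi] additive_imps[OF additive_rphi] del: One_nat_def)
  qed
  have "KF F (QF F x) = (\<Sum>j\<in>F. \<Sum>i\<in>F. rphi (- od j) (rpsi (- od i) (?P j (?M i x))))"
    unfolding QF_def KF_def
    by (simp only: additive_imps(5)[OF additive_rphi] additive_imps(5)[OF additive_cmap[OF additive_pd]] cmap_rpsi[OF additive_pd])
  also have "\<dots> = (\<Sum>i\<in>F. \<Sum>j\<in>F. rphi (- od j) (rpsi (- od i) (?P j (?M i x))))" by (rule sum.swap)
  also have "\<dots> = (\<Sum>i\<in>F. \<Sum>j\<in>F. (if j = i then rphi (- od i) (rpsi (- od i) x) + ?M i (?P i x) else 0)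
      - rpsi (- od i) (rphi (- od j) (?M i (?P j x))))" by (simp only: t)
  also have "\<dots> = (\<Sum>i\<in>F. rphi (- od i) (rpsi (- od i) x) + ?M i (?P i x)) - QF F (KF F x)"
    unfolding 1 sum_subtractf using assms(1) by (simp del: One_nat_def)
  finally have "QF F (KF F x) + KF F (QF F x) = (\<Sum>i\<in>F. rphi (- od i) (rpsi (- od i) x)) + (\<Sum>i\<in>F. ?M i (?P i x))"
    by (simp add: sum.distrib del: One_nat_def)
  also have "\<dots> = diag_op (Nlev F) x"
  proof (rule fock_ext[where x=x])
    show "Modules.additive (\<lambda>x. (\<Sum>i\<in>F. rphi (- od i) (rpsi (- od i) x)) + (\<Sum>i\<in>F. ?M i (?P i x)))"
      by (intro additive_plus additive_sum additive_comp[OF additive_rphi additive_rpsi] additive_comp[OF additive_cmap[OF additive_mult] additive_cmap[OF additive_pd]])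
    fix X a c
    have m: "dv i * pd i (sg a c) = sg a (of_nat (lk a i) * c)" for i
    proof -
      have "dmono (\<lambda>k. if k = i then 1 else 0) a = (\<Sum>k\<in>ks a. if k = i then of_nat (lk a k) * sg (a - sg k 1) 1 else 0)"
        unfolding dmono_def by (intro sum.cong) auto
      also have "\<dots> = of_nat (lk a i) * sg (a - sg i 1) 1" by (auto simp: in_keys_iff)
      finally have d: "pd i (sg a c) = cst (of_nat (lk a i) * c) * sg (a - sg i 1) 1" by (simp add: pd_def der_single mult_ac)
      show ?thesis
      proof (cases "lk a i = 0")
        case False
        then have "sg i 1 + (a - sg i 1) = a"
          by (intro poly_mapping_eqI) (auto simp: lookup_add lookup_minus lookup_single when_def)
        then have "dv i * sg (a - sg i 1) 1 = sg a 1" by (simp add: mult_single del: One_nat_def)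
        then have "dv i * pd i (sg a c) = cst (of_nat (lk a i) * c) * sg a 1"
          unfolding d mult.left_commute[of "dv i"] by (simp only:)
        then show ?thesis by (simp only: single_cst[symmetric])
      qed (simp add: d)
    qed
    have "(\<Sum>i\<in>F. ?M i (?P i (sg X (sg a c)))) = (\<Sum>i\<in>F. sg X (sg a (of_nat (lk a i) * c)))"
      by (simp only: cmap_single[OF additive_pd] cmap_single[OF additive_mult] m)
    also have "\<dots> = sg X (sg a (\<Sum>i\<in>F. of_nat (lk a i) * c))"
      by (simp only: additive_imps(5)[OF additive_single])
    finally have "(\<Sum>i\<in>F. ?M i (?P i (sg X (sg a c)))) = sg X (sg a (of_nat (\<Sum>i\<in>F. lk a i) * c))"
      by (simp add: sum_distrib_right del: One_nat_def)
    moreover have "of_nat (card (holes X \<inter> F)) * sg a c = sg a (of_nat (card (holes X \<inter> F)) * c)"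
      by (metis mult_single single_of_nat add_0)
    ultimately show "(\<Sum>i\<in>F. rphi (- od i) (rpsi (- od i) (sg X (sg a c)))) + (\<Sum>i\<in>F. ?M i (?P i (sg X (sg a c)))) = diag_op (Nlev F) (sg X (sg a c))"
      unfolding sum_rphi_rpsi_single[OF assms(1)] diag_op_single
      by (simp only: single_add[symmetric] distrib_right[symmetric] of_nat_add add.commute)
  qed (rule additive_diag_op)
  finally show ?thesis .
qed

text \<open>In each mode \<open>QF\<close> adds one variable and fills one hole, so the level is
  unchanged and functions of the level, in particular its inverse, commute with
  \<open>QF\<close>.\<close>

lemma QF_diag_op:
  assumes "finite F"
  shows "QF F (diag_op (\<lambda>X a. g (Nlev F X a)) x) = diag_op (\<lambda>X a. g (Nlev F X a)) (QF F x)"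
proof (rule fock_ext[where x=x])
  fix X a c
  have "rpsi (- od r) (sg X (dv r * sg a (g (Nlev F X a) * c))) = diag_op (\<lambda>X a. g (Nlev F X a)) (rpsi (- od r) (sg X (dv r * sg a c)))"
    if r: "r \<in> F" for r
  proof (cases "- od r \<in> X")
    case True
    then show ?thesis by (simp only: rpsi_single if_True additive_imps(1)[OF additive_diag_op])
  next
    case False
    let ?X = "insert (- od r) X" and ?a = "sg r 1 + a" and ?k = "card {s\<in>X. s > - od r}"
    have "holes X \<inter> F = insert r (holes ?X \<inter> F)" using False r by (auto simp: holes_def)
    moreover have "r \<notin> holes ?X \<inter> F" by (simp add: holes_def)
    ultimately have h: "card (holes X \<inter> F) = Suc (card (holes ?X \<inter> F))" using assms by simp
    have "(\<Sum>i\<in>F. lk ?a i) = Suc (\<Sum>i\<in>F. lk a i)"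
      using assms r by (simp add: lookup_add sum.distrib lookup_single when_def)
    then have N: "Nlev F ?X ?a = Nlev F X a" using h by simp
    have s: "(-1) ^ k * sg b (d::complex) = sg b ((-1) ^ k * d)" for k and b :: "nat \<Rightarrow>\<^sub>0 nat" and d
      by (cases "even k") (simp_all add: single_uminus)
    have "rpsi (- od r) (sg X (dv r * sg a (g (Nlev F X a) * c))) = sg ?X (sg ?a ((-1) ^ ?k * (g (Nlev F X a) * c)))"
      using False by (simp only: rpsi_single mult_single mult_1_left s if_False)
    also have "\<dots> = sg ?X (sg ?a (g (Nlev F ?X ?a) * ((-1) ^ ?k * c)))"
      unfolding N by (simp only: mult.left_commute)
    also have "\<dots> = diag_op (\<lambda>X a. g (Nlev F X a)) (rpsi (- od r) (sg X (dv r * sg a c)))"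
      using False by (simp only: rpsi_single mult_single mult_1_left s if_False diag_op_single)
    finally show ?thesis .
  qed
  then show "QF F (diag_op (\<lambda>X a. g (Nlev F X a)) (sg X (sg a c))) = diag_op (\<lambda>X a. g (Nlev F X a)) (QF F (sg X (sg a c)))"
    unfolding QF_def diag_op_single additive_imps(5)[OF additive_diag_op] cmap_single[OF additive_mult] by (intro sum.cong) simp_all
qed (rule additive_comp[OF additive_QF additive_diag_op] additive_comp[OF additive_diag_op additive_QF])+

lemma EF_CF_commutator:
  assumes "finite F" "x \<in> Up"
  shows "EF F (CF F x) - CF F (EF F x) =
    (\<Sum>r\<in>F. x - rpsi (od r) (rphi (od r) x) - rpsi (- od r) (rphi (- od r) x))"
proof -
  let ?p = "\<lambda>r. rpsi (- od r)" and ?q = "\<lambda>r. rpsi (od r)" and ?f = "\<lambda>r. rphi (- od r)" and ?h = "\<lambda>r. rphi (od r)"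
  note U = Up_ops[OF assms(2)] Up_ops(1,2)[OF Up_ops(1)[OF assms(2)]] Up_ops(1,2)[OF Up_ops(2)[OF assms(2)]] assms(2)
  note A = additive_imps[OF additive_rpsi] additive_imps[OF additive_rphi]
  have c: "?h j (?f j (?p i (?q i x))) = (if i = j then x - ?q i (?h i x) - ?p i (?f i x) else 0) + ?p i (?q i (?h j (?f j x)))" for i j
  proof -
    have "?f j (?p i (?q i x)) = (if j = i then ?q i x else 0) + ?p i (?q i (?f j x))"
      using phi_psi[of "?q i x" "- od j" "- od i"] phi_psi[of x "- od j" "od i"] U by (simp add: A)
    moreover have "?h j (?p i (?q i (?f j x))) = - ?p i ((if j = i then ?f j x else 0) - ?q i (?h j (?f j x)))"
      using phi_psi[of "?q i (?f j x)" "od j" "- od i"] phi_psi[of "?f j x" "od j" "od i"] U by (simp add: A)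
    moreover have "?h j (?q i x) = (if j = i then x else 0) - ?q i (?h j x)"
      using phi_psi[of x "od j" "od i"] U by simp
    ultimately show ?thesis by (cases "i = j") (simp_all add: A)
  qed
  have "EF F (CF F x) = (\<Sum>j\<in>F. \<Sum>i\<in>F. ?h j (?f j (?p i (?q i x))))"
    unfolding EF_def CF_def by (simp only: additive_imps(5)[OF additive_rphi])
  also have "\<dots> = (\<Sum>i\<in>F. \<Sum>j\<in>F. ?h j (?f j (?p i (?q i x))))" by (rule sum.swap)
  also have "\<dots> = (\<Sum>i\<in>F. x - ?q i (?h i x) - ?p i (?f i x)) + (\<Sum>i\<in>F. \<Sum>j\<in>F. ?p i (?q i (?h j (?f j x))))"
    unfolding c sum.distrib using assms(1) by simp
  also have "(\<Sum>i\<in>F. \<Sum>j\<in>F. ?p i (?q i (?h j (?f j x)))) = CF F (EF F x)"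
    unfolding EF_def CF_def by (simp only: additive_imps(5)[OF additive_rpsi])
  finally show ?thesis by simp
qed

text \<open>The commutator counts holes minus particles in \<open>F\<close>. It acts as the scalar
  \<open>w\<close> because \<open>F\<close> contains all of them.\<close>

lemma EF_CF:
  assumes "finite F" "x \<in> Up" "\<And>X. X \<in> ks x \<Longrightarrow> holes X \<subseteq> F \<and> parts X \<subseteq> F \<and> card (holes X) = card (parts X) + w"
  shows "EF F (CF F x) = CF F (EF F x) + cmap ((*) (of_nat w)) x"
proof -
  have "(\<Sum>r\<in>F. x - rpsi (od r) (rphi (od r) x) - rpsi (- od r) (rphi (- od r) x)) = cmap ((*) (of_nat w)) x"
  proof (rule additive_ext[where x=x])
    show "Modules.additive (\<lambda>x. \<Sum>r\<in>F. x - rpsi (od r) (rphi (od r) x) - rpsi (- od r) (rphi (- od r) (x::fock)))"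
      by (intro additive_sum additive_diff additive_id additive_comp[OF additive_rpsi additive_rphi])
    show "Modules.additive (cmap ((*) (of_nat w)))" by (intro additive_cmap additive_mult)
    fix X and p :: dring assume X: "X \<in> ks x"
    have e: "rpsi n (rphi n (sg X p)) = (if n \<in> X then sg X p else 0)" for n
    proof -
      have "{s\<in>X - {n}. n < s} = {s\<in>X. n < s}" by auto
      then show ?thesis by (simp add: rpsi_single rphi_single sign_sq insert_absorb additive_imps[OF additive_rpsi])
    qed
    have "sg X p - (if od r \<in> X then sg X p else 0) - (if - od r \<in> X then sg X p else 0)
       = (if r \<in> holes X then sg X p else 0) - (if r \<in> parts X then sg X p else 0)" for r
      by (simp add: holes_def parts_def)
    then have "(\<Sum>r\<in>F. sg X p - rpsi (od r) (rphi (od r) (sg X p)) - rpsi (- od r) (rphi (- od r) (sg X p)))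
      = (\<Sum>r\<in>F. if r \<in> holes X then sg X p else 0) - (\<Sum>r\<in>F. if r \<in> parts X then sg X p else 0)"
      unfolding e by (simp only: sum_subtractf)
    also have "(\<Sum>r\<in>F. if r \<in> holes X then sg X p else 0) = (\<Sum>r\<in>holes X. sg X p)"
      using assms(1) assms(3)[OF X] by (intro sum.mono_neutral_cong_right) auto
    also have "(\<Sum>r\<in>F. if r \<in> parts X then sg X p else 0) = (\<Sum>r\<in>parts X. sg X p)"
      using assms(1) assms(3)[OF X] by (intro sum.mono_neutral_cong_right) auto
    also have "(\<Sum>r\<in>holes X. sg X p) - (\<Sum>r\<in>parts X. sg X p) = sg X (of_nat w * p)"
      using assms(3)[OF X] by (simp add: additive_imps(5)[OF additive_single, symmetric] single_diff[symmetric] algebra_simps)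
    finally show "(\<Sum>r\<in>F. sg X p - rpsi (od r) (rphi (od r) (sg X p)) - rpsi (- od r) (rphi (- od r) (sg X p))) = cmap ((*) (of_nat w)) (sg X p)"
      by (simp add: cmap_single additive_mult)
  qed
  then show ?thesis using EF_CF_commutator[OF assms(1,2)] by (simp add: algebra_simps)
qed

section \<open>Exactness in positive degrees\<close>

definition charged :: "nat \<Rightarrow> int set \<Rightarrow> bool" where
  "charged k X \<longleftrightarrow> odds X \<and> finite (holes X) \<and> finite (parts X) \<and> card (holes X) = card (parts X) + k"

definition Mk :: "nat \<Rightarrow> fock set" where "Mk k = Msp (- 2 * int k - 1)"

lemma Mk_iff: "x \<in> Mk k \<longleftrightarrow> (\<forall>X\<in>ks x. charged k X)"
  unfolding Mk_def Msp_def charged_def valid_iff by simp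

lemma Mk_add: "x \<in> Mk k \<Longrightarrow> y \<in> Mk k \<Longrightarrow> x + y \<in> Mk k"
  and Mk_diff: "x \<in> Mk k \<Longrightarrow> y \<in> Mk k \<Longrightarrow> x - y \<in> Mk k"
  and Mk_0: "0 \<in> Mk k"
  and Mk_sum: "(\<And>a. a \<in> A \<Longrightarrow> f a \<in> Mk k) \<Longrightarrow> (\<Sum>a\<in>A. f a) \<in> Mk k"
  unfolding Mk_def by (auto intro: Msp_add Msp_diff Msp_sum Msp_uminus)

lemma holes_remove: "holes (X - {- od r}) = insert r (holes X)" "holes (X - {od r}) = holes X"
  by (auto simp: holes_def)

lemma parts_remove: "parts (X - {- od r}) = parts X" "parts (X - {od r}) = parts X - {r}"
  by (auto simp: parts_def)

lemma odds_remove: "odds X \<Longrightarrow> odds (X - {n})"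
  by (auto simp: odds_def)

lemma charged_insert_neg: "charged (Suc k) X \<Longrightarrow> - od r \<notin> X \<Longrightarrow> charged k (insert (- od r) X)"
proof -
  assume X: "charged (Suc k) X" "- od r \<notin> X"
  then have "r \<in> holes X" by (simp add: holes_def)
  then show ?thesis using X(1) unfolding charged_def holes_insert parts_insert odds_insert by simp
qed

lemma charged_insert_both:
  assumes X: "charged (k + 2) X" "- od r \<notin> X" "od r \<notin> X"
  shows "charged k (insert (- od r) (insert (od r) X))"
proof -
  have "r \<in> holes X" "r \<notin> parts X" using X by (simp_all add: holes_def parts_def)
  then show ?thesis using X(1) unfolding charged_def holes_insert parts_insert odds_insert by simp
qed

lemma charged_remove_neg:
  assumes X: "charged k X" "- od r \<in> X"
  shows "charged (Suc k) (X - {- od r})"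
proof -
  have "r \<notin> holes X" using X by (simp add: holes_def)
  then show ?thesis using X(1) odds_remove unfolding charged_def holes_remove parts_remove by simp
qed

lemma charged_remove_both:
  assumes X: "charged k X" "- od r \<in> X" "od r \<in> X"
  shows "charged (k + 2) (X - {- od r} - {od r})"
proof -
  have r: "r \<notin> holes X" "r \<in> parts X" using X by (simp_all add: holes_def parts_def)
  then have "card (parts X) > 0" using X(1) by (auto simp: charged_def card_gt_0_iff)
  then show ?thesis using X(1) r odds_remove unfolding charged_def holes_remove parts_remove by simp
qed

lemma keys_QF: "Y \<in> ks (QF F x) \<Longrightarrow> \<exists>X\<in>ks x. \<exists>r\<in>F. - od r \<notin> X \<and> Y = insert (- od r) X"
proof -
  assume "Y \<in> ks (QF F x)"
  then have "Y \<in> (\<Union>r\<in>F. ks (rpsi (- od r) (cmap ((*) (dv r)) x)))"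
    unfolding QF_def by (rule subsetD[OF keys_sum])
  then obtain r where r: "r \<in> F" "Y \<in> ks (rpsi (- od r) (cmap ((*) (dv r)) x))" by blast
  from keys_rpsi[OF r(2)] show ?thesis using r(1) keys_cmap by blast
qed

lemma keys_CF: "Y \<in> ks (CF F x) \<Longrightarrow> \<exists>X\<in>ks x. \<exists>r\<in>F. - od r \<notin> X \<and> od r \<notin> X \<and> Y = insert (- od r) (insert (od r) X)"
proof -
  assume "Y \<in> ks (CF F x)"
  then have "Y \<in> (\<Union>r\<in>F. ks (rpsi (- od r) (rpsi (od r) x)))"
    unfolding CF_def by (rule subsetD[OF keys_sum])
  then obtain r where r: "r \<in> F" "Y \<in> ks (rpsi (- od r) (rpsi (od r) x))" by blast
  from keys_rpsi[OF r(2)] obtain Z where Z: "Z \<in> ks (rpsi (od r) x)" "- od r \<notin> Z" "Y = insert (- od r) Z" by blast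
  from keys_rpsi[OF Z(1)] show ?thesis using Z r(1) by blast
qed

lemma keys_KF: "Y \<in> ks (KF F x) \<Longrightarrow> \<exists>X\<in>ks x. \<exists>r\<in>F. - od r \<in> X \<and> Y = X - {- od r}"
proof -
  assume "Y \<in> ks (KF F x)"
  then have "Y \<in> (\<Union>r\<in>F. ks (rphi (- od r) (cmap (pd r) x)))"
    unfolding KF_def by (rule subsetD[OF keys_sum])
  then obtain r where r: "r \<in> F" "Y \<in> ks (rphi (- od r) (cmap (pd r) x))" by blast
  from keys_rphi[OF r(2)] show ?thesis using r(1) keys_cmap by blast
qed

lemma keys_EF: "Y \<in> ks (EF F x) \<Longrightarrow> \<exists>X\<in>ks x. \<exists>r\<in>F. - od r \<in> X \<and> od r \<in> X \<and> Y = X - {- od r} - {od r}"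
proof -
  assume "Y \<in> ks (EF F x)"
  then have "Y \<in> (\<Union>r\<in>F. ks (rphi (od r) (rphi (- od r) x)))"
    unfolding EF_def by (rule subsetD[OF keys_sum])
  then obtain r where r: "r \<in> F" "Y \<in> ks (rphi (od r) (rphi (- od r) x))" by blast
  from keys_rphi[OF r(2)] obtain Z where Z: "Z \<in> ks (rphi (- od r) x)" "od r \<in> Z" "Y = Z - {od r}" by blast
  from keys_rphi[OF Z(1)] show ?thesis using Z r(1) by blast
qed

lemma Mk_QF: "x \<in> Mk (Suc k) \<Longrightarrow> QF F x \<in> Mk k"
  unfolding Mk_iff
proof
  fix Y assume x: "\<forall>X\<in>ks x. charged (Suc k) X" and "Y \<in> ks (QF F x)"
  then obtain X r where "X \<in> ks x" "- od r \<notin> X" "Y = insert (- od r) X" using keys_QF by meson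
  then show "charged k Y" using x charged_insert_neg by blast
qed

lemma Mk_CF: "x \<in> Mk (k + 2) \<Longrightarrow> CF F x \<in> Mk k"
  unfolding Mk_iff
proof
  fix Y assume x: "\<forall>X\<in>ks x. charged (k + 2) X" and "Y \<in> ks (CF F x)"
  then obtain X r where "X \<in> ks x" "- od r \<notin> X" "od r \<notin> X" "Y = insert (- od r) (insert (od r) X)" using keys_CF by meson
  then show "charged k Y" using x charged_insert_both by blast
qed

lemma Mk_KF: "x \<in> Mk k \<Longrightarrow> KF F x \<in> Mk (Suc k)"
  unfolding Mk_iff
proof
  fix Y assume x: "\<forall>X\<in>ks x. charged k X" and "Y \<in> ks (KF F x)"
  then obtain X r where "X \<in> ks x" "- od r \<in> X" "Y = X - {- od r}" using keys_KF by meson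
  then show "charged (Suc k) Y" using x charged_remove_neg by blast
qed

lemma Mk_EF: "x \<in> Mk k \<Longrightarrow> EF F x \<in> Mk (k + 2)"
  unfolding Mk_iff
proof
  fix Y assume x: "\<forall>X\<in>ks x. charged k X" and "Y \<in> ks (EF F x)"
  then obtain X r where "X \<in> ks x" "- od r \<in> X" "od r \<in> X" "Y = X - {- od r} - {od r}" using keys_EF by meson
  then show "charged (k + 2) Y" using x charged_remove_both by blast
qed

lemma holes_in_QF: "holes_in F x \<Longrightarrow> holes_in F (QF F' x)"
  unfolding holes_in_def
proof
  fix Y assume x: "\<forall>X\<in>ks x. holes X \<subseteq> F" and "Y \<in> ks (QF F' x)"
  then obtain X r where "X \<in> ks x" "Y = insert (- od r) X" using keys_QF by meson
  then show "holes Y \<subseteq> F" unfolding \<open>Y = _\<close> holes_insert using x by auto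
qed

lemma holes_in_CF: "holes_in F x \<Longrightarrow> holes_in F (CF F' x)"
  unfolding holes_in_def
proof
  fix Y assume x: "\<forall>X\<in>ks x. holes X \<subseteq> F" and "Y \<in> ks (CF F' x)"
  then obtain X r where "X \<in> ks x" "Y = insert (- od r) (insert (od r) X)" using keys_CF by meson
  then show "holes Y \<subseteq> F" unfolding \<open>Y = _\<close> holes_insert using x by auto
qed

lemma holes_in_KF: "holes_in F x \<Longrightarrow> holes_in F (KF F x)"
  unfolding holes_in_def
proof
  fix Y assume x: "\<forall>X\<in>ks x. holes X \<subseteq> F" and "Y \<in> ks (KF F x)"
  then obtain X r where "X \<in> ks x" "r \<in> F" "Y = X - {- od r}" using keys_KF by meson
  then show "holes Y \<subseteq> F" unfolding \<open>Y = _\<close> holes_remove using x by auto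
qed

lemma upfin_charged: "charged k X \<Longrightarrow> upfin X"
  unfolding upfin_def
proof
  fix n assume X: "charged k X"
  have "- od (nat (- n)) \<le> n" by simp
  then have "{s\<in>X. s > n} \<subseteq> {s\<in>X. s > - od (nat (- n))}" by auto
  moreover have "finite {s\<in>X. s > - od (nat (- n))}"
    using X unfolding charged_def by (subst card_above_neg(1)) auto
  ultimately show "finite {s\<in>X. s > n}" by (rule finite_subset)
qed

lemma Mk_Up: "x \<in> Mk k \<Longrightarrow> x \<in> Up"
  unfolding Mk_iff Up_def using upfin_charged by blast

lemma Mk_modes:
  assumes "x \<in> Mk k"
  shows "\<exists>F. finite F \<and> (\<forall>X\<in>ks x. holes X \<subseteq> F \<and> parts X \<subseteq> F)"
proof (intro exI conjI)
  show "finite (\<Union>X\<in>ks x. holes X \<union> parts X)" using assms by (auto simp: Mk_iff charged_def)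
qed auto

lemma Mk_holes_in:
  assumes "x \<in> Mk k"
  obtains F where "finite F" "holes_in F x"
proof -
  obtain F where F: "finite F" "\<forall>X\<in>ks x. holes X \<subseteq> F \<and> parts X \<subseteq> F"
    using Mk_modes[OF assms] by blast
  show thesis by (rule that[of F]) (use F in \<open>simp_all add: holes_in_def\<close>)
qed

lemma Mk_Qop: "x \<in> Mk (Suc k) \<Longrightarrow> Qop x \<in> Mk k"
proof -
  assume x: "x \<in> Mk (Suc k)"
  obtain F where F: "finite F" "holes_in F x" by (rule Mk_holes_in[OF x])
  show ?thesis unfolding Qop_QF[OF F] by (rule Mk_QF[OF x])
qed

lemma Mk_Cop: "x \<in> Mk (k + 2) \<Longrightarrow> Cop x \<in> Mk k"
proof -
  assume x: "x \<in> Mk (k + 2)"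
  obtain F where F: "finite F" "holes_in F x" by (rule Mk_holes_in[OF x])
  show ?thesis unfolding Cop_CF[OF F] by (rule Mk_CF[OF x])
qed

lemma Qop_Cop: "x \<in> Mk k \<Longrightarrow> Qop (Cop x) = Cop (Qop x)"
proof -
  assume x: "x \<in> Mk k"
  obtain F where F: "finite F" "holes_in F x" by (rule Mk_holes_in[OF x])
  show ?thesis
    by (simp only: Cop_CF[OF F] Qop_QF[OF F] Qop_QF[OF F(1) holes_in_CF[OF F(2)]] Cop_CF[OF F(1) holes_in_QF[OF F(2)]] QF_CF[OF Mk_Up[OF x]])
qed

lemma Qop_Qop: "x \<in> Mk k \<Longrightarrow> Qop (Qop x) = 0"
proof -
  assume x: "x \<in> Mk k"
  obtain F where F: "finite F" "holes_in F x" by (rule Mk_holes_in[OF x])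
  show ?thesis
    by (simp only: Qop_QF[OF F] Qop_QF[OF F(1) holes_in_QF[OF F(2)]] QF_QF[OF Mk_Up[OF x]])
qed

text \<open>If \<open>Cop\<close> kills \<open>x\<close>, then moving \<open>CF\<close> through
  powers of \<open>EF\<close> shows that it maps each power to a nonzero multiple of the preceding
  one. High powers vanish for lack of particles, and hence so do all the lower ones, down to
  \<open>x\<close>.\<close>

lemma Cop_inj:
  assumes "x \<in> Mk k" "k \<ge> 1" "Cop x = 0"
  shows "x = 0"
proof -
  obtain F where F: "finite F" "\<forall>X\<in>ks x. holes X \<subseteq> F \<and> parts X \<subseteq> F"
    using Mk_modes[OF assms(1)] by blast
  have C0: "CF F x = 0" using Cop_CF[OF F(1)] F(2) assms(3) by (simp add: holes_in_def)
  define e where "e n = (EF F ^^ n) x" for n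
  have eS: "e (Suc n) = EF F (e n)" for n by (simp add: e_def)
  have M: "e n \<in> Mk (k + 2 * n)" for n
  proof (induction n)
    case (Suc n)
    have "EF F (e n) \<in> Mk (k + 2 * n + 2)" by (rule Mk_EF[OF Suc])
    then show ?case by (simp add: eS)
  qed (simp add: e_def assms)
  \<comment> \<open>Each application of \<open>EF\<close> removes a particle lying in
    \<open>F\<close>, so at most \<open>card F\<close> of them are possible.\<close>
  have K: "holes X \<subseteq> F \<and> parts X \<subseteq> F \<and> card (parts X) + n \<le> card F" if "X \<in> ks (e n)" for X n
    using that
  proof (induction n arbitrary: X)
    case 0
    then show ?case using F by (auto simp: e_def intro: card_mono)
  next
    case (Suc n)
    then obtain Y r where Y: "Y \<in> ks (e n)" "r \<in> F" "- od r \<in> Y" "od r \<in> Y" "X = Y - {- od r} - {od r}"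
      unfolding eS using keys_EF by meson
    have r: "r \<in> parts Y" using Y(4) by (simp add: parts_def)
    have f: "finite (parts Y)" using M[of n] Y(1) by (simp add: Mk_iff charged_def)
    have "card (parts Y) > 0" using r f by (auto simp: card_gt_0_iff)
    then show ?case unfolding Y(5) holes_remove parts_remove using Suc.IH[OF Y(1)] Y(2) r f by auto
  qed
  have step: "EF F (CF F (e n)) = CF F (e (Suc n)) + cmap ((*) (of_nat (k + 2 * n))) (e n)" for n
    unfolding eS
  proof (rule EF_CF[OF F(1) Mk_Up[OF M]])
    fix X assume X: "X \<in> ks (e n)"
    have "charged (k + 2 * n) X" using M X by (simp add: Mk_iff)
    then show "holes X \<subseteq> F \<and> parts X \<subseteq> F \<and> card (holes X) = card (parts X) + (k + 2 * n)" using K[OF X] by (simp add: charged_def)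
  qed
  have cm: "cmap ((*) (of_nat (a + b))) y = cmap ((*) (of_nat a)) y + cmap ((*) (of_nat b)) y" for a b y
    by (rule poly_mapping_eqI) (simp add: lookup_cmap additive_mult lookup_add distrib_right)
  have EFc: "EF F (cmap ((*) (of_nat a)) y) = cmap ((*) (of_nat a)) (EF F y)" for a y
    unfolding EF_def by (simp only: additive_imps(5)[OF additive_cmap[OF additive_mult]] cmap_rphi[OF additive_mult])
  \<comment> \<open>The factor \<open>t\<close> is the sum of the commutator scalars k, k + 2, ...
    up to \<open>k + 2 * n\<close>, positive because \<open>k\<close> is.\<close>
  have scal: "\<exists>t>0. CF F (e (Suc n)) = - cmap ((*) (of_nat t)) (e n)" for n
  proof (induction n)
    case 0
    have "CF F (e (Suc 0)) = - cmap ((*) (of_nat k)) (e 0)"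
      using step[of 0] C0 by (simp add: e_def additive_imps[OF additive_EF] eq_neg_iff_add_eq_0)
    then show ?case using assms(2) by (intro exI[of _ k]) simp
  next
    case (Suc n)
    then obtain t where t: "t > 0" "CF F (e (Suc n)) = - cmap ((*) (of_nat t)) (e n)" by blast
    have "- cmap ((*) (of_nat t)) (e (Suc n)) = CF F (e (Suc (Suc n))) + cmap ((*) (of_nat (k + 2 * Suc n))) (e (Suc n))"
      using step[of "Suc n"] unfolding t(2) by (simp only: additive_imps(4)[OF additive_EF] EFc eS)
    then have "CF F (e (Suc (Suc n))) = - cmap ((*) (of_nat (t + (k + 2 * Suc n)))) (e (Suc n))"
      unfolding cm[of t] by (simp add: algebra_simps)
    then show ?case using t(1) by (intro exI[of _ "t + (k + 2 * Suc n)"]) simp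
  qed
  have down: "e n = 0" if "e (Suc n) = 0" for n
  proof -
    obtain t where t: "t > 0" "CF F (e (Suc n)) = - cmap ((*) (of_nat t)) (e n)" using scal[of n] by blast
    then have z: "cmap ((*) (of_nat t)) (e n) = 0" using that by (simp add: additive_imps[OF additive_CF])
    have "of_nat t * lk (e n) X = 0" for X
      using arg_cong[OF z, of "\<lambda>y. lk y X"] by (simp add: lookup_cmap additive_mult)
    then show ?thesis using t(1) by (intro poly_mapping_eqI) simp
  qed
  have "e (Suc (card F)) = 0"
  proof (rule ccontr)
    assume "e (Suc (card F)) \<noteq> 0"
    then obtain X where "X \<in> ks (e (Suc (card F)))" by (metis ex_in_conv keys_eq_empty)
    from K[OF this] show False by simp
  qed
  moreover have "e 0 = 0" if "e n = 0" for n
    using that by (induction n) (use down in auto)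
  ultimately have "e 0 = 0" by blast
  then show ?thesis by (simp add: e_def)
qed

text \<open>In positive \<open>Suc k\<close> every basis vector has a hole, so the number operator
  is invertible. Its inverse commutes with \<open>QF\<close>, and \<open>QF_KF\<close> on the
  rescaled cycle exhibits \<open>x\<close> as a boundary.\<close>

lemma Qop_exact:
  assumes "x \<in> Mk (Suc k)" "Qop x = 0"
  shows "\<exists>y\<in>Mk (Suc (Suc k)). x = Qop y"
proof -
  obtain F where F: "finite F" "holes_in F x" by (rule Mk_holes_in[OF assms(1)])
  have Q0: "QF F x = 0" using Qop_QF[OF F] assms(2) by simp
  let ?z = "diag_op (\<lambda>X a. inverse (Nlev F X a)) x"
  have z: "?z \<in> Mk (Suc k)" using assms(1) keys_diag_op unfolding Mk_iff by blast
  have zF: "holes_in F ?z" using F(2) keys_diag_op unfolding holes_in_def by blast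
  have "QF F ?z = diag_op (\<lambda>X a. inverse (Nlev F X a)) (QF F x)" by (rule QF_diag_op[OF F(1)])
  then have "QF F ?z = 0" using Q0 by (simp add: additive_imps[OF additive_diag_op])
  then have "QF F (KF F ?z) = diag_op (Nlev F) ?z"
    using QF_KF[OF F(1) Mk_Up[OF z]] by (simp add: additive_imps[OF additive_KF])
  also have "\<dots> = x" unfolding diag_op_diag_op
  proof (rule diag_op_1)
    fix X a assume X: "X \<in> ks x"
    then have "holes X \<inter> F = holes X" "charged (Suc k) X" using F(2) assms(1) by (auto simp: holes_in_def Mk_iff)
    then have "(\<Sum>r\<in>F. lk a r) + card (holes X \<inter> F) \<noteq> 0" by (simp add: charged_def)
    then have "Nlev F X a \<noteq> 0" by (metis of_nat_eq_0_iff)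
    then show "Nlev F X a * inverse (Nlev F X a) = 1" by simp
  qed
  finally have "Qop (KF F ?z) = x" using Qop_QF[OF F(1) holes_in_KF[OF zF]] by simp
  then show ?thesis by (intro bexI[of _ "KF F ?z"] Mk_KF[OF z]) simp
qed

lemma Nsp_Mk: "Nsp (- 2 * int k - 1) = Cop ` Mk (k + 2)"
proof -
  have "- 2 * int k - 1 - 4 = - 2 * int (k + 2) - 1" by simp
  then show ?thesis unfolding Nsp_def Mk_def by (simp only:)
qed

lemma Msp_Mk: "Msp (- 2 * int k - 1) = Mk k" "Msp (- 2 * int k - 3) = Mk (Suc k)"
proof -
  have "- 2 * int k - 3 = - 2 * int (Suc k) - 1" by simp
  then show "Msp (- 2 * int k - 3) = Mk (Suc k)" unfolding Mk_def by (simp only:)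
qed (simp only: Mk_def)

lemma Qop_Nsp: "Qop ` Cop ` Mk (k + 3) \<subseteq> Cop ` Mk (k + 2)"
proof -
  have "Qop (Cop x) \<in> Cop ` Mk (k + 2)" if "x \<in> Mk (k + 3)" for x
  proof -
    have "Qop x \<in> Mk (k + 2)" using that Mk_Qop[of x "k + 2"] by (simp add: numeral_3_eq_3)
    then show ?thesis using Qop_Cop[OF that] by auto
  qed
  then show ?thesis by blast
qed

text \<open>A chase: if \<open>Qop x = Cop z\<close>, then injectivity of \<open>Cop\<close> makes
  \<open>z\<close> a cycle, hence \<open>z = Qop w\<close>. Then \<open>x - Cop w\<close> is a cycle
  and so a boundary.\<close>

lemma quotient_exact:
  "{x \<in> Mk (Suc k). Qop x \<in> Cop ` Mk (k + 2)} = {y + z |y z. y \<in> Qop ` Mk (k + 2) \<and> z \<in> Cop ` Mk (k + 3)}"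
proof (intro equalityI subsetI)
  fix x assume "x \<in> {x \<in> Mk (Suc k). Qop x \<in> Cop ` Mk (k + 2)}"
  then obtain z where x: "x \<in> Mk (Suc k)" and z: "z \<in> Mk (k + 2)" "Qop x = Cop z" by auto
  have Qz: "Qop z \<in> Mk (Suc k)" using Mk_Qop[of z "Suc k"] z by simp
  have "Cop (Qop z) = Qop (Qop x)" using Qop_Cop[OF z(1)] z(2) by simp
  then have "Cop (Qop z) = 0" using Qop_Qop[OF x] by simp
  then have "Qop z = 0" using Cop_inj[OF Qz] by simp
  then obtain w where w: "w \<in> Mk (k + 3)" "z = Qop w"
    using Qop_exact[of z "Suc k"] z(1) by (auto simp: numeral_3_eq_3)
  have Cw: "Cop w \<in> Mk (Suc k)" using Mk_Cop[of w "Suc k"] w(1) by (simp add: numeral_3_eq_3)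
  have "Qop (x - Cop w) = 0"
    using z(2) w(2) Qop_Cop[OF w(1)] by (simp add: additive_imps[OF additive_Qop])
  then obtain y where y: "y \<in> Mk (k + 2)" "x - Cop w = Qop y"
    using Qop_exact[of "x - Cop w" k] Mk_diff[OF x Cw] by auto
  then have "x = Qop y + Cop w" by (simp add: algebra_simps)
  then show "x \<in> {y + z |y z. y \<in> Qop ` Mk (k + 2) \<and> z \<in> Cop ` Mk (k + 3)}" using y(1) w(1) by blast
next
  fix x assume "x \<in> {y + z |y z. y \<in> Qop ` Mk (k + 2) \<and> z \<in> Cop ` Mk (k + 3)}"
  then obtain y w where x: "x = Qop y + Cop w" and y: "y \<in> Mk (k + 2)" and w: "w \<in> Mk (k + 3)" by blast
  have "Qop y \<in> Mk (Suc k)" using Mk_Qop[of y "Suc k"] y by simp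
  moreover have "Cop w \<in> Mk (Suc k)" using Mk_Cop[of w "Suc k"] w by (simp add: numeral_3_eq_3)
  ultimately have "x \<in> Mk (Suc k)" unfolding x by (rule Mk_add)
  moreover have "Qop x = Qop (Cop w)" unfolding x using Qop_Qop[OF y] by (simp add: additive_imps[OF additive_Qop])
  ultimately show "x \<in> {x \<in> Mk (Suc k). Qop x \<in> Cop ` Mk (k + 2)}" using Qop_Nsp[of k] w by auto
qed

section \<open>Counting basis vectors by degree\<close>

definition energy :: "int set \<Rightarrow> nat" where
  "energy X = (\<Sum>l\<in>holes X. 2 * l + 1) + (\<Sum>j\<in>parts X. 2 * j + 1)"

text \<open>The odd number $2i+1$ is indexed by \<open>i\<close>.\<close>
definition occ :: "int set \<Rightarrow> int \<Rightarrow> bool" where "occ X i \<longleftrightarrow> 2 * i + 1 \<in> X"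

definition holes_upto :: "int set \<Rightarrow> int \<Rightarrow> nat" where "holes_upto X i = card {w. w \<le> i \<and> \<not> occ X w}"
definition parts_above :: "int set \<Rightarrow> int \<Rightarrow> nat" where "parts_above X i = card {w. w > i \<and> occ X w}"

lemma occ_nat: "occ X (int j) \<longleftrightarrow> j \<in> parts X" "\<not> occ X (- int r - 1) \<longleftrightarrow> r \<in> holes X"
proof -
  show "occ X (int j) \<longleftrightarrow> j \<in> parts X" by (simp add: occ_def parts_def)
  have "2 * (- int r - 1) + 1 = - od r" by simp
  then show "\<not> occ X (- int r - 1) \<longleftrightarrow> r \<in> holes X" unfolding occ_def holes_def by (simp only: mem_Collect_eq)
qed

lemma int_cases_index: obtains (nonneg) j where "i = int j" | (neg) r where "i = - int r - 1"
proof (cases "i \<ge> 0")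
  case True then show ?thesis using nonneg[of "nat i"] by simp
next
  case False then show ?thesis using neg[of "nat (- i - 1)"] by simp
qed

lemma finite_below_holes: "finite (holes X) \<Longrightarrow> finite {w. w \<le> i \<and> \<not> occ X w}"
proof -
  assume "finite (holes X)"
  then have "finite ((\<lambda>r. - int r - 1) ` holes X \<union> {0..i})" by simp
  moreover have "{w. w \<le> i \<and> \<not> occ X w} \<subseteq> (\<lambda>r. - int r - 1) ` holes X \<union> {0..i}"
  proof
    fix w assume w: "w \<in> {w. w \<le> i \<and> \<not> occ X w}"
    show "w \<in> (\<lambda>r. - int r - 1) ` holes X \<union> {0..i}"
      by (cases w rule: int_cases_index) (use w occ_nat in auto)
  qed
  ultimately show ?thesis by (rule finite_subset[rotated])
qed

lemma finite_above_parts: "finite (parts X) \<Longrightarrow> finite {w. w > i \<and> occ X w}"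
proof -
  assume "finite (parts X)"
  then have "finite (int ` parts X \<union> {i..-1})" by simp
  moreover have "{w. w > i \<and> occ X w} \<subseteq> int ` parts X \<union> {i..-1}"
  proof
    fix w assume w: "w \<in> {w. w > i \<and> occ X w}"
    show "w \<in> int ` parts X \<union> {i..-1}"
      by (cases w rule: int_cases_index) (use w occ_nat in auto)
  qed
  ultimately show ?thesis by (rule finite_subset[rotated])
qed

text \<open>The place \<open>i + 1\<close> either is empty and joins the holes below, or is occupied
  and leaves the particles above.\<close>

lemma charge_step:
  assumes "charged 0 X"
  shows "int (holes_upto X (i + 1)) - int (parts_above X (i + 1)) = int (holes_upto X i) - int (parts_above X i) + 1"
proof -
  have f: "finite {w. w \<le> i \<and> \<not> occ X w}" "finite {w. w > i + 1 \<and> occ X w}"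
    using assms finite_below_holes finite_above_parts by (auto simp: charged_def)
  show ?thesis
  proof (cases "occ X (i + 1)")
    case True
    have "{w. w \<le> i + 1 \<and> \<not> occ X w} = {w. w \<le> i \<and> \<not> occ X w}"
      using True by (auto simp: le_less)
    moreover have "{w. w > i \<and> occ X w} = insert (i + 1) {w. w > i + 1 \<and> occ X w}"
      using True by (auto simp: order.order_iff_strict)
    ultimately show ?thesis using f by (simp add: holes_upto_def parts_above_def)
  next
    case False
    have "{w. w \<le> i + 1 \<and> \<not> occ X w} = insert (i + 1) {w. w \<le> i \<and> \<not> occ X w}"
      using False by auto
    moreover have "{w. w > i \<and> occ X w} = {w. w > i + 1 \<and> occ X w}"
    proof (intro Collect_cong)
      fix w show "w > i \<and> occ X w \<longleftrightarrow> w > i + 1 \<and> occ X w" using False by (cases "w = i + 1") auto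
    qed
    ultimately show ?thesis using f by (simp add: holes_upto_def parts_above_def)
  qed
qed

lemma holes_upto_minus: "holes_upto X (- int r - 1) = card {l\<in>holes X. l \<ge> r}"
proof -
  have "{w. w \<le> - int r - 1 \<and> \<not> occ X w} = (\<lambda>l. - int l - 1) ` {l\<in>holes X. l \<ge> r}"
  proof (intro equalityI subsetI)
    fix w assume w: "w \<in> {w. w \<le> - int r - 1 \<and> \<not> occ X w}"
    show "w \<in> (\<lambda>l. - int l - 1) ` {l\<in>holes X. l \<ge> r}"
      by (cases w rule: int_cases_index) (use w occ_nat in auto)
  qed (use occ_nat in auto)
  then show ?thesis by (simp add: holes_upto_def card_image inj_on_def)
qed

lemma parts_above_nat: "parts_above X (int j) = card {q\<in>parts X. q > j}"
proof -
  have "{w. w > int j \<and> occ X w} = int ` {q\<in>parts X. q > j}"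
  proof (intro equalityI subsetI)
    fix w assume w: "w \<in> {w. w > int j \<and> occ X w}"
    show "w \<in> int ` {q\<in>parts X. q > j}"
      by (cases w rule: int_cases_index) (use w occ_nat in auto)
  qed (use occ_nat in auto)
  then show ?thesis by (simp add: parts_above_def card_image)
qed

lemma charge:
  assumes "charged 0 X"
  shows "int (holes_upto X i) - int (parts_above X i) = i + 1"
proof -
  have base: "int (holes_upto X (-1)) - int (parts_above X (-1)) = 0"
  proof -
    have "holes_upto X (-1) = card (holes X)" using holes_upto_minus[of X 0] by simp
    moreover have "parts_above X (-1) = card (parts X)"
    proof -
      have "{w. w > -1 \<and> occ X w} = int ` parts X"
      proof (intro equalityI subsetI)
        fix w assume w: "w \<in> {w. w > -1 \<and> occ X w}"
        show "w \<in> int ` parts X"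
          by (cases w rule: int_cases_index) (use w occ_nat in auto)
      qed (use occ_nat in auto)
      then show ?thesis by (simp add: parts_above_def card_image)
    qed
    ultimately show ?thesis using assms by (simp add: charged_def)
  qed
  show ?thesis
  proof (induction i rule: int_induct[where k="-1"])
    case base
    show ?case using \<open>int (holes_upto X (-1)) - int (parts_above X (-1)) = 0\<close> by simp
  next
    case (step1 i)
    then show ?case using charge_step[OF assms, of i] by simp
  next
    case (step2 i)
    then show ?case using charge_step[OF assms, of "i - 1"] by simp
  qed
qed

text \<open>An occupied place with \<open>p\<close> empty places below it stands for a part
  \<open>p\<close> of a partition, \<open>p = 0\<close> giving no part. \<open>occ_mult\<close> is
  the multiplicity of the part \<open>p\<close>, and \<open>occ_mult_ge\<close> the length of the
  p-th column of the diagram.\<close>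

definition occ_mult :: "int set \<Rightarrow> nat \<Rightarrow> nat" where "occ_mult X p = card {z. occ X z \<and> holes_upto X z = p}"
definition occ_mult_ge :: "int set \<Rightarrow> nat \<Rightarrow> nat" where "occ_mult_ge X p = card {z. occ X z \<and> holes_upto X z \<ge> p}"

lemma holes_upto_mono: "finite (holes X) \<Longrightarrow> i \<le> j \<Longrightarrow> holes_upto X i \<le> holes_upto X j"
  unfolding holes_upto_def by (intro card_mono finite_below_holes) auto

lemma finite_occ_holes_upto:
  assumes "charged 0 X"
  shows "finite {z. occ X z \<and> holes_upto X z \<ge> 1}"
proof -
  have L: "finite (holes X)" "finite (parts X)" using assms by (simp_all add: charged_def)
  define r where "r = Suc (Max (insert 0 (holes X)))"
  have "{z. occ X z \<and> holes_upto X z \<ge> 1} \<subseteq> {w. w > - int r - 1 \<and> occ X w}"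
  proof
    fix z assume z: "z \<in> {z. occ X z \<and> holes_upto X z \<ge> 1}"
    have "z > - int r - 1"
    proof (rule ccontr)
      assume "\<not> z > - int r - 1"
      then have "holes_upto X z \<le> holes_upto X (- int r - 1)" using L by (intro holes_upto_mono) auto
      moreover have "{l\<in>holes X. l \<ge> r} = {}"
        using L Max_ge[of "insert 0 (holes X)"] unfolding r_def by (auto simp: not_less_eq_eq)
      ultimately show False using z unfolding holes_upto_minus by simp
    qed
    then show "z \<in> {w. w > - int r - 1 \<and> occ X w}" using z by simp
  qed
  then show ?thesis using finite_above_parts[OF L(2)] by (rule finite_subset)
qed

lemma occ_mult_ge_rec: "charged 0 X \<Longrightarrow> p \<ge> 1 \<Longrightarrow> occ_mult_ge X p = occ_mult X p + occ_mult_ge X (Suc p)"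
proof -
  assume X: "charged 0 X" and p: "p \<ge> 1"
  have "{z. occ X z \<and> holes_upto X z \<ge> p} = {z. occ X z \<and> holes_upto X z = p} \<union> {z. occ X z \<and> holes_upto X z \<ge> Suc p}" by auto
  moreover have "finite {z. occ X z \<and> holes_upto X z = p}" "finite {z. occ X z \<and> holes_upto X z \<ge> Suc p}"
    using p by (auto intro: finite_subset[OF _ finite_occ_holes_upto[OF X]])
  ultimately show ?thesis unfolding occ_mult_ge_def occ_mult_def by (simp add: card_Un_disjoint disjoint_iff)
qed

lemma occ_mult_ge_zero:
  assumes "charged 0 X"
  shows "\<exists>M\<ge>1. \<forall>p>M. {z. occ X z \<and> holes_upto X z \<ge> p} = {}"
proof -
  let ?S = "{z. occ X z \<and> holes_upto X z \<ge> 1}"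
  have f: "finite (holes_upto X ` ?S)" using finite_occ_holes_upto[OF assms] by simp
  show ?thesis
  proof (intro exI[of _ "Max (insert 1 (holes_upto X ` ?S))"] conjI allI impI)
    show "Max (insert 1 (holes_upto X ` ?S)) \<ge> 1" using f by simp
    fix p assume p: "Max (insert 1 (holes_upto X ` ?S)) < p"
    have "holes_upto X z < p" if "z \<in> ?S" for z using f p that by simp
    then show "{z. occ X z \<and> holes_upto X z \<ge> p} = {}" using p f by fastforce
  qed
qed

text \<open>Column lengths are recovered from multiplicities by descending recursion, starting
  beyond the largest parts of both partitions.\<close>

lemma occ_mult_ge_cong:
  assumes X: "charged 0 X" and Y: "charged 0 Y" and e: "\<And>p. p \<ge> 1 \<Longrightarrow> occ_mult X p = occ_mult Y p" and p: "p \<ge> 1"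
  shows "occ_mult_ge X p = occ_mult_ge Y p"
proof -
  have z: "\<exists>M\<ge>1. \<forall>q>M. occ_mult_ge Z q = 0" if "charged 0 Z" for Z
  proof -
    note g = occ_mult_ge_zero[OF that]
    obtain M where M: "M \<ge> 1" "\<forall>p>M. {z. occ Z z \<and> holes_upto Z z \<ge> p} = {}" using g by blast
    have "occ_mult_ge Z q = 0" if "q > M" for q
      unfolding occ_mult_ge_def M(2)[rule_format, OF that] by simp
    then show ?thesis using M(1) by blast
  qed
  obtain M where M: "M \<ge> 1" "\<forall>q>M. occ_mult_ge X q = 0" using z[OF X] by blast
  obtain M' where M': "M' \<ge> 1" "\<forall>q>M'. occ_mult_ge Y q = 0" using z[OF Y] by blast
  define K where "K = max M M' + p"
  have "occ_mult_ge X (K + 1 - n) = occ_mult_ge Y (K + 1 - n)" if "n \<le> K" for n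
    using that
  proof (induction n)
    case 0
    show ?case using M M' by (simp add: K_def)
  next
    case (Suc n)
    then have "K + 1 - n = Suc (K + 1 - Suc n)" "K + 1 - Suc n \<ge> 1" by auto
    then show ?case using Suc occ_mult_ge_rec[OF X, of "K + 1 - Suc n"] occ_mult_ge_rec[OF Y, of "K + 1 - Suc n"] e by simp
  qed
  from this[of "K + 1 - p"] show ?thesis using p M(1) by (simp add: K_def)
qed

text \<open>For an empty place, lying above it and having at least as many holes below are the same
  thing for an occupied place. Together with \<open>charge\<close>, the column lengths thus fix
  where the p-th hole lies.\<close>

lemma hole_position:
  assumes X: "charged 0 X" and y: "\<not> occ X y"
  shows "holes_upto X y \<ge> 1" "occ_mult_ge X (holes_upto X y) = parts_above X y"
proof -
  have L: "finite (holes X)" using X by (simp add: charged_def)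
  have "y \<in> {w. w \<le> y \<and> \<not> occ X w}" using y by simp
  then have "card {w. w \<le> y \<and> \<not> occ X w} > 0" using finite_below_holes[OF L] by (auto simp: card_gt_0_iff)
  then show "holes_upto X y \<ge> 1" by (simp add: holes_upto_def)
  have "{z. occ X z \<and> holes_upto X z \<ge> holes_upto X y} = {w. w > y \<and> occ X w}"
  proof (intro equalityI subsetI)
    fix z assume z: "z \<in> {z. occ X z \<and> holes_upto X z \<ge> holes_upto X y}"
    have "\<not> z < y"
    proof
      assume "z < y"
      have "{w. w \<le> z \<and> \<not> occ X w} \<subset> {w. w \<le> y \<and> \<not> occ X w}"
      proof (rule psubsetI)
        show "{w. w \<le> z \<and> \<not> occ X w} \<subseteq> {w. w \<le> y \<and> \<not> occ X w}" using \<open>z < y\<close> by auto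
        have "y \<in> {w. w \<le> y \<and> \<not> occ X w}" "y \<notin> {w. w \<le> z \<and> \<not> occ X w}" using y \<open>z < y\<close> by auto
        then show "{w. w \<le> z \<and> \<not> occ X w} \<noteq> {w. w \<le> y \<and> \<not> occ X w}" by metis
      qed
      then have "holes_upto X z < holes_upto X y" unfolding holes_upto_def using finite_below_holes[OF L] by (rule psubset_card_mono[rotated])
      then show False using z by simp
    qed
    then show "z \<in> {w. w > y \<and> occ X w}" using z y by (cases "z = y") auto
  qed (use holes_upto_mono[OF L] in auto)
  then show "occ_mult_ge X (holes_upto X y) = parts_above X y" by (simp add: occ_mult_ge_def parts_above_def)
qed

lemma occ_mult_ge_antimono: "charged 0 X \<Longrightarrow> 1 \<le> p \<Longrightarrow> p \<le> q \<Longrightarrow> occ_mult_ge X q \<le> occ_mult_ge X p"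
  unfolding occ_mult_ge_def by (rule card_mono) (auto intro: finite_subset[OF _ finite_occ_holes_upto])

text \<open>Consider the strictly increasing function \<open>p\<close> minus the p-th column length.
  At the rank of a hole \<open>y\<close> it takes the value y + 1. If \<open>y\<close> were occupied
  in \<open>Y\<close>, with \<open>q\<close> holes below, it would jump from at most y at
  \<open>q\<close> to at least y + 2 at \<open>Suc q\<close>.\<close>

lemma occ_occ_mult:
  assumes X: "charged 0 X" and Y: "charged 0 Y" and e: "\<And>p. p \<ge> 1 \<Longrightarrow> occ_mult X p = occ_mult Y p" and y: "\<not> occ X y"
  shows "\<not> occ Y y"
proof
  assume o: "occ Y y"
  have L: "finite (holes Y)" "finite (parts Y)" using Y by (simp_all add: charged_def)
  define p where "p = holes_upto X y"
  define q where "q = holes_upto Y y"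
  have p1: "p \<ge> 1" and G: "occ_mult_ge Y p = parts_above X y"
    using hole_position[OF X y] occ_mult_ge_cong[OF X Y e, of "holes_upto X y"] by (simp_all add: p_def)
  have 1: "int p - int (occ_mult_ge Y p) = y + 1" using charge[OF X, of y] G by (simp add: p_def)
  have 2: "int q - int (parts_above Y y) = y + 1" using charge[OF Y, of y] by (simp add: q_def)
  have a: "occ_mult_ge Y q \<ge> Suc (parts_above Y y)" if "q \<ge> 1"
  proof -
    have "insert y {w. w > y \<and> occ Y w} \<subseteq> {z. occ Y z \<and> holes_upto Y z \<ge> q}"
      using o holes_upto_mono[OF L(1)] by (auto simp: q_def)
    then have "card (insert y {w. w > y \<and> occ Y w}) \<le> occ_mult_ge Y q"
      unfolding occ_mult_ge_def using that by (intro card_mono) (auto intro: finite_subset[OF _ finite_occ_holes_upto[OF Y]])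
    then show ?thesis using finite_above_parts[OF L(2)] by (simp add: parts_above_def)
  qed
  have b: "occ_mult_ge Y (Suc q) \<le> parts_above Y y"
  proof -
    have "{z. occ Y z \<and> holes_upto Y z \<ge> Suc q} \<subseteq> {w. w > y \<and> occ Y w}"
    proof
      fix z assume z: "z \<in> {z. occ Y z \<and> holes_upto Y z \<ge> Suc q}"
      have "\<not> z \<le> y"
      proof
        assume "z \<le> y"
        then have "holes_upto Y z \<le> q" unfolding q_def by (rule holes_upto_mono[OF L(1)])
        then show False using z by simp
      qed
      then show "z \<in> {w. w > y \<and> occ Y w}" using z by simp
    qed
    then show ?thesis unfolding occ_mult_ge_def parts_above_def using finite_above_parts[OF L(2)] by (intro card_mono)
  qed
  show False
  proof (cases "p \<le> q")
    case True
    then have "occ_mult_ge Y q \<le> occ_mult_ge Y p" using occ_mult_ge_antimono[OF Y p1] by simp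
    then show False using a True p1 1 2 by linarith
  next
    case False
    then have "occ_mult_ge Y p \<le> occ_mult_ge Y (Suc q)" using occ_mult_ge_antimono[OF Y, of "Suc q" p] by simp
    then show False using b False 1 2 by linarith
  qed
qed

lemma occ_mult_inj:
  assumes X: "charged 0 X" and Y: "charged 0 Y" and e: "\<And>p. p \<ge> 1 \<Longrightarrow> occ_mult X p = occ_mult Y p"
  shows "X = Y"
proof -
  have o: "occ X y = occ Y y" for y
    using occ_occ_mult[OF X Y e, of y] occ_occ_mult[OF Y X, of y] e by auto
  have "s \<in> X \<longleftrightarrow> s \<in> Y" for s
  proof (cases "odd s")
    case True
    then obtain i where "s = 2 * i + 1" by (auto elim: oddE)
    then show ?thesis using o[of i] by (simp add: occ_def)
  next
    case False
    then show ?thesis using X Y by (auto simp: charged_def odds_def)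
  qed
  then show ?thesis by blast
qed

lemma sum_above: "finite J \<Longrightarrow> (\<Sum>j\<in>J. card {q\<in>J. q > j}) = (\<Sum>p<card J. p)" for J :: "nat set"
proof -
  assume J: "finite J"
  have "(\<Sum>j\<in>J. card {q\<in>J. q > j}) = card (Sigma J (\<lambda>j. {q\<in>J. q > j}))" using J by simp
  also have "\<dots> = card (Sigma J (\<lambda>j. {q\<in>J. q < j}))"
    by (rule bij_betw_same_card[of prod.swap], rule bij_betw_byWitness[where f'=prod.swap]) auto
  also have "\<dots> = (\<Sum>j\<in>J. below J j)" using J by (simp add: below_def)
  finally show ?thesis using sum_below[OF J] by simp
qed

text \<open>The size of a partition in terms of its Frobenius coordinates, which are the particles
  and holes. \<open>energy\<close> weighs each of them by an odd number, hence the factor 2.\<close>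

lemma sum_holes_upto:
  assumes "charged 0 X"
  shows "2 * (\<Sum>z | occ X z \<and> holes_upto X z \<ge> 1. holes_upto X z) = energy X"
proof -
  let ?L = "holes X" and ?J = "parts X"
  have L: "finite ?L" "finite ?J" "card ?L = card ?J" using assms by (simp_all add: charged_def)
  let ?S = "{z. occ X z \<and> holes_upto X z \<ge> 1}"
  let ?R = "{r. r \<notin> ?L \<and> holes_upto X (- int r - 1) \<ge> 1}"
  have Hj: "holes_upto X (int j) = j + 1 + card {q\<in>?J. q > j}" for j
    using charge[OF assms, of "int j"] unfolding parts_above_nat by simp
  have S: "?S = int ` ?J \<union> (\<lambda>r. - int r - 1) ` ?R"
  proof (intro equalityI subsetI)
    fix z assume z: "z \<in> ?S"
    show "z \<in> int ` ?J \<union> (\<lambda>r. - int r - 1) ` ?R"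
    proof (cases z rule: int_cases_index)
      case (nonneg j)
      then show ?thesis using z occ_nat(1) by auto
    next
      case (neg r)
      then have "r \<in> ?R" using z occ_nat(2) by auto
      then show ?thesis using neg by blast
    qed
  next
    fix z assume "z \<in> int ` ?J \<union> (\<lambda>r. - int r - 1) ` ?R"
    then consider j where "z = int j" "j \<in> ?J" | r where "z = - int r - 1" "r \<in> ?R" by blast
    then show "z \<in> ?S" by cases (use occ_nat Hj in auto)
  qed
  have fS: "finite ?S" by (rule finite_occ_holes_upto[OF assms])
  have fR: "finite ?R"
  proof -
    have "finite ((\<lambda>r. - int r - 1) ` ?R)" using fS unfolding S by simp
    then show ?thesis by (rule finite_imageD) (simp add: inj_on_def)
  qed
  have "(\<Sum>z\<in>?S. holes_upto X z) = (\<Sum>z\<in>int ` ?J. holes_upto X z) + (\<Sum>z\<in>(\<lambda>r. - int r - 1) ` ?R. holes_upto X z)"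
    unfolding S using L fR by (intro sum.union_disjoint) auto
  also have "(\<Sum>z\<in>int ` ?J. holes_upto X z) = (\<Sum>j\<in>?J. j + 1 + card {q\<in>?J. q > j})"
    by (simp add: sum.reindex Hj)
  also have "\<dots> = (\<Sum>j\<in>?J. j + 1) + (\<Sum>p<card ?J. p)"
    unfolding sum_above[OF L(2), symmetric] by (rule sum.distrib)
  also have "(\<Sum>z\<in>(\<lambda>r. - int r - 1) ` ?R. holes_upto X z) = (\<Sum>r\<in>?R. card {l\<in>?L. l > r})"
  proof -
    have "(\<Sum>z\<in>(\<lambda>r. - int r - 1) ` ?R. holes_upto X z) = (\<Sum>r\<in>?R. holes_upto X (- int r - 1))"
      by (subst sum.reindex) (auto simp: inj_on_def)
    also have "\<dots> = (\<Sum>r\<in>?R. card {l\<in>?L. l > r})"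
    proof (rule sum.cong)
      fix r assume "r \<in> ?R"
      then have "{l\<in>?L. l \<ge> r} = {l\<in>?L. l > r}" by (auto simp: le_less)
      then show "holes_upto X (- int r - 1) = card {l\<in>?L. l > r}" unfolding holes_upto_minus by simp
    qed simp
    finally show ?thesis .
  qed
  also have "(\<Sum>r\<in>?R. card {l\<in>?L. l > r}) = card (Sigma ?R (\<lambda>r. {l\<in>?L. l > r}))" using fR L by simp
  \<comment> \<open>Pairs of an occupied negative place and a hole further out, so far counted from
    the occupied place, are now counted from the hole.\<close>
  also have "\<dots> = card (Sigma ?L (\<lambda>l. {r. r < l \<and> r \<notin> ?L}))"
  proof (rule bij_betw_same_card[of prod.swap], rule bij_betw_byWitness[where f'=prod.swap])
    have "holes_upto X (- int r - 1) \<ge> 1" if "l \<in> ?L" "r < l" for r l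
    proof -
      have "l \<in> {l\<in>?L. l \<ge> r}" using that by simp
      then have "card {l\<in>?L. l \<ge> r} > 0" using L by (auto simp: card_gt_0_iff)
      then show ?thesis unfolding holes_upto_minus by simp
    qed
    then show "prod.swap ` Sigma ?L (\<lambda>l. {r. r < l \<and> r \<notin> ?L}) \<subseteq> Sigma ?R (\<lambda>r. {l\<in>?L. l > r})" by auto
  qed auto
  also have "\<dots> = (\<Sum>l\<in>?L. card {r. r < l \<and> r \<notin> ?L})" using L by simp
  also have "\<dots> = (\<Sum>l\<in>?L. l - below ?L l)"
  proof (rule sum.cong)
    fix l
    have "{r. r < l \<and> r \<notin> ?L} = {..<l} - {x\<in>?L. x < l}" by auto
    then show "card {r. r < l \<and> r \<notin> ?L} = l - below ?L l"
      unfolding below_def by (simp only:) (subst card_Diff_subset, auto intro: finite_subset[of _ "{..<l}"])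
  qed simp
  finally have "(\<Sum>z\<in>?S. holes_upto X z) = (\<Sum>j\<in>?J. j + 1) + (\<Sum>p<card ?J. p) + (\<Sum>l\<in>?L. l - below ?L l)" .
  moreover have "(\<Sum>p<card ?J. p) + (\<Sum>l\<in>?L. l - below ?L l) = (\<Sum>l\<in>?L. l)"
    unfolding L(3)[symmetric] sum_below[OF L(1), symmetric] sum.distrib[symmetric]
    by (intro sum.cong) (auto simp: below_le)
  ultimately have "(\<Sum>z\<in>?S. holes_upto X z) = (\<Sum>j\<in>?J. j + 1) + (\<Sum>l\<in>?L. l)" by simp
  moreover have s1: "(\<Sum>j\<in>A. 2 * j + 1) = 2 * (\<Sum>j\<in>A. j) + card A" for A :: "nat set"
    by (simp only: sum.distrib sum_distrib_left[symmetric] sum_constant) simp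
  moreover have s2: "(\<Sum>j\<in>A. j + 1) = (\<Sum>j\<in>A. j) + card A" for A :: "nat set"
    by (simp only: sum.distrib sum_constant) simp
  ultimately have "(\<Sum>z\<in>?S. holes_upto X z) = (\<Sum>j\<in>?J. j) + card ?J + (\<Sum>l\<in>?L. l)" by (simp only: s2)
  then show ?thesis unfolding energy_def s1 L(3) by linarith
qed

text \<open>Exponents at even indices record the positions of the occupied numbers (the partition of \<open>X\<close>), those at
  odd indices record the operator monomial, apart from its first variable, which has no room and must be absent.\<close>
definition occ_monom :: "int set \<Rightarrow> (nat \<Rightarrow>\<^sub>0 nat) \<Rightarrow> (nat \<Rightarrow>\<^sub>0 nat)" where
  "occ_monom X a = Abs_poly_mapping (\<lambda>k. if even k then occ_mult X (Suc (k div 2)) else lk a (Suc (k div 2)))"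

lemma lookup_occ_monom:
  assumes "charged 0 X"
  shows "lk (occ_monom X a) k = (if even k then occ_mult X (Suc (k div 2)) else lk a (Suc (k div 2)))"
proof -
  obtain M where M: "\<forall>p>M. {z. occ X z \<and> holes_upto X z \<ge> p} = {}" using occ_mult_ge_zero[OF assms] by blast
  have e: "occ_mult X p = 0" if "p > M" for p
  proof -
    have "{z. occ X z \<and> holes_upto X z = p} \<subseteq> {z. occ X z \<and> holes_upto X z \<ge> p}" by auto
    then have "{z. occ X z \<and> holes_upto X z = p} = {}" using M that by blast
    then show ?thesis unfolding occ_mult_def by (simp only: card.empty)
  qed
  obtain N where N: "\<forall>k\<in>ks a. k \<le> N" using finite_nat_set_iff_bounded_le[of "ks a"] by auto
  have "{k. (if even k then occ_mult X (Suc (k div 2)) else lk a (Suc (k div 2))) \<noteq> 0} \<subseteq> {..2 * M + 2 * N + 2}"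
  proof
    fix k assume k: "k \<in> {k. (if even k then occ_mult X (Suc (k div 2)) else lk a (Suc (k div 2))) \<noteq> 0}"
    have "Suc (k div 2) \<le> M \<or> Suc (k div 2) \<le> N"
    proof (cases "even k")
      case True
      then have "occ_mult X (Suc (k div 2)) \<noteq> 0" using k by simp
      then have "\<not> Suc (k div 2) > M" using e[of "Suc (k div 2)"] by (intro notI) simp
      then show ?thesis by simp
    next
      case False
      then have "Suc (k div 2) \<in> ks a" using k by (simp add: in_keys_iff)
      then show ?thesis using N by blast
    qed
    then show "k \<in> {..2 * M + 2 * N + 2}" by auto
  qed
  then have "finite {k. (if even k then occ_mult X (Suc (k div 2)) else lk a (Suc (k div 2))) \<noteq> 0}" by (rule finite_subset) simp
  then show ?thesis unfolding occ_monom_def by simp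
qed

lemma sum_lessThan_double: "(\<Sum>k<2 * M. f k) = (\<Sum>i<M. f (2 * i)) + (\<Sum>i<M. f (2 * i + 1))" for f :: "nat \<Rightarrow> nat"
  by (induction M) (simp_all add: algebra_simps)

text \<open>The variable of index 2i has weight 2i + 2, the energy of a part i + 1; that of index 2i
  + 1 has weight 2i + 3, the weight of operator variable i + 1. No variable of A has weight 1, hence
  the hypothesis on \<open>a\<close>.\<close>

lemma wt_occ_monom:
  assumes "charged 0 X" "lk a 0 = 0"
  shows "wt (occ_monom X a) = energy X + wtd a"
proof -
  obtain M0 where M0: "\<forall>p>M0. {z. occ X z \<and> holes_upto X z \<ge> p} = {}" using occ_mult_ge_zero[OF assms(1)] by blast
  obtain N where N: "\<forall>k\<in>ks a. k \<le> N" using finite_nat_set_iff_bounded_le[of "ks a"] by auto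
  obtain N' where N': "\<forall>k\<in>ks (occ_monom X a). k \<le> N'" using finite_nat_set_iff_bounded_le[of "ks (occ_monom X a)"] by auto
  define M where "M = M0 + N + N' + 1"
  have Hle: "holes_upto X z \<le> M0" if "occ X z" for z
  proof (rule ccontr)
    assume "\<not> holes_upto X z \<le> M0"
    then have "z \<in> {z. occ X z \<and> holes_upto X z \<ge> Suc M0}" using that by simp
    moreover have "{z. occ X z \<and> holes_upto X z \<ge> Suc M0} = {}" by (rule M0[rule_format]) simp
    ultimately show False by simp
  qed
  have "ks (occ_monom X a) \<subseteq> {..<2 * M}" using N' by (force simp: M_def)
  then have "wt (occ_monom X a) = (\<Sum>k<2 * M. lk (occ_monom X a) k * (k + 2))" by (intro wt_superset) auto
  also have "\<dots> = (\<Sum>i<M. occ_mult X (Suc i) * (2 * i + 2)) + (\<Sum>i<M. lk a (Suc i) * (2 * i + 3))"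
    unfolding sum_lessThan_double
  proof (intro arg_cong2[where f="(+)"] sum.cong refl)
    fix i
    have l: "lk (occ_monom X a) (2 * i) = occ_mult X (Suc i)" "lk (occ_monom X a) (2 * i + 1) = lk a (Suc i)"
      by (simp_all add: lookup_occ_monom assms(1))
    have e: "2 * i + 1 + 2 = 2 * i + (3::nat)" by simp
    show "lk (occ_monom X a) (2 * i) * (2 * i + 2) = occ_mult X (Suc i) * (2 * i + 2)" unfolding l ..
    show "lk (occ_monom X a) (2 * i + 1) * (2 * i + 1 + 2) = lk a (Suc i) * (2 * i + 3)" unfolding l e ..
  qed
  also have "(\<Sum>i<M. lk a (Suc i) * (2 * i + 3)) = wtd a"
  proof -
    have "ks a \<subseteq> {..<Suc M}" using N by (force simp: M_def)
    then have "wtd a = (\<Sum>k<Suc M. lk a k * (2 * k + 1))" by (intro wtd_superset) auto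
    also have "\<dots> = lk a 0 * (2 * 0 + 1) + (\<Sum>i<M. lk a (Suc i) * (2 * Suc i + 1))"
      by (rule sum.lessThan_Suc_shift)
    also have "(\<Sum>i<M. lk a (Suc i) * (2 * Suc i + 1)) = (\<Sum>i<M. lk a (Suc i) * (2 * i + 3))"
    proof -
      have "2 * Suc i + 1 = 2 * i + 3" for i by simp
      then show ?thesis by (simp only:)
    qed
    finally show ?thesis by (simp only: assms(2) mult_0 add_0)
  qed
  also have "(\<Sum>i<M. occ_mult X (Suc i) * (2 * i + 2)) = 2 * (\<Sum>i<M. occ_mult X (Suc i) * Suc i)"
    by (simp add: sum_distrib_left algebra_simps)
  also have "(\<Sum>i<M. occ_mult X (Suc i) * Suc i) = (\<Sum>p\<in>{1..M}. occ_mult X p * p)"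
    by (rule sum.reindex_bij_witness[of _ "\<lambda>p. p - 1" Suc]) auto
  also have "\<dots> = (\<Sum>p\<in>{1..M}. \<Sum>z\<in>{z \<in> {z. occ X z \<and> holes_upto X z \<ge> 1}. holes_upto X z = p}. holes_upto X z)"
  proof (rule sum.cong)
    fix p assume p: "p \<in> {1..M}"
    have "{z \<in> {z. occ X z \<and> holes_upto X z \<ge> 1}. holes_upto X z = p} = {z. occ X z \<and> holes_upto X z = p}" using p by auto
    then show "occ_mult X p * p = (\<Sum>z\<in>{z \<in> {z. occ X z \<and> holes_upto X z \<ge> 1}. holes_upto X z = p}. holes_upto X z)" by (simp add: occ_mult_def)
  qed simp
  also have "\<dots> = (\<Sum>z | occ X z \<and> holes_upto X z \<ge> 1. holes_upto X z)"
  proof (rule sum.group)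
    show "holes_upto X ` {z. occ X z \<and> holes_upto X z \<ge> 1} \<subseteq> {1..M}"
    proof
      fix p assume "p \<in> holes_upto X ` {z. occ X z \<and> holes_upto X z \<ge> 1}"
      then obtain z where z: "occ X z" "p = holes_upto X z" "p \<ge> 1" by auto
      then show "p \<in> {1..M}" using Hle[OF z(1)] by (simp add: M_def)
    qed
  qed (use finite_occ_holes_upto[OF assms(1)] in simp_all)
  also have "2 * \<dots> = energy X" by (rule sum_holes_upto[OF assms(1)])
  finally show ?thesis .
qed

text \<open>Trades the first operator variable for a shift of the charge: from charge $-1$ to $-3$.\<close>
definition shiftX :: "int set \<Rightarrow> int set" where "shiftX X = (\<lambda>s. s - 2) ` X"

lemma mem_shiftX: "s \<in> shiftX X \<longleftrightarrow> s + 2 \<in> X"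
  unfolding shiftX_def by (metis (no_types, lifting) add_diff_cancel_right' diff_add_cancel image_iff)

lemma holes_shiftX: "holes (shiftX X) = Suc ` holes X \<union> ({0} - parts X)"
proof (intro equalityI subsetI)
  fix r assume r: "r \<in> holes (shiftX X)"
  show "r \<in> Suc ` holes X \<union> ({0} - parts X)"
  proof (cases r)
    case (Suc r')
    have "- od r + 2 = - od r'" using Suc by simp
    moreover have "- od r + 2 \<notin> X" using r unfolding holes_def mem_Collect_eq mem_shiftX .
    ultimately have "r' \<in> holes X" unfolding holes_def mem_Collect_eq by metis
    then show ?thesis using Suc by blast
  qed (use r in \<open>simp add: holes_def mem_shiftX parts_def\<close>)
next
  fix r assume "r \<in> Suc ` holes X \<union> ({0} - parts X)"
  then consider r' where "r = Suc r'" "r' \<in> holes X" | "r = 0" "0 \<notin> parts X" by auto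
  then show "r \<in> holes (shiftX X)"
  proof cases
    case 1
    have "- od r + 2 = - od r'" using 1 by simp
    moreover have "- od r' \<notin> X" using 1(2) unfolding holes_def mem_Collect_eq .
    ultimately show ?thesis unfolding holes_def mem_Collect_eq mem_shiftX by metis
  qed (simp add: holes_def mem_shiftX parts_def)
qed

lemma parts_shiftX: "parts (shiftX X) = (\<lambda>r. r - 1) ` (parts X - {0})"
proof (intro equalityI subsetI)
  fix r assume "r \<in> parts (shiftX X)"
  then have "Suc r \<in> parts X - {0}" by (simp add: parts_def mem_shiftX algebra_simps)
  then show "r \<in> (\<lambda>r. r - 1) ` (parts X - {0})" by force
next
  fix r assume "r \<in> (\<lambda>r. r - 1) ` (parts X - {0})"
  then obtain q where "q \<in> parts X" "q \<noteq> 0" "r = q - 1" by auto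
  then show "r \<in> parts (shiftX X)" by (cases q) (simp_all add: parts_def mem_shiftX algebra_simps)
qed

text \<open>The gain of 1 in energy makes up for the weight of the operator variable that
  \<open>card_basis_le_0\<close> removes at the same time. The case distinction concerns the lowest
  particle place, which becomes a negative one.\<close>

lemma shiftX_charged:
  assumes "charged 0 X"
  shows "charged 1 (shiftX X)" "energy (shiftX X) = energy X + 1"
proof -
  let ?L = "holes X" and ?J = "parts X"
  have L: "finite ?L" "finite ?J" "card ?L = card ?J" "odds X" using assms by (simp_all add: charged_def)
  have o: "odds (shiftX X)" using L(4) by (auto simp: odds_def shiftX_def)
  have inj: "inj_on (\<lambda>r::nat. r - 1) (?J - {0})" by (auto simp: inj_on_def)
  have cp: "card (parts (shiftX X)) = card (?J - {0})" unfolding parts_shiftX by (rule card_image[OF inj])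
  have ch: "card (holes (shiftX X)) = card ?L + card ({0} - ?J)"
    unfolding holes_shiftX using L by (subst card_Un_disjoint) (auto simp: card_image)
  have sp: "(\<Sum>j\<in>parts (shiftX X). 2 * j + 1) + 2 * card (?J - {0}) = (\<Sum>j\<in>?J - {0}. 2 * j + 1)"
  proof -
    have "(\<Sum>j\<in>parts (shiftX X). 2 * j + 1) = (\<Sum>j\<in>?J - {0}. 2 * (j - 1) + 1)"
      unfolding parts_shiftX by (subst sum.reindex[OF inj]) simp
    moreover have "(\<Sum>j\<in>?J - {0}. 2 * (j - 1) + 1 + 2) = (\<Sum>j\<in>?J - {0}. 2 * (j - 1) + 1) + (\<Sum>j\<in>?J - {0}. 2)"
      by (rule sum.distrib)
    ultimately have "(\<Sum>j\<in>parts (shiftX X). 2 * j + 1) + 2 * card (?J - {0}) = (\<Sum>j\<in>?J - {0}. 2 * (j - 1) + 1 + 2)"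
      by simp
    also have "\<dots> = (\<Sum>j\<in>?J - {0}. 2 * j + 1)" by (rule sum.cong) auto
    finally show ?thesis .
  qed
  have sh: "(\<Sum>l\<in>holes (shiftX X). 2 * l + 1) = (\<Sum>l\<in>?L. 2 * l + 1) + 2 * card ?L + card ({0} - ?J)"
  proof -
    have "(\<Sum>l\<in>holes (shiftX X). 2 * l + 1) = (\<Sum>l\<in>Suc ` ?L. 2 * l + 1) + (\<Sum>l\<in>{0} - ?J. 2 * l + 1)"
      unfolding holes_shiftX using L by (intro sum.union_disjoint) auto
    also have "(\<Sum>l\<in>Suc ` ?L. 2 * l + 1) = (\<Sum>l\<in>?L. 2 * l + 1 + 2)"
      by (simp add: sum.reindex)
    also have "\<dots> = (\<Sum>l\<in>?L. 2 * l + 1) + (\<Sum>l\<in>?L. 2)"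
      by (rule sum.distrib)
    also have "(\<Sum>l\<in>?L. 2) = 2 * card ?L" by simp
    also have "(\<Sum>l\<in>{0} - ?J. 2 * l + 1) = card ({0} - ?J)"
    proof (cases "0 \<in> ?J")
      case False
      then have "{0} - ?J = {0}" by auto
      then show ?thesis by (simp only:) simp
    qed auto
    finally show ?thesis .
  qed
  have fin: "finite (holes (shiftX X))" "finite (parts (shiftX X))" unfolding holes_shiftX parts_shiftX using L by simp_all
  define c where "c = card (?J - {0})"
  define e :: nat where "e = (if 0 \<in> ?J then 1 else 0)"
  have J: "card ?J = c + e"
  proof (cases "0 \<in> ?J")
    case True
    then show ?thesis using card_Suc_Diff1[OF L(2) True] by (simp only: c_def e_def if_True)
  qed (simp add: c_def e_def)
  have z: "card ({0} - ?J) = 1 - e" by (simp add: e_def insert_Diff_if)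
  have e1: "e \<le> 1" by (simp add: e_def)
  have s: "(\<Sum>j\<in>?J. 2 * j + 1) = (\<Sum>j\<in>?J - {0}. 2 * j + 1) + e"
  proof (cases "0 \<in> ?J")
    case True
    then show ?thesis using sum.remove[OF L(2) True, of "\<lambda>j. 2 * j + 1"] by (simp add: e_def)
  qed (simp add: e_def)
  have "card (holes (shiftX X)) = card (parts (shiftX X)) + 1"
    unfolding ch cp z c_def[symmetric] L(3) J using e1 by linarith
  then show "charged 1 (shiftX X)" using o fin by (simp add: charged_def)
  have arith: "SL + 2 * (c + e) + (1 - e) + P = SL + (Q + e) + 1" if "P + 2 * c = Q" for SL P Q :: nat
    using that e1 by arith
  show "energy (shiftX X) = energy X + 1"
    unfolding energy_def sh s z L(3) J by (rule arith[OF sp[folded c_def]])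
qed

section \<open>Counting in bounded degree\<close>

definition basis_le :: "nat \<Rightarrow> nat \<Rightarrow> (int set \<times> (nat \<Rightarrow>\<^sub>0 nat)) set" where
  "basis_le k d = {(X, a). charged k X \<and> energy X + wtd a \<le> d}"

lemma finite_bounded_exponents:
  fixes E :: "(nat \<Rightarrow>\<^sub>0 nat) set" and d :: nat
  assumes "\<And>a. a \<in> E \<Longrightarrow> ks a \<subseteq> {..d} \<and> (\<forall>k. lk a k \<le> d)"
  shows "finite E"
proof (rule finite_imageD)
  have "lk ` E \<subseteq> {f. \<forall>x. (x \<in> {..d} \<longrightarrow> f x \<in> {..d}) \<and> (x \<notin> {..d} \<longrightarrow> f x = 0)}"
    using assms by (auto simp: in_keys_iff subset_iff)
  then show "finite (lk ` E)" by (rule finite_subset) (intro finite_set_of_finite_funs; simp)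
  show "inj_on lk E"
  proof (rule inj_onI)
    fix a b :: "nat \<Rightarrow>\<^sub>0 nat" assume "lk a = lk b"
    then show "a = b" by (intro poly_mapping_eqI) (rule fun_cong)
  qed
qed

lemma weighted_sum_bound:
  fixes a :: "nat \<Rightarrow>\<^sub>0 nat"
  assumes "(\<Sum>k\<in>ks a. lk a k * w k) \<le> d" "\<And>k. w k \<ge> k" "\<And>k. w k \<ge> 1"
  shows "ks a \<subseteq> {..d} \<and> (\<forall>k. lk a k \<le> d)"
proof -
  have le: "lk a k * w k \<le> d" for k
  proof (cases "k \<in> ks a")
    case True
    then have "lk a k * w k \<le> (\<Sum>k\<in>ks a. lk a k * w k)" by (intro member_le_sum) auto
    then show ?thesis using assms(1) by simp
  qed (simp add: in_keys_iff)
  have "k \<le> d" if "k \<in> ks a" for k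
  proof -
    have "1 * k \<le> lk a k * w k" using that assms(2)[of k] by (intro mult_le_mono) (auto simp: in_keys_iff)
    then show ?thesis using le[of k] by simp
  qed
  moreover have "lk a k \<le> d" for k
  proof -
    have "lk a k * 1 \<le> lk a k * w k" using assms(3)[of k] by (intro mult_le_mono) auto
    from order_trans[OF this le] show ?thesis by simp
  qed
  ultimately show ?thesis by auto
qed

lemma finite_wt: "finite {m. wt m \<le> d}"
  by (rule finite_bounded_exponents[of _ d]) (auto simp: wt_def dest!: weighted_sum_bound[of _ "\<lambda>k. k + 2", simplified])

lemma finite_wtd: "finite {a. wtd a \<le> d}"
  by (rule finite_bounded_exponents[of _ d]) (auto simp: wtd_def dest!: weighted_sum_bound[of _ "\<lambda>k. 2 * k + 1", simplified])

lemma energy_bound: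
  assumes "charged k X" "energy X \<le> d"
  shows "holes X \<subseteq> {..d}" "parts X \<subseteq> {..d}"
proof -
  have f: "finite (holes X)" "finite (parts X)" using assms by (simp_all add: charged_def)
  have "l \<le> d" if "l \<in> holes X" for l
  proof -
    have "2 * l + 1 \<le> (\<Sum>l\<in>holes X. 2 * l + 1)" using f that by (intro member_le_sum) auto
    then show ?thesis using assms by (simp add: energy_def)
  qed
  moreover have "l \<le> d" if "l \<in> parts X" for l
  proof -
    have "2 * l + 1 \<le> (\<Sum>l\<in>parts X. 2 * l + 1)" using f that by (intro member_le_sum) auto
    then show ?thesis using assms by (simp add: energy_def)
  qed
  ultimately show "holes X \<subseteq> {..d}" "parts X \<subseteq> {..d}" by auto
qed

lemma finite_basis_le: "finite (basis_le k d)"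
proof -
  have "basis_le k d \<subseteq> (\<lambda>((L, J), a). (mkX L J, a)) ` ((Pow {..d} \<times> Pow {..d}) \<times> {a. wtd a \<le> d})"
  proof
    fix z assume "z \<in> basis_le k d"
    then obtain X a where z: "z = (X, a)" "charged k X" "energy X + wtd a \<le> d" by (auto simp: basis_le_def)
    have "X = mkX (holes X) (parts X)" using z(2) by (simp add: charged_def mkX_holes_parts)
    moreover have "holes X \<subseteq> {..d}" "parts X \<subseteq> {..d}" using energy_bound[OF z(2), of d] z(3) by auto
    ultimately show "z \<in> (\<lambda>((L, J), a). (mkX L J, a)) ` ((Pow {..d} \<times> Pow {..d}) \<times> {a. wtd a \<le> d})"
      using z by (intro image_eqI[of _ _ "((holes X, parts X), a)"]) auto
  qed
  then show ?thesis by (rule finite_subset) (intro finite_imageI finite_cartesian_product finite_wtd; simp)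
qed

text \<open>A basis element is sent to a monomial of A if the first operator variable is absent;
  otherwise one factor of it is removed and the configuration is shifted. Both branches preserve the
  degree and can be inverted.\<close>

lemma card_basis_le_0: "card (basis_le 0 d) \<le> card {m. wt m \<le> d} + card (basis_le 1 d)"
proof -
  define f where "f = (\<lambda>(X, a). if lk a 0 = 0 then Inl (occ_monom X a) else Inr (shiftX X, a - sg 0 1))"
  have "inj_on f (basis_le 0 d)"
  proof (rule inj_onI, clarify)
    fix X a Y b assume A: "(X, a) \<in> basis_le 0 d" "(Y, b) \<in> basis_le 0 d" "f (X, a) = f (Y, b)"
    then have V: "charged 0 X" "charged 0 Y" by (simp_all add: basis_le_def)
    show "X = Y \<and> a = b"
    proof (cases "lk a 0 = 0")
      case True
      then have b0: "lk b 0 = 0" and m: "occ_monom X a = occ_monom Y b" using A(3) by (auto simp: f_def split: if_splits)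
      have e: "occ_mult X p = occ_mult Y p" if "p \<ge> 1" for p
        using arg_cong[OF m, of "\<lambda>m. lk m (2 * (p - 1))"] that by (simp add: lookup_occ_monom V)
      have "lk a k = lk b k" for k
        using arg_cong[OF m, of "\<lambda>m. lk m (2 * (k - 1) + 1)"] True b0 by (cases k) (simp_all add: lookup_occ_monom V)
      then show ?thesis using occ_mult_inj[OF V e] by (simp add: poly_mapping_eqI)
    next
      case False
      then have b0: "lk b 0 \<noteq> 0" and m: "shiftX X = shiftX Y" "a - sg 0 1 = b - sg 0 1"
        using A(3) by (auto simp: f_def split: if_splits)
      have "s \<in> X \<longleftrightarrow> s \<in> Y" for s
        using mem_shiftX[of "s - 2" X] mem_shiftX[of "s - 2" Y] m(1) by simp
      then have "X = Y" by blast
      moreover have "lk a k = lk b k" for k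
        using arg_cong[OF m(2), of "\<lambda>m. lk m k"] False b0 by (cases "k = 0") (simp_all add: lookup_minus lookup_single)
      ultimately show ?thesis by (simp add: poly_mapping_eqI)
    qed
  qed
  moreover have "f ` basis_le 0 d \<subseteq> {m. wt m \<le> d} <+> basis_le 1 d"
  proof
    fix z assume "z \<in> f ` basis_le 0 d"
    then obtain X a where z: "z = f (X, a)" "charged 0 X" "energy X + wtd a \<le> d" by (auto simp: basis_le_def)
    show "z \<in> {m. wt m \<le> d} <+> basis_le 1 d"
    proof (cases "lk a 0 = 0")
      case True
      then show ?thesis using z wt_occ_monom[OF z(2) True] by (auto simp: f_def)
    next
      case False
      then have "a = (a - sg 0 1) + sg 0 1"
        by (intro poly_mapping_eqI) (auto simp: lookup_add lookup_minus lookup_single when_def)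
      from arg_cong[OF this, of wtd] have "wtd a = wtd (a - sg 0 1) + 1" by (simp only: wtd_add wtd_single) simp
      then have "energy (shiftX X) + wtd (a - sg 0 1) \<le> d" using z(3) shiftX_charged(2)[OF z(2)] by simp
      then have "(shiftX X, a - sg 0 1) \<in> basis_le 1 d" using shiftX_charged(1)[OF z(2)] by (simp add: basis_le_def)
      then have "Inr (shiftX X, a - sg 0 1) \<in> {m. wt m \<le> d} <+> basis_le 1 d" by (rule InrI)
      then show ?thesis using False z(1) by (simp add: f_def)
    qed
  qed
  ultimately have "card (basis_le 0 d) \<le> card ({m. wt m \<le> d} <+> basis_le 1 d)"
    by (intro card_inj_on_le[of f]) (simp_all add: finite_wt finite_basis_le)
  then show ?thesis by (simp add: card_Plus finite_wt finite_basis_le)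
qed

text \<open>Gaussian elimination: a vector with nonzero coordinate \<open>j\<close> clears this
  coordinate in the others, and one vector and one coordinate drop out.\<close>

lemma linear_dependence:
  fixes M :: "'i \<Rightarrow> 'j \<Rightarrow> 'a::field"
  assumes "finite J" "finite I" "card J < card I"
  shows "\<exists>c. (\<exists>i\<in>I. c i \<noteq> 0) \<and> (\<forall>j\<in>J. (\<Sum>i\<in>I. c i * M i j) = 0)"
  using assms
proof (induction J arbitrary: I M rule: finite_induct)
  case empty
  then have "I \<noteq> {}" by auto
  then show ?case by (intro exI[of _ "\<lambda>_. 1"]) auto
next
  case (insert j J)
  show ?case
  proof (cases "\<forall>i\<in>I. M i j = 0")
    case True
    obtain c where "\<exists>i\<in>I. c i \<noteq> 0" "\<forall>j\<in>J. (\<Sum>i\<in>I. c i * M i j) = 0"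
      using insert.IH[of I M] insert.prems insert.hyps by auto
    then show ?thesis using True by (intro exI[of _ c]) auto
  next
    case False
    then obtain i0 where i0: "i0 \<in> I" "M i0 j \<noteq> 0" by auto
    let ?I = "I - {i0}"
    define t where "t i = M i j / M i0 j" for i
    have "card J < card ?I" using insert i0 by simp
    then obtain c where c: "\<exists>i\<in>?I. c i \<noteq> 0" "\<forall>k\<in>J. (\<Sum>i\<in>?I. c i * (M i k - t i * M i0 k)) = 0"
      using insert.IH[of ?I "\<lambda>i k. M i k - t i * M i0 k"] insert.prems by auto
    \<comment> \<open>The coefficient of the pivot collects all the multiples of it that were
      subtracted.\<close>
    define c' where "c' = c(i0 := - (\<Sum>i\<in>?I. c i * t i))"
    have s: "(\<Sum>i\<in>I. c' i * M i k) = (\<Sum>i\<in>?I. c i * (M i k - t i * M i0 k))" for k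
    proof -
      have "(\<Sum>i\<in>I. c' i * M i k) = c' i0 * M i0 k + (\<Sum>i\<in>?I. c' i * M i k)"
        using insert.prems i0 by (simp add: sum.remove)
      also have "(\<Sum>i\<in>?I. c' i * M i k) = (\<Sum>i\<in>?I. c i * M i k)" by (intro sum.cong) (auto simp: c'_def)
      finally show ?thesis
        by (simp add: c'_def algebra_simps sum_subtractf sum_distrib_left sum_distrib_right)
    qed
    have "(\<Sum>i\<in>I. c' i * M i j) = 0"
      unfolding s using i0 by (intro sum.neutral) (simp add: t_def)
    moreover have "\<exists>i\<in>I. c' i \<noteq> 0" using c(1) by (auto simp: c'_def)
    ultimately show ?thesis using c(2) s by (intro exI[of _ c']) auto
  qed
qed

section \<open>The kernel of the evaluation map\<close>

definition deg_le :: "nat \<Rightarrow> fock \<Rightarrow> bool" where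
  "deg_le d x \<longleftrightarrow> (\<forall>X a. lk (lk x X) a \<noteq> 0 \<longrightarrow> energy X + wtd a \<le> d)"

lemma deg_le_0: "deg_le d 0"
  by (simp add: deg_le_def)

lemma deg_le_add: "deg_le d x \<Longrightarrow> deg_le d y \<Longrightarrow> deg_le d (x + y)"
  unfolding deg_le_def
proof (intro allI impI)
  fix X a assume x: "\<forall>X a. lk (lk x X) a \<noteq> 0 \<longrightarrow> energy X + wtd a \<le> d" and y: "\<forall>X a. lk (lk y X) a \<noteq> 0 \<longrightarrow> energy X + wtd a \<le> d"
    and "lk (lk (x + y) X) a \<noteq> 0"
  then have "lk (lk x X) a \<noteq> 0 \<or> lk (lk y X) a \<noteq> 0" by (auto simp: lookup_add)
  then show "energy X + wtd a \<le> d" using x y by blast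
qed

lemma deg_le_sum: "(\<And>i. i \<in> A \<Longrightarrow> deg_le d (f i)) \<Longrightarrow> deg_le d (\<Sum>i\<in>A. f i)"
  by (induction A rule: infinite_finite_induct) (simp_all add: deg_le_0 deg_le_add)

lemma deg_le_single: "energy X + wtd a \<le> d \<Longrightarrow> deg_le d (sg X (sg a c))"
  unfolding deg_le_def by (simp add: lookup_single when_def)

lemma fock_expansion: "x = (\<Sum>X\<in>ks x. \<Sum>a\<in>ks (lk x X). sg X (sg a (lk (lk x X) a)))" for x :: fock
proof -
  have "(\<Sum>X\<in>ks x. \<Sum>a\<in>ks (lk x X). sg X (sg a (lk (lk x X) a))) = (\<Sum>X\<in>ks x. sg X (\<Sum>a\<in>ks (lk x X). sg a (lk (lk x X) a)))"
    by (simp only: additive_imps(5)[OF additive_single])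
  also have "\<dots> = (\<Sum>X\<in>ks x. sg X (lk x X))"
    by (simp only: pm_sum_singles[symmetric])
  also have "\<dots> = x" by (rule pm_sum_singles[symmetric])
  finally show ?thesis by (rule sym)
qed

lemma deg_le_op:
  assumes G: "Modules.additive G" "\<And>X a c. charged k X \<Longrightarrow> energy X + wtd a \<le> d \<Longrightarrow> deg_le d (G (sg X (sg a c)))"
    and x: "x \<in> Mk k" "deg_le d x"
  shows "deg_le d (G x)"
proof -
  have "G x = G (\<Sum>X\<in>ks x. \<Sum>a\<in>ks (lk x X). sg X (sg a (lk (lk x X) a)))"
    by (rule arg_cong[where f=G]) (rule fock_expansion)
  also have "\<dots> = (\<Sum>X\<in>ks x. \<Sum>a\<in>ks (lk x X). G (sg X (sg a (lk (lk x X) a))))"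
    by (simp only: additive_imps(5)[OF G(1)])
  also have "deg_le d \<dots>"
  proof (intro deg_le_sum G(2))
    fix X a assume X: "X \<in> ks x" and a: "a \<in> ks (lk x X)"
    show "charged k X" using x(1) X by (simp add: Mk_iff)
    have "lk (lk x X) a \<noteq> 0" using a by (simp add: in_keys_iff)
    then show "energy X + wtd a \<le> d" using x(2) unfolding deg_le_def by blast
  qed
  finally show ?thesis .
qed

lemma energy_insert_neg:
  assumes "charged k X" "- od r \<notin> X"
  shows "energy (insert (- od r) X) + (2 * r + 1) = energy X"
proof -
  have "r \<in> holes X" "finite (holes X)" using assms by (simp_all add: holes_def charged_def)
  then have "(\<Sum>l\<in>holes X. 2 * l + 1) = 2 * r + 1 + (\<Sum>l\<in>holes X - {r}. 2 * l + 1)" by (rule sum.remove[rotated])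
  then show ?thesis unfolding energy_def holes_insert parts_insert by linarith
qed

lemma energy_insert_both:
  assumes "charged k X" "- od r \<notin> X" "od r \<notin> X"
  shows "energy (insert (- od r) (insert (od r) X)) = energy X"
proof -
  have h: "r \<in> holes X" "finite (holes X)" "r \<notin> parts X" "finite (parts X)" using assms by (simp_all add: holes_def parts_def charged_def)
  then have "(\<Sum>l\<in>holes X. 2 * l + 1) = 2 * r + 1 + (\<Sum>l\<in>holes X - {r}. 2 * l + 1)" by (intro sum.remove)
  moreover have "(\<Sum>j\<in>insert r (parts X). 2 * j + 1) = 2 * r + 1 + (\<Sum>j\<in>parts X. 2 * j + 1)" using h by (intro sum.insert)
  ultimately show ?thesis unfolding energy_def holes_insert parts_insert by linarith
qed

lemma energy_remove_neg:
  assumes "charged k X" "- od r \<in> X"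
  shows "energy (X - {- od r}) = energy X + (2 * r + 1)"
proof -
  have h: "r \<notin> holes X" "finite (holes X)" using assms by (simp_all add: holes_def charged_def)
  have "(\<Sum>l\<in>insert r (holes X). 2 * l + 1) = 2 * r + 1 + (\<Sum>l\<in>holes X. 2 * l + 1)" using h by (intro sum.insert)
  then show ?thesis unfolding energy_def holes_remove parts_remove by linarith
qed

lemma sign_single: "(-1) ^ k * sg b (d::complex) = sg b ((-1) ^ k * d)" for b :: "nat \<Rightarrow>\<^sub>0 nat"
  by (cases "even k") (simp_all add: single_uminus)

lemma pd_single: "pd r (sg a c) = sg (a - sg r 1) (of_nat (lk a r) * c)"
proof -
  have "dmono (\<lambda>k. if k = r then 1 else 0) a = (\<Sum>k\<in>ks a. if k = r then of_nat (lk a k) * sg (a - sg k 1) 1 else 0)"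
    unfolding dmono_def by (intro sum.cong) auto
  also have "\<dots> = of_nat (lk a r) * sg (a - sg r 1) 1" by (auto simp: in_keys_iff)
  finally have "pd r (sg a c) = cst (of_nat (lk a r) * c) * sg (a - sg r 1) 1" by (simp add: pd_def der_single mult_ac)
  then show ?thesis by (simp only: single_cst[symmetric])
qed

text \<open>Filling the hole \<open>r\<close> loses the energy that the new variable adds. In the
  same way \<open>Cop\<close> moves energy from a hole to a particle and \<open>KF\<close> turns a
  variable into a hole.\<close>

lemma deg_le_Qop: "x \<in> Mk k \<Longrightarrow> deg_le d x \<Longrightarrow> deg_le d (Qop x)"
proof (rule deg_le_op[OF additive_Qop])
  fix X a c assume X: "charged k X" "energy X + wtd a \<le> d"
  show "deg_le d (Qop (sg X (sg a c)))" unfolding Qop_single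
  proof (rule deg_le_sum)
    fix r assume "r \<in> holes X"
    then have n: "- od r \<notin> X" unfolding holes_def mem_Collect_eq .
    have "energy (insert (- od r) X) + wtd (sg r 1 + a) \<le> d"
      using energy_insert_neg[OF X(1) n] X(2) unfolding wtd_add wtd_single mult_1_left by linarith
    then show "deg_le d (rpsi (- od r) (sg X (dv r * sg a c)))"
      unfolding rpsi_single mult_single mult_1_left sign_single using n by (simp only: if_False deg_le_single)
  qed
qed

lemma deg_le_Cop: "x \<in> Mk k \<Longrightarrow> deg_le d x \<Longrightarrow> deg_le d (Cop x)"
proof (rule deg_le_op[OF additive_Cop])
  fix X a c assume X: "charged k X" "energy X + wtd a \<le> d"
  show "deg_le d (Cop (sg X (sg a c)))" unfolding Cop_single
  proof (rule deg_le_sum)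
    fix r assume "r \<in> holes X"
    then have n: "- od r \<notin> X" unfolding holes_def mem_Collect_eq .
    show "deg_le d (rpsi (- od r) (rpsi (od r) (sg X (sg a c))))"
    proof (cases "od r \<in> X")
      case True
      then show ?thesis unfolding rpsi_single[of "od r"] by (simp only: if_True additive_imps(1)[OF additive_rpsi] deg_le_0)
    next
      case False
      have n': "- od r \<notin> insert (od r) X" using n by simp
      have "energy (insert (- od r) (insert (od r) X)) + wtd a \<le> d"
        using energy_insert_both[OF X(1) n False] X(2) by linarith
      then show ?thesis
        using False n' by (simp only: rpsi_single if_False sign_single deg_le_single)
    qed
  qed
qed

lemma deg_le_KF: "x \<in> Mk k \<Longrightarrow> deg_le d x \<Longrightarrow> deg_le d (KF F x)"
proof (rule deg_le_op[OF additive_KF])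
  fix X a c assume X: "charged k X" "energy X + wtd a \<le> d"
  show "deg_le d (KF F (sg X (sg a c)))" unfolding KF_def cmap_single[OF additive_pd] pd_single
  proof (rule deg_le_sum)
    fix r
    show "deg_le d (rphi (- od r) (sg X (sg (a - sg r 1) (of_nat (lk a r) * c))))"
    proof (cases "lk a r = 0 \<or> - od r \<notin> X")
      case True
      then have "rphi (- od r) (sg X (sg (a - sg r 1) (of_nat (lk a r) * c))) = 0"
        unfolding rphi_single by auto
      then show ?thesis by (simp only: deg_le_0)
    next
      case False
      then have "a = (a - sg r 1) + sg r 1"
        by (intro poly_mapping_eqI) (auto simp: lookup_add lookup_minus lookup_single when_def)
      from arg_cong[OF this, of wtd] have "wtd a = wtd (a - sg r 1) + (2 * r + 1)"
        by (simp only: wtd_add wtd_single mult_1_left)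
      moreover have m: "- od r \<in> X" using False by blast
      ultimately have "energy (X - {- od r}) + wtd (a - sg r 1) \<le> d"
        using energy_remove_neg[OF X(1) m] X(2) by linarith
      then show ?thesis by (simp only: rphi_single m if_True sign_single deg_le_single)
    qed
  qed
qed

lemma lookup_diag_op: "lk (lk (diag_op g x) X) a = g X a * lk (lk x X) a"
proof (rule fock_ext[where x=x])
  show "Modules.additive (\<lambda>x. lk (lk (diag_op g x) X) a)"
    by (simp add: additive_def additive_imps[OF additive_diag_op] lookup_add)
  show "Modules.additive (\<lambda>x. g X a * lk (lk x X) a)"
    by (simp add: additive_def lookup_add distrib_left)
  show "lk (lk (diag_op g (sg Y (sg b c))) X) a = g X a * lk (lk (sg Y (sg b c)) X) a" for Y b c
    unfolding diag_op_single by (simp add: lookup_single when_def)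
qed

abbreviation ftrunc :: "(nat \<Rightarrow> bool) \<Rightarrow> fock \<Rightarrow> fock" where
  "ftrunc T \<equiv> diag_op (\<lambda>X a. if T (energy X + wtd a) then 1 else 0)"

lemma charged_0: "charged 0 X \<longleftrightarrow> valid (-1) X"
  unfolding charged_def valid_0 by simp

lemma homog_ev2_single:
  assumes "charged 0 X"
  shows "homog (energy X + wtd a) (ev2 (sg X (sg a c)))"
proof -
  have v: "valid (-1) X" using assms by (simp add: charged_0)
  have "homog (energy X) (sdet zt (holes X) (parts X))"
    unfolding energy_def using assms by (intro homog_sdet_zt) (simp_all add: charged_def)
  then have "homog (energy X) (cst ((-1) ^ (\<Sum>l\<in>holes X. l)) * sdet zt (holes X) (parts X))" by (rule homog_cst_mult)
  then have "homog (energy X) (ev2_basis X)" unfolding ev2_basis_valid[OF v] by simp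
  then show ?thesis unfolding ev2_single dact_single by (intro homog_cst_mult homog_dmon)
qed

lemma trunc_ev2: "x \<in> Mk 0 \<Longrightarrow> trunc T (ev2 x) = ev2 (ftrunc T x)"
proof (rule fock_ext[where x=x and F="\<lambda>x. trunc T (ev2 x)" and G="\<lambda>x. ev2 (ftrunc T x)"])
  show "Modules.additive (\<lambda>x. trunc T (ev2 x))" by (rule additive_comp[OF additive_trunc additive_ev2])
  show "Modules.additive (\<lambda>x. ev2 (ftrunc T x))" by (rule additive_comp[OF additive_ev2 additive_diag_op])
  fix X a c assume "x \<in> Mk 0" "X \<in> ks x"
  then have "charged 0 X" by (simp add: Mk_iff)
  then have "trunc T (ev2 (sg X (sg a c))) = (if T (energy X + wtd a) then ev2 (sg X (sg a c)) else 0)"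
    by (intro trunc_homog homog_ev2_single)
  then show "trunc T (ev2 (sg X (sg a c))) = ev2 (ftrunc T (sg X (sg a c)))"
    unfolding diag_op_single by (simp add: additive_imps[OF additive_ev2])
qed

abbreviation sc :: "complex \<Rightarrow> fock \<Rightarrow> fock" where "sc c \<equiv> cmap ((*) (cst c))"

lemma lookup_sc: "lk (lk (sc c x) X) a = c * lk (lk x X) a"
  by (simp add: lookup_cmap additive_mult lookup_cst_mult)

lemma sc_0: "sc 0 x = 0"
  by (intro poly_mapping_eqI) (simp only: lookup_sc mult_zero_left lookup_zero)

lemma additive_sc: "Modules.additive (sc c)"
  by (intro additive_cmap additive_mult)

lemma Cop_cmap: "Modules.additive f \<Longrightarrow> Cop (cmap f x) = cmap f (Cop x)"
proof (rule additive_ext[where x=x and F="\<lambda>x. Cop (cmap f x)" and G="\<lambda>x. cmap f (Cop x)"])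
  assume f: "Modules.additive f"
  show "Modules.additive (\<lambda>x. Cop (cmap f x))" by (rule additive_comp[OF additive_Cop additive_cmap[OF f]])
  show "Modules.additive (\<lambda>x. cmap f (Cop x))" by (rule additive_comp[OF additive_cmap[OF f] additive_Cop])
  show "Cop (cmap f (sg X p)) = cmap f (Cop (sg X p))" for X p
    unfolding Cop_single cmap_single[OF f] additive_imps(5)[OF additive_cmap[OF f]] cmap_rpsi[OF f] ..
qed

lemma Qop_sc: "Qop (sc c x) = sc c (Qop x)"
proof (rule additive_ext[where x=x and F="\<lambda>x. Qop (sc c x)" and G="\<lambda>x. sc c (Qop x)"])
  show "Modules.additive (\<lambda>x. Qop (sc c x))" by (rule additive_comp[OF additive_Qop additive_sc])
  show "Modules.additive (\<lambda>x. sc c (Qop x))" by (rule additive_comp[OF additive_sc additive_Qop])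
  show "Qop (sc c (sg X p)) = sc c (Qop (sg X p))" for X p
    unfolding Qop_single cmap_single[OF additive_mult] additive_imps(5)[OF additive_sc] cmap_rpsi[OF additive_mult]
      mult.left_commute[of "cst c"] ..
qed

lemma KF_sc: "KF F (sc c x) = sc c (KF F x)"
proof -
  have "cmap (pd r) (sc c x) = sc c (cmap (pd r) x)" for r
  proof -
    have "pd r (cst c * p) = cst c * pd r p" for p by (simp only: pd_def der_cst_mult)
    then show ?thesis by (simp only: cmap_cmap[OF additive_pd additive_mult] cmap_cmap[OF additive_mult additive_pd])
  qed
  then show ?thesis
    unfolding KF_def by (simp only: additive_imps(5)[OF additive_sc] cmap_rphi[OF additive_mult])
qed

lemma ev2_sc: "ev2 (sc c x) = cst c * ev2 x"
proof (rule additive_ext[where x=x and F="\<lambda>x. ev2 (sc c x)" and G="\<lambda>x. cst c * ev2 x"])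
  show "Modules.additive (\<lambda>x. ev2 (sc c x))" by (rule additive_comp[OF additive_ev2 additive_sc])
  show "Modules.additive (\<lambda>x. cst c * ev2 x)" by (rule additive_comp[OF additive_mult additive_ev2])
  fix X p
  have "dact (cst c * p) f = cst c * dact p f" for f
  proof -
    have "dact (cst c) g = cst c * dmon 0 g" for g using dact_single[of 0 c g] by (simp only: cst_def)
    moreover have "dmon 0 g = g" for g using dact_single[of 0 1 g] by simp
    ultimately show ?thesis by (simp only: dact_mult)
  qed
  then show "ev2 (sc c (sg X p)) = cst c * ev2 (sg X p)"
    unfolding cmap_single[OF additive_mult] ev2_single .
qed

lemma Mk_single: "charged k X \<Longrightarrow> sg X p \<in> Mk k"
  unfolding Mk_iff
proof
  fix Y assume V: "charged k X" and "Y \<in> ks (sg X p)"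
  then show "charged k Y" by (cases "p = 0") (auto simp: V)
qed

lemma Mk_cmap: "x \<in> Mk k \<Longrightarrow> cmap f x \<in> Mk k"
  unfolding Mk_iff using keys_cmap by blast

lemma Mk_diag_op: "x \<in> Mk k \<Longrightarrow> diag_op g x \<in> Mk k"
  unfolding Mk_iff using keys_diag_op by blast

lemma Nlev_inj:
  assumes "finite F" "y \<in> Mk (Suc k)" "holes_in F y" "diag_op (Nlev F) y = 0"
  shows "y = 0"
proof -
  have "diag_op (\<lambda>X a. inverse (Nlev F X a)) (diag_op (Nlev F) y) = y" unfolding diag_op_diag_op
  proof (rule diag_op_1)
    fix X a assume X: "X \<in> ks y"
    then have "holes X \<inter> F = holes X" "charged (Suc k) X" using assms by (auto simp: holes_in_def Mk_iff)
    then have "(\<Sum>r\<in>F. lk a r) + card (holes X \<inter> F) \<noteq> 0" by (simp add: charged_def)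
    then have "Nlev F X a \<noteq> 0" by (simp only: of_nat_eq_0_iff not_False_eq_True)
    then show "inverse (Nlev F X a) * Nlev F X a = 1" by (rule left_inverse)
  qed
  then show ?thesis using assms(4) by (simp add: additive_imps[OF additive_diag_op])
qed

text \<open>Applying \<open>Qop\<close> leaves \<open>Cop (Qop (KF F z)) = 0\<close>, so
  \<open>KF F z\<close> is killed by \<open>QF\<close> and, as a square, by \<open>KF\<close>. The
  number operator then kills it, and it is invertible in this charge. What is left,
  \<open>Qop z = 0\<close> and \<open>KF F z = 0\<close>, gives \<open>z = 0\<close> in the same
  way.\<close>

lemma Qop_plus_Cop_KF_inj:
  assumes F: "finite F" and z: "z \<in> Mk 1" "holes_in F z" and 0: "Qop z + Cop (KF F z) = 0"
  shows "z = 0"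
proof -
  let ?y = "KF F z"
  have y: "?y \<in> Mk 2" using Mk_KF[OF z(1), of F] by (simp only: Suc_1)
  have yF: "holes_in F ?y" by (rule holes_in_KF[OF z(2)])
  have "Qop (Qop z + Cop ?y) = 0" unfolding 0 by (rule additive_imps[OF additive_Qop])
  then have "Cop (Qop ?y) = 0"
    using Qop_Qop[OF z(1)] Qop_Cop[OF y] by (simp add: additive_imps[OF additive_Qop])
  moreover have "Qop ?y \<in> Mk 1" using Mk_Qop[of ?y 1] y by (simp only: Suc_1)
  ultimately have Qy: "Qop ?y = 0" using Cop_inj[of "Qop ?y" 1] by simp
  have "QF F (KF F ?y) + KF F (QF F ?y) = diag_op (Nlev F) ?y" by (rule QF_KF[OF F Mk_Up[OF y]])
  moreover have "KF F ?y = 0" by (rule KF_KF[OF Mk_Up[OF z(1)]])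
  moreover have "QF F ?y = 0" using Qop_QF[OF F yF] Qy by simp
  ultimately have "diag_op (Nlev F) ?y = 0" by (simp add: additive_imps[OF additive_QF] additive_imps[OF additive_KF])
  then have y0: "?y = 0" using Nlev_inj[OF F, of ?y 1] y yF by (simp only: Suc_1)
  then have "Qop z = 0" using 0 by (simp add: additive_imps[OF additive_Cop])
  then have "QF F z = 0" using Qop_QF[OF F z(2)] by simp
  then have "diag_op (Nlev F) z = 0"
    using QF_KF[OF F Mk_Up[OF z(1)]] y0 by (simp add: additive_imps[OF additive_QF] additive_imps[OF additive_KF])
  then show ?thesis using Nlev_inj[OF F, of z 0] z by simp
qed

lemma deg_le_exists: "\<exists>d. deg_le d x"
proof (intro exI[of _ "\<Sum>X\<in>ks x. \<Sum>a\<in>ks (lk x X). energy X + wtd a"], unfold deg_le_def, intro allI impI)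
  fix X a assume nz: "lk (lk x X) a \<noteq> 0"
  then have a: "a \<in> ks (lk x X)" by (simp add: in_keys_iff)
  then have X: "X \<in> ks x" by (auto simp: in_keys_iff)
  have "energy X + wtd a \<le> (\<Sum>a\<in>ks (lk x X). energy X + wtd a)"
    using a by (rule member_le_sum) simp_all
  also have "\<dots> \<le> (\<Sum>X\<in>ks x. \<Sum>a\<in>ks (lk x X). energy X + wtd a)"
    using X by (rule member_le_sum) simp_all
  finally show "energy X + wtd a \<le> (\<Sum>X\<in>ks x. \<Sum>a\<in>ks (lk x X). energy X + wtd a)" .
qed

text \<open>By counting, the \<open>Q z + C (K z)\<close> with \<open>z\<close> of bounded degree exhaust the kernel in that degree.\<close>
lemma ev2_kernel:
  assumes surj: "ev2 ` Mk 0 = UNIV" and x: "x \<in> Mk 0" "ev2 x = 0"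
  shows "\<exists>z\<in>Mk 1. \<exists>w\<in>Mk 2. x = Qop z + Cop w"
proof -
  obtain d where d: "deg_le d x" using deg_le_exists by blast
  let ?A = "{m. wt m \<le> d}"
  \<comment> \<open>Holes of configurations of energy at most \<open>d\<close> have index at most
    \<open>d\<close>, so these modes suffice for all elements counted below.\<close>
  define F where "F = {..d}"
  have F: "finite F" by (simp add: F_def)
  \<comment> \<open>Truncating an arbitrary preimage keeps its image, since \<open>ev2\<close>
    respects degrees; this is the second use of surjectivity.\<close>
  have "\<exists>y. y \<in> Mk 0 \<and> deg_le d y \<and> ev2 y = sg m 1" if m: "m \<in> ?A" for m
  proof -
    obtain y where y: "y \<in> Mk 0" "ev2 y = sg m 1" using surj by (metis UNIV_I imageE)
    show ?thesis
    proof (intro exI conjI)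
      show "ftrunc (\<lambda>e. e \<le> d) y \<in> Mk 0" by (rule Mk_diag_op[OF y(1)])
      show "deg_le d (ftrunc (\<lambda>e. e \<le> d) y)" unfolding deg_le_def lookup_diag_op by simp
      have "ev2 (ftrunc (\<lambda>e. e \<le> d) y) = trunc (\<lambda>e. e \<le> d) (sg m 1)" using trunc_ev2[OF y(1)] y(2) by simp
      also have "\<dots> = sg m 1" using m by (simp add: trunc_homog[OF homog_single])
      finally show "ev2 (ftrunc (\<lambda>e. e \<le> d) y) = sg m 1" .
    qed
  qed
  then obtain y where y: "\<And>m. m \<in> ?A \<Longrightarrow> y m \<in> Mk 0 \<and> deg_le d (y m) \<and> ev2 (y m) = sg m 1" by metis
  define \<phi> where "\<phi> z = Qop z + Cop (KF F z)" for z
  have add\<phi>: "Modules.additive \<phi>" unfolding \<phi>_def[abs_def]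
    by (intro additive_plus additive_Qop additive_comp[OF additive_Cop additive_KF])
  have \<phi>sc: "\<phi> (sc c z) = sc c (\<phi> z)" for c z
    unfolding \<phi>_def Qop_sc KF_sc Cop_cmap[OF additive_mult] by (simp only: additive_imps(2)[OF additive_sc])
  have \<phi>M: "\<phi> z \<in> Mk 0" "ev2 (\<phi> z) = 0" "KF F z \<in> Mk 2" if z: "z \<in> Mk 1" for z
  proof -
    show K: "KF F z \<in> Mk 2" using Mk_KF[OF z, of F] by (simp only: Suc_1)
    have Q0: "Qop z \<in> Mk 0" using Mk_Qop[of z 0] z by simp
    have C0: "Cop (KF F z) \<in> Mk 0" using Mk_Cop[of "KF F z" 0] K by (simp add: numeral_2_eq_2)
    show "\<phi> z \<in> Mk 0" unfolding \<phi>_def by (rule Mk_add[OF Q0 C0])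
    have "z \<in> Msp (-3)" "KF F z \<in> Msp (-5)" using z K by (simp_all add: Mk_def)
    then show "ev2 (\<phi> z) = 0" unfolding \<phi>_def by (simp add: additive_imps[OF additive_ev2] ev2_Qop ev2_Cop)
  qed
  define e :: "int set \<times> (nat \<Rightarrow>\<^sub>0 nat) \<Rightarrow> fock" where "e b = sg (fst b) (sg (snd b) 1)" for b
  have e: "e b \<in> Mk 1" "deg_le d (e b)" if "b \<in> basis_le 1 d" for b
  proof -
    have b: "charged 1 (fst b)" "energy (fst b) + wtd (snd b) \<le> d" using that by (auto simp: basis_le_def)
    show "e b \<in> Mk 1" unfolding e_def by (rule Mk_single[OF b(1)])
    show "deg_le d (e b)" unfolding e_def by (rule deg_le_single[OF b(2)])
  qed
  have \<phi>d: "deg_le d (\<phi> (e b))" if b: "b \<in> basis_le 1 d" for b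
    unfolding \<phi>_def using e[OF b] by (intro deg_le_add deg_le_Qop deg_le_Cop[OF \<phi>M(3)] deg_le_KF)
  \<comment> \<open>Preimages of monomials, the candidate kernel elements and \<open>x\<close> are
    together more vectors than there are coordinates in degree up to \<open>d\<close>, so they
    satisfy a linear relation.\<close>
  define v where "v i = (case i of Inl m \<Rightarrow> y m | Inr (Inl b) \<Rightarrow> \<phi> (e b) | Inr (Inr _) \<Rightarrow> x)"
    for i :: "(nat \<Rightarrow>\<^sub>0 nat) + ((int set \<times> (nat \<Rightarrow>\<^sub>0 nat)) + unit)"
  let ?I = "?A <+> (basis_le 1 d <+> {()})"
  have v: "v i \<in> Mk 0 \<and> deg_le d (v i)" if i: "i \<in> ?I" for i
    using i
  proof (elim PlusE)
    fix m assume "m \<in> ?A" "i = Inl m"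
    then show ?thesis using y[of m] by (simp add: v_def)
  next
    fix k b assume "i = Inr k" "k = Inl b" "b \<in> basis_le 1 d"
    then show ?thesis using \<phi>M(1)[OF e(1)] \<phi>d by (simp add: v_def)
  next
    fix k u assume "i = Inr k" "k = Inr u"
    then show ?thesis using x(1) d by (simp add: v_def)
  qed
  have fI: "finite ?I" by (simp add: finite_wt finite_basis_le)
  have "card ?I = card ?A + (card (basis_le 1 d) + 1)" by (simp add: card_Plus finite_wt finite_basis_le)
  then have "card (basis_le 0 d) < card ?I" using card_basis_le_0[of d] by simp
  then obtain c where c: "\<exists>i\<in>?I. c i \<noteq> 0"
      "\<forall>b\<in>basis_le 0 d. (\<Sum>i\<in>?I. c i * lk (lk (v i) (fst b)) (snd b)) = 0"
    using linear_dependence[OF finite_basis_le fI, of 0 d "\<lambda>i b. lk (lk (v i) (fst b)) (snd b)"] by blast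
  have w0: "(\<Sum>i\<in>?I. sc (c i) (v i)) = 0"
  proof (intro poly_mapping_eqI)
    fix X a
    have l: "lk (lk (\<Sum>i\<in>?I. sc (c i) (v i)) X) a = (\<Sum>i\<in>?I. c i * lk (lk (v i) X) a)"
      by (simp only: lookup_sum lookup_sc)
    have "(\<Sum>i\<in>?I. c i * lk (lk (v i) X) a) = 0"
    proof (cases "(X, a) \<in> basis_le 0 d")
      case True
      then show ?thesis using c(2) by fastforce
    next
      case False
      have "lk (lk (v i) X) a = 0" if i: "i \<in> ?I" for i
      proof (rule ccontr)
        assume nz: "lk (lk (v i) X) a \<noteq> 0"
        then have "X \<in> ks (v i)" by (auto simp: in_keys_iff)
        then have "charged 0 X" using v[OF i] by (simp add: Mk_iff)
        moreover have "energy X + wtd a \<le> d" using v[OF i] nz unfolding deg_le_def by blast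
        ultimately show False using False by (simp add: basis_le_def)
      qed
      then show ?thesis by (intro sum.neutral) simp
    qed
    then show "lk (lk (\<Sum>i\<in>?I. sc (c i) (v i)) X) a = lk (lk 0 X) a" unfolding l by simp
  qed
  define \<alpha> where "\<alpha> m = c (Inl m)" for m
  define \<beta> where "\<beta> b = c (Inr (Inl b))" for b
  define \<gamma> where "\<gamma> = c (Inr (Inr ()))"
  have split: "(\<Sum>m\<in>?A. sc (\<alpha> m) (y m)) + ((\<Sum>b\<in>basis_le 1 d. sc (\<beta> b) (\<phi> (e b))) + sc \<gamma> x) = 0"
    using w0 by (simp add: sum.Plus finite_wt finite_basis_le v_def \<alpha>_def \<beta>_def \<gamma>_def)
  have "ev2 (\<Sum>b\<in>basis_le 1 d. sc (\<beta> b) (\<phi> (e b))) = 0"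
    unfolding additive_imps(5)[OF additive_ev2] ev2_sc
  proof (intro sum.neutral ballI)
    fix b assume b: "b \<in> basis_le 1 d"
    show "cst (\<beta> b) * ev2 (\<phi> (e b)) = 0" by (simp only: \<phi>M(2)[OF e(1)[OF b]] mult_zero_right)
  qed
  \<comment> \<open>\<open>ev2\<close> kills the candidates and \<open>x\<close>, so only the
    distinct monomials remain and their coefficients vanish.\<close>
  then have "ev2 (\<Sum>m\<in>?A. sc (\<alpha> m) (y m)) = 0"
    using arg_cong[OF split, of ev2] x(2) by (simp add: additive_imps(1,2)[OF additive_ev2] ev2_sc)
  then have "(\<Sum>m\<in>?A. cst (\<alpha> m) * sg m 1) = 0"
    unfolding additive_imps(5)[OF additive_ev2] ev2_sc using y by simp
  then have s: "(\<Sum>m\<in>?A. sg m (\<alpha> m)) = 0" by (simp only: single_cst[symmetric])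
  have \<alpha>0: "\<alpha> m = 0" if m: "m \<in> ?A" for m
  proof -
    have "lk (\<Sum>n\<in>?A. sg n (\<alpha> n)) m = (\<Sum>n\<in>?A. if n = m then \<alpha> m else 0)"
      unfolding lookup_sum by (intro sum.cong) (auto simp: lookup_single when_def)
    then show ?thesis using s m finite_wt[of d] by simp
  qed
  define z where "z = (\<Sum>b\<in>basis_le 1 d. sc (\<beta> b) (e b))"
  have z: "z \<in> Mk 1" unfolding z_def by (intro Mk_sum Mk_cmap e)
  have "deg_le d z" unfolding z_def
  proof (rule deg_le_sum)
    fix b assume "b \<in> basis_le 1 d"
    then show "deg_le d (sc (\<beta> b) (e b))" using e(2)[of b] unfolding deg_le_def lookup_sc by simp
  qed
  have zF: "holes_in F z" unfolding holes_in_def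
  proof
    fix X assume X: "X \<in> ks z"
    then obtain a where "lk (lk z X) a \<noteq> 0" by (metis in_keys_iff lookup_zero poly_mapping_eqI)
    then have "energy X \<le> d" using \<open>deg_le d z\<close> unfolding deg_le_def by (meson add_leD1)
    moreover have "charged 1 X" using z X by (simp add: Mk_iff)
    ultimately show "holes X \<subseteq> F" unfolding F_def by (intro energy_bound)
  qed
  have \<phi>z: "\<phi> z = (\<Sum>b\<in>basis_le 1 d. sc (\<beta> b) (\<phi> (e b)))"
    unfolding z_def additive_imps(5)[OF add\<phi>] \<phi>sc ..
  have "(\<Sum>m\<in>?A. sc (\<alpha> m) (y m)) = 0"
  proof (intro sum.neutral ballI)
    fix m assume "m \<in> ?A"
    then show "sc (\<alpha> m) (y m) = 0" by (simp only: \<alpha>0 sc_0)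
  qed
  then have rel: "\<phi> z + sc \<gamma> x = 0" using split unfolding \<phi>z by simp
  \<comment> \<open>Otherwise the relation would involve only the candidates, which injectivity
    makes independent. Hence the relation can be solved for \<open>x\<close>.\<close>
  have "\<gamma> \<noteq> 0"
  proof
    assume \<gamma>: "\<gamma> = 0"
    then have "sc \<gamma> x = 0" by (simp only: sc_0)
    then have "z = 0" using rel Qop_plus_Cop_KF_inj[OF F z zF] by (simp add: \<phi>_def)
    have "\<beta> b = 0" if b: "b \<in> basis_le 1 d" for b
    proof -
      have "lk (lk z (fst b)) (snd b) = (\<Sum>b'\<in>basis_le 1 d. \<beta> b' * lk (lk (e b') (fst b)) (snd b))"
        unfolding z_def by (simp only: lookup_sum lookup_sc)
      also have "\<dots> = (\<Sum>b'\<in>basis_le 1 d. if b' = b then \<beta> b else 0)"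
        by (intro sum.cong) (auto simp: e_def lookup_single when_def prod_eq_iff)
      finally show ?thesis using \<open>z = 0\<close> b finite_basis_le[of 1 d] by simp
    qed
    then have "c i = 0" if "i \<in> ?I" for i
      using that \<alpha>0 \<gamma> by (auto simp: \<alpha>_def \<beta>_def \<gamma>_def)
    then show False using c(1) by blast
  qed
  have "x = sc (- 1 / \<gamma>) (\<phi> z)"
  proof -
    have "\<phi> z = - sc \<gamma> x" using rel by (simp add: eq_neg_iff_add_eq_0)
    moreover have "lk (lk (sc (- 1 / \<gamma>) (- sc \<gamma> x)) X) a = lk (lk x X) a" for X a
      unfolding lookup_sc lookup_uminus using \<open>\<gamma> \<noteq> 0\<close> by simp
    ultimately show ?thesis by (intro poly_mapping_eqI) (simp only:)
  qed
  also have "\<dots> = Qop (sc (- 1 / \<gamma>) z) + Cop (sc (- 1 / \<gamma>) (KF F z))"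
    unfolding \<phi>_def Qop_sc Cop_cmap[OF additive_mult] by (rule additive_imps(2)[OF additive_sc])
  finally show ?thesis using Mk_cmap[OF z] Mk_cmap[OF \<phi>M(3)[OF z]] by blast
qed

section \<open>Freeness of the quotients\<close>

definition const_fock :: "nat \<Rightarrow> fock set" where
  "const_fock k = {x \<in> Mk k. \<forall>X. ks (lk x X) \<subseteq> {0}}"

text \<open>Extracts the coefficient vector of one operator monomial. Being a coefficientwise map it
  commutes with \<open>Cop\<close>, which reduces relations over the operators to complex
  ones.\<close>

definition dcoeff :: "(nat \<Rightarrow>\<^sub>0 nat) \<Rightarrow> fock \<Rightarrow> fock" where
  "dcoeff a = cmap (\<lambda>p. sg 0 (lk p a))"

lemma additive_sg_lk: "Modules.additive (\<lambda>p. sg 0 (lk p a))"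
  by (simp add: additive_def lookup_add single_add)

lemma additive_dcoeff: "Modules.additive (dcoeff a)"
  unfolding dcoeff_def by (rule additive_cmap[OF additive_sg_lk])

lemma lookup_dcoeff: "lk (dcoeff a x) X = sg 0 (lk (lk x X) a)"
  unfolding dcoeff_def by (rule lookup_cmap[OF additive_sg_lk])

lemma dcoeff_const_fock: "x \<in> Mk k \<Longrightarrow> dcoeff a x \<in> const_fock k"
  unfolding const_fock_def mem_Collect_eq lookup_dcoeff
  by (intro conjI allI keys_single_subset) (simp only: dcoeff_def Mk_cmap)

lemma const_fock_lookup: "b \<in> const_fock k \<Longrightarrow> lk b X = cst (lk (lk b X) 0)"
proof (rule poly_mapping_eqI)
  fix a assume "b \<in> const_fock k"
  then have "ks (lk b X) \<subseteq> {0}" by (simp add: const_fock_def)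
  then show "lk (lk b X) a = lk (cst (lk (lk b X) 0)) a"
    by (cases "a = 0") (auto simp: cst_def lookup_single when_def in_keys_iff)
qed

lemma dcoeff_dscale:
  assumes b: "b \<in> const_fock k"
  shows "dcoeff a (dscale P b) = sc (lk P a) b"
proof (intro poly_mapping_eqI)
  fix X a'
  define q where "q = lk (lk b X) 0"
  have q: "lk b X = cst q" unfolding q_def by (rule const_fock_lookup[OF b])
  have "lk (P * cst q) a = q * lk P a" unfolding mult.commute[of P] by (rule lookup_cst_mult)
  then have "lk (lk (dcoeff a (dscale P b)) X) a' = lk (sg 0 (q * lk P a)) a'"
    unfolding lookup_dcoeff dscale_cmap lookup_cmap[OF additive_mult] q by (simp only:)
  also have "\<dots> = lk (lk (sc (lk P a) b) X) a'"
    unfolding lookup_sc q by (simp add: cst_def lookup_single when_def)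
  finally show "lk (lk (dcoeff a (dscale P b)) X) a' = lk (lk (sc (lk P a) b) X) a'" .
qed

interpretation fock: vector_space sc
proof
  fix c d x y
  show "sc c (x + y) = sc c x + sc c y" by (rule additive_imps(2)[OF additive_sc])
  show "sc (c + d) x = sc c x + sc d x"
    by (intro poly_mapping_eqI) (simp only: lookup_sc lookup_add distrib_right)
  show "sc c (sc d x) = sc (c * d) x"
    by (intro poly_mapping_eqI) (simp only: lookup_sc mult.assoc)
  show "sc 1 x = x" by (intro poly_mapping_eqI) (simp only: lookup_sc mult_1_left)
qed

lemma fock_expansion_dscale: "x = (\<Sum>X\<in>ks x. dscale (lk x X) (sg X 1))"
proof -
  have "dscale (lk x X) (sg X 1) = sg X (lk x X)" for X
    unfolding dscale_cmap cmap_single[OF additive_mult] by (simp only: mult_1_right)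
  then show ?thesis by (simp only: pm_sum_singles[symmetric])
qed

lemma additive_dscale: "Modules.additive (dscale P)"
  unfolding dscale_cmap[abs_def] by (rule additive_cmap[OF additive_mult])

lemma dscale_add_left: "dscale (P + Q) x = dscale P x + dscale Q x"
  by (rule poly_mapping_eqI) (simp only: dscale_cmap lookup_cmap additive_mult lookup_add distrib_right)

lemma dscale_0_left: "dscale 0 x = 0"
  by (rule poly_mapping_eqI) (simp add: dscale_cmap lookup_cmap additive_mult)

lemma dscale_mult: "dscale P (dscale Q x) = dscale (P * Q) x"
  by (rule poly_mapping_eqI) (simp only: dscale_cmap lookup_cmap additive_mult mult.assoc)

lemma Cop_dscale: "Cop (dscale P x) = dscale P (Cop x)"
  unfolding dscale_cmap by (rule Cop_cmap[OF additive_mult])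

lemma Mk_dscale: "x \<in> Mk k \<Longrightarrow> dscale P x \<in> Mk k"
  unfolding dscale_cmap by (rule Mk_cmap)

lemma sum_mem:
  assumes "0 \<in> N" "\<And>x y. x \<in> N \<Longrightarrow> y \<in> N \<Longrightarrow> x + y \<in> N" "\<And>i. i \<in> A \<Longrightarrow> f i \<in> N"
  shows "(\<Sum>i\<in>A. f i) \<in> N"
  using assms(3) by (induction A rule: infinite_finite_induct) (simp_all add: assms(1,2))

text \<open>The finite set \<open>t\<close> may exceed the support of \<open>c\<close>, so that two
  representations can be added over the union of their index sets without tracking
  cancellations.\<close>

definition spanned :: "fock set \<Rightarrow> fock set \<Rightarrow> fock \<Rightarrow> bool" where
  "spanned B N x \<longleftrightarrow> (\<exists>c t. finite t \<and> t \<subseteq> B \<and> x - (\<Sum>b\<in>t. dscale (c b) b) \<in> N)"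

lemma spanned_sum:
  assumes N: "0 \<in> N" "\<And>x y. x \<in> N \<Longrightarrow> y \<in> N \<Longrightarrow> x + y \<in> N"
    and f: "\<And>i. i \<in> A \<Longrightarrow> spanned B N (f i)"
  shows "spanned B N (\<Sum>i\<in>A. f i)"
  using f
proof (induction A rule: infinite_finite_induct)
  case (insert i A)
  obtain c s where c: "finite s" "s \<subseteq> B" "f i - (\<Sum>b\<in>s. dscale (c b) b) \<in> N"
    using insert.prems[of i] unfolding spanned_def by auto
  obtain e t where e: "finite t" "t \<subseteq> B" "(\<Sum>i\<in>A. f i) - (\<Sum>b\<in>t. dscale (e b) b) \<in> N"
    using insert.IH insert.prems unfolding spanned_def by auto
  define h where "h b = (if b \<in> s then c b else 0) + (if b \<in> t then e b else 0)" for b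
  have ext: "(\<Sum>b\<in>r. dscale (g b) b) = (\<Sum>b\<in>s \<union> t. dscale (if b \<in> r then g b else 0) b)"
    if "r \<subseteq> s \<union> t" for r and g :: "fock \<Rightarrow> dring"
    using that c(1) e(1) by (intro sum.mono_neutral_cong_left) (auto simp: dscale_0_left)
  have h: "(\<Sum>b\<in>s \<union> t. dscale (h b) b) = (\<Sum>b\<in>s. dscale (c b) b) + (\<Sum>b\<in>t. dscale (e b) b)"
    unfolding h_def dscale_add_left sum.distrib ext[OF Un_upper1] ext[OF Un_upper2] ..
  have "f i + (\<Sum>i\<in>A. f i) - (\<Sum>b\<in>s \<union> t. dscale (h b) b) \<in> N"
    using N(2)[OF c(3) e(3)] unfolding h by (simp only: add_diff_add)
  then show ?case unfolding spanned_def sum.insert[OF insert.hyps]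
    using c(1,2) e(1,2) by (intro exI[of _ h] exI[of _ "s \<union> t"]) simp
qed (auto simp: spanned_def N(1) intro!: exI[of _ "{}"])

lemma spanned_dscale:
  assumes N: "\<And>x. x \<in> N \<Longrightarrow> dscale P x \<in> N" and x: "spanned B N x"
  shows "spanned B N (dscale P x)"
proof -
  obtain c t where t: "finite t" "t \<subseteq> B" "x - (\<Sum>b\<in>t. dscale (c b) b) \<in> N"
    using x unfolding spanned_def by auto
  have "dscale P x - (\<Sum>b\<in>t. dscale (P * c b) b) \<in> N"
    using N[OF t(3)] unfolding additive_imps[OF additive_dscale] dscale_mult .
  then show ?thesis unfolding spanned_def
    using t(1,2) by (intro exI[of _ "\<lambda>b. P * c b"] exI[of _ t]) simp
qed

text \<open>\<^term>\<open>Cop\<close> preserves the complex subspaces of vectors with constant coefficients, so a complex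
  complement of its image there has a basis that is a basis of the quotient over the operators.\<close>
lemma free_quot_Cop: "free_quot (Mk k) (Cop ` Mk (k + 2))"
proof -
  let ?V = "const_fock k" and ?W = "Cop ` const_fock (k + 2)" and ?N = "Cop ` Mk (k + 2)"
  have Cop_const: "Cop x \<in> ?V" if x: "x \<in> const_fock (k + 2)" for x
  proof -
    have M: "x \<in> Mk (k + 2)" using x by (simp add: const_fock_def)
    have "dcoeff 0 x = x"
    proof (rule poly_mapping_eqI)
      fix X
      show "lk (dcoeff 0 x) X = lk x X"
        unfolding lookup_dcoeff by (rule const_fock_lookup[OF x, unfolded cst_def, symmetric])
    qed
    then have "Cop x = dcoeff 0 (Cop x)"
      using Cop_cmap[OF additive_sg_lk, of 0 x] by (simp only: dcoeff_def)
    moreover have "dcoeff 0 (Cop x) \<in> ?V" using Mk_Cop[of x k] M by (intro dcoeff_const_fock) simp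
    ultimately show ?thesis by (simp only:)
  qed
  obtain I where I: "I \<subseteq> ?W" "fock.independent I" "?W \<subseteq> fock.span I"
    using fock.maximal_independent_subset[of ?W] by blast
  have "I \<subseteq> ?V" using I(1) Cop_const by blast
  from fock.maximal_independent_subset_extend[OF this I(2)]
  obtain B where B: "I \<subseteq> B" "B \<subseteq> ?V" "fock.independent B" "?V \<subseteq> fock.span B" by blast
  \<comment> \<open>\<open>I\<close> spans the image of the constant vectors under
    \<open>Cop\<close>, so what remains of the extended basis spans a complement.\<close>
  define B' where "B' = B - I"
  have B'M: "B' \<subseteq> Mk k" using B(2) by (auto simp: B'_def const_fock_def)
  have N0: "0 \<in> ?N" using Mk_0 additive_imps(1)[OF additive_Cop] by (metis image_eqI)
  have Nadd: "x + y \<in> ?N" if "x \<in> ?N" "y \<in> ?N" for x y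
    using that Mk_add[of _ "k + 2"] by (auto simp: additive_imps(2)[OF additive_Cop, symmetric])
  have Nscale: "dscale P x \<in> ?N" if "x \<in> ?N" for P x
    using that Mk_dscale[of _ "k + 2"] by (auto simp: Cop_dscale[symmetric])
  have IN: "I \<subseteq> ?N" using I(1) by (auto simp: const_fock_def)

  have gen: "spanned B' ?N x" if x: "x \<in> ?V" for x
  proof -
    have "x \<in> fock.span B" using x B(4) by blast
    then obtain t r where t: "finite t" "t \<subseteq> B" "(\<Sum>b\<in>t. sc (r b) b) = x"
      unfolding fock.span_explicit by blast
    have "x = (\<Sum>b\<in>t \<inter> I. sc (r b) b) + (\<Sum>b\<in>t - I. sc (r b) b)"
      using t(1) unfolding t(3)[symmetric] by (rule sum.Int_Diff)
    then have "x - (\<Sum>b\<in>t - I. dscale (cst (r b)) b) = (\<Sum>b\<in>t \<inter> I. dscale (cst (r b)) b)"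
      unfolding dscale_cmap by (simp only: add_diff_cancel_right')
    moreover have "\<dots> \<in> ?N"
    proof (rule sum_mem[OF N0 Nadd])
      fix b assume "b \<in> t \<inter> I"
      then have "b \<in> ?N" by (intro subsetD[OF IN]) (rule IntD2)
      then show "dscale (cst (r b)) b \<in> ?N" by (rule Nscale)
    qed
    ultimately have "x - (\<Sum>b\<in>t - I. dscale (cst (r b)) b) \<in> ?N" by (simp only:)
    then show ?thesis unfolding spanned_def
      using t(1,2) by (intro exI[of _ "\<lambda>b. cst (r b)"] exI[of _ "t - I"]) (auto simp: B'_def)
  qed
  have span: "spanned B' ?N x" if x: "x \<in> Mk k" for x
  proof -
    have "spanned B' ?N (dscale (lk x X) (sg X 1))" if X: "X \<in> ks x" for X
    proof (rule spanned_dscale[OF Nscale gen])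
      have "charged k X" using x X by (simp add: Mk_iff)
      then have "sg X 1 \<in> Mk k" by (rule Mk_single)
      moreover have "ks (lk (sg X (1 :: dring)) Y) \<subseteq> {0}" for Y
        by (cases "Y = X") (auto simp: lookup_single when_def)
      ultimately show "sg X 1 \<in> ?V" by (simp add: const_fock_def)
    qed
    from spanned_sum[OF N0 Nadd this]
    have "spanned B' ?N (\<Sum>X\<in>ks x. dscale (lk x X) (sg X 1))" .
    then show ?thesis by (simp only: fock_expansion_dscale[symmetric])
  qed
  show ?thesis unfolding free_quot_def
  proof (intro exI[of _ B'] conjI ballI allI impI B'M)
    fix x assume "x \<in> Mk k"
    from span[OF this] obtain c t where t: "finite t" "t \<subseteq> B'" "x - (\<Sum>b\<in>t. dscale (c b) b) \<in> ?N"
      unfolding spanned_def by auto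
    define h where "h b = (if b \<in> t then c b else 0)" for b
    have s: "{b \<in> B'. h b \<noteq> 0} \<subseteq> t" by (auto simp: h_def)
    have "(\<Sum>b | b \<in> B' \<and> h b \<noteq> 0. dscale (h b) b) = (\<Sum>b\<in>t. dscale (c b) b)"
      using t(1,2) s by (intro sum.mono_neutral_cong_left) (auto simp: h_def dscale_0_left)
    then show "\<exists>c. finite {b \<in> B'. c b \<noteq> 0} \<and> x - (\<Sum>b | b \<in> B' \<and> c b \<noteq> 0. dscale (c b) b) \<in> ?N"
      using t(1,3) finite_subset[OF s] by (intro exI[of _ h]) simp
  next
    fix c b
    assume c: "finite {b \<in> B'. c b \<noteq> 0} \<and> (\<Sum>b | b \<in> B' \<and> c b \<noteq> 0. dscale (c b) b) \<in> ?N" and b: "b \<in> B'"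
    define t where "t = {b \<in> B'. c b \<noteq> 0}"
    obtain y where y: "y \<in> Mk (k + 2)" "(\<Sum>b\<in>t. dscale (c b) b) = Cop y" using c unfolding t_def by blast
    show "c b = 0"
    proof (rule ccontr)
      assume "c b \<noteq> 0"
      then have bt: "b \<in> t" using b by (simp add: t_def)
      obtain a where a: "lk (c b) a \<noteq> 0" using \<open>c b \<noteq> 0\<close> by (metis lookup_zero poly_mapping_eqI)
      \<comment> \<open>Taking the coefficient of a monomial \<open>a\<close> that occurs in
        \<open>c b\<close> gives a complex relation whose right-hand side lies in the span of
        \<open>I\<close>.\<close>
      have "(\<Sum>b\<in>t. sc (lk (c b) a) b) = (\<Sum>b\<in>t. dcoeff a (dscale (c b) b))"
      proof (intro sum.cong refl)
        fix b assume "b \<in> t"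
        then have "b \<in> ?V" using B(2) by (auto simp: t_def B'_def)
        then show "sc (lk (c b) a) b = dcoeff a (dscale (c b) b)" by (rule dcoeff_dscale[symmetric])
      qed
      also have "\<dots> = dcoeff a (Cop y)" unfolding y(2)[symmetric] additive_imps(5)[OF additive_dcoeff] ..
      also have "\<dots> = Cop (dcoeff a y)" unfolding dcoeff_def by (rule Cop_cmap[OF additive_sg_lk, symmetric])
      finally have e: "(\<Sum>b\<in>t. sc (lk (c b) a) b) = Cop (dcoeff a y)" .
      have "Cop (dcoeff a y) \<in> fock.span I" using I(3) dcoeff_const_fock[OF y(1)] by blast
      then obtain s r where s: "Cop (dcoeff a y) = (\<Sum>b\<in>s. sc (r b) b)" "finite s" "s \<subseteq> I"
        unfolding fock.span_explicit mem_Collect_eq by (elim exE conjE) (rule that)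
      have ft: "finite t" using c by (simp add: t_def)
      have dis: "t \<inter> s = {}" using s(3) by (auto simp: t_def B'_def)
      \<comment> \<open>Both sides combined: a relation within the independent set \<open>B\<close>,
        whose coefficient at \<open>b\<close> is the nonzero one chosen above.\<close>
      define u where "u b = (if b \<in> t then lk (c b) a else - r b)" for b
      have neg: "sc (- q) b = - sc q b" for q b by (rule fock.scale_minus_left)
      have "(\<Sum>b\<in>t \<union> s. sc (u b) b) = (\<Sum>b\<in>t. sc (u b) b) + (\<Sum>b\<in>s. sc (u b) b)"
        by (rule sum.union_disjoint[OF ft s(2) dis])
      also have "(\<Sum>b\<in>t. sc (u b) b) = (\<Sum>b\<in>t. sc (lk (c b) a) b)"
        by (intro sum.cong refl) (simp only: u_def if_True)
      also have "(\<Sum>b\<in>s. sc (u b) b) = (\<Sum>b\<in>s. - sc (r b) b)"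
      proof (intro sum.cong refl)
        fix b assume "b \<in> s"
        then have "b \<notin> t" using dis by blast
        then show "sc (u b) b = - sc (r b) b" by (simp only: u_def if_False neg)
      qed
      also have "(\<Sum>b\<in>t. sc (lk (c b) a) b) + (\<Sum>b\<in>s. - sc (r b) b) = 0"
        unfolding e sum_negf s(1) by (rule right_minus)
      finally have 0: "(\<Sum>b\<in>t \<union> s. sc (u b) b) = 0" .
      have "t \<union> s \<subseteq> B" using s(3) B(1) by (auto simp: t_def B'_def)
      from fock.independentD[OF B(3) _ this 0, of b] have "u b = 0" using ft s(2) bt by simp
      then show False using a bt by (simp add: u_def)
    qed
  qed
qed

theorem theorem2:
  assumes "surj ev1"
  shows "ev2 ` Msp (-1) = UNIV
    \<and> (\<forall>x\<in>Nsp (-1). ev2 x = 0)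
    \<and> (\<forall>k::nat. Qop ` Nsp (- 2 * int k - 3) \<subseteq> Nsp (- 2 * int k - 1))
    \<and> {x\<in>Msp (-1). ev2 x = 0} = {y + z |y z. y \<in> Qop ` Msp (-3) \<and> z \<in> Nsp (-1)}
    \<and> (\<forall>k::nat. k \<ge> 1 \<longrightarrow>
           {x\<in>Msp (- 2 * int k - 1). Qop x \<in> Nsp (- 2 * int k + 1)} =
           {y + z |y z. y \<in> Qop ` Msp (- 2 * int k - 3) \<and> z \<in> Nsp (- 2 * int k - 1)})
    \<and> (\<forall>k::nat. free_quot (Msp (- 2 * int k - 1)) (Nsp (- 2 * int k - 1)))"
proof -
  have M: "Msp (-1) = Mk 0" "Msp (-3) = Mk 1" "Msp (-5) = Mk 2" by (simp_all add: Mk_def)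
  have N: "Nsp (-1) = Cop ` Mk 2" using Nsp_Mk[of 0] by (simp add: numeral_2_eq_2)
  have N3: "Nsp (- 2 * int k - 3) = Cop ` Mk (k + 3)" for k
  proof -
    have "- 2 * int k - 3 = - 2 * int (Suc k) - 1" "k + 3 = Suc k + 2" by simp_all
    then show ?thesis by (simp only: Nsp_Mk)
  qed
  have surj: "ev2 ` Mk 0 = UNIV" using ev2_surj[OF assms] unfolding M .
  have Q0: "ev2 (Qop x) = 0" if "x \<in> Mk 1" for x using ev2_Qop[of x] that unfolding M .
  have C0: "ev2 (Cop x) = 0" if "x \<in> Mk 2" for x using ev2_Cop[of x] that unfolding M .
  show ?thesis
  proof (intro conjI allI impI)
    show "ev2 ` Msp (-1) = UNIV" unfolding M by (rule surj)
    show "\<forall>x\<in>Nsp (-1). ev2 x = 0" unfolding N using C0 by blast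
    show "Qop ` Nsp (- 2 * int k - 3) \<subseteq> Nsp (- 2 * int k - 1)" for k
      unfolding N3 Nsp_Mk by (rule Qop_Nsp)
    show "{x\<in>Msp (-1). ev2 x = 0} = {y + z |y z. y \<in> Qop ` Msp (-3) \<and> z \<in> Nsp (-1)}"
      unfolding M N
    proof (intro equalityI subsetI)
      fix x assume "x \<in> {x \<in> Mk 0. ev2 x = 0}"
      then obtain z w where "z \<in> Mk 1" "w \<in> Mk 2" "x = Qop z + Cop w"
        using ev2_kernel[OF surj] by blast
      then show "x \<in> {y + z |y z. y \<in> Qop ` Mk 1 \<and> z \<in> Cop ` Mk 2}" by blast
    next
      fix x assume "x \<in> {y + z |y z. y \<in> Qop ` Mk 1 \<and> z \<in> Cop ` Mk 2}"
      then obtain z w where z: "z \<in> Mk 1" and w: "w \<in> Mk 2" and x: "x = Qop z + Cop w" by blast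
      have "Qop z \<in> Mk 0" "Cop w \<in> Mk 0"
        using z w Mk_Qop[of z 0] Mk_Cop[of w 0] by (simp_all add: numeral_2_eq_2)
      then have "x \<in> Mk 0" unfolding x by (rule Mk_add)
      moreover have "ev2 x = 0" unfolding x additive_imps(2)[OF additive_ev2] Q0[OF z] C0[OF w] by simp
      ultimately show "x \<in> {x \<in> Mk 0. ev2 x = 0}" by blast
    qed
    show "free_quot (Msp (- 2 * int k - 1)) (Nsp (- 2 * int k - 1))" for k
      unfolding Nsp_Mk Msp_Mk(1) by (rule free_quot_Cop)
  next
    fix k :: nat
    assume "1 \<le> k"
    \<comment> \<open>The claim is indexed by the middle term, \<open>quotient_exact\<close> by the
      target of \<open>Qop\<close>.\<close>
    then obtain j where k: "k = Suc j" by (cases k) auto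
    have i: "- 2 * int k + 1 = - 2 * int j - 1" unfolding k by simp
    have "k + 2 = j + 3" unfolding k by simp
    then have "Nsp (- 2 * int k - 1) = Cop ` Mk (j + 3)" by (simp only: Nsp_Mk)
    moreover have "Msp (- 2 * int k - 3) = Mk (j + 2)" using Msp_Mk(2)[of k] unfolding k by simp
    ultimately show "{x\<in>Msp (- 2 * int k - 1). Qop x \<in> Nsp (- 2 * int k + 1)} =
           {y + z |y z. y \<in> Qop ` Msp (- 2 * int k - 3) \<and> z \<in> Nsp (- 2 * int k - 1)}"
      unfolding i Nsp_Mk[of j] Msp_Mk(1)[of k] using quotient_exact[of j] by (simp only: k)
  qed
qed

end
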